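(* The functor $R\mapsto\mathbf{R}$ from restriction species to decomposition spaces and CULF functors (sending a restriction species to its decomposition space of layered $R$-structures) extends to a functor from the category of monoidal restriction species and their morphisms to that of monoidal decomposition spaces and CULF monoidal functors.
   Context: Conventions: functors into groupoids $\mathbf{Grpd}$ (in particular simplicial groupoids $\Delta^{\mathrm{op}}\to\mathbf{Grpd}$) are pseudo-functors, transformations are pseudo-natural, pullbacks are homotopy pullbacks. $\mathbb{I}$ is the category of finite sets and injections, symmetric monoidal under disjoint union. A restriction species is a pseudo-functor $R:\mathbb{I}^{\mathrm{op}}\to\mathbf{Grpd}$ with locally finite values (all automorphism groups finite), or equivalently a right fibration (cartesian fibration with groupoid fibres) $\mathbb{R}\to\mathbb{I}$; morphisms are pseudo-natural transformations, equivalently morphisms of right fibrations over $\mathbb{I}$. For $B\subset A$ and $X\in R[A]$, $X|B\in R[B]$ is the restriction. A monoidal restriction species is a right fibration $\mathbb{R}\to\mathbb{I}$ for which the total category $\mathbb{R}$ has a monoidal structure $\sqcup$ and the projection to $\mathbb{I}$ is strong monoidal. A morphism of monoidal restriction species is a strong monoidal functor which is also a morphism of right fibrations. $\Delta$ has objects $[n]=\{0,\dots,n\}$. A map $a:[m]\to[n]$ is generic if $a(0)=0$ and $a(m)=n$, and free if $a(i+1)=a(i)+1$ for $0\le i\le m-1$; every map factors uniquely as generic followed by free, and generic and free maps admit pushouts along each other. A decomposition space is a simplicial groupoid sending generic–free pushouts in $\Delta$ to pullbacks. A simplicial map is CULF if its naturality squares on all generic maps are pullbacks. A monoidal decomposition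 space is a decomposition space $\mathbf{X}$ with a functor $\otimes:\mathbf{X}\times\mathbf{X}\to\mathbf{X}$ required to be a monoidal structure and to be CULF. $\underline{\Delta}$ has objects $\underline n=\{1,\dots,n\}$, $n\ge0$, and monotone maps. A generic map $g:[n]\to[m]$ corresponds to $\underline g:\underline m\to\underline n$ sending $j$ to the unique $i$ with $g(i-1)<j\le g(i)$. A free map $f:[n]\to[m]$, $f(i)=i+c$, with $n\ge1$, corresponds to $\underline f:\underline n\to\underline m$, $i\mapsto i+c$; every map $[0]\to[m]$ corresponds to $\underline 0\to\underline m$. Given $R$, $\mathbf{R}_n$ is the groupoid of triples $(A,p,X)$ with $A$ a finite set, $p:A\to\underline n$ any function and $X\in R[A]$, with morphisms the isomorphisms of $R$-structures whose underlying bijection is over $\underline n$. A generic map $g:[n]\to[m]$ acts by $(A,p,X)\mapsto(A,\underline g\circ p,X)$; a free map $f:[n]\to[m]$ acts by $(A,p,X)\mapsto(A',p',X|A')$ where $p':A'\to\underline n$ is the pullback of $p$ along $\underline f$. A morphism $\phi:R'\to R$ induces $(A,p,X)\mapsto(A,p,\phi(X))$. For a monoidal $R$, the monoidal structure on $\mathbf{R}$ is given in degree $n$ by $\sqcup$ on $R$-structures, the disjoint union of underlying sets carrying the layering to $\underline n$ induced from those of the two summands. *)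

theory Defs
  imports "HOL-Library.FuncSet"
begin

section \<open>Categories and functors\<close>

text \<open>Functors, natural transformations etc. are represented by extensional functions
  (\<open>undefined\<close> outside the carrier), so that HOL equality is the mathematical equality.\<close>

record ('o, 'm) cat =
  Obj :: "'o set"
  Arr :: "'m set"
  Dom :: "'m \<Rightarrow> 'o"
  Cod :: "'m \<Rightarrow> 'o"
  Id  :: "'o \<Rightarrow> 'm"
  Cmp :: "'m \<Rightarrow> 'm \<Rightarrow> 'm"

abbreviation cmp_infix :: "'m \<Rightarrow> ('o, 'm) cat \<Rightarrow> 'm \<Rightarrow> 'm"  ("(_ \<cdot>\<^bsub>_\<^esub> _)" [70, 0, 71] 70)
  where "g \<cdot>\<^bsub>C\<^esub> f \<equiv> Cmp C g f"

definition hom :: "('o, 'm) cat \<Rightarrow> 'o \<Rightarrow> 'o \<Rightarrow> 'm set" where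
  "hom C x y = {f \<in> Arr C. Dom C f = x \<and> Cod C f = y}"

definition category :: "('o, 'm) cat \<Rightarrow> bool" where
  "category C \<longleftrightarrow>
     (\<forall>f \<in> Arr C. Dom C f \<in> Obj C \<and> Cod C f \<in> Obj C) \<and>
     (\<forall>x \<in> Obj C. Id C x \<in> hom C x x) \<and>
     (\<forall>f \<in> Arr C. \<forall>g \<in> Arr C. Cod C f = Dom C g \<longrightarrow> g \<cdot>\<^bsub>C\<^esub> f \<in> hom C (Dom C f) (Cod C g)) \<and>
     (\<forall>f \<in> Arr C. f \<cdot>\<^bsub>C\<^esub> Id C (Dom C f) = f \<and> Id C (Cod C f) \<cdot>\<^bsub>C\<^esub> f = f) \<and>
     (\<forall>f \<in> Arr C. \<forall>g \<in> Arr C. \<forall>h \<in> Arr C. Cod C f = Dom C g \<and> Cod C g = Dom C h \<longrightarrow>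
        h \<cdot>\<^bsub>C\<^esub> (g \<cdot>\<^bsub>C\<^esub> f) = (h \<cdot>\<^bsub>C\<^esub> g) \<cdot>\<^bsub>C\<^esub> f)"

definition is_inverse :: "('o, 'm) cat \<Rightarrow> 'm \<Rightarrow> 'm \<Rightarrow> bool" where
  "is_inverse C f g \<longleftrightarrow> f \<in> Arr C \<and> g \<in> hom C (Cod C f) (Dom C f) \<and>
     g \<cdot>\<^bsub>C\<^esub> f = Id C (Dom C f) \<and> f \<cdot>\<^bsub>C\<^esub> g = Id C (Cod C f)"

definition iso :: "('o, 'm) cat \<Rightarrow> 'm \<Rightarrow> bool" where
  "iso C f \<longleftrightarrow> (\<exists>g. is_inverse C f g)"

definition inverse_arr :: "('o, 'm) cat \<Rightarrow> 'm \<Rightarrow> 'm" where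
  "inverse_arr C f = (THE g. is_inverse C f g)"

definition groupoid :: "('o, 'm) cat \<Rightarrow> bool" where
  "groupoid C \<longleftrightarrow> category C \<and> (\<forall>f \<in> Arr C. iso C f)"

text \<open>The category with objects those satisfying \<open>ob\<close> and with arrows the triples
  \<open>(x, f, y)\<close> where \<open>f\<close> is a morphism from \<open>x\<close> to \<open>y\<close> in the sense of \<open>mor\<close>.\<close>

definition mk_cat :: "('o \<Rightarrow> bool) \<Rightarrow> ('o \<Rightarrow> 'f \<Rightarrow> 'o \<Rightarrow> bool) \<Rightarrow> ('o \<Rightarrow> 'f) \<Rightarrow>
    ('o \<Rightarrow> 'o \<Rightarrow> 'o \<Rightarrow> 'f \<Rightarrow> 'f \<Rightarrow> 'f) \<Rightarrow> ('o, 'o \<times> 'f \<times> 'o) cat" where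
  "mk_cat ob mor idm cmpm = \<lparr>
     Obj = {x. ob x},
     Arr = {(x, f, y). ob x \<and> ob y \<and> mor x f y},
     Dom = (\<lambda>(x, f, y). x),
     Cod = (\<lambda>(x, f, y). y),
     Id = (\<lambda>x. (x, idm x, x)),
     Cmp = (\<lambda>(y', g, z) (x, f, y). (x, cmpm x y z g f, z)) \<rparr>"

record ('o, 'm, 'p, 'n) ftr =
  fo :: "'o \<Rightarrow> 'p"
  fa :: "'m \<Rightarrow> 'n"

definition is_functor :: "('o, 'm) cat \<Rightarrow> ('p, 'n) cat \<Rightarrow> ('o, 'm, 'p, 'n) ftr \<Rightarrow> bool" where
  "is_functor C D F \<longleftrightarrow> category C \<and> category D \<and>
     fo F \<in> Obj C \<rightarrow>\<^sub>E Obj D \<and> fa F \<in> Arr C \<rightarrow>\<^sub>E Arr D \<and>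
     (\<forall>f \<in> Arr C. fa F f \<in> hom D (fo F (Dom C f)) (fo F (Cod C f))) \<and>
     (\<forall>x \<in> Obj C. fa F (Id C x) = Id D (fo F x)) \<and>
     (\<forall>f \<in> Arr C. \<forall>g \<in> Arr C. Cod C f = Dom C g \<longrightarrow>
        fa F (g \<cdot>\<^bsub>C\<^esub> f) = fa F g \<cdot>\<^bsub>D\<^esub> fa F f)"

definition idF :: "('o, 'm) cat \<Rightarrow> ('o, 'm, 'o, 'm) ftr" where
  "idF C = \<lparr> fo = (\<lambda>x \<in> Obj C. x), fa = (\<lambda>f \<in> Arr C. f) \<rparr>"

text \<open>The composite \<open>G \<circ> F\<close>; the first argument is the source category of \<open>F\<close>.\<close>

definition compF :: "('o, 'm) cat \<Rightarrow> ('p, 'n, 'q, 'k) ftr \<Rightarrow> ('o, 'm, 'p, 'n) ftr \<Rightarrow>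
    ('o, 'm, 'q, 'k) ftr" where
  "compF C G F = \<lparr> fo = (\<lambda>x \<in> Obj C. fo G (fo F x)), fa = (\<lambda>f \<in> Arr C. fa G (fa F f)) \<rparr>"

definition nat_iso :: "('o, 'm) cat \<Rightarrow> ('p, 'n) cat \<Rightarrow> ('o, 'm, 'p, 'n) ftr \<Rightarrow>
    ('o, 'm, 'p, 'n) ftr \<Rightarrow> ('o \<Rightarrow> 'n) \<Rightarrow> bool" where
  "nat_iso C D F G t \<longleftrightarrow> t \<in> extensional (Obj C) \<and>
     (\<forall>x \<in> Obj C. t x \<in> hom D (fo F x) (fo G x) \<and> iso D (t x)) \<and>
     (\<forall>f \<in> Arr C. t (Cod C f) \<cdot>\<^bsub>D\<^esub> fa F f = fa G f \<cdot>\<^bsub>D\<^esub> t (Dom C f))"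

definition equivalence :: "('o, 'm) cat \<Rightarrow> ('p, 'n) cat \<Rightarrow> ('o, 'm, 'p, 'n) ftr \<Rightarrow> bool" where
  "equivalence C D F \<longleftrightarrow> is_functor C D F \<and>
     (\<forall>x \<in> Obj C. \<forall>y \<in> Obj C. bij_betw (fa F) (hom C x y) (hom D (fo F x) (fo F y))) \<and>
     (\<forall>z \<in> Obj D. \<exists>x \<in> Obj C. \<exists>i \<in> hom D (fo F x) z. iso D i)"

definition prodC :: "('o, 'm) cat \<Rightarrow> ('p, 'n) cat \<Rightarrow> ('o \<times> 'p, 'm \<times> 'n) cat" where
  "prodC C D = \<lparr>
     Obj = Obj C \<times> Obj D,
     Arr = Arr C \<times> Arr D,
     Dom = map_prod (Dom C) (Dom D),
     Cod = map_prod (Cod C) (Cod D),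
     Id = map_prod (Id C) (Id D),
     Cmp = (\<lambda>(g, g') (f, f'). (g \<cdot>\<^bsub>C\<^esub> f, g' \<cdot>\<^bsub>D\<^esub> f')) \<rparr>"

definition oneC :: "(unit, unit) cat" where
  "oneC = \<lparr> Obj = UNIV, Arr = UNIV, Dom = id, Cod = id, Id = id, Cmp = (\<lambda>_ _. ()) \<rparr>"

definition prodF :: "('o, 'm) cat \<Rightarrow> ('p, 'n) cat \<Rightarrow> ('o, 'm, 'o2, 'm2) ftr \<Rightarrow>
    ('p, 'n, 'p2, 'n2) ftr \<Rightarrow> ('o \<times> 'p, 'm \<times> 'n, 'o2 \<times> 'p2, 'm2 \<times> 'n2) ftr" where
  "prodF C D F G = \<lparr>
     fo = (\<lambda>x \<in> Obj (prodC C D). map_prod (fo F) (fo G) x),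
     fa = (\<lambda>f \<in> Arr (prodC C D). map_prod (fa F) (fa G) f) \<rparr>"

definition assocF :: "('o, 'm) cat \<Rightarrow> ('p, 'n) cat \<Rightarrow> ('q, 'k) cat \<Rightarrow>
    (('o \<times> 'p) \<times> 'q, ('m \<times> 'n) \<times> 'k, 'o \<times> 'p \<times> 'q, 'm \<times> 'n \<times> 'k) ftr" where
  "assocF C D E = \<lparr>
     fo = (\<lambda>((x, y), z) \<in> Obj (prodC (prodC C D) E). (x, y, z)),
     fa = (\<lambda>((f, g), h) \<in> Arr (prodC (prodC C D) E). (f, g, h)) \<rparr>"

definition insLF :: "('o, 'm) cat \<Rightarrow> ('p, 'n) cat \<Rightarrow> 'p \<Rightarrow> ('o, 'm, 'p \<times> 'o, 'n \<times> 'm) ftr" where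
  "insLF C D e = \<lparr> fo = (\<lambda>x \<in> Obj C. (e, x)), fa = (\<lambda>f \<in> Arr C. (Id D e, f)) \<rparr>"

definition insRF :: "('o, 'm) cat \<Rightarrow> ('p, 'n) cat \<Rightarrow> 'p \<Rightarrow> ('o, 'm, 'o \<times> 'p, 'm \<times> 'n) ftr" where
  "insRF C D e = \<lparr> fo = (\<lambda>x \<in> Obj C. (x, e)), fa = (\<lambda>f \<in> Arr C. (f, Id D e)) \<rparr>"

section \<open>Monoidal categories and strong monoidal functors\<close>

record ('o, 'm) moncat =
  MC  :: "('o, 'm) cat"
  Ten :: "('o \<times> 'o, 'm \<times> 'm, 'o, 'm) ftr"
  One :: 'o
  Asc :: "('o \<times> 'o) \<times> 'o \<Rightarrow> 'm"
  LUn :: "'o \<Rightarrow> 'm"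
  RUn :: "'o \<Rightarrow> 'm"

definition pentagon :: "('o, 'm) moncat \<Rightarrow> bool" where
  "pentagon M \<longleftrightarrow> (let C = MC M; t = fo (Ten M); T = fa (Ten M); a = Asc M in
     \<forall>w \<in> Obj C. \<forall>x \<in> Obj C. \<forall>y \<in> Obj C. \<forall>z \<in> Obj C.
       a ((w, x), t (y, z)) \<cdot>\<^bsub>C\<^esub> a ((t (w, x), y), z) =
       (T (Id C w, a ((x, y), z)) \<cdot>\<^bsub>C\<^esub> a ((w, t (x, y)), z)) \<cdot>\<^bsub>C\<^esub> T (a ((w, x), y), Id C z))"

definition triangle :: "('o, 'm) moncat \<Rightarrow> bool" where
  "triangle M \<longleftrightarrow> (let C = MC M; T = fa (Ten M) in
     \<forall>x \<in> Obj C. \<forall>y \<in> Obj C.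
       T (Id C x, LUn M y) \<cdot>\<^bsub>C\<^esub> Asc M ((x, One M), y) = T (RUn M x, Id C y))"

definition monoidal_category :: "('o, 'm) moncat \<Rightarrow> bool" where
  "monoidal_category M \<longleftrightarrow> (let C = MC M; T = Ten M; CC = prodC C C in
     category C \<and> is_functor CC C T \<and> One M \<in> Obj C \<and>
     nat_iso (prodC CC C) C
       (compF (prodC CC C) T (prodF CC C T (idF C)))
       (compF (prodC CC C) T (compF (prodC CC C) (prodF C CC (idF C) T) (assocF C C C)))
       (Asc M) \<and>
     nat_iso C C (compF C T (insLF C C (One M))) (idF C) (LUn M) \<and>
     nat_iso C C (compF C T (insRF C C (One M))) (idF C) (RUn M) \<and>
     pentagon M \<and> triangle M)"

text \<open>\<open>F2 (x, y) : F x \<otimes> F y \<rightarrow> F (x \<otimes> y)\<close> and \<open>F0 : 1 \<rightarrow> F 1\<close>.\<close>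

record ('o, 'm, 'p, 'n) smf =
  SF :: "('o, 'm, 'p, 'n) ftr"
  F2 :: "'o \<times> 'o \<Rightarrow> 'n"
  F0 :: 'n

definition strong_monoidal ::
    "('o, 'm) moncat \<Rightarrow> ('p, 'n) moncat \<Rightarrow> ('o, 'm, 'p, 'n) smf \<Rightarrow> bool" where
  "strong_monoidal M N \<Phi> \<longleftrightarrow>
    (let C = MC M; D = MC N; F = SF \<Phi>; f = fo F; tM = fo (Ten M); T = fa (Ten N); \<mu> = F2 \<Phi> in
     is_functor C D F \<and>
     nat_iso (prodC C C) D (compF (prodC C C) (Ten N) (prodF C C F F))
       (compF (prodC C C) F (Ten M)) \<mu> \<and>
     F0 \<Phi> \<in> hom D (One N) (f (One M)) \<and> iso D (F0 \<Phi>) \<and>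
     (\<forall>x \<in> Obj C. \<forall>y \<in> Obj C. \<forall>z \<in> Obj C.
        (fa F (Asc M ((x, y), z)) \<cdot>\<^bsub>D\<^esub> \<mu> (tM (x, y), z)) \<cdot>\<^bsub>D\<^esub> T (\<mu> (x, y), Id D (f z)) =
        (\<mu> (x, tM (y, z)) \<cdot>\<^bsub>D\<^esub> T (Id D (f x), \<mu> (y, z))) \<cdot>\<^bsub>D\<^esub> Asc N ((f x, f y), f z)) \<and>
     (\<forall>x \<in> Obj C.
        (fa F (LUn M x) \<cdot>\<^bsub>D\<^esub> \<mu> (One M, x)) \<cdot>\<^bsub>D\<^esub> T (F0 \<Phi>, Id D (f x)) = LUn N (f x) \<and>
        (fa F (RUn M x) \<cdot>\<^bsub>D\<^esub> \<mu> (x, One M)) \<cdot>\<^bsub>D\<^esub> T (Id D (f x), F0 \<Phi>) = RUn N (f x)))"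

definition id_smf :: "('o, 'm) moncat \<Rightarrow> ('o, 'm, 'o, 'm) smf" where
  "id_smf M = (let C = MC M in
     \<lparr> SF = idF C, F2 = (\<lambda>p \<in> Obj (prodC C C). Id C (fo (Ten M) p)), F0 = Id C (One M) \<rparr>)"

definition comp_smf :: "('o, 'm) moncat \<Rightarrow> ('p, 'n) moncat \<Rightarrow> ('q, 'k) moncat \<Rightarrow>
    ('p, 'n, 'q, 'k) smf \<Rightarrow> ('o, 'm, 'p, 'n) smf \<Rightarrow> ('o, 'm, 'q, 'k) smf" where
  "comp_smf M N P \<Psi> \<Phi> = (let C = MC M; E = MC P; f = fo (SF \<Phi>); G = fa (SF \<Psi>) in
     \<lparr> SF = compF C (SF \<Psi>) (SF \<Phi>),
       F2 = (\<lambda>(x, y) \<in> Obj (prodC C C). G (F2 \<Phi> (x, y)) \<cdot>\<^bsub>E\<^esub> F2 \<Psi> (f x, f y)),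
       F0 = G (F0 \<Phi>) \<cdot>\<^bsub>E\<^esub> F0 \<Psi> \<rparr>)"

section \<open>Finite sets and injections\<close>

text \<open>Finite sets are the finite sets of elements of a universe which is closed under
  tagging, so that they are closed under disjoint union.\<close>

datatype 'a elt = Pt 'a | Lft "'a elt" | Rgt "'a elt"

type_synonym 'a inj_arr = "'a elt set \<times> ('a elt \<Rightarrow> 'a elt) \<times> 'a elt set"

definition FinInj :: "('a elt set, 'a inj_arr) cat" where
  "FinInj = mk_cat finite
     (\<lambda>A f B. f \<in> A \<rightarrow>\<^sub>E B \<and> inj_on f A)
     (\<lambda>A. \<lambda>x \<in> A. x)
     (\<lambda>A B C g f. compose A g f)"

abbreviation map_of_inj :: "'a inj_arr \<Rightarrow> 'a elt \<Rightarrow> 'a elt" where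
  "map_of_inj f \<equiv> fst (snd f)"

definition dunion :: "'a elt set \<Rightarrow> 'a elt set \<Rightarrow> 'a elt set" where
  "dunion A B = Lft ` A \<union> Rgt ` B"

fun copair :: "('a elt \<Rightarrow> 'b) \<Rightarrow> ('a elt \<Rightarrow> 'b) \<Rightarrow> 'a elt \<Rightarrow> 'b" where
  "copair f g (Lft x) = f x"
| "copair f g (Rgt y) = g y"
| "copair f g (Pt _) = undefined"

definition dunionF :: "('a elt set \<times> 'a elt set, 'a inj_arr \<times> 'a inj_arr,
    'a elt set, 'a inj_arr) ftr" where
  "dunionF = \<lparr>
     fo = (\<lambda>(A, B) \<in> Obj (prodC FinInj FinInj). dunion A B),
     fa = (\<lambda>((A, f, A'), (B, g, B')) \<in> Arr (prodC FinInj FinInj).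
       (dunion A B, \<lambda>x \<in> dunion A B. copair (Lft \<circ> f) (Rgt \<circ> g) x, dunion A' B')) \<rparr>"

definition FinInjM :: "('a elt set, 'a inj_arr) moncat" where
  "FinInjM = \<lparr>
     MC = FinInj,
     Ten = dunionF,
     One = {},
     Asc = (\<lambda>((A, B), C) \<in> Obj (prodC (prodC FinInj FinInj) FinInj).
       (dunion (dunion A B) C,
        \<lambda>x \<in> dunion (dunion A B) C. copair (copair Lft (Rgt \<circ> Lft)) (Rgt \<circ> Rgt) x,
        dunion A (dunion B C))),
     LUn = (\<lambda>A \<in> Obj FinInj. (dunion {} A, \<lambda>x \<in> dunion {} A. copair id id x, A)),
     RUn = (\<lambda>A \<in> Obj FinInj. (dunion A {}, \<lambda>x \<in> dunion A {}. copair id id x, A)) \<rparr>"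

section \<open>Restriction species\<close>

definition cartesian :: "('o, 'm) cat \<Rightarrow> ('p, 'n) cat \<Rightarrow> ('o, 'm, 'p, 'n) ftr \<Rightarrow> 'm \<Rightarrow> bool" where
  "cartesian E B P u \<longleftrightarrow> u \<in> Arr E \<and>
     (\<forall>v \<in> Arr E. \<forall>w \<in> hom B (fo P (Dom E v)) (fo P (Dom E u)).
        Cod E v = Cod E u \<and> fa P u \<cdot>\<^bsub>B\<^esub> w = fa P v \<longrightarrow>
        (\<exists>!t. t \<in> hom E (Dom E v) (Dom E u) \<and> fa P t = w \<and> u \<cdot>\<^bsub>E\<^esub> t = v))"

definition fibre :: "('o, 'm) cat \<Rightarrow> ('p, 'n) cat \<Rightarrow> ('o, 'm, 'p, 'n) ftr \<Rightarrow> 'p \<Rightarrow> ('o, 'm) cat" where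
  "fibre E B P b = E \<lparr> Obj := {X \<in> Obj E. fo P X = b}, Arr := {u \<in> Arr E. fa P u = Id B b} \<rparr>"

definition right_fibration :: "('o, 'm) cat \<Rightarrow> ('p, 'n) cat \<Rightarrow> ('o, 'm, 'p, 'n) ftr \<Rightarrow> bool" where
  "right_fibration E B P \<longleftrightarrow> is_functor E B P \<and>
     (\<forall>X \<in> Obj E. \<forall>f \<in> Arr B. Cod B f = fo P X \<longrightarrow>
        (\<exists>u. cartesian E B P u \<and> Cod E u = X \<and> fa P u = f)) \<and>
     (\<forall>b \<in> Obj B. groupoid (fibre E B P b))"

record ('a, 'o, 'm) rspecies =
  Tot :: "('o, 'm) cat"
  Prj :: "('o, 'm, 'a elt set, 'a inj_arr) ftr"

definition restriction_species :: "('a, 'o, 'm) rspecies \<Rightarrow> bool" where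
  "restriction_species R \<longleftrightarrow> right_fibration (Tot R) FinInj (Prj R) \<and>
     (\<forall>A \<in> Obj FinInj. \<forall>X \<in> Obj (fibre (Tot R) FinInj (Prj R) A).
        finite (hom (fibre (Tot R) FinInj (Prj R) A) X X))"

definition rspecies_morphism ::
    "('a, 'o, 'm) rspecies \<Rightarrow> ('o, 'm, 'o, 'm) ftr \<Rightarrow> ('a, 'o, 'm) rspecies \<Rightarrow> bool" where
  "rspecies_morphism R F S \<longleftrightarrow>
     is_functor (Tot R) (Tot S) F \<and> compF (Tot R) (Prj S) F = Prj R"

type_synonym ('a, 'o, 'm) rspecies_arr =
  "('a, 'o, 'm) rspecies \<times> ('o, 'm, 'o, 'm) ftr \<times> ('a, 'o, 'm) rspecies"

definition RSp :: "(('a, 'o, 'm) rspecies, ('a, 'o, 'm) rspecies_arr) cat" where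
  "RSp = mk_cat restriction_species rspecies_morphism
     (\<lambda>R. idF (Tot R)) (\<lambda>R S T G F. compF (Tot R) G F)"

record ('a, 'o, 'm) mrspecies =
  MTot :: "('o, 'm) moncat"
  MPrj :: "('o, 'm, 'a elt set, 'a inj_arr) smf"

definition underlying_rspecies :: "('a, 'o, 'm) mrspecies \<Rightarrow> ('a, 'o, 'm) rspecies" where
  "underlying_rspecies R = \<lparr> Tot = MC (MTot R), Prj = SF (MPrj R) \<rparr>"

definition monoidal_restriction_species :: "('a, 'o, 'm) mrspecies \<Rightarrow> bool" where
  "monoidal_restriction_species R \<longleftrightarrow>
     restriction_species (underlying_rspecies R) \<and>
     monoidal_category (MTot R) \<and>
     strong_monoidal (MTot R) FinInjM (MPrj R)"

definition mrspecies_morphism ::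
    "('a, 'o, 'm) mrspecies \<Rightarrow> ('o, 'm, 'o, 'm) smf \<Rightarrow> ('a, 'o, 'm) mrspecies \<Rightarrow> bool" where
  "mrspecies_morphism R \<Phi> S \<longleftrightarrow>
     strong_monoidal (MTot R) (MTot S) \<Phi> \<and>
     rspecies_morphism (underlying_rspecies R) (SF \<Phi>) (underlying_rspecies S)"

type_synonym ('a, 'o, 'm) mrspecies_arr =
  "('a, 'o, 'm) mrspecies \<times> ('o, 'm, 'o, 'm) smf \<times> ('a, 'o, 'm) mrspecies"

definition MonRSp :: "(('a, 'o, 'm) mrspecies, ('a, 'o, 'm) mrspecies_arr) cat" where
  "MonRSp = mk_cat monoidal_restriction_species mrspecies_morphism
     (\<lambda>R. id_smf (MTot R))
     (\<lambda>R S T \<Psi> \<Phi>. comp_smf (MTot R) (MTot S) (MTot T) \<Psi> \<Phi>)"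

definition forget_MonRSp :: "(('a, 'o, 'm) mrspecies, ('a, 'o, 'm) mrspecies_arr,
    ('a, 'o, 'm) rspecies, ('a, 'o, 'm) rspecies_arr) ftr" where
  "forget_MonRSp = \<lparr>
     fo = (\<lambda>R \<in> Obj MonRSp. underlying_rspecies R),
     fa = (\<lambda>(R, \<Phi>, S) \<in> Arr MonRSp. (underlying_rspecies R, SF \<Phi>, underlying_rspecies S)) \<rparr>"

section \<open>Contravariant pseudo-functors with values in groupoids\<close>

text \<open>For \<open>a : x \<rightarrow> y\<close> and \<open>b : y \<rightarrow> z\<close>, writing \<open>a* = Act X a\<close>, the coherence isomorphisms are
  \<open>CmpI X a b u : a* (b* u) \<rightarrow> (b a)* u\<close> and \<open>IdI X x u : u \<rightarrow> (id x)* u\<close>.\<close>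

record ('c, 'k, 'o, 'm) psh =
  Gpd  :: "'c \<Rightarrow> ('o, 'm) cat"
  Act  :: "'k \<Rightarrow> ('o, 'm, 'o, 'm) ftr"
  CmpI :: "'k \<Rightarrow> 'k \<Rightarrow> 'o \<Rightarrow> 'm"
  IdI  :: "'c \<Rightarrow> 'o \<Rightarrow> 'm"

definition pseudofunctor :: "('c, 'k) cat \<Rightarrow> ('c, 'k, 'o, 'm) psh \<Rightarrow> bool" where
  "pseudofunctor C X \<longleftrightarrow> category C \<and>
     (\<forall>c \<in> Obj C. groupoid (Gpd X c)) \<and>
     (\<forall>a \<in> Arr C. is_functor (Gpd X (Cod C a)) (Gpd X (Dom C a)) (Act X a)) \<and>
     (\<forall>a \<in> Arr C. \<forall>b \<in> Arr C. Cod C a = Dom C b \<longrightarrow>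
        nat_iso (Gpd X (Cod C b)) (Gpd X (Dom C a))
          (compF (Gpd X (Cod C b)) (Act X a) (Act X b)) (Act X (b \<cdot>\<^bsub>C\<^esub> a)) (CmpI X a b)) \<and>
     (\<forall>c \<in> Obj C. nat_iso (Gpd X c) (Gpd X c) (idF (Gpd X c)) (Act X (Id C c)) (IdI X c)) \<and>
     (\<forall>a \<in> Arr C. \<forall>b \<in> Arr C. \<forall>d \<in> Arr C. Cod C a = Dom C b \<and> Cod C b = Dom C d \<longrightarrow>
        (\<forall>u \<in> Obj (Gpd X (Cod C d)).
           CmpI X a (d \<cdot>\<^bsub>C\<^esub> b) u \<cdot>\<^bsub>Gpd X (Dom C a)\<^esub> fa (Act X a) (CmpI X b d u) =
           CmpI X (b \<cdot>\<^bsub>C\<^esub> a) d u \<cdot>\<^bsub>Gpd X (Dom C a)\<^esub> CmpI X a b (fo (Act X d) u))) \<and>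
     (\<forall>a \<in> Arr C. \<forall>u \<in> Obj (Gpd X (Cod C a)).
        CmpI X (Id C (Dom C a)) a u \<cdot>\<^bsub>Gpd X (Dom C a)\<^esub> IdI X (Dom C a) (fo (Act X a) u) =
          Id (Gpd X (Dom C a)) (fo (Act X a) u) \<and>
        CmpI X a (Id C (Cod C a)) u \<cdot>\<^bsub>Gpd X (Dom C a)\<^esub> fa (Act X a) (IdI X (Cod C a) u) =
          Id (Gpd X (Dom C a)) (fo (Act X a) u))"

text \<open>Pseudo-natural transformations \<open>\<tau> : X \<rightarrow> Y\<close>: for \<open>a : x \<rightarrow> y\<close> the naturality isomorphism is
  \<open>Nat \<tau> a u : \<tau> (a* u) \<rightarrow> a* (\<tau> u)\<close>.\<close>

record ('c, 'k, 'o, 'm, 'p, 'n) pnt =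
  Cpt :: "'c \<Rightarrow> ('o, 'm, 'p, 'n) ftr"
  Nat :: "'k \<Rightarrow> 'o \<Rightarrow> 'n"

definition pseudonatural :: "('c, 'k) cat \<Rightarrow> ('c, 'k, 'o, 'm) psh \<Rightarrow> ('c, 'k, 'p, 'n) psh \<Rightarrow>
    ('c, 'k, 'o, 'm, 'p, 'n) pnt \<Rightarrow> bool" where
  "pseudonatural C X Y \<tau> \<longleftrightarrow>
     Cpt \<tau> \<in> extensional (Obj C) \<and> Nat \<tau> \<in> extensional (Arr C) \<and>
     (\<forall>c \<in> Obj C. is_functor (Gpd X c) (Gpd Y c) (Cpt \<tau> c)) \<and>
     (\<forall>a \<in> Arr C. nat_iso (Gpd X (Cod C a)) (Gpd Y (Dom C a))
        (compF (Gpd X (Cod C a)) (Cpt \<tau> (Dom C a)) (Act X a))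
        (compF (Gpd X (Cod C a)) (Act Y a) (Cpt \<tau> (Cod C a))) (Nat \<tau> a)) \<and>
     (\<forall>a \<in> Arr C. \<forall>b \<in> Arr C. Cod C a = Dom C b \<longrightarrow>
        (\<forall>u \<in> Obj (Gpd X (Cod C b)).
           Nat \<tau> (b \<cdot>\<^bsub>C\<^esub> a) u \<cdot>\<^bsub>Gpd Y (Dom C a)\<^esub> fa (Cpt \<tau> (Dom C a)) (CmpI X a b u) =
           (CmpI Y a b (fo (Cpt \<tau> (Cod C b)) u) \<cdot>\<^bsub>Gpd Y (Dom C a)\<^esub> fa (Act Y a) (Nat \<tau> b u))
             \<cdot>\<^bsub>Gpd Y (Dom C a)\<^esub> Nat \<tau> a (fo (Act X b) u))) \<and>
     (\<forall>c \<in> Obj C. \<forall>u \<in> Obj (Gpd X c).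
        Nat \<tau> (Id C c) u \<cdot>\<^bsub>Gpd Y c\<^esub> fa (Cpt \<tau> c) (IdI X c u) = IdI Y c (fo (Cpt \<tau> c) u))"

definition modification :: "('c, 'k) cat \<Rightarrow> ('c, 'k, 'o, 'm) psh \<Rightarrow> ('c, 'k, 'p, 'n) psh \<Rightarrow>
    ('c, 'k, 'o, 'm, 'p, 'n) pnt \<Rightarrow> ('c, 'k, 'o, 'm, 'p, 'n) pnt \<Rightarrow> ('c \<Rightarrow> 'o \<Rightarrow> 'n) \<Rightarrow> bool" where
  "modification C X Y \<sigma> \<tau> \<Gamma> \<longleftrightarrow> \<Gamma> \<in> extensional (Obj C) \<and>
     (\<forall>c \<in> Obj C. nat_iso (Gpd X c) (Gpd Y c) (Cpt \<sigma> c) (Cpt \<tau> c) (\<Gamma> c)) \<and>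
     (\<forall>a \<in> Arr C. \<forall>u \<in> Obj (Gpd X (Cod C a)).
        Nat \<tau> a u \<cdot>\<^bsub>Gpd Y (Dom C a)\<^esub> \<Gamma> (Dom C a) (fo (Act X a) u) =
        fa (Act Y a) (\<Gamma> (Cod C a) u) \<cdot>\<^bsub>Gpd Y (Dom C a)\<^esub> Nat \<sigma> a u)"

definition idP :: "('c, 'k) cat \<Rightarrow> ('c, 'k, 'o, 'm) psh \<Rightarrow> ('c, 'k, 'o, 'm, 'o, 'm) pnt" where
  "idP C X = \<lparr>
     Cpt = (\<lambda>c \<in> Obj C. idF (Gpd X c)),
     Nat = (\<lambda>a \<in> Arr C. \<lambda>u \<in> Obj (Gpd X (Cod C a)). Id (Gpd X (Dom C a)) (fo (Act X a) u)) \<rparr>"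

text \<open>The composite \<open>X \<rightarrow> Y \<rightarrow> Z\<close> of \<open>\<sigma>\<close> followed by \<open>\<tau>\<close> (the data of \<open>Y\<close> are not needed).\<close>

definition compP :: "('c, 'k) cat \<Rightarrow> ('c, 'k, 'o, 'm) psh \<Rightarrow> ('c, 'k, 'q, 'l) psh \<Rightarrow>
    ('c, 'k, 'p, 'n, 'q, 'l) pnt \<Rightarrow> ('c, 'k, 'o, 'm, 'p, 'n) pnt \<Rightarrow>
    ('c, 'k, 'o, 'm, 'q, 'l) pnt" where
  "compP C X Z \<tau> \<sigma> = \<lparr>
     Cpt = (\<lambda>c \<in> Obj C. compF (Gpd X c) (Cpt \<tau> c) (Cpt \<sigma> c)),
     Nat = (\<lambda>a \<in> Arr C. \<lambda>u \<in> Obj (Gpd X (Cod C a)).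
       Nat \<tau> a (fo (Cpt \<sigma> (Cod C a)) u) \<cdot>\<^bsub>Gpd Z (Dom C a)\<^esub> fa (Cpt \<tau> (Dom C a)) (Nat \<sigma> a u)) \<rparr>"

definition prodX :: "('c, 'k) cat \<Rightarrow> ('c, 'k, 'o, 'm) psh \<Rightarrow> ('c, 'k, 'p, 'n) psh \<Rightarrow>
    ('c, 'k, 'o \<times> 'p, 'm \<times> 'n) psh" where
  "prodX C X Y = \<lparr>
     Gpd = (\<lambda>c. prodC (Gpd X c) (Gpd Y c)),
     Act = (\<lambda>a. prodF (Gpd X (Cod C a)) (Gpd Y (Cod C a)) (Act X a) (Act Y a)),
     CmpI = (\<lambda>a b. \<lambda>u \<in> Obj (prodC (Gpd X (Cod C b)) (Gpd Y (Cod C b))).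
       map_prod (CmpI X a b) (CmpI Y a b) u),
     IdI = (\<lambda>c. \<lambda>u \<in> Obj (prodC (Gpd X c) (Gpd Y c)). map_prod (IdI X c) (IdI Y c) u) \<rparr>"

definition oneX :: "('c, 'k, unit, unit) psh" where
  "oneX = \<lparr> Gpd = (\<lambda>_. oneC), Act = (\<lambda>_. idF oneC), CmpI = (\<lambda>_ _ _. ()), IdI = (\<lambda>_ _. ()) \<rparr>"

definition prodP :: "('c, 'k) cat \<Rightarrow> ('c, 'k, 'o, 'm) psh \<Rightarrow> ('c, 'k, 'p, 'n) psh \<Rightarrow>
    ('c, 'k, 'o, 'm, 'o2, 'm2) pnt \<Rightarrow> ('c, 'k, 'p, 'n, 'p2, 'n2) pnt \<Rightarrow>
    ('c, 'k, 'o \<times> 'p, 'm \<times> 'n, 'o2 \<times> 'p2, 'm2 \<times> 'n2) pnt" where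
  "prodP C X Y \<sigma> \<tau> = \<lparr>
     Cpt = (\<lambda>c \<in> Obj C. prodF (Gpd X c) (Gpd Y c) (Cpt \<sigma> c) (Cpt \<tau> c)),
     Nat = (\<lambda>a \<in> Arr C. \<lambda>u \<in> Obj (prodC (Gpd X (Cod C a)) (Gpd Y (Cod C a))).
       map_prod (Nat \<sigma> a) (Nat \<tau> a) u) \<rparr>"

definition assocP :: "('c, 'k) cat \<Rightarrow> ('c, 'k, 'o, 'm) psh \<Rightarrow>
    ('c, 'k, ('o \<times> 'o) \<times> 'o, ('m \<times> 'm) \<times> 'm, 'o \<times> 'o \<times> 'o, 'm \<times> 'm \<times> 'm) pnt" where
  "assocP C X = (let X2 = prodX C X X; X3 = prodX C X2 X; X3' = prodX C X X2 in \<lparr>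
     Cpt = (\<lambda>c \<in> Obj C. assocF (Gpd X c) (Gpd X c) (Gpd X c)),
     Nat = (\<lambda>a \<in> Arr C. \<lambda>((u, v), w) \<in> Obj (Gpd X3 (Cod C a)).
       Id (Gpd X3' (Dom C a)) (fo (Act X3' a) (u, v, w))) \<rparr>)"

definition insLP :: "('c, 'k) cat \<Rightarrow> ('c, 'k, 'o, 'm) psh \<Rightarrow>
    ('c, 'k, 'o, 'm, unit \<times> 'o, unit \<times> 'm) pnt" where
  "insLP C X = \<lparr>
     Cpt = (\<lambda>c \<in> Obj C. insLF (Gpd X c) oneC ()),
     Nat = (\<lambda>a \<in> Arr C. \<lambda>u \<in> Obj (Gpd X (Cod C a)). ((), Id (Gpd X (Dom C a)) (fo (Act X a) u))) \<rparr>"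

definition insRP :: "('c, 'k) cat \<Rightarrow> ('c, 'k, 'o, 'm) psh \<Rightarrow>
    ('c, 'k, 'o, 'm, 'o \<times> unit, 'm \<times> unit) pnt" where
  "insRP C X = \<lparr>
     Cpt = (\<lambda>c \<in> Obj C. insRF (Gpd X c) oneC ()),
     Nat = (\<lambda>a \<in> Arr C. \<lambda>u \<in> Obj (Gpd X (Cod C a)). (Id (Gpd X (Dom C a)) (fo (Act X a) u), ())) \<rparr>"

section \<open>Monoidal structures on pseudo-functors\<close>

record ('c, 'k, 'o, 'm) monpsh =
  Und  :: "('c, 'k, 'o, 'm) psh"
  Mul  :: "('c, 'k, 'o \<times> 'o, 'm \<times> 'm, 'o, 'm) pnt"
  Uni  :: "('c, 'k, unit, unit, 'o, 'm) pnt"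
  AscM :: "'c \<Rightarrow> ('o \<times> 'o) \<times> 'o \<Rightarrow> 'm"
  LUnM :: "'c \<Rightarrow> 'o \<Rightarrow> 'm"
  RUnM :: "'c \<Rightarrow> 'o \<Rightarrow> 'm"

definition level :: "('c, 'k, 'o, 'm) monpsh \<Rightarrow> 'c \<Rightarrow> ('o, 'm) moncat" where
  "level M c = \<lparr> MC = Gpd (Und M) c, Ten = Cpt (Mul M) c, One = fo (Cpt (Uni M) c) (),
     Asc = AscM M c, LUn = LUnM M c, RUn = RUnM M c \<rparr>"

text \<open>The pentagon and triangle equations for the modifications are equations in the groupoids
  at each object \<open>c\<close>; they are part of \<open>monoidal_category (level M c)\<close>.\<close>

definition monoidal_psh :: "('c, 'k) cat \<Rightarrow> ('c, 'k, 'o, 'm) monpsh \<Rightarrow> bool" where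
  "monoidal_psh C M \<longleftrightarrow>
    (let X = Und M; X2 = prodX C X X; X3 = prodX C X2 X; T = Mul M in
     pseudofunctor C X \<and> pseudonatural C X2 X T \<and> pseudonatural C oneX X (Uni M) \<and>
     modification C X3 X
       (compP C X3 X T (prodP C X2 X T (idP C X)))
       (compP C X3 X T (compP C X3 X2 (prodP C X X2 (idP C X) T) (assocP C X)))
       (AscM M) \<and>
     modification C X X
       (compP C X X T (compP C X X2 (prodP C oneX X (Uni M) (idP C X)) (insLP C X)))
       (idP C X) (LUnM M) \<and>
     modification C X X
       (compP C X X T (compP C X X2 (prodP C X oneX (idP C X) (Uni M)) (insRP C X)))
       (idP C X) (RUnM M) \<and>
     (\<forall>c \<in> Obj C. monoidal_category (level M c)))"

record ('c, 'k, 'o, 'm, 'p, 'n) monpnt =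
  MF :: "('c, 'k, 'o, 'm, 'p, 'n) pnt"
  M2 :: "'c \<Rightarrow> 'o \<times> 'o \<Rightarrow> 'n"
  M0 :: "'c \<Rightarrow> unit \<Rightarrow> 'n"

definition levelF :: "('c, 'k, 'o, 'm, 'p, 'n) monpnt \<Rightarrow> 'c \<Rightarrow> ('o, 'm, 'p, 'n) smf" where
  "levelF \<Phi> c = \<lparr> SF = Cpt (MF \<Phi>) c, F2 = M2 \<Phi> c, F0 = M0 \<Phi> c () \<rparr>"

definition monoidal_pnt :: "('c, 'k) cat \<Rightarrow> ('c, 'k, 'o, 'm) monpsh \<Rightarrow> ('c, 'k, 'p, 'n) monpsh \<Rightarrow>
    ('c, 'k, 'o, 'm, 'p, 'n) monpnt \<Rightarrow> bool" where
  "monoidal_pnt C M N \<Phi> \<longleftrightarrow>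
    (let X = Und M; Y = Und N; X2 = prodX C X X; F = MF \<Phi> in
     pseudonatural C X Y F \<and>
     modification C X2 Y (compP C X2 Y (Mul N) (prodP C X X F F)) (compP C X2 Y F (Mul M)) (M2 \<Phi>) \<and>
     modification C oneX Y (Uni N) (compP C oneX Y F (Uni M)) (M0 \<Phi>) \<and>
     (\<forall>c \<in> Obj C. strong_monoidal (level M c) (level N c) (levelF \<Phi> c)))"

definition id_monpnt :: "('c, 'k) cat \<Rightarrow> ('c, 'k, 'o, 'm) monpsh \<Rightarrow>
    ('c, 'k, 'o, 'm, 'o, 'm) monpnt" where
  "id_monpnt C M = \<lparr>
     MF = idP C (Und M),
     M2 = (\<lambda>c \<in> Obj C. F2 (id_smf (level M c))),
     M0 = (\<lambda>c \<in> Obj C. \<lambda>_. F0 (id_smf (level M c))) \<rparr>"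

definition comp_monpnt :: "('c, 'k) cat \<Rightarrow> ('c, 'k, 'o, 'm) monpsh \<Rightarrow> ('c, 'k, 'p, 'n) monpsh \<Rightarrow>
    ('c, 'k, 'q, 'l) monpsh \<Rightarrow> ('c, 'k, 'p, 'n, 'q, 'l) monpnt \<Rightarrow>
    ('c, 'k, 'o, 'm, 'p, 'n) monpnt \<Rightarrow> ('c, 'k, 'o, 'm, 'q, 'l) monpnt" where
  "comp_monpnt C M N P \<Psi> \<Phi> =
    (let cmp = (\<lambda>c. comp_smf (level M c) (level N c) (level P c) (levelF \<Psi> c) (levelF \<Phi> c)) in
     \<lparr> MF = compP C (Und M) (Und P) (MF \<Psi>) (MF \<Phi>),
       M2 = (\<lambda>c \<in> Obj C. F2 (cmp c)),
       M0 = (\<lambda>c \<in> Obj C. \<lambda>_. F0 (cmp c)) \<rparr>)"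

section \<open>Decomposition spaces\<close>

text \<open>The object \<open>[n]\<close> of the simplex category is represented by \<open>n\<close>.\<close>

type_synonym simp_arr = "nat \<times> (nat \<Rightarrow> nat) \<times> nat"

definition Simp :: "(nat, simp_arr) cat" where
  "Simp = mk_cat (\<lambda>_. True)
     (\<lambda>m a n. a \<in> {0..m} \<rightarrow>\<^sub>E {0..n} \<and> mono_on {0..m} a)
     (\<lambda>n. \<lambda>i \<in> {0..n}. i)
     (\<lambda>l m n b a. compose {0..l} b a)"

definition generic :: "simp_arr \<Rightarrow> bool" where
  "generic = (\<lambda>(m, a, n). (m, a, n) \<in> Arr Simp \<and> a 0 = 0 \<and> a m = n)"

definition free :: "simp_arr \<Rightarrow> bool" where
  "free = (\<lambda>(m, a, n). (m, a, n) \<in> Arr Simp \<and> (\<forall>i < m. a (i + 1) = a i + 1))"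

definition pushout :: "('o, 'm) cat \<Rightarrow> 'm \<Rightarrow> 'm \<Rightarrow> 'm \<Rightarrow> 'm \<Rightarrow> bool" where
  "pushout C f g f' g' \<longleftrightarrow>
     f \<in> Arr C \<and> g \<in> Arr C \<and> f' \<in> Arr C \<and> g' \<in> Arr C \<and> Dom C f = Dom C g \<and>
     Cod C f = Dom C f' \<and> Cod C g = Dom C g' \<and> Cod C f' = Cod C g' \<and>
     f' \<cdot>\<^bsub>C\<^esub> f = g' \<cdot>\<^bsub>C\<^esub> g \<and>
     (\<forall>h \<in> Arr C. \<forall>k \<in> Arr C. Dom C h = Cod C f \<and> Dom C k = Cod C g \<and> Cod C h = Cod C k \<and>
        h \<cdot>\<^bsub>C\<^esub> f = k \<cdot>\<^bsub>C\<^esub> g \<longrightarrow>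
        (\<exists>!t. t \<in> hom C (Cod C f') (Cod C h) \<and> t \<cdot>\<^bsub>C\<^esub> f' = h \<and> t \<cdot>\<^bsub>C\<^esub> g' = k))"

text \<open>The standard homotopy pullback of \<open>f : A \<rightarrow> E\<close> and \<open>g : B \<rightarrow> E\<close>.\<close>

definition hpb :: "('o, 'm) cat \<Rightarrow> ('p, 'n) cat \<Rightarrow> ('q, 'l) cat \<Rightarrow> ('o, 'm, 'q, 'l) ftr \<Rightarrow>
    ('p, 'n, 'q, 'l) ftr \<Rightarrow>
    ('o \<times> 'p \<times> 'l, ('o \<times> 'p \<times> 'l) \<times> ('m \<times> 'n) \<times> ('o \<times> 'p \<times> 'l)) cat" where
  "hpb A B E f g = mk_cat
     (\<lambda>(a, b, \<gamma>). a \<in> Obj A \<and> b \<in> Obj B \<and> \<gamma> \<in> hom E (fo f a) (fo g b))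
     (\<lambda>(a, b, \<gamma>) (u, v) (a', b', \<gamma>'). u \<in> hom A a a' \<and> v \<in> hom B b b' \<and>
        \<gamma>' \<cdot>\<^bsub>E\<^esub> fa f u = fa g v \<cdot>\<^bsub>E\<^esub> \<gamma>)
     (\<lambda>(a, b, \<gamma>). (Id A a, Id B b))
     (\<lambda>_ _ _ (u', v') (u, v). (u' \<cdot>\<^bsub>A\<^esub> u, v' \<cdot>\<^bsub>B\<^esub> v))"

text \<open>The square of functors \<open>p : P \<rightarrow> A\<close>, \<open>q : P \<rightarrow> B\<close>, \<open>f : A \<rightarrow> E\<close>, \<open>g : B \<rightarrow> E\<close> with
  the isomorphism \<open>\<theta> : f p \<rightarrow> g q\<close> is a homotopy pullback.\<close>

definition homotopy_pullback :: "('r, 's) cat \<Rightarrow> ('o, 'm) cat \<Rightarrow> ('p, 'n) cat \<Rightarrow> ('q, 'l) cat \<Rightarrow>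
    ('r, 's, 'o, 'm) ftr \<Rightarrow> ('r, 's, 'p, 'n) ftr \<Rightarrow> ('o, 'm, 'q, 'l) ftr \<Rightarrow>
    ('p, 'n, 'q, 'l) ftr \<Rightarrow> ('r \<Rightarrow> 'l) \<Rightarrow> bool" where
  "homotopy_pullback P A B E p q f g \<theta> \<longleftrightarrow>
     (let comp = (\<lambda>x. (fo p x, fo q x, \<theta> x)) in
      equivalence P (hpb A B E f g)
       \<lparr> fo = (\<lambda>x \<in> Obj P. comp x),
         fa = (\<lambda>h \<in> Arr P. (comp (Dom P h), (fa p h, fa q h), comp (Cod P h))) \<rparr>)"

type_synonym ('o, 'm) sgpd = "(nat, simp_arr, 'o, 'm) psh"
type_synonym ('o, 'm, 'p, 'n) smap = "(nat, simp_arr, 'o, 'm, 'p, 'n) pnt"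

text \<open>The isomorphism filling the image of a commutative square \<open>f' g = g' f\<close> is
  \<open>g* (f'* x) \<rightarrow> (f' g)* x = (g' f)* x \<rightarrow> f* (g'* x)\<close>.\<close>

definition decomposition_space :: "('o, 'm) sgpd \<Rightarrow> bool" where
  "decomposition_space X \<longleftrightarrow> pseudofunctor Simp X \<and>
     (\<forall>g f f' g'. generic g \<and> free f \<and> pushout Simp g f f' g' \<longrightarrow>
        homotopy_pullback
          (Gpd X (Cod Simp f')) (Gpd X (Cod Simp g)) (Gpd X (Cod Simp f)) (Gpd X (Dom Simp g))
          (Act X f') (Act X g') (Act X g) (Act X f)
          (\<lambda>x. inverse_arr (Gpd X (Dom Simp g)) (CmpI X f g' x)
             \<cdot>\<^bsub>Gpd X (Dom Simp g)\<^esub> CmpI X g f' x))"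

definition culf :: "('o, 'm) sgpd \<Rightarrow> ('p, 'n) sgpd \<Rightarrow> ('o, 'm, 'p, 'n) smap \<Rightarrow> bool" where
  "culf X Y \<tau> \<longleftrightarrow> pseudonatural Simp X Y \<tau> \<and>
     (\<forall>g. generic g \<longrightarrow>
        homotopy_pullback
          (Gpd X (Cod Simp g)) (Gpd X (Dom Simp g)) (Gpd Y (Cod Simp g)) (Gpd Y (Dom Simp g))
          (Act X g) (Cpt \<tau> (Cod Simp g)) (Cpt \<tau> (Dom Simp g)) (Act Y g) (Nat \<tau> g))"

definition Dcmp :: "(('o, 'm) sgpd, ('o, 'm) sgpd \<times> ('o, 'm, 'o, 'm) smap \<times> ('o, 'm) sgpd) cat" where
  "Dcmp = mk_cat decomposition_space (\<lambda>X \<tau> Y. culf X Y \<tau>)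
     (\<lambda>X. idP Simp X) (\<lambda>X Y Z \<tau> \<sigma>. compP Simp X Z \<tau> \<sigma>)"

type_synonym ('o, 'm) msgpd = "(nat, simp_arr, 'o, 'm) monpsh"
type_synonym ('o, 'm, 'p, 'n) msmap = "(nat, simp_arr, 'o, 'm, 'p, 'n) monpnt"

definition monoidal_decomposition_space :: "('o, 'm) msgpd \<Rightarrow> bool" where
  "monoidal_decomposition_space M \<longleftrightarrow>
     decomposition_space (Und M) \<and> monoidal_psh Simp M \<and>
     culf (prodX Simp (Und M) (Und M)) (Und M) (Mul M)"

definition MonDcmp ::
    "(('o, 'm) msgpd, ('o, 'm) msgpd \<times> ('o, 'm, 'o, 'm) msmap \<times> ('o, 'm) msgpd) cat" where
  "MonDcmp = mk_cat monoidal_decomposition_space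
     (\<lambda>M \<Phi> N. monoidal_pnt Simp M N \<Phi> \<and> culf (Und M) (Und N) (MF \<Phi>))
     (\<lambda>M. id_monpnt Simp M) (\<lambda>M N P \<Psi> \<Phi>. comp_monpnt Simp M N P \<Psi> \<Phi>)"

definition forget_MonDcmp ::
    "(('o, 'm) msgpd, ('o, 'm) msgpd \<times> ('o, 'm, 'o, 'm) msmap \<times> ('o, 'm) msgpd,
      ('o, 'm) sgpd, ('o, 'm) sgpd \<times> ('o, 'm, 'o, 'm) smap \<times> ('o, 'm) sgpd) ftr" where
  "forget_MonDcmp = \<lparr>
     fo = (\<lambda>M \<in> Obj MonDcmp. Und M),
     fa = (\<lambda>(M, \<Phi>, N) \<in> Arr MonDcmp. (Und M, MF \<Phi>, Und N)) \<rparr>"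

section \<open>The decomposition space of layered structures\<close>

text \<open>For \<open>g : [n] \<rightarrow> [m]\<close> generic, a map \<open>{1..m} \<rightarrow> {1..n}\<close>; for \<open>f : [n] \<rightarrow> [m]\<close> free, a map
  \<open>{1..n} \<rightarrow> {1..m}\<close>.\<close>

definition under_generic :: "simp_arr \<Rightarrow> nat \<Rightarrow> nat" where
  "under_generic = (\<lambda>(n, g, m). \<lambda>j \<in> {1..m}. THE i. i \<in> {1..n} \<and> g (i - 1) < j \<and> j \<le> g i)"

definition under_free :: "simp_arr \<Rightarrow> nat \<Rightarrow> nat" where
  "under_free = (\<lambda>(n, f, m). \<lambda>i \<in> {1..n}. i + f 0)"

definition generic_part :: "simp_arr \<Rightarrow> simp_arr" where
  "generic_part = (\<lambda>(m, a, n). (m, \<lambda>i \<in> {0..m}. a i - a 0, a m - a 0))"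

definition free_part :: "simp_arr \<Rightarrow> simp_arr" where
  "free_part = (\<lambda>(m, a, n). (a m - a 0, \<lambda>i \<in> {0..a m - a 0}. i + a 0, n))"

text \<open>A layered structure \<open>(A, p, X)\<close>; \<open>p\<close> is extensional.\<close>

type_synonym ('a, 'o) lay = "'a elt set \<times> ('a elt \<Rightarrow> nat) \<times> 'o"
type_synonym ('a, 'o, 'm) lay_arr = "('a, 'o) lay \<times> 'm \<times> ('a, 'o) lay"

definition Lay :: "('a, 'o, 'm) rspecies \<Rightarrow> nat \<Rightarrow> (('a, 'o) lay, ('a, 'o, 'm) lay_arr) cat" where
  "Lay R n = mk_cat
     (\<lambda>(A, p, X). finite A \<and> p \<in> A \<rightarrow>\<^sub>E {1..n} \<and> X \<in> Obj (Tot R) \<and> fo (Prj R) X = A)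
     (\<lambda>(A, p, X) u (B, q, Y). u \<in> hom (Tot R) X Y \<and> iso (Tot R) u \<and>
        (\<forall>x \<in> A. q (map_of_inj (fa (Prj R) u) x) = p x))
     (\<lambda>(A, p, X). Id (Tot R) X)
     (\<lambda>_ _ _ v u. v \<cdot>\<^bsub>Tot R\<^esub> u)"

text \<open>A chosen cartesian lift \<open>X|B \<rightarrow> X\<close> of the inclusion of \<open>B\<close> in the underlying set \<open>A\<close> of
  \<open>X\<close>. The choice is normalised by \<open>X|A = X\<close>, so that generic maps (whose free part is an
  identity) act strictly as \<open>(A, p, X) \<mapsto> (A, under_generic g \<circ> p, X)\<close>.\<close>

definition res_lift :: "('a, 'o, 'm) rspecies \<Rightarrow> 'o \<Rightarrow> 'a elt set \<Rightarrow> 'm" where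
  "res_lift R X B = (let A = fo (Prj R) X in
     if B = A then Id (Tot R) X
     else SOME u. cartesian (Tot R) FinInj (Prj R) u \<and> Cod (Tot R) u = X \<and>
            fa (Prj R) u = (B, \<lambda>x \<in> B. x, A))"

definition restrict_to :: "('a, 'o, 'm) rspecies \<Rightarrow> 'o \<Rightarrow> 'a elt set \<Rightarrow> 'o" where
  "restrict_to R X B = Dom (Tot R) (res_lift R X B)"

text \<open>The factorisation of \<open>h\<close> through the cartesian arrow \<open>l\<close>; it is unique, as all arrows of
  \<open>FinInj\<close> are monomorphisms.\<close>

definition fill :: "('a, 'o, 'm) rspecies \<Rightarrow> 'm \<Rightarrow> 'm \<Rightarrow> 'm" where
  "fill R l h = (THE t. t \<in> hom (Tot R) (Dom (Tot R) h) (Dom (Tot R) l) \<and> l \<cdot>\<^bsub>Tot R\<^esub> t = h)"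

definition act_generic :: "simp_arr \<Rightarrow> ('a, 'o) lay \<Rightarrow> ('a, 'o) lay" where
  "act_generic g = (\<lambda>(A, p, X). (A, compose A (under_generic g) p, X))"

definition act_free :: "('a, 'o, 'm) rspecies \<Rightarrow> simp_arr \<Rightarrow> ('a, 'o) lay \<Rightarrow> ('a, 'o) lay" where
  "act_free R f = (\<lambda>(A, p, X).
     (let L = {1..fst f}; A' = {x \<in> A. p x \<in> under_free f ` L} in
      (A', \<lambda>x \<in> A'. THE i. i \<in> L \<and> under_free f i = p x, restrict_to R X A')))"

definition act_lay :: "('a, 'o, 'm) rspecies \<Rightarrow> simp_arr \<Rightarrow> ('a, 'o) lay \<Rightarrow> ('a, 'o) lay" where
  "act_lay R a t = act_generic (generic_part a) (act_free R (free_part a) t)"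

text \<open>The arrow of the total category from the structure of \<open>a* t\<close> to the structure of \<open>t\<close>.\<close>

definition act_lift :: "('a, 'o, 'm) rspecies \<Rightarrow> simp_arr \<Rightarrow> ('a, 'o) lay \<Rightarrow> 'm" where
  "act_lift R a t = res_lift R (snd (snd t)) (fst (act_lay R a t))"

definition LaySp :: "('a, 'o, 'm) rspecies \<Rightarrow> (('a, 'o) lay, ('a, 'o, 'm) lay_arr) sgpd" where
  "LaySp R = \<lparr>
     Gpd = Lay R,
     Act = (\<lambda>a. \<lparr>
       fo = (\<lambda>t \<in> Obj (Lay R (Cod Simp a)). act_lay R a t),
       fa = (\<lambda>(s, u, t) \<in> Arr (Lay R (Cod Simp a)).
         (act_lay R a s, fill R (act_lift R a t) (u \<cdot>\<^bsub>Tot R\<^esub> act_lift R a s), act_lay R a t)) \<rparr>),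
     CmpI = (\<lambda>a b. \<lambda>t \<in> Obj (Lay R (Cod Simp b)). let s = act_lay R b t; c = b \<cdot>\<^bsub>Simp\<^esub> a in
       (act_lay R a s, fill R (act_lift R c t) (act_lift R b t \<cdot>\<^bsub>Tot R\<^esub> act_lift R a s),
        act_lay R c t)),
     IdI = (\<lambda>n. \<lambda>t \<in> Obj (Lay R n). let i = Id Simp n in
       (t, fill R (act_lift R i t) (Id (Tot R) (snd (snd t))), act_lay R i t)) \<rparr>"

definition lay_map :: "('o, 'm, 'o, 'm) ftr \<Rightarrow> ('a, 'o) lay \<Rightarrow> ('a, 'o) lay" where
  "lay_map F = (\<lambda>(A, p, X). (A, p, fo F X))"

definition LayMap :: "('a, 'o, 'm) rspecies \<Rightarrow> ('o, 'm, 'o, 'm) ftr \<Rightarrow> ('a, 'o, 'm) rspecies \<Rightarrow>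
    (('a, 'o) lay, ('a, 'o, 'm) lay_arr, ('a, 'o) lay, ('a, 'o, 'm) lay_arr) smap" where
  "LayMap R F S = \<lparr>
     Cpt = (\<lambda>n. \<lparr>
       fo = (\<lambda>t \<in> Obj (Lay R n). lay_map F t),
       fa = (\<lambda>(s, u, t) \<in> Arr (Lay R n). (lay_map F s, fa F u, lay_map F t)) \<rparr>),
     Nat = (\<lambda>a \<in> Arr Simp. \<lambda>t \<in> Obj (Lay R (Cod Simp a)).
       (lay_map F (act_lay R a t),
        fill S (act_lift S a (lay_map F t)) (fa F (act_lift R a t)),
        act_lay S a (lay_map F t))) \<rparr>"

definition LayF :: "(('a, 'o, 'm) rspecies, ('a, 'o, 'm) rspecies_arr,
    (('a, 'o) lay, ('a, 'o, 'm) lay_arr) sgpd,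
    (('a, 'o) lay, ('a, 'o, 'm) lay_arr) sgpd \<times>
    (('a, 'o) lay, ('a, 'o, 'm) lay_arr, ('a, 'o) lay, ('a, 'o, 'm) lay_arr) smap \<times>
    (('a, 'o) lay, ('a, 'o, 'm) lay_arr) sgpd) ftr" where
  "LayF = \<lparr>
     fo = (\<lambda>R \<in> Obj RSp. LaySp R),
     fa = (\<lambda>(R, F, S) \<in> Arr RSp. (LaySp R, LayMap R F S, LaySp S)) \<rparr>"

subsection \<open>The monoidal structure\<close>

text \<open>The underlying set of \<open>X \<squnion> Y\<close> is identified with the disjoint union \<open>A \<squnion> B\<close> of the underlying
  sets by the structure isomorphism \<open>\<phi>\<close> of the projection; the layering is transported along it.
  In the same way the underlying set of the unit is isomorphic, hence equal, to the empty set.\<close>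

definition lay_ten :: "('a, 'o, 'm) mrspecies \<Rightarrow> ('a, 'o) lay \<times> ('a, 'o) lay \<Rightarrow> ('a, 'o) lay" where
  "lay_ten R = (\<lambda>((A, p, X), (B, q, Y)).
     (let Z = fo (Ten (MTot R)) (X, Y); C = fo (SF (MPrj R)) Z;
          \<phi> = map_of_inj (F2 (MPrj R) (X, Y)) in
      (C, \<lambda>z \<in> C. copair p q (the_inv_into (dunion A B) \<phi> z), Z)))"

definition lay_one :: "('a, 'o, 'm) mrspecies \<Rightarrow> ('a, 'o) lay" where
  "lay_one R = ({}, \<lambda>_. undefined, One (MTot R))"

definition LayM :: "('a, 'o, 'm) mrspecies \<Rightarrow> (('a, 'o) lay, ('a, 'o, 'm) lay_arr) msgpd" where
  "LayM R = (let U = underlying_rspecies R; M = MTot R; C = MC M;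
       T = fa (Ten M); L = Lay U; str = (\<lambda>t. snd (snd t)) in
     \<lparr> Und = LaySp U,
       Mul = \<lparr>
         Cpt = (\<lambda>n. \<lparr>
           fo = (\<lambda>(s, t) \<in> Obj (prodC (L n) (L n)). lay_ten R (s, t)),
           fa = (\<lambda>((s, u, s'), (t, v, t')) \<in> Arr (prodC (L n) (L n)).
             (lay_ten R (s, t), T (u, v), lay_ten R (s', t'))) \<rparr>),
         Nat = (\<lambda>a \<in> Arr Simp. \<lambda>(s, t) \<in> Obj (prodC (L (Cod Simp a)) (L (Cod Simp a))).
           (lay_ten R (act_lay U a s, act_lay U a t),
            fill U (act_lift U a (lay_ten R (s, t))) (T (act_lift U a s, act_lift U a t)),
            act_lay U a (lay_ten R (s, t)))) \<rparr>,
       Uni = \<lparr>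
         Cpt = (\<lambda>n. \<lparr>
           fo = (\<lambda>_. lay_one R),
           fa = (\<lambda>_. (lay_one R, Id C (One M), lay_one R)) \<rparr>),
         Nat = (\<lambda>a \<in> Arr Simp. \<lambda>_.
           (lay_one R, fill U (act_lift U a (lay_one R)) (Id C (One M)), act_lay U a (lay_one R))) \<rparr>,
       AscM = (\<lambda>n. \<lambda>((r, s), t) \<in> Obj (prodC (prodC (L n) (L n)) (L n)).
         (lay_ten R (lay_ten R (r, s), t), Asc M ((str r, str s), str t),
          lay_ten R (r, lay_ten R (s, t)))),
       LUnM = (\<lambda>n. \<lambda>t \<in> Obj (L n). (lay_ten R (lay_one R, t), LUn M (str t), t)),
       RUnM = (\<lambda>n. \<lambda>t \<in> Obj (L n). (lay_ten R (t, lay_one R), RUn M (str t), t)) \<rparr>)"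

definition LayMapM :: "('a, 'o, 'm) mrspecies \<Rightarrow> ('o, 'm, 'o, 'm) smf \<Rightarrow> ('a, 'o, 'm) mrspecies \<Rightarrow>
    (('a, 'o) lay, ('a, 'o, 'm) lay_arr, ('a, 'o) lay, ('a, 'o, 'm) lay_arr) msmap" where
  "LayMapM R \<Phi> S = (let U = underlying_rspecies R; F = SF \<Phi>; str = (\<lambda>t. snd (snd t)) in
     \<lparr> MF = LayMap U F (underlying_rspecies S),
       M2 = (\<lambda>n. \<lambda>(s, t) \<in> Obj (prodC (Lay U n) (Lay U n)).
         (lay_ten S (lay_map F s, lay_map F t), F2 \<Phi> (str s, str t), lay_map F (lay_ten R (s, t)))),
       M0 = (\<lambda>n _. (lay_one S, F0 \<Phi>, lay_map F (lay_one R))) \<rparr>)"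

definition LayFM :: "(('a, 'o, 'm) mrspecies, ('a, 'o, 'm) mrspecies_arr,
    (('a, 'o) lay, ('a, 'o, 'm) lay_arr) msgpd,
    (('a, 'o) lay, ('a, 'o, 'm) lay_arr) msgpd \<times>
    (('a, 'o) lay, ('a, 'o, 'm) lay_arr, ('a, 'o) lay, ('a, 'o, 'm) lay_arr) msmap \<times>
    (('a, 'o) lay, ('a, 'o, 'm) lay_arr) msgpd) ftr" where
  "LayFM = \<lparr>
     fo = (\<lambda>R \<in> Obj MonRSp. LayM R),
     fa = (\<lambda>(R, \<Phi>, S) \<in> Arr MonRSp. (LayM R, LayMapM R \<Phi> S, LayM S)) \<rparr>"

end

theory Submission
  imports Defs
begin

text \<open>Every layered structure over \<open>R\<close> has an underlying \<open>R\<close>-structure, and acting by a simplicial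
  map \<open>a\<close> comes with a lift \<open>X|A' \<rightarrow> X\<close> of the inclusion of the layers in the image of \<open>a\<close>. All
  arrows of a right fibration over finite sets and injections are cartesian, hence monic, so the
  coherence isomorphisms are determined by their compatibility with these lifts, and the
  coherence equations can be checked in the total category of \<open>R\<close>. For a monoidal \<open>R\<close> they become
  the coherence equations of its monoidal structure. A generic map only changes the
  layering, which can be transported along isomorphisms; this makes the tensor product and the
  maps induced by morphisms of species CULF.\<close>

section \<open>Categories, functors and products\<close>

text \<open>Restrictions are chosen, so the simplicial structure carries genuine coherence
  isomorphisms. What keeps the homotopy pullbacks manageable is the normalisation in
  \<open>res_lift\<close>: over a generic map the lift is an identity, the structure is literally
  unchanged, and objects can be lifted strictly. Free maps do not share this, so the isomorphism
  filling a decomposition square has to be identified through its composite with a lift. Since the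
  simplex category has no isomorphisms except identities, its pushouts are strictly unique, and one
  explicit pushout for each generic-free pair suffices. The obstacle in the monoidal part is that a
  morphism of monoidal species commutes with the projections merely as a functor, whereas its
  structure maps must preserve layerings, that is, respect the identification of the underlying set
  of a tensor product with a disjoint union. This compatibility is not part of the definition and
  has to be derived. The functor laws of the conclusion are equalities of extensional functions;
  equalities between chosen cells come from the uniqueness of factorisations through monic
  lifts.\<close>

lemma in_hom: "f \<in> hom C x y \<longleftrightarrow> f \<in> Arr C \<and> Dom C f = x \<and> Cod C f = y"
  by (auto simp: hom_def)

lemma category_rules [simp]:
  assumes "category C"
  shows "f \<in> Arr C \<Longrightarrow> Dom C f \<in> Obj C" "f \<in> Arr C \<Longrightarrow> Cod C f \<in> Obj C"
    "x \<in> Obj C \<Longrightarrow> Id C x \<in> Arr C" "x \<in> Obj C \<Longrightarrow> Dom C (Id C x) = x" "x \<in> Obj C \<Longrightarrow> Cod C (Id C x) = x"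
    "f \<in> Arr C \<Longrightarrow> g \<in> Arr C \<Longrightarrow> Cod C f = Dom C g \<Longrightarrow> Cmp C g f \<in> Arr C"
    "f \<in> Arr C \<Longrightarrow> g \<in> Arr C \<Longrightarrow> Cod C f = Dom C g \<Longrightarrow> Dom C (Cmp C g f) = Dom C f"
    "f \<in> Arr C \<Longrightarrow> g \<in> Arr C \<Longrightarrow> Cod C f = Dom C g \<Longrightarrow> Cod C (Cmp C g f) = Cod C g"
    "f \<in> Arr C \<Longrightarrow> Dom C f = x \<Longrightarrow> Cmp C f (Id C x) = f"
    "f \<in> Arr C \<Longrightarrow> Cod C f = x \<Longrightarrow> Cmp C (Id C x) f = f"
    "f \<in> Arr C \<Longrightarrow> g \<in> Arr C \<Longrightarrow> h \<in> Arr C \<Longrightarrow> Cod C f = Dom C g \<Longrightarrow> Cod C g = Dom C h \<Longrightarrow>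
       Cmp C (Cmp C h g) f = Cmp C h (Cmp C g f)"
  using assms unfolding category_def in_hom by auto

text \<open>Serves the homotopy pullbacks, the simplex category and the four categories of the
  conclusion. As arrows carry their endpoints, only the middle components have to be composed and
  compared.\<close>

lemma category_mk_cat:
  assumes "\<And>x. ob x \<Longrightarrow> mor x (i x) x"
    and "\<And>x y z f g. ob x \<Longrightarrow> ob y \<Longrightarrow> ob z \<Longrightarrow> mor x f y \<Longrightarrow> mor y g z \<Longrightarrow> mor x (c x y z g f) z"
    and "\<And>x y f. ob x \<Longrightarrow> ob y \<Longrightarrow> mor x f y \<Longrightarrow> c x x y f (i x) = f \<and> c x y y (i y) f = f"
    and "\<And>x y z w f g h. ob x \<Longrightarrow> ob y \<Longrightarrow> ob z \<Longrightarrow> ob w \<Longrightarrow> mor x f y \<Longrightarrow> mor y g z \<Longrightarrow> mor z h w \<Longrightarrow>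
      c x z w h (c x y z g f) = c x y w (c y z w h g) f"
  shows "category (mk_cat ob mor i c)"
  unfolding category_def mk_cat_def in_hom by (auto simp: assms)

lemma mk_cat_simps:
  "Obj (mk_cat ob mor i c) = {x. ob x}"
  "(x, f, y) \<in> Arr (mk_cat ob mor i c) \<longleftrightarrow> ob x \<and> ob y \<and> mor x f y"
  "Dom (mk_cat ob mor i c) (x, f, y) = x"
  "Cod (mk_cat ob mor i c) (x, f, y) = y"
  "Id (mk_cat ob mor i c) x = (x, i x, x)"
  "Cmp (mk_cat ob mor i c) (y', g, z) (x, f, y) = (x, c x y z g f, z)"
  by (auto simp: mk_cat_def)

text \<open>Composites are normalised to the right, which breaks up the two-arrow sides of a
  commuting square. This is the square in the shape it takes in front of a further arrow
  \<open>x\<close>.\<close>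

lemma reassoc:
  assumes "category C" "Cmp C g f = Cmp C k h"
    and "f \<in> Arr C" "g \<in> Arr C" "Cod C f = Dom C g" "h \<in> Arr C" "k \<in> Arr C" "Cod C h = Dom C k"
    and "x \<in> Arr C" "Cod C x = Dom C f"
  shows "Cmp C g (Cmp C f x) = Cmp C k (Cmp C h x)"
proof -
  have "Dom C f = Dom C h" using assms by (metis category_rules(7))
  then have "Cmp C g (Cmp C f x) = Cmp C (Cmp C g f) x" "Cmp C k (Cmp C h x) = Cmp C (Cmp C k h) x"
    using assms(1,3-) by simp_all
  then show ?thesis by (simp only: assms(2))
qed

lemma inverse_unique:
  assumes "category C" "is_inverse C f g" "is_inverse C f h"
  shows "g = h"
proof -
  have "g = Cmp C g (Cmp C f h)" using assms by (simp add: is_inverse_def in_hom)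
  also have "\<dots> = Cmp C (Cmp C g f) h" using assms by (subst category_rules(11)) (auto simp: is_inverse_def in_hom)
  also have "\<dots> = h" using assms by (simp add: is_inverse_def in_hom)
  finally show ?thesis .
qed

lemma is_inverse_inverse_arr: "category C \<Longrightarrow> iso C f \<Longrightarrow> is_inverse C f (inverse_arr C f)"
  unfolding iso_def inverse_arr_def by (metis inverse_unique theI)

lemma iso_Id: "category C \<Longrightarrow> x \<in> Obj C \<Longrightarrow> iso C (Id C x)"
  unfolding iso_def is_inverse_def in_hom by (intro exI[of _ "Id C x"]) simp

lemma iso_Cmp:
  assumes c: "category C" and "iso C f" "iso C g" "Cod C f = Dom C g"
  shows "iso C (Cmp C g f)"
proof -
  obtain f' g' where i: "is_inverse C f f'" "is_inverse C g g'" using assms unfolding iso_def by blast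
  then have t: "f \<in> Arr C" "g \<in> Arr C" "f' \<in> Arr C" "g' \<in> Arr C" "Dom C f' = Cod C f" "Cod C f' = Dom C f"
     "Dom C g' = Cod C g" "Cod C g' = Dom C g"
     and e: "Cmp C f' f = Id C (Dom C f)" "Cmp C f f' = Id C (Cod C f)"
       "Cmp C g' g = Id C (Dom C g)" "Cmp C g g' = Id C (Cod C g)"
    by (auto simp: is_inverse_def in_hom)
  have "Cmp C g' (Cmp C g f) = f" "Cmp C f (Cmp C f' g') = g'"
    using t c assms(4) category_rules(11)[OF c, of f g g'] category_rules(11)[OF c, of g' f' f] e by auto
  then have "is_inverse C (Cmp C g f) (Cmp C f' g')"
    using t c assms(4) e by (auto simp: is_inverse_def in_hom)
  then show ?thesis unfolding iso_def by blast
qed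

lemma groupoid_category [simp]: "groupoid G \<Longrightarrow> category G"
  by (simp add: groupoid_def)

lemma groupoid_iso [simp]: "groupoid G \<Longrightarrow> f \<in> Arr G \<Longrightarrow> iso G f"
  by (simp add: groupoid_def)

lemma inverse_arr_rules:
  assumes "category G" "iso G f"
  shows "f \<in> Arr G" "inverse_arr G f \<in> Arr G" "Dom G (inverse_arr G f) = Cod G f" "Cod G (inverse_arr G f) = Dom G f"
    "Cmp G (inverse_arr G f) f = Id G (Dom G f)" "Cmp G f (inverse_arr G f) = Id G (Cod G f)"
  using is_inverse_inverse_arr[OF assms] by (auto simp: is_inverse_def in_hom)

lemma groupoid_inverse_arr [simp]:
  assumes "groupoid G" "f \<in> Arr G"
  shows "inverse_arr G f \<in> Arr G" "Dom G (inverse_arr G f) = Cod G f" "Cod G (inverse_arr G f) = Dom G f"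
    "Cmp G (inverse_arr G f) f = Id G (Dom G f)" "Cmp G f (inverse_arr G f) = Id G (Cod G f)"
  using inverse_arr_rules[of G f] assms by auto

lemma iso_cancel:
  assumes "category G" "iso G f" "g \<in> Arr G" "Cod G g = Cod G f"
  shows "Cmp G f (Cmp G (inverse_arr G f) g) = g"
  using category_rules(11)[OF assms(1), of g "inverse_arr G f" f] inverse_arr_rules[OF assms(1,2)] assms by simp

lemma functor_rules:
  assumes "is_functor C D F"
  shows "category C" "category D" "\<And>x. x \<in> Obj C \<Longrightarrow> fo F x \<in> Obj D"
    "\<And>f. f \<in> Arr C \<Longrightarrow> fa F f \<in> Arr D"
    "\<And>f. f \<in> Arr C \<Longrightarrow> Dom D (fa F f) = fo F (Dom C f)"
    "\<And>f. f \<in> Arr C \<Longrightarrow> Cod D (fa F f) = fo F (Cod C f)"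
    "\<And>x. x \<in> Obj C \<Longrightarrow> fa F (Id C x) = Id D (fo F x)"
    "\<And>f g. f \<in> Arr C \<Longrightarrow> g \<in> Arr C \<Longrightarrow> Cod C f = Dom C g \<Longrightarrow> fa F (Cmp C g f) = Cmp D (fa F g) (fa F f)"
  using assms unfolding is_functor_def in_hom by (auto simp: PiE_iff)

lemma functor_ext:
  assumes "is_functor C D F"
  shows "fo F \<in> extensional (Obj C)" "fa F \<in> extensional (Arr C)"
  using assms unfolding is_functor_def by (auto simp: PiE_iff)

lemma functorI:
  assumes "category C" "category D" "fo F \<in> extensional (Obj C)" "fa F \<in> extensional (Arr C)"
    "\<And>x. x \<in> Obj C \<Longrightarrow> fo F x \<in> Obj D"
    "\<And>f. f \<in> Arr C \<Longrightarrow> fa F f \<in> Arr D \<and> Dom D (fa F f) = fo F (Dom C f) \<and> Cod D (fa F f) = fo F (Cod C f)"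
    "\<And>x. x \<in> Obj C \<Longrightarrow> fa F (Id C x) = Id D (fo F x)"
    "\<And>f g. f \<in> Arr C \<Longrightarrow> g \<in> Arr C \<Longrightarrow> Cod C f = Dom C g \<Longrightarrow> fa F (Cmp C g f) = Cmp D (fa F g) (fa F f)"
  shows "is_functor C D F"
  using assms unfolding is_functor_def in_hom by (auto simp: PiE_iff)

lemma functor_iso:
  assumes "is_functor C D F" "iso C f"
  shows "iso D (fa F f)"
proof -
  note r = functor_rules[OF assms(1)] and i = inverse_arr_rules[OF functor_rules(1)[OF assms(1)] assms(2)]
  have "is_inverse D (fa F f) (fa F (inverse_arr C f))"
    unfolding is_inverse_def in_hom by (simp add: r i flip: r(8))
  then show ?thesis unfolding iso_def by blast
qed

lemma idF_simps [simp]: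
  "x \<in> Obj C \<Longrightarrow> fo (idF C) x = x" "f \<in> Arr C \<Longrightarrow> fa (idF C) f = f"
  by (simp_all add: idF_def)

lemma compF_simps [simp]:
  "x \<in> Obj C \<Longrightarrow> fo (compF C G F) x = fo G (fo F x)" "f \<in> Arr C \<Longrightarrow> fa (compF C G F) f = fa G (fa F f)"
  by (simp_all add: compF_def)

text \<open>Both components are extensional, so agreement on the carriers is equality in the logic.
  The equations between functors below rest on this rule.\<close>

lemma ftr_eqI:
  assumes "fo F \<in> extensional A" "fo G \<in> extensional A" "fa F \<in> extensional B" "fa G \<in> extensional B"
    "\<And>x. x \<in> A \<Longrightarrow> fo F x = fo G x" "\<And>f. f \<in> B \<Longrightarrow> fa F f = fa G f"
  shows "F = (G :: ('o, 'm, 'p, 'n) ftr)"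
proof (rule ftr.equality)
  show "fo F = fo G" using assms(1,2,5) by (rule extensionalityI)
  show "fa F = fa G" using assms(3,4,6) by (rule extensionalityI)
qed simp

lemma ext_ftr [simp]:
  "fo (compF C G F) \<in> extensional (Obj C)" "fa (compF C G F) \<in> extensional (Arr C)"
  "fo (idF C) \<in> extensional (Obj C)" "fa (idF C) \<in> extensional (Arr C)"
  "fo (prodF C D F' G') \<in> extensional (Obj C \<times> Obj D)" "fa (prodF C D F' G') \<in> extensional (Arr C \<times> Arr D)"
  by (simp_all add: compF_def idF_def prodF_def prodC_def)

lemma functor_idF: "category C \<Longrightarrow> is_functor C C (idF C)"
  by (rule functorI) auto

lemma functor_compF:
  assumes "is_functor C D F" "is_functor D E G"
  shows "is_functor C E (compF C G F)"
  by (rule functorI) (simp_all add: functor_rules[OF assms(1)] functor_rules[OF assms(2)])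

lemma compF_idF: "is_functor C D F \<Longrightarrow> compF C F (idF C) = F"
  by (rule ftr_eqI[of _ "Obj C" _ "Arr C"]) (auto dest: functor_ext)

lemma idF_compF: "is_functor C D F \<Longrightarrow> compF C (idF D) F = F"
  by (rule ftr_eqI[of _ "Obj C" _ "Arr C"]) (auto dest: functor_ext functor_rules)

lemma compF_assoc: "is_functor C D F \<Longrightarrow> compF C (compF D H G) F = compF C H (compF C G F)"
  by (rule ftr_eqI[of _ "Obj C" _ "Arr C"]) (auto dest: functor_ext functor_rules)

section \<open>Products of categories and the one-object category\<close>

lemma prodC_simps [simp]:
  "Obj (prodC C D) = Obj C \<times> Obj D" "Arr (prodC C D) = Arr C \<times> Arr D"
  "Dom (prodC C D) (f, f') = (Dom C f, Dom D f')" "Cod (prodC C D) (f, f') = (Cod C f, Cod D f')"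
  "Id (prodC C D) (x, y) = (Id C x, Id D y)"
  "Cmp (prodC C D) (g, g') (f, f') = (Cmp C g f, Cmp D g' f')"
  by (simp_all add: prodC_def)

lemma category_prodC [simp]:
  assumes "category C" "category D" shows "category (prodC C D)"
  unfolding category_def in_hom using assms by auto

lemma iso_prodC:
  assumes "iso C f" "iso D g"
  shows "iso (prodC C D) (f, g)"
proof -
  obtain f' g' where "is_inverse C f f'" "is_inverse D g g'" using assms unfolding iso_def by blast
  then have "is_inverse (prodC C D) (f, g) (f', g')" by (auto simp: is_inverse_def in_hom)
  then show ?thesis unfolding iso_def by blast
qed

lemma groupoid_prodC [simp]: "groupoid C \<Longrightarrow> groupoid D \<Longrightarrow> groupoid (prodC C D)"
  unfolding groupoid_def by (auto intro: iso_prodC)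

lemma oneC_simps [simp]:
  "Obj oneC = UNIV" "Arr oneC = UNIV" "Dom oneC f = ()" "Cod oneC f = ()" "Id oneC x = ()" "Cmp oneC g f = ()"
  by (simp_all add: oneC_def)

lemma category_oneC [simp]: "category oneC"
  unfolding category_def in_hom by simp

lemma groupoid_oneC [simp]: "groupoid oneC"
  unfolding groupoid_def by (auto simp: iso_def is_inverse_def in_hom)

lemma prodF_simps [simp]:
  "x \<in> Obj C \<Longrightarrow> y \<in> Obj D \<Longrightarrow> fo (prodF C D F G) (x, y) = (fo F x, fo G y)"
  "f \<in> Arr C \<Longrightarrow> g \<in> Arr D \<Longrightarrow> fa (prodF C D F G) (f, g) = (fa F f, fa G g)"
  by (simp_all add: prodF_def)

lemma functor_prodF:
  assumes "is_functor C D F" "is_functor C' D' F'"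
  shows "is_functor (prodC C C') (prodC D D') (prodF C C' F F')"
  by (rule functorI) (auto simp: functor_rules[OF assms(1)] functor_rules[OF assms(2)])

lemma assocF_simps [simp]:
  "x \<in> Obj C \<Longrightarrow> y \<in> Obj D \<Longrightarrow> z \<in> Obj E \<Longrightarrow> fo (assocF C D E) ((x, y), z) = (x, y, z)"
  "f \<in> Arr C \<Longrightarrow> g \<in> Arr D \<Longrightarrow> h \<in> Arr E \<Longrightarrow> fa (assocF C D E) ((f, g), h) = (f, g, h)"
  by (simp_all add: assocF_def)

lemma functor_assocF:
  assumes "category C" "category D" "category E"
  shows "is_functor (prodC (prodC C D) E) (prodC C (prodC D E)) (assocF C D E)"
  by (rule functorI) (use assms in \<open>auto simp: assocF_def\<close>)

lemma insF_simps [simp]: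
  "x \<in> Obj C \<Longrightarrow> fo (insLF C D e) x = (e, x)" "f \<in> Arr C \<Longrightarrow> fa (insLF C D e) f = (Id D e, f)"
  "x \<in> Obj C \<Longrightarrow> fo (insRF C D e) x = (x, e)" "f \<in> Arr C \<Longrightarrow> fa (insRF C D e) f = (f, Id D e)"
  by (simp_all add: insLF_def insRF_def)

lemma functor_insF:
  assumes "category C" "category D" "e \<in> Obj D"
  shows "is_functor C (prodC D C) (insLF C D e)" "is_functor C (prodC C D) (insRF C D e)"
  by (rule functorI; use assms in \<open>auto simp: insLF_def insRF_def\<close>)+

lemma nat_iso_rules:
  assumes "nat_iso C D F G t"
  shows "\<And>x. x \<in> Obj C \<Longrightarrow> t x \<in> Arr D" "\<And>x. x \<in> Obj C \<Longrightarrow> Dom D (t x) = fo F x"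
    "\<And>x. x \<in> Obj C \<Longrightarrow> Cod D (t x) = fo G x" "\<And>x. x \<in> Obj C \<Longrightarrow> iso D (t x)"
    "\<And>f. f \<in> Arr C \<Longrightarrow> Cmp D (t (Cod C f)) (fa F f) = Cmp D (fa G f) (t (Dom C f))"
    "t \<in> extensional (Obj C)"
  using assms unfolding nat_iso_def in_hom by auto

lemma nat_isoI:
  assumes "t \<in> extensional (Obj C)"
    "\<And>x. x \<in> Obj C \<Longrightarrow> t x \<in> Arr D \<and> Dom D (t x) = fo F x \<and> Cod D (t x) = fo G x \<and> iso D (t x)"
    "\<And>f. f \<in> Arr C \<Longrightarrow> Cmp D (t (Cod C f)) (fa F f) = Cmp D (fa G f) (t (Dom C f))"
  shows "nat_iso C D F G t"
  using assms unfolding nat_iso_def in_hom by auto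

section \<open>Homotopy pullbacks\<close>

lemma hpb_simps:
  "(a, b, \<gamma>) \<in> Obj (hpb A B E f g) \<longleftrightarrow> a \<in> Obj A \<and> b \<in> Obj B \<and> \<gamma> \<in> hom E (fo f a) (fo g b)"
  "((a, b, \<gamma>), (u, v), (a', b', \<gamma>')) \<in> Arr (hpb A B E f g) \<longleftrightarrow>
     (a, b, \<gamma>) \<in> Obj (hpb A B E f g) \<and> (a', b', \<gamma>') \<in> Obj (hpb A B E f g) \<and>
     u \<in> hom A a a' \<and> v \<in> hom B b b' \<and> Cmp E \<gamma>' (fa f u) = Cmp E (fa g v) \<gamma>"
  "Dom (hpb A B E f g) (x, w, y) = x" "Cod (hpb A B E f g) (x, w, y) = y"
  "Id (hpb A B E f g) (a, b, \<gamma>) = ((a, b, \<gamma>), (Id A a, Id B b), (a, b, \<gamma>))"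
  "Cmp (hpb A B E f g) (y', (u', v'), z) (x, (u, v), y) = (x, (Cmp A u' u, Cmp B v' v), z)"
  by (auto simp: hpb_def mk_cat_simps)

lemma category_hpb:
  assumes "is_functor A E f" "is_functor B E g"
  shows "category (hpb A B E f g)"
  unfolding hpb_def
proof (rule category_mk_cat, goal_cases)
  case (1 x) then show ?case
    using functor_rules[OF assms(1)] functor_rules[OF assms(2)] by (auto simp: in_hom)
next
  case (2 x y z h k)
  note r = functor_rules[OF assms(1)] functor_rules[OF assms(2)]
  obtain a b \<gamma> a' b' \<gamma>' a'' b'' \<gamma>'' u v u' v' where e: "x = (a, b, \<gamma>)" "y = (a', b', \<gamma>')" "z = (a'', b'', \<gamma>'')"
    "h = (u, v)" "k = (u', v')" by (metis prod_cases3 surj_pair)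
  have t: "u \<in> Arr A" "v \<in> Arr B" "u' \<in> Arr A" "v' \<in> Arr B" "\<gamma> \<in> Arr E" "\<gamma>' \<in> Arr E" "\<gamma>'' \<in> Arr E"
    "Dom A u = a" "Cod A u = a'" "Dom A u' = a'" "Cod A u' = a''"
    "Dom B v = b" "Cod B v = b'" "Dom B v' = b'" "Cod B v' = b''"
    "Dom E \<gamma> = fo f a" "Cod E \<gamma> = fo g b" "Dom E \<gamma>' = fo f a'" "Cod E \<gamma>' = fo g b'"
    "Dom E \<gamma>'' = fo f a''" "Cod E \<gamma>'' = fo g b''"
    and q: "Cmp E \<gamma>' (fa f u) = Cmp E (fa g v) \<gamma>" "Cmp E \<gamma>'' (fa f u') = Cmp E (fa g v') \<gamma>'"
    using 2 by (auto simp: e in_hom)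
  have "Cmp E \<gamma>'' (Cmp E (fa f u') (fa f u)) = Cmp E (fa g v') (Cmp E (fa g v) \<gamma>)"
    using reassoc[OF r(2) q(2), of "fa f u"] by (simp add: r t q)
  then show ?case by (simp add: e in_hom r t)
next
  case (3 x y h) then show ?case
    using functor_rules[OF assms(1)] functor_rules[OF assms(2)] by (auto simp: in_hom)
next
  case (4 x y z w h k l) then show ?case
    using functor_rules[OF assms(1)] functor_rules[OF assms(2)] by (auto simp: in_hom)
qed

text \<open>Composing the compatibility square of \<open>(u, v)\<close> with the inverse of
  \<open>v\<close> on the left and the inverse of \<open>u\<close> on the right gives the square of
  the inverses, so the componentwise inverses form an arrow back.\<close>

lemma iso_hpbI:
  assumes F: "is_functor A E f" "is_functor B E g"
    and w: "((a, b, \<gamma>), (u, v), (a', b', \<gamma>')) \<in> Arr (hpb A B E f g)" and i: "iso A u" "iso B v"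
  shows "iso (hpb A B E f g) ((a, b, \<gamma>), (u, v), (a', b', \<gamma>'))"
proof -
  note r = functor_rules[OF F(1)] functor_rules[OF F(2)]
  have t: "a \<in> Obj A" "a' \<in> Obj A" "b \<in> Obj B" "b' \<in> Obj B"
    "u \<in> Arr A" "v \<in> Arr B" "\<gamma> \<in> Arr E" "\<gamma>' \<in> Arr E"
    "Dom A u = a" "Cod A u = a'" "Dom B v = b" "Cod B v = b'"
    "Dom E \<gamma> = fo f a" "Cod E \<gamma> = fo g b" "Dom E \<gamma>' = fo f a'" "Cod E \<gamma>' = fo g b'"
    and q: "Cmp E \<gamma>' (fa f u) = Cmp E (fa g v) \<gamma>"
    using w by (auto simp: hpb_simps in_hom)
  let ?u = "inverse_arr A u" and ?v = "inverse_arr B v"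
  note iu = inverse_arr_rules[OF r(1) i(1)] and iv = inverse_arr_rules[OF r(9) i(2)]
  have s: "Cmp E (fa f u) (fa f ?u) = Id E (fo f a')" "Cmp E (fa g ?v) (fa g v) = Id E (fo g b)"
    using iu iv t by (simp_all add: r flip: r(8,16))
  have "Cmp E (fa g ?v) \<gamma>' = Cmp E (fa g ?v) (Cmp E (Cmp E \<gamma>' (fa f u)) (fa f ?u))"
    using s r t iu by simp
  also have "\<dots> = Cmp E (Cmp E (fa g ?v) (fa g v)) (Cmp E \<gamma> (fa f ?u))"
    unfolding q using r t iu iv by simp
  also have "\<dots> = Cmp E \<gamma> (fa f ?u)" unfolding s using r t iu by simp
  finally have "((a', b', \<gamma>'), (?u, ?v), (a, b, \<gamma>)) \<in> Arr (hpb A B E f g)"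
    using iu iv t w by (auto simp: hpb_simps in_hom)
  then have "is_inverse (hpb A B E f g) ((a, b, \<gamma>), (u, v), (a', b', \<gamma>')) ((a', b', \<gamma>'), (?u, ?v), (a, b, \<gamma>))"
    using w iu iv t by (auto simp: is_inverse_def in_hom hpb_simps(3-))
  then show ?thesis unfolding iso_def by blast
qed

text \<open>The situation of \<open>homotopy_pullback\<close> together with the typing and the
  naturality that its definition leaves implicit. The filling \<open>\<theta>\<close> is invertible
  because \<open>E\<close> is a groupoid.\<close>

locale square =
  fixes P :: "('r, 's) cat" and A :: "('o, 'm) cat" and B :: "('p, 'n) cat" and E :: "('q, 'l) cat"
    and p q f g \<theta>
  assumes groupoids: "groupoid P" "groupoid A" "groupoid B" "groupoid E"
    and p: "is_functor P A p" and q: "is_functor P B q" and f: "is_functor A E f" and g: "is_functor B E g"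
    and \<theta>: "\<And>x. x \<in> Obj P \<Longrightarrow> \<theta> x \<in> hom E (fo f (fo p x)) (fo g (fo q x))"
    and \<theta>_nat: "\<And>h. h \<in> Arr P \<Longrightarrow> Cmp E (\<theta> (Cod P h)) (fa f (fa p h)) = Cmp E (fa g (fa q h)) (\<theta> (Dom P h))"
begin

text \<open>Bijectivity of the comparison functor on hom-sets, unpacked: an arrow of the homotopy
  pullback between objects coming from \<open>P\<close> is a pair \<open>(u, v)\<close> compatible
  with \<open>\<theta>\<close>.\<close>

abbreviation "fully \<equiv> (\<forall>x \<in> Obj P. \<forall>y \<in> Obj P. \<forall>u \<in> hom A (fo p x) (fo p y). \<forall>v \<in> hom B (fo q x) (fo q y).
    Cmp E (\<theta> y) (fa f u) = Cmp E (fa g v) (\<theta> x) \<longrightarrow> (\<exists>!w. w \<in> hom P x y \<and> fa p w = u \<and> fa q w = v))"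

text \<open>Essential surjectivity of the comparison functor. Invertibility does not appear because
  \<open>u\<close> and \<open>v\<close> are arrows of groupoids, and a compatible pair of
  isomorphisms is an isomorphism by \<open>iso_hpbI\<close>.\<close>

abbreviation "essential \<equiv> (\<forall>a \<in> Obj A. \<forall>b \<in> Obj B. \<forall>\<gamma> \<in> hom E (fo f a) (fo g b).
   \<exists>x \<in> Obj P. \<exists>u \<in> hom A (fo p x) a. \<exists>v \<in> hom B (fo q x) b. Cmp E \<gamma> (fa f u) = Cmp E (fa g v) (\<theta> x))"

abbreviation "cm x \<equiv> (fo p x, fo q x, \<theta> x)"

abbreviation "K \<equiv> \<lparr> fo = (\<lambda>x \<in> Obj P. cm x), fa = (\<lambda>h \<in> Arr P. (cm (Dom P h), (fa p h, fa q h), cm (Cod P h))) \<rparr>"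

lemma cm_obj: "x \<in> Obj P \<Longrightarrow> cm x \<in> Obj (hpb A B E f g)"
  using \<theta> functor_rules[OF p] functor_rules[OF q] by (auto simp: hpb_simps)

lemma K_functor: "is_functor P (hpb A B E f g) K"
proof (rule functorI)
  show "category (hpb A B E f g)" by (rule category_hpb[OF f g])
  fix h assume h: "h \<in> Arr P"
  then have "cm (Dom P h) \<in> Obj (hpb A B E f g)" "cm (Cod P h) \<in> Obj (hpb A B E f g)"
    using cm_obj groupoids by auto
  then show "fa K h \<in> Arr (hpb A B E f g) \<and> Dom (hpb A B E f g) (fa K h) = fo K (Dom P h) \<and>
    Cod (hpb A B E f g) (fa K h) = fo K (Cod P h)"
    using h groupoids functor_rules[OF p] functor_rules[OF q] \<theta>_nat by (simp add: hpb_simps(2-) in_hom)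
qed (use cm_obj groupoids functor_rules[OF p] functor_rules[OF q] in \<open>auto simp: hpb_simps(3-)\<close>)

lemma homotopy_pullback_iff: "homotopy_pullback P A B E p q f g \<theta> \<longleftrightarrow> fully \<and> essential"
proof -
  let ?H = "hpb A B E f g"
  have bij: "bij_betw (fa K) (hom P x y) (hom ?H (cm x) (cm y)) \<longleftrightarrow>
     (\<forall>u \<in> hom A (fo p x) (fo p y). \<forall>v \<in> hom B (fo q x) (fo q y).
    Cmp E (\<theta> y) (fa f u) = Cmp E (fa g v) (\<theta> x) \<longrightarrow> (\<exists>!w. w \<in> hom P x y \<and> fa p w = u \<and> fa q w = v))"
    (is "?L \<longleftrightarrow> ?R") if x: "x \<in> Obj P" and y: "y \<in> Obj P" for x y
  proof -
    have K: "fa K w = (cm x, (fa p w, fa q w), cm y)" if "w \<in> hom P x y" for w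
      using that by (auto simp: in_hom)
    \<comment> \<open>With both endpoints fixed, an arrow of the homotopy pullback amounts to its
      two components.\<close>
    have hm: "w \<in> hom ?H (cm x) (cm y) \<longleftrightarrow> (\<exists>u v. w = (cm x, (u, v), cm y) \<and> u \<in> hom A (fo p x) (fo p y) \<and>
       v \<in> hom B (fo q x) (fo q y) \<and> Cmp E (\<theta> y) (fa f u) = Cmp E (fa g v) (\<theta> x))" for w
      using cm_obj[OF x] cm_obj[OF y] unfolding in_hom
      by (cases w) (auto simp: hpb_simps(2-) in_hom)
    have sub: "fa K ` hom P x y \<subseteq> hom ?H (cm x) (cm y)"
    proof
      fix w assume "w \<in> fa K ` hom P x y"
      then show "w \<in> hom ?H (cm x) (cm y)" using functor_rules[OF K_functor] x y by (auto simp: in_hom)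
    qed
    show ?thesis
    proof
      assume L: ?L
      show ?R
      proof (intro ballI impI)
        fix u v assume "u \<in> hom A (fo p x) (fo p y)" "v \<in> hom B (fo q x) (fo q y)"
          "Cmp E (\<theta> y) (fa f u) = Cmp E (fa g v) (\<theta> x)"
        then have "(cm x, (u, v), cm y) \<in> hom ?H (cm x) (cm y)" unfolding hm by blast
        then have "(cm x, (u, v), cm y) \<in> fa K ` hom P x y"
          by (simp only: bij_betw_imp_surj_on[OF L])
        then obtain w where w: "w \<in> hom P x y" "fa K w = (cm x, (u, v), cm y)" by (elim imageE) (rule that, auto)
        show "\<exists>!w. w \<in> hom P x y \<and> fa p w = u \<and> fa q w = v"
        proof
          show "w \<in> hom P x y \<and> fa p w = u \<and> fa q w = v" using w K[OF w(1)] by simp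
          fix w' assume w': "w' \<in> hom P x y \<and> fa p w' = u \<and> fa q w' = v"
          then have "fa K w' = fa K w" using K[of w'] w(2) by simp
          then show "w' = w" using L w(1) w' unfolding bij_betw_def by (meson inj_onD)
        qed
      qed
    next
      assume R: ?R
      have "inj_on (fa K) (hom P x y)"
      proof (rule inj_onI)
        fix w w' assume w: "w \<in> hom P x y" "w' \<in> hom P x y" and e: "fa K w = fa K w'"
        have "fa K w \<in> hom ?H (cm x) (cm y)" using sub w by blast
        then have "fa p w \<in> hom A (fo p x) (fo p y)" "fa q w \<in> hom B (fo q x) (fo q y)"
          "Cmp E (\<theta> y) (fa f (fa p w)) = Cmp E (fa g (fa q w)) (\<theta> x)"
          unfolding hm K[OF w(1)] by auto
        then have "\<exists>!w''. w'' \<in> hom P x y \<and> fa p w'' = fa p w \<and> fa q w'' = fa q w" using R by blast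
        moreover have "fa p w' = fa p w" "fa q w' = fa q w" using e K[OF w(1)] K[OF w(2)] by auto
        ultimately show "w = w'" using w by blast
      qed
      moreover have "hom ?H (cm x) (cm y) \<subseteq> fa K ` hom P x y"
      proof
        fix w assume "w \<in> hom ?H (cm x) (cm y)"
        then obtain u v where w: "w = (cm x, (u, v), cm y)" "u \<in> hom A (fo p x) (fo p y)"
       "v \<in> hom B (fo q x) (fo q y)" "Cmp E (\<theta> y) (fa f u) = Cmp E (fa g v) (\<theta> x)" unfolding hm by blast
        then obtain h where h: "h \<in> hom P x y" "fa p h = u" "fa q h = v" using R by blast
        have "w = fa K h" using K[OF h(1)] h(2,3) w(1) by simp
        then show "w \<in> fa K ` hom P x y" using h(1) by (rule image_eqI)
      qed
      ultimately show ?L using sub unfolding bij_betw_def by blast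
    qed
  qed
  have es: "(\<forall>z \<in> Obj ?H. \<exists>x \<in> Obj P. \<exists>i \<in> hom ?H (fo K x) z. iso ?H i) \<longleftrightarrow> essential" (is "?L \<longleftrightarrow> ?R")
  proof
    assume L: ?L
    show ?R
    proof (intro ballI)
      fix a b \<gamma> assume "a \<in> Obj A" "b \<in> Obj B" "\<gamma> \<in> hom E (fo f a) (fo g b)"
      then have "(a, b, \<gamma>) \<in> Obj ?H" by (simp add: hpb_simps)
      then obtain x i where x: "x \<in> Obj P" "i \<in> hom ?H (fo K x) (a, b, \<gamma>)" using L by blast
      then obtain u v where "i = (cm x, (u, v), (a, b, \<gamma>))" "i \<in> Arr ?H"
        by (cases i) (auto simp: in_hom hpb_simps)
      with x show "\<exists>x \<in> Obj P. \<exists>u \<in> hom A (fo p x) a. \<exists>v \<in> hom B (fo q x) b. Cmp E \<gamma> (fa f u) = Cmp E (fa g v) (\<theta> x)"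
        by (auto simp: hpb_simps)
    qed
  next
    assume R: ?R
    show ?L
    proof
      fix z assume z: "z \<in> Obj ?H"
      obtain a b \<gamma> where e: "z = (a, b, \<gamma>)" by (metis surj_pair)
      with z obtain x u v where x: "x \<in> Obj P" and uv: "u \<in> hom A (fo p x) a" "v \<in> hom B (fo q x) b"
        "Cmp E \<gamma> (fa f u) = Cmp E (fa g v) (\<theta> x)" using R unfolding hpb_simps e by blast
      have "(cm x, (u, v), (a, b, \<gamma>)) \<in> Arr ?H"
        using uv z cm_obj[OF x] by (simp add: e hpb_simps)
      moreover from iso_hpbI[OF f g this] have "iso ?H (cm x, (u, v), (a, b, \<gamma>))"
        using uv groupoids by (auto simp: in_hom)
      ultimately have "(cm x, (u, v), (a, b, \<gamma>)) \<in> hom ?H (fo K x) z" "iso ?H (cm x, (u, v), (a, b, \<gamma>))"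
        using x by (auto simp: e in_hom hpb_simps(3-))
      then show "\<exists>x \<in> Obj P. \<exists>i \<in> hom ?H (fo K x) z. iso ?H i" using x by blast
    qed
  qed
  show ?thesis
    unfolding homotopy_pullback_def equivalence_def Let_def es
    using K_functor bij by simp
qed

end

text \<open>Pasting of homotopy pullbacks, in the direction needed to compose CULF maps. The filling
  \<open>\<theta>''\<close> is a parameter that agrees with the pasted one on objects, so that the
  lemma applies directly to the extensional \<open>Nat\<close> of a composite
  transformation.\<close>

lemma square_paste:
  assumes s1: "square P A B E p q f g \<theta>" and s2: "square B E B' E' g q' f' g' \<theta>'"
    and s3: "square P A B' E' p (compF P q' q) (compF A f' f) g' \<theta>''"
    and \<theta>'': "\<And>x. x \<in> Obj P \<Longrightarrow> \<theta>'' x = Cmp E' (\<theta>' (fo q x)) (fa f' (\<theta> x))"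
    and h1: "homotopy_pullback P A B E p q f g \<theta>" and h2: "homotopy_pullback B E B' E' g q' f' g' \<theta>'"
  shows "homotopy_pullback P A B' E' p (compF P q' q) (compF A f' f) g' \<theta>''"
proof -
  note P = square.groupoids[OF s1] square.groupoids[OF s2]
  note C = P[THEN groupoid_category]
  note r = functor_rules[OF square.p[OF s1]] functor_rules[OF square.q[OF s1]]
     functor_rules[OF square.f[OF s1]] functor_rules[OF square.g[OF s1]]
     functor_rules[OF square.q[OF s2]] functor_rules[OF square.f[OF s2]] functor_rules[OF square.g[OF s2]]
  note t = square.\<theta>[OF s1, unfolded in_hom] square.\<theta>[OF s2, unfolded in_hom]
  note n = square.\<theta>_nat[OF s1] square.\<theta>_nat[OF s2]
  note H1 = h1[unfolded square.homotopy_pullback_iff[OF s1]] and H2 = h2[unfolded square.homotopy_pullback_iff[OF s2]]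
  show ?thesis unfolding square.homotopy_pullback_iff[OF s3]
  proof (intro conjI ballI impI)
    fix x y u v assume x: "x \<in> Obj P" and y: "y \<in> Obj P" and u: "u \<in> hom A (fo p x) (fo p y)"
      and v: "v \<in> hom B' (fo (compF P q' q) x) (fo (compF P q' q) y)"
      and e: "Cmp E' (\<theta>'' y) (fa (compF A f' f) u) = Cmp E' (fa g' v) (\<theta>'' x)"
    let ?i = "inverse_arr E (\<theta> x)"
    \<comment> \<open>The arrow \<open>u\<close> conjugated by the filling of the first square. It
      is the edge in \<open>E\<close> at which the second pullback is tested, and by
      \<open>ki\<close> it is the only arrow of its type matching \<open>u\<close> through
      \<open>\<theta>\<close>.\<close>
    define k where "k = Cmp E (Cmp E (\<theta> y) (fa f u)) ?i"
    note T = t(1)[OF x] t(1)[OF y] t(2)[OF r(11)[OF x]] t(2)[OF r(11)[OF y]] u[unfolded in_hom] v[unfolded in_hom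
        compF_simps(1)[OF x] compF_simps(1)[OF y]]
    have k: "k \<in> hom E (fo g (fo q x)) (fo g (fo q y))"
      using T x y P C unfolding k_def in_hom by (simp add: r)
    have k\<theta>: "Cmp E k (\<theta> x) = Cmp E (\<theta> y) (fa f u)"
      using T x y P C unfolding k_def by (simp add: r)
    have ki: "l = k" if "l \<in> hom E (fo g (fo q x)) (fo g (fo q y))" "Cmp E l (\<theta> x) = Cmp E (\<theta> y) (fa f u)" for l
    proof -
      have "Cmp E (Cmp E l (\<theta> x)) ?i = l" using T x y P C that(1) unfolding in_hom by (simp add: r)
      then show ?thesis unfolding that(2) k_def by simp
    qed
    have e': "Cmp E' (Cmp E' (\<theta>' (fo q y)) (fa f' (\<theta> y))) (fa f' (fa f u)) = Cmp E' (fa g' v) (Cmp E' (\<theta>' (fo q x)) (fa f' (\<theta>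
        x)))"
      using e u by (simp add: in_hom \<theta>'' x y)
    have "Cmp E' (\<theta>' (fo q y)) (fa f' k) = Cmp E' (fa g' v) (\<theta>' (fo q x))"
    proof -
      have "fa f' k = Cmp E' (fa f' (\<theta> y)) (Cmp E' (fa f' (fa f u)) (fa f' ?i))"
        using T x y P C unfolding k_def by (simp add: r)
      then have "Cmp E' (\<theta>' (fo q y)) (fa f' k) = Cmp E' (Cmp E' (Cmp E' (\<theta>' (fo q y)) (fa f' (\<theta> y))) (fa f' (fa f u))) (fa
          f' ?i)"
        using T x y P C by (simp add: r)
      also have "\<dots> = Cmp E' (Cmp E' (fa g' v) (\<theta>' (fo q x))) (fa f' (Cmp E (\<theta> x) ?i))"
        unfolding e' using T x y P C by (simp add: r del: groupoid_inverse_arr(5))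
      also have "\<dots> = Cmp E' (fa g' v) (\<theta>' (fo q x))"
        using T x y P C by (simp add: r)
      finally show ?thesis .
    qed
    then have "\<exists>!b. b \<in> hom B (fo q x) (fo q y) \<and> fa g b = k \<and> fa q' b = v"
      using H2 k v x y r(11) by (simp add: Ball_def)
    then obtain b where b: "b \<in> hom B (fo q x) (fo q y)" "fa g b = k" "fa q' b = v"
      and bu: "\<And>b'. b' \<in> hom B (fo q x) (fo q y) \<Longrightarrow> fa g b' = k \<Longrightarrow> fa q' b' = v \<Longrightarrow> b' = b" by blast
    have "\<exists>!w. w \<in> hom P x y \<and> fa p w = u \<and> fa q w = b"
      using H1 x y u b k\<theta> by (simp add: Ball_def)
    then obtain w where w: "w \<in> hom P x y" "fa p w = u" "fa q w = b"
      and wu: "\<And>w'. w' \<in> hom P x y \<Longrightarrow> fa p w' = u \<Longrightarrow> fa q w' = b \<Longrightarrow> w' = w" by blast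
    show "\<exists>!w. w \<in> hom P x y \<and> fa p w = u \<and> fa (compF P q' q) w = v"
    proof
      show "w \<in> hom P x y \<and> fa p w = u \<and> fa (compF P q' q) w = v"
        using w b by (simp add: in_hom)
      fix w' assume w': "w' \<in> hom P x y \<and> fa p w' = u \<and> fa (compF P q' q) w' = v"
      then have w'': "w' \<in> Arr P" "Dom P w' = x" "Cod P w' = y" "fa p w' = u" "fa q' (fa q w') = v"
        by (auto simp: in_hom)
      have "fa g (fa q w') = k"
        using n(1)[of w'] w'' x y by (intro ki) (simp_all add: in_hom r)
      then have "fa q w' = b" using w'' by (intro bu) (simp_all add: in_hom r)
      then show "w' = w" using w' wu by blast
    qed
  next
    fix a b' \<gamma> assume a: "a \<in> Obj A" and b': "b' \<in> Obj B'" and \<gamma>: "\<gamma> \<in> hom E' (fo (compF A f' f) a) (fo g' b')"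
    then have "\<gamma> \<in> hom E' (fo f' (fo f a)) (fo g' b')" by simp
    then have "\<exists>x\<in>Obj B. \<exists>u\<in>hom E (fo g x) (fo f a). \<exists>v\<in>hom B' (fo q' x) b'. Cmp E' \<gamma> (fa f' u) = Cmp E' (fa g' v) (\<theta>' x)"
      using H2 a b' r(19) by blast
    then obtain b e v where b: "b \<in> Obj B" "e \<in> hom E (fo g b) (fo f a)" "v \<in> hom B' (fo q' b) b'"
      "Cmp E' \<gamma> (fa f' e) = Cmp E' (fa g' v) (\<theta>' b)" by blast
    \<comment> \<open>The second pullback supplies \<open>e\<close> from \<open>fo g b\<close> to
      \<open>fo f a\<close>; the first one expects an arrow out of \<open>fo f a\<close>, hence the
      inverse.\<close>
    let ?e = "inverse_arr E e"
    have "?e \<in> hom E (fo f a) (fo g b)" using b P by (simp add: in_hom)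
    then have "\<exists>x\<in>Obj P. \<exists>u\<in>hom A (fo p x) a. \<exists>v\<in>hom B (fo q x) b. Cmp E ?e (fa f u) = Cmp E (fa g v) (\<theta> x)"
      using H1 a b(1) by blast
    then obtain x u w where x: "x \<in> Obj P" and u: "u \<in> hom A (fo p x) a" and w: "w \<in> hom B (fo q x) b"
      and e: "Cmp E ?e (fa f u) = Cmp E (fa g w) (\<theta> x)" by blast
    note T = t(1)[OF x] t(2)[OF r(11)[OF x]] t(2)[OF b(1)] u[unfolded in_hom] w[unfolded in_hom] b(1-3)[unfolded in_hom]
        \<gamma>[unfolded in_hom compF_simps(1)[OF a]]
    have fu: "fa f u = Cmp E e (Cmp E (fa g w) (\<theta> x))"
      unfolding e[symmetric] using T x P C a by (subst iso_cancel) (simp_all add: r)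
    have "Cmp E' \<gamma> (fa f' (fa f u)) = Cmp E' (Cmp E' \<gamma> (fa f' e)) (Cmp E' (fa f' (fa g w)) (fa f' (\<theta> x)))"
      unfolding fu using T x P C a by (simp add: r)
    also have "\<dots> = Cmp E' (fa g' v) (Cmp E' (Cmp E' (\<theta>' b) (fa f' (fa g w))) (fa f' (\<theta> x)))"
      unfolding b(4) using T x P C a by (simp add: r)
    also have "Cmp E' (\<theta>' b) (fa f' (fa g w)) = Cmp E' (fa g' (fa q' w)) (\<theta>' (fo q x))"
      using n(2)[of w] T by simp
    finally have "Cmp E' \<gamma> (fa (compF A f' f) u) = Cmp E' (fa g' (Cmp B' v (fa q' w))) (\<theta>'' x)"
      using T x P C a by (simp add: r \<theta>'')
    moreover have "Cmp B' v (fa q' w) \<in> hom B' (fo (compF P q' q) x) b'"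
      using T x P C a by (simp add: r in_hom)
    ultimately show "\<exists>x\<in>Obj P. \<exists>u\<in>hom A (fo p x) a. \<exists>v\<in>hom B' (fo (compF P q' q) x) b'.
      Cmp E' \<gamma> (fa (compF A f' f) u) = Cmp E' (fa g' v) (\<theta>'' x)" using x u by blast
  qed
qed

section \<open>Pseudo-functors and pseudo-natural transformations\<close>

lemma pseudofunctor_rules:
  assumes "pseudofunctor C X"
  shows "category C" "\<And>c. c \<in> Obj C \<Longrightarrow> groupoid (Gpd X c)"
    "\<And>a. a \<in> Arr C \<Longrightarrow> is_functor (Gpd X (Cod C a)) (Gpd X (Dom C a)) (Act X a)"
    "\<And>a b u. a \<in> Arr C \<Longrightarrow> b \<in> Arr C \<Longrightarrow> Cod C a = Dom C b \<Longrightarrow> u \<in> Obj (Gpd X (Cod C b)) \<Longrightarrow>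
       CmpI X a b u \<in> Arr (Gpd X (Dom C a))"
    "\<And>a b u. a \<in> Arr C \<Longrightarrow> b \<in> Arr C \<Longrightarrow> Cod C a = Dom C b \<Longrightarrow> u \<in> Obj (Gpd X (Cod C b)) \<Longrightarrow>
       Dom (Gpd X (Dom C a)) (CmpI X a b u) = fo (Act X a) (fo (Act X b) u)"
    "\<And>a b u. a \<in> Arr C \<Longrightarrow> b \<in> Arr C \<Longrightarrow> Cod C a = Dom C b \<Longrightarrow> u \<in> Obj (Gpd X (Cod C b)) \<Longrightarrow>
       Cod (Gpd X (Dom C a)) (CmpI X a b u) = fo (Act X (Cmp C b a)) u"
    "\<And>c u. c \<in> Obj C \<Longrightarrow> u \<in> Obj (Gpd X c) \<Longrightarrow> IdI X c u \<in> Arr (Gpd X c)"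
    "\<And>c u. c \<in> Obj C \<Longrightarrow> u \<in> Obj (Gpd X c) \<Longrightarrow> Dom (Gpd X c) (IdI X c u) = u"
    "\<And>c u. c \<in> Obj C \<Longrightarrow> u \<in> Obj (Gpd X c) \<Longrightarrow> Cod (Gpd X c) (IdI X c u) = fo (Act X (Id C c)) u"
proof -
  show "category C" "\<And>c. c \<in> Obj C \<Longrightarrow> groupoid (Gpd X c)"
    "\<And>a. a \<in> Arr C \<Longrightarrow> is_functor (Gpd X (Cod C a)) (Gpd X (Dom C a)) (Act X a)"
    using assms unfolding pseudofunctor_def by auto
  { fix a b u assume a: "a \<in> Arr C" "b \<in> Arr C" "Cod C a = Dom C b" and u: "u \<in> Obj (Gpd X (Cod C b))"
    then have "nat_iso (Gpd X (Cod C b)) (Gpd X (Dom C a)) (compF (Gpd X (Cod C b)) (Act X a) (Act X b))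
       (Act X (Cmp C b a)) (CmpI X a b)"
      using assms unfolding pseudofunctor_def by blast
    from nat_iso_rules[OF this] u show "CmpI X a b u \<in> Arr (Gpd X (Dom C a))"
      "Dom (Gpd X (Dom C a)) (CmpI X a b u) = fo (Act X a) (fo (Act X b) u)"
      "Cod (Gpd X (Dom C a)) (CmpI X a b u) = fo (Act X (Cmp C b a)) u" by simp_all }
  { fix c u assume c: "c \<in> Obj C" and u: "u \<in> Obj (Gpd X c)"
    then have "nat_iso (Gpd X c) (Gpd X c) (idF (Gpd X c)) (Act X (Id C c)) (IdI X c)"
      using assms unfolding pseudofunctor_def by blast
    from nat_iso_rules[OF this] u show "IdI X c u \<in> Arr (Gpd X c)" "Dom (Gpd X c) (IdI X c u) = u"
      "Cod (Gpd X c) (IdI X c u) = fo (Act X (Id C c)) u" by simp_all }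
qed

lemma pseudonatural_rules:
  assumes "pseudonatural C X Y \<tau>"
  shows "Cpt \<tau> \<in> extensional (Obj C)" "Nat \<tau> \<in> extensional (Arr C)"
    "\<And>c. c \<in> Obj C \<Longrightarrow> is_functor (Gpd X c) (Gpd Y c) (Cpt \<tau> c)"
    "\<And>a. a \<in> Arr C \<Longrightarrow> Nat \<tau> a \<in> extensional (Obj (Gpd X (Cod C a)))"
    "\<And>a u. a \<in> Arr C \<Longrightarrow> u \<in> Obj (Gpd X (Cod C a)) \<Longrightarrow> Nat \<tau> a u \<in> Arr (Gpd Y (Dom C a))"
    "\<And>a u. a \<in> Arr C \<Longrightarrow> u \<in> Obj (Gpd X (Cod C a)) \<Longrightarrow>
       Dom (Gpd Y (Dom C a)) (Nat \<tau> a u) = fo (Cpt \<tau> (Dom C a)) (fo (Act X a) u)"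
    "\<And>a u. a \<in> Arr C \<Longrightarrow> u \<in> Obj (Gpd X (Cod C a)) \<Longrightarrow>
       Cod (Gpd Y (Dom C a)) (Nat \<tau> a u) = fo (Act Y a) (fo (Cpt \<tau> (Cod C a)) u)"
    "\<And>a f. a \<in> Arr C \<Longrightarrow> is_functor (Gpd X (Cod C a)) (Gpd X (Dom C a)) (Act X a) \<Longrightarrow>
       is_functor (Gpd X (Cod C a)) (Gpd Y (Cod C a)) (Cpt \<tau> (Cod C a)) \<Longrightarrow> f \<in> Arr (Gpd X (Cod C a)) \<Longrightarrow>
       Cmp (Gpd Y (Dom C a)) (Nat \<tau> a (Cod (Gpd X (Cod C a)) f)) (fa (Cpt \<tau> (Dom C a)) (fa (Act X a) f)) =
       Cmp (Gpd Y (Dom C a)) (fa (Act Y a) (fa (Cpt \<tau> (Cod C a)) f)) (Nat \<tau> a (Dom (Gpd X (Cod C a)) f))"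
    "\<And>a b u. a \<in> Arr C \<Longrightarrow> b \<in> Arr C \<Longrightarrow> Cod C a = Dom C b \<Longrightarrow> u \<in> Obj (Gpd X (Cod C b)) \<Longrightarrow>
       Cmp (Gpd Y (Dom C a)) (Nat \<tau> (Cmp C b a) u) (fa (Cpt \<tau> (Dom C a)) (CmpI X a b u)) =
       Cmp (Gpd Y (Dom C a)) (Cmp (Gpd Y (Dom C a)) (CmpI Y a b (fo (Cpt \<tau> (Cod C b)) u)) (fa (Act Y a) (Nat \<tau> b u)))
             (Nat \<tau> a (fo (Act X b) u))"
    "\<And>c u. c \<in> Obj C \<Longrightarrow> u \<in> Obj (Gpd X c) \<Longrightarrow>
        Cmp (Gpd Y c) (Nat \<tau> (Id C c) u) (fa (Cpt \<tau> c) (IdI X c u)) = IdI Y c (fo (Cpt \<tau> c) u)"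
proof -
  show "Cpt \<tau> \<in> extensional (Obj C)" "Nat \<tau> \<in> extensional (Arr C)"
    "\<And>c. c \<in> Obj C \<Longrightarrow> is_functor (Gpd X c) (Gpd Y c) (Cpt \<tau> c)"
    using assms unfolding pseudonatural_def by auto
  fix a assume a: "a \<in> Arr C"
  then have n: "nat_iso (Gpd X (Cod C a)) (Gpd Y (Dom C a))
        (compF (Gpd X (Cod C a)) (Cpt \<tau> (Dom C a)) (Act X a))
        (compF (Gpd X (Cod C a)) (Act Y a) (Cpt \<tau> (Cod C a))) (Nat \<tau> a)"
    using assms unfolding pseudonatural_def by auto
  show "Nat \<tau> a \<in> extensional (Obj (Gpd X (Cod C a)))" by (rule nat_iso_rules[OF n])
  { fix u assume "u \<in> Obj (Gpd X (Cod C a))"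
    then show "Nat \<tau> a u \<in> Arr (Gpd Y (Dom C a))"
       "Dom (Gpd Y (Dom C a)) (Nat \<tau> a u) = fo (Cpt \<tau> (Dom C a)) (fo (Act X a) u)"
       "Cod (Gpd Y (Dom C a)) (Nat \<tau> a u) = fo (Act Y a) (fo (Cpt \<tau> (Cod C a)) u)"
      by (simp_all add: nat_iso_rules[OF n]) }
  { fix f assume f: "f \<in> Arr (Gpd X (Cod C a))"
    then show "Cmp (Gpd Y (Dom C a)) (Nat \<tau> a (Cod (Gpd X (Cod C a)) f)) (fa (Cpt \<tau> (Dom C a)) (fa (Act X a) f)) =
       Cmp (Gpd Y (Dom C a)) (fa (Act Y a) (fa (Cpt \<tau> (Cod C a)) f)) (Nat \<tau> a (Dom (Gpd X (Cod C a)) f))"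
      using nat_iso_rules(5)[OF n f] by simp }
next
  fix a b u assume "a \<in> Arr C" "b \<in> Arr C" "Cod C a = Dom C b" "u \<in> Obj (Gpd X (Cod C b))"
  then show "Cmp (Gpd Y (Dom C a)) (Nat \<tau> (Cmp C b a) u) (fa (Cpt \<tau> (Dom C a)) (CmpI X a b u)) =
       Cmp (Gpd Y (Dom C a)) (Cmp (Gpd Y (Dom C a)) (CmpI Y a b (fo (Cpt \<tau> (Cod C b)) u)) (fa (Act Y a) (Nat \<tau> b u)))
             (Nat \<tau> a (fo (Act X b) u))"
    using assms unfolding pseudonatural_def by auto
next
  fix c u assume "c \<in> Obj C" "u \<in> Obj (Gpd X c)"
  then show "Cmp (Gpd Y c) (Nat \<tau> (Id C c) u) (fa (Cpt \<tau> c) (IdI X c u)) = IdI Y c (fo (Cpt \<tau> c) u)"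
    using assms unfolding pseudonatural_def by auto
qed

text \<open>Invertibility of the naturality cells is absent from the premises because
  \<open>Y\<close> takes values in groupoids.\<close>

lemma pseudonaturalI:
  assumes X: "pseudofunctor C X" and Y: "pseudofunctor C Y"
    and "Cpt \<tau> \<in> extensional (Obj C)" "Nat \<tau> \<in> extensional (Arr C)"
    "\<And>c. c \<in> Obj C \<Longrightarrow> is_functor (Gpd X c) (Gpd Y c) (Cpt \<tau> c)"
    "\<And>a. a \<in> Arr C \<Longrightarrow> Nat \<tau> a \<in> extensional (Obj (Gpd X (Cod C a)))"
    "\<And>a u. a \<in> Arr C \<Longrightarrow> u \<in> Obj (Gpd X (Cod C a)) \<Longrightarrow> Nat \<tau> a u \<in> Arr (Gpd Y (Dom C a)) \<and>
       Dom (Gpd Y (Dom C a)) (Nat \<tau> a u) = fo (Cpt \<tau> (Dom C a)) (fo (Act X a) u) \<and>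
       Cod (Gpd Y (Dom C a)) (Nat \<tau> a u) = fo (Act Y a) (fo (Cpt \<tau> (Cod C a)) u)"
    "\<And>a f. a \<in> Arr C \<Longrightarrow> f \<in> Arr (Gpd X (Cod C a)) \<Longrightarrow>
       Cmp (Gpd Y (Dom C a)) (Nat \<tau> a (Cod (Gpd X (Cod C a)) f)) (fa (Cpt \<tau> (Dom C a)) (fa (Act X a) f)) =
       Cmp (Gpd Y (Dom C a)) (fa (Act Y a) (fa (Cpt \<tau> (Cod C a)) f)) (Nat \<tau> a (Dom (Gpd X (Cod C a)) f))"
    "\<And>a b u. a \<in> Arr C \<Longrightarrow> b \<in> Arr C \<Longrightarrow> Cod C a = Dom C b \<Longrightarrow> u \<in> Obj (Gpd X (Cod C b)) \<Longrightarrow>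
       Cmp (Gpd Y (Dom C a)) (Nat \<tau> (Cmp C b a) u) (fa (Cpt \<tau> (Dom C a)) (CmpI X a b u)) =
       Cmp (Gpd Y (Dom C a)) (Cmp (Gpd Y (Dom C a)) (CmpI Y a b (fo (Cpt \<tau> (Cod C b)) u)) (fa (Act Y a) (Nat \<tau> b u)))
             (Nat \<tau> a (fo (Act X b) u))"
    "\<And>c u. c \<in> Obj C \<Longrightarrow> u \<in> Obj (Gpd X c) \<Longrightarrow>
        Cmp (Gpd Y c) (Nat \<tau> (Id C c) u) (fa (Cpt \<tau> c) (IdI X c u)) = IdI Y c (fo (Cpt \<tau> c) u)"
  shows "pseudonatural C X Y \<tau>"
proof -
  have "nat_iso (Gpd X (Cod C a)) (Gpd Y (Dom C a))
        (compF (Gpd X (Cod C a)) (Cpt \<tau> (Dom C a)) (Act X a))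
        (compF (Gpd X (Cod C a)) (Act Y a) (Cpt \<tau> (Cod C a))) (Nat \<tau> a)" if "a \<in> Arr C" for a
    using assms(6-8)[OF that] that pseudofunctor_rules[OF Y] pseudofunctor_rules[OF X]
    by (intro nat_isoI) auto
  then show ?thesis unfolding pseudonatural_def using assms by auto
qed

lemma compP_simps [simp]:
  "c \<in> Obj C \<Longrightarrow> Cpt (compP C X Z \<tau> \<sigma>) c = compF (Gpd X c) (Cpt \<tau> c) (Cpt \<sigma> c)"
  "a \<in> Arr C \<Longrightarrow> u \<in> Obj (Gpd X (Cod C a)) \<Longrightarrow> Nat (compP C X Z \<tau> \<sigma>) a u =
     Cmp (Gpd Z (Dom C a)) (Nat \<tau> a (fo (Cpt \<sigma> (Cod C a)) u)) (fa (Cpt \<tau> (Dom C a)) (Nat \<sigma> a u))"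
  "Cpt (compP C X Z \<tau> \<sigma>) \<in> extensional (Obj C)" "Nat (compP C X Z \<tau> \<sigma>) \<in> extensional (Arr C)"
  "a \<in> Arr C \<Longrightarrow> Nat (compP C X Z \<tau> \<sigma>) a \<in> extensional (Obj (Gpd X (Cod C a)))"
  by (simp_all add: compP_def)

lemma idP_simps [simp]:
  "c \<in> Obj C \<Longrightarrow> Cpt (idP C X) c = idF (Gpd X c)"
  "a \<in> Arr C \<Longrightarrow> u \<in> Obj (Gpd X (Cod C a)) \<Longrightarrow> Nat (idP C X) a u = Id (Gpd X (Dom C a)) (fo (Act X a) u)"
  "Cpt (idP C X) \<in> extensional (Obj C)" "Nat (idP C X) \<in> extensional (Arr C)"
  "a \<in> Arr C \<Longrightarrow> Nat (idP C X) a \<in> extensional (Obj (Gpd X (Cod C a)))"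
  by (simp_all add: idP_def)

text \<open>The naturality data are functions of two arguments, extensional in each, so equality is
  checked in two stages; \<open>A a\<close> is the domain of the inner function.\<close>

lemma pnt_eqI:
  assumes "Cpt \<sigma> \<in> extensional (Obj C)" "Cpt \<tau> \<in> extensional (Obj C)" "Nat \<sigma> \<in> extensional (Arr C)" "Nat \<tau> \<in> extensional (Arr
      C)"
    "\<And>c. c \<in> Obj C \<Longrightarrow> Cpt \<sigma> c = Cpt \<tau> c"
    "\<And>a. a \<in> Arr C \<Longrightarrow> Nat \<sigma> a \<in> extensional (A a)" "\<And>a. a \<in> Arr C \<Longrightarrow> Nat \<tau> a \<in> extensional (A a)"
    "\<And>a u. a \<in> Arr C \<Longrightarrow> u \<in> A a \<Longrightarrow> Nat \<sigma> a u = Nat \<tau> a u"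
  shows "\<sigma> = (\<tau> :: ('c, 'k, 'o, 'm, 'p, 'n) pnt)"
proof (rule pnt.equality)
  show "Cpt \<sigma> = Cpt \<tau>" using assms(1,2,5) by (rule extensionalityI)
  have "Nat \<sigma> a = Nat \<tau> a" if "a \<in> Arr C" for a
    using assms(6-8)[OF that] by (rule extensionalityI)
  then show "Nat \<sigma> = Nat \<tau>" by (rule extensionalityI[OF assms(3,4)])
qed simp

lemma pseudonatural_idP:
  assumes X: "pseudofunctor C X"
  shows "pseudonatural C X X (idP C X)"
proof -
  note r = pseudofunctor_rules[OF X]
  show ?thesis
  proof (rule pseudonaturalI[OF X X])
    fix a assume a: "a \<in> Arr C"
    note f = functor_rules[OF r(3)[OF a]]
    { fix h assume "h \<in> Arr (Gpd X (Cod C a))"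
      then show "Cmp (Gpd X (Dom C a)) (Nat (idP C X) a (Cod (Gpd X (Cod C a)) h)) (fa (Cpt (idP C X) (Dom C a)) (fa (Act X
          a) h)) =
         Cmp (Gpd X (Dom C a)) (fa (Act X a) (fa (Cpt (idP C X) (Cod C a)) h)) (Nat (idP C X) a (Dom (Gpd X (Cod C a)) h))"
        using a r(1) by (simp add: f) }
    { fix u assume "u \<in> Obj (Gpd X (Cod C a))"
      then show "Nat (idP C X) a u \<in> Arr (Gpd X (Dom C a)) \<and>
         Dom (Gpd X (Dom C a)) (Nat (idP C X) a u) = fo (Cpt (idP C X) (Dom C a)) (fo (Act X a) u) \<and>
         Cod (Gpd X (Dom C a)) (Nat (idP C X) a u) = fo (Act X a) (fo (Cpt (idP C X) (Cod C a)) u)"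
        using a r(1) by (simp add: f) }
    fix b u assume b: "b \<in> Arr C" "Cod C a = Dom C b" "u \<in> Obj (Gpd X (Cod C b))"
    note g = functor_rules[OF r(3)[OF b(1)]] and f' = f[unfolded b(2)]
    show "Cmp (Gpd X (Dom C a)) (Nat (idP C X) (Cmp C b a) u) (fa (Cpt (idP C X) (Dom C a)) (CmpI X a b u)) =
       Cmp (Gpd X (Dom C a)) (Cmp (Gpd X (Dom C a)) (CmpI X a b (fo (Cpt (idP C X) (Cod C b)) u)) (fa (Act X a) (Nat (idP C
           X) b u)))
             (Nat (idP C X) a (fo (Act X b) u))"
      using a b r(1) by (simp add: r f' g)
  qed (simp_all add: r functor_idF)
qed

text \<open>The cell of the composite is the cell of \<open>\<sigma>\<close> mapped by
  \<open>\<tau>\<close>, followed by the cell of \<open>\<tau>\<close>. Each axiom is obtained by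
  pasting the axioms of the two factors; where the factors have to change places, naturality of
  \<open>Nat \<tau> a\<close> at an arrow coming from \<open>\<sigma>\<close> is used.\<close>

lemma pseudonatural_compP:
  assumes X: "pseudofunctor C X" and Y: "pseudofunctor C Y" and Z: "pseudofunctor C Z"
    and \<sigma>: "pseudonatural C X Y \<sigma>" and \<tau>: "pseudonatural C Y Z \<tau>"
  shows "pseudonatural C X Z (compP C X Z \<tau> \<sigma>)"
proof -
  note rX = pseudofunctor_rules[OF X] and rY = pseudofunctor_rules[OF Y] and rZ = pseudofunctor_rules[OF Z]
  note s = pseudonatural_rules[OF \<sigma>] and t = pseudonatural_rules[OF \<tau>]
  let ?p = "compP C X Z \<tau> \<sigma>"
  have C: "category C" by (rule rX)
  show ?thesis
  proof (rule pseudonaturalI[OF X Z])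
    show "is_functor (Gpd X c) (Gpd Z c) (Cpt ?p c)" if "c \<in> Obj C" for c
      using that by (simp add: functor_compF[OF s(3) t(3)])
    fix a assume a: "a \<in> Arr C"
    define d where "d = Dom C a"
    have d: "d \<in> Obj C" "Cod C a \<in> Obj C" using a C by (auto simp: d_def)
    note ra = functor_rules[OF rX(3)[OF a], folded d_def] functor_rules[OF rY(3)[OF a], folded d_def] functor_rules[OF
        rZ(3)[OF a], folded d_def]
    note sa = functor_rules[OF s(3)[OF d(1)]] functor_rules[OF t(3)[OF d(1)]] functor_rules[OF s(3)[OF d(2)]]
        functor_rules[OF t(3)[OF d(2)]]
    note na = s(5-7)[OF a, folded d_def] t(5-7)[OF a, folded d_def]
    let ?D = "Gpd Z d"
    { fix h assume h: "h \<in> Arr (Gpd X (Cod C a))"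
      note nt = s(8)[OF a rX(3)[OF a] s(3)[OF d(2)] h, folded d_def]
        t(8)[OF a rY(3)[OF a] t(3)[OF d(2)] sa(20)[OF h], folded d_def]
      let ?x = "Dom (Gpd X (Cod C a)) h" and ?y = "Cod (Gpd X (Cod C a)) h"
      have "Cmp ?D (Nat ?p a ?y) (fa (Cpt ?p d) (fa (Act X a) h)) =
        Cmp ?D (Nat \<tau> a (fo (Cpt \<sigma> (Cod C a)) ?y)) (fa (Cpt \<tau> d) (Cmp (Gpd Y d) (Nat \<sigma> a ?y) (fa (Cpt \<sigma> d) (fa (Act X a)
            h))))"
        using a h d by (simp add: ra sa na d_def[symmetric])
      also have "\<dots> = Cmp ?D (Cmp ?D (Nat \<tau> a (fo (Cpt \<sigma> (Cod C a)) ?y)) (fa (Cpt \<tau> d) (fa (Act Y a) (fa (Cpt \<sigma> (Cod C a))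
          h)))) (fa (Cpt \<tau> d) (Nat \<sigma> a ?x))"
        unfolding nt(1) using a h d by (simp add: ra sa na)
      also have "\<dots> = Cmp ?D (fa (Act Z a) (fa (Cpt ?p (Cod C a)) h)) (Nat ?p a ?x)"
        using nt(2) a h d by (simp add: ra sa na d_def[symmetric])
      finally show "Cmp (Gpd Z (Dom C a)) (Nat ?p a ?y) (fa (Cpt ?p (Dom C a)) (fa (Act X a) h)) =
       Cmp (Gpd Z (Dom C a)) (fa (Act Z a) (fa (Cpt ?p (Cod C a)) h)) (Nat ?p a ?x)" unfolding d_def . }
    { fix u assume "u \<in> Obj (Gpd X (Cod C a))"
      then show "Nat ?p a u \<in> Arr (Gpd Z (Dom C a)) \<and>
         Dom (Gpd Z (Dom C a)) (Nat ?p a u) = fo (Cpt ?p (Dom C a)) (fo (Act X a) u) \<and>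
         Cod (Gpd Z (Dom C a)) (Nat ?p a u) = fo (Act Z a) (fo (Cpt ?p (Cod C a)) u)"
        using a d by (simp add: ra sa na d_def[symmetric]) }
    fix b u assume b: "b \<in> Arr C" "Cod C a = Dom C b" and u: "u \<in> Obj (Gpd X (Cod C b))"
    have d': "Cod C b \<in> Obj C" using b C by auto
    note rb = functor_rules[OF rX(3)[OF b(1)], folded b(2)] functor_rules[OF rY(3)[OF b(1)], folded b(2)] functor_rules[OF
        rZ(3)[OF b(1)], folded b(2)]
    note sb = functor_rules[OF s(3)[OF d']] functor_rules[OF t(3)[OF d']]
    note nb = s(5-7)[OF b(1), folded b(2)] t(5-7)[OF b(1), folded b(2)]
    note ci = rX(4-6)[OF a b u, folded d_def] rY(4-6)[OF a b sb(3)[OF u], folded d_def] rZ(4-6)[OF a b sb(11)[OF sb(3)[OF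
        u]], folded d_def]
    note nt = s(9)[OF a b u, folded d_def] t(9)[OF a b sb(3)[OF u], folded d_def]
    have ba: "Cmp C b a \<in> Arr C" "Dom C (Cmp C b a) = d" "Cod C (Cmp C b a) = Cod C b"
      using a b C by (auto simp: d_def)
    note nba = s(5-7)[OF ba(1), unfolded ba(2,3)] t(5-7)[OF ba(1), unfolded ba(2,3)]
    have "Cmp ?D (Nat ?p (Cmp C b a) u) (fa (Cpt ?p d) (CmpI X a b u)) =
      Cmp ?D (Nat \<tau> (Cmp C b a) (fo (Cpt \<sigma> (Cod C b)) u)) (fa (Cpt \<tau> d) (Cmp (Gpd Y d) (Nat \<sigma> (Cmp C b a) u) (fa (Cpt \<sigma> d)
          (CmpI X a b u))))"
      using a b(1) u d d' by (simp add: b(2)[symmetric] ba ra rb sa sb na nb nba ci)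
    also have "\<dots> = Cmp ?D (Cmp ?D (Nat \<tau> (Cmp C b a) (fo (Cpt \<sigma> (Cod C b)) u)) (fa (Cpt \<tau> d) (CmpI Y a b (fo (Cpt \<sigma> (Cod C
        b)) u))))
      (Cmp ?D (fa (Cpt \<tau> d) (fa (Act Y a) (Nat \<sigma> b u))) (fa (Cpt \<tau> d) (Nat \<sigma> a (fo (Act X b) u))))"
      unfolding nt(1) using a b(1) u d d' by (simp add: b(2)[symmetric] ba ra rb sa sb na nb nba ci)
    also have "\<dots> = Cmp ?D (CmpI Z a b (fo (Cpt \<tau> (Cod C b)) (fo (Cpt \<sigma> (Cod C b)) u)))
       (Cmp ?D (fa (Act Z a) (Nat \<tau> b (fo (Cpt \<sigma> (Cod C b)) u)))
       (Cmp ?D (Cmp ?D (Nat \<tau> a (fo (Act Y b) (fo (Cpt \<sigma> (Cod C b)) u))) (fa (Cpt \<tau> d) (fa (Act Y a) (Nat \<sigma> b u)))) (fa (Cpt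
           \<tau> d) (Nat \<sigma> a (fo (Act X b) u)))))"
      unfolding nt(2) using a b(1) u d d' by (simp add: b(2)[symmetric] ba ra rb sa sb na nb nba ci)
    \<comment> \<open>Interchange: \<open>Nat \<tau> a\<close> passes the arrow
      \<open>Nat \<sigma> b u\<close>. Afterwards the two cells belonging to \<open>b\<close> stand
      together, and so do the two belonging to \<open>a\<close>.\<close>
    also have "Cmp ?D (Nat \<tau> a (fo (Act Y b) (fo (Cpt \<sigma> (Cod C b)) u))) (fa (Cpt \<tau> d) (fa (Act Y a) (Nat \<sigma> b u))) =
      Cmp ?D (fa (Act Z a) (fa (Cpt \<tau> (Cod C a)) (Nat \<sigma> b u))) (Nat \<tau> a (fo (Cpt \<sigma> (Cod C a)) (fo (Act X b) u)))"
      using t(8)[OF a rY(3)[OF a] t(3)[OF d(2)], folded d_def, of "Nat \<sigma> b u"] u by (simp add: nb)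
    finally show "Cmp (Gpd Z (Dom C a)) (Nat ?p (Cmp C b a) u) (fa (Cpt ?p (Dom C a)) (CmpI X a b u)) =
       Cmp (Gpd Z (Dom C a)) (Cmp (Gpd Z (Dom C a)) (CmpI Z a b (fo (Cpt ?p (Cod C b)) u)) (fa (Act Z a) (Nat ?p b u)))
             (Nat ?p a (fo (Act X b) u))"
      using a b(1) u d d' by (simp add: b(2)[symmetric] ba ra rb sa sb na nb nba ci d_def[symmetric])
  next
    fix c u assume c: "c \<in> Obj C" and u: "u \<in> Obj (Gpd X c)"
    have i: "Id C c \<in> Arr C" "Dom C (Id C c) = c" "Cod C (Id C c) = c" using C c by auto
    note sc = functor_rules[OF s(3)[OF c]] functor_rules[OF t(3)[OF c]]
      functor_rules[OF rX(3)[OF i(1)], unfolded i(2,3)] functor_rules[OF rY(3)[OF i(1)], unfolded i(2,3)]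
    note n = s(5-7)[OF i(1), unfolded i(2,3)] t(5-7)[OF i(1), unfolded i(2,3)]
    have "Cmp (Gpd Z c) (Nat ?p (Id C c) u) (fa (Cpt ?p c) (IdI X c u)) =
      Cmp (Gpd Z c) (Nat \<tau> (Id C c) (fo (Cpt \<sigma> c) u)) (fa (Cpt \<tau> c) (Cmp (Gpd Y c) (Nat \<sigma> (Id C c) u) (fa (Cpt \<sigma> c) (IdI X c
          u))))"
      using c u C by (simp add: i n rX(7-9) sc)
    also have "\<dots> = IdI Z c (fo (Cpt ?p c) u)"
      unfolding s(10)[OF c u] using t(10)[OF c sc(3)[OF u]] c u by simp
    finally show "Cmp (Gpd Z c) (Nat ?p (Id C c) u) (fa (Cpt ?p c) (IdI X c u)) = IdI Z c (fo (Cpt ?p c) u)" .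
  qed simp_all
qed

lemma compP_idP:
  assumes X: "pseudofunctor C X" and Y: "pseudofunctor C Y" and \<tau>: "pseudonatural C X Y \<tau>"
  shows "compP C X Y \<tau> (idP C X) = \<tau>"
proof (rule pnt_eqI[where A = "\<lambda>a. Obj (Gpd X (Cod C a))"])
  note r = pseudofunctor_rules[OF X] and t = pseudonatural_rules[OF \<tau>]
  have C: "category C" by (rule r)
  show "Cpt (compP C X Y \<tau> (idP C X)) c = Cpt \<tau> c" if "c \<in> Obj C" for c
    using that compF_idF[OF t(3)[OF that]] by simp
  fix a u assume a: "a \<in> Arr C" and u: "u \<in> Obj (Gpd X (Cod C a))"
  note f = functor_rules[OF r(3)[OF a]] and g = functor_rules[OF t(3)[OF category_rules(1)[OF C a]]]
  show "Nat (compP C X Y \<tau> (idP C X)) a u = Nat \<tau> a u"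
    using a u C by (simp add: f g t)
qed (use pseudonatural_rules[OF \<tau>] in auto)

lemma idP_compP:
  assumes X: "pseudofunctor C X" and Y: "pseudofunctor C Y" and \<tau>: "pseudonatural C X Y \<tau>"
  shows "compP C X Y (idP C Y) \<tau> = \<tau>"
proof (rule pnt_eqI[where A = "\<lambda>a. Obj (Gpd X (Cod C a))"])
  note r = pseudofunctor_rules[OF X] and r' = pseudofunctor_rules[OF Y] and t = pseudonatural_rules[OF \<tau>]
  have C: "category C" by (rule r)
  show "Cpt (compP C X Y (idP C Y) \<tau>) c = Cpt \<tau> c" if "c \<in> Obj C" for c
    using that idF_compF[OF t(3)[OF that]] by simp
  fix a u assume a: "a \<in> Arr C" and u: "u \<in> Obj (Gpd X (Cod C a))"
  note f = functor_rules[OF r'(3)[OF a]] and g = functor_rules[OF t(3)[OF category_rules(2)[OF C a]]]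
  show "Nat (compP C X Y (idP C Y) \<tau>) a u = Nat \<tau> a u"
    using a u C by (simp add: f g t)
qed (use pseudonatural_rules[OF \<tau>] in auto)

lemma compP_assoc:
  assumes W: "pseudofunctor C W" and X: "pseudofunctor C X" and Y: "pseudofunctor C Y" and Z: "pseudofunctor C Z"
    and \<rho>: "pseudonatural C W X \<rho>" and \<sigma>: "pseudonatural C X Y \<sigma>" and \<tau>: "pseudonatural C Y Z \<tau>"
  shows "compP C W Z (compP C X Z \<tau> \<sigma>) \<rho> = compP C W Z \<tau> (compP C W Y \<sigma> \<rho>)"
proof (rule pnt_eqI[where A = "\<lambda>a. Obj (Gpd W (Cod C a))"])
  note s = pseudonatural_rules[OF \<rho>] pseudonatural_rules[OF \<sigma>] pseudonatural_rules[OF \<tau>]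
  have C: "category C" by (rule pseudofunctor_rules[OF X])
  show "Cpt (compP C W Z (compP C X Z \<tau> \<sigma>) \<rho>) c = Cpt (compP C W Z \<tau> (compP C W Y \<sigma> \<rho>)) c" if "c \<in> Obj C" for c
    using that compF_assoc[OF s(3)[OF that]] by simp
  fix a u assume a: "a \<in> Arr C" and u: "u \<in> Obj (Gpd W (Cod C a))"
  have d: "Dom C a \<in> Obj C" "Cod C a \<in> Obj C" using C a by auto
  note f = functor_rules[OF s(3)[OF d(1)]] functor_rules[OF s(3)[OF d(2)]] functor_rules[OF s(13)[OF d(1)]] functor_rules[OF
      s(13)[OF d(2)]]
      functor_rules[OF s(23)[OF d(1)]] functor_rules[OF s(23)[OF d(2)]] functor_rules[OF pseudofunctor_rules(3)[OF X a]]
      functor_rules[OF pseudofunctor_rules(3)[OF Y a]] functor_rules[OF pseudofunctor_rules(3)[OF W a]]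
  note n = s(5-7)[OF a] s(15-17)[OF a] s(25-27)[OF a]
  show "Nat (compP C W Z (compP C X Z \<tau> \<sigma>) \<rho>) a u = Nat (compP C W Z \<tau> (compP C W Y \<sigma> \<rho>)) a u"
    using a u d by (simp add: f n)
qed simp_all

section \<open>The category of decomposition spaces\<close>

lemma culf_square:
  assumes X: "pseudofunctor C X" and Y: "pseudofunctor C Y" and \<tau>: "pseudonatural C X Y \<tau>" and g: "g \<in> Arr C"
  shows "square (Gpd X (Cod C g)) (Gpd X (Dom C g)) (Gpd Y (Cod C g)) (Gpd Y (Dom C g))
          (Act X g) (Cpt \<tau> (Cod C g)) (Cpt \<tau> (Dom C g)) (Act Y g) (Nat \<tau> g)"
proof -
  have C: "category C" by (rule pseudofunctor_rules[OF X])
  have d: "Dom C g \<in> Obj C" "Cod C g \<in> Obj C" using C g by auto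
  note t = pseudonatural_rules[OF \<tau>]
  note r = pseudofunctor_rules[OF X] pseudofunctor_rules[OF Y]
  show ?thesis
    by unfold_locales (use g d in \<open>auto simp: r t(3,5-7) in_hom intro!: t(8)\<close>)
qed

lemma generic_Arr: "generic g \<Longrightarrow> g \<in> Arr Simp"
  by (auto simp: generic_def)

lemma culf_idP:
  assumes X: "pseudofunctor Simp X"
  shows "culf X X (idP Simp X)"
  unfolding culf_def
proof (intro conjI allI impI)
  show n: "pseudonatural Simp X X (idP Simp X)" by (rule pseudonatural_idP[OF X])
  fix g assume "generic g"
  then have g: "g \<in> Arr Simp" by (rule generic_Arr)
  note r = pseudofunctor_rules[OF X]
  have d: "Dom Simp g \<in> Obj Simp" "Cod Simp g \<in> Obj Simp" using r(1) g by auto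
  note f = functor_rules[OF r(3)[OF g]]
  have gd: "groupoid (Gpd X (Dom Simp g))" using r d by auto
  show "homotopy_pullback (Gpd X (Cod Simp g)) (Gpd X (Dom Simp g)) (Gpd X (Cod Simp g)) (Gpd X (Dom Simp g))
          (Act X g) (Cpt (idP Simp X) (Cod Simp g)) (Cpt (idP Simp X) (Dom Simp g)) (Act X g) (Nat (idP Simp X) g)"
    unfolding square.homotopy_pullback_iff[OF culf_square[OF X X n g]]
  proof (intro conjI ballI impI)
    fix x y u v assume x: "x \<in> Obj (Gpd X (Cod Simp g))" "y \<in> Obj (Gpd X (Cod Simp g))"
     "u \<in> hom (Gpd X (Dom Simp g)) (fo (Act X g) x) (fo (Act X g) y)"
     "v \<in> hom (Gpd X (Cod Simp g)) (fo (Cpt (idP Simp X) (Cod Simp g)) x) (fo (Cpt (idP Simp X) (Cod Simp g)) y)"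
     "Nat (idP Simp X) g y \<cdot>\<^bsub>Gpd X (Dom Simp g)\<^esub> fa (Cpt (idP Simp X) (Dom Simp g)) u =
       fa (Act X g) v \<cdot>\<^bsub>Gpd X (Dom Simp g)\<^esub> Nat (idP Simp X) g x"
    show "\<exists>!w. w \<in> hom (Gpd X (Cod Simp g)) x y \<and> fa (Act X g) w = u \<and> fa (Cpt (idP Simp X) (Cod Simp g)) w = v"
    proof
      have "fa (Act X g) v = u" using x g d gd by (simp add: in_hom f)
      then show "v \<in> hom (Gpd X (Cod Simp g)) x y \<and> fa (Act X g) v = u \<and> fa (Cpt (idP Simp X) (Cod Simp g)) v = v"
        using x d by (simp add: in_hom)
    qed (use d in \<open>auto simp: in_hom\<close>)
  next
    fix a b \<gamma> assume a: "a \<in> Obj (Gpd X (Dom Simp g))" "b \<in> Obj (Gpd X (Cod Simp g))"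
     "\<gamma> \<in> hom (Gpd X (Dom Simp g)) (fo (Cpt (idP Simp X) (Dom Simp g)) a) (fo (Act X g) b)"
    show "\<exists>x\<in>Obj (Gpd X (Cod Simp g)). \<exists>u\<in>hom (Gpd X (Dom Simp g)) (fo (Act X g) x) a.
          \<exists>v\<in>hom (Gpd X (Cod Simp g)) (fo (Cpt (idP Simp X) (Cod Simp g)) x) b.
          \<gamma> \<cdot>\<^bsub>Gpd X (Dom Simp g)\<^esub> fa (Cpt (idP Simp X) (Dom Simp g)) u = fa (Act X g) v \<cdot>\<^bsub>Gpd X (Dom Simp g)\<^esub> Nat (idP Simp
              X) g x"
      \<comment> \<open>The given \<open>b\<close> is its own lift: the inverse of
        \<open>\<gamma>\<close> is taken on one side and an identity on the other.\<close>
      using a g d gd by (intro bexI[of _ b] bexI[of _ "inverse_arr (Gpd X (Dom Simp g)) \<gamma>"] bexI[of _ "Id (Gpd X (Cod Simp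
          g)) b"])
        (auto simp: in_hom f)
  qed
qed

lemma culf_compP:
  assumes X: "pseudofunctor Simp X" and Y: "pseudofunctor Simp Y" and Z: "pseudofunctor Simp Z"
    and \<sigma>: "culf X Y \<sigma>" and \<tau>: "culf Y Z \<tau>"
  shows "culf X Z (compP Simp X Z \<tau> \<sigma>)"
proof -
  have s: "pseudonatural Simp X Y \<sigma>" and t: "pseudonatural Simp Y Z \<tau>" using \<sigma> \<tau> by (auto simp: culf_def)
  have st: "pseudonatural Simp X Z (compP Simp X Z \<tau> \<sigma>)" by (rule pseudonatural_compP[OF X Y Z s t])
  show ?thesis unfolding culf_def
  proof (intro conjI allI impI st)
    fix g assume gg: "generic g"
    then have g: "g \<in> Arr Simp" by (rule generic_Arr)
    have d: "Dom Simp g \<in> Obj Simp" "Cod Simp g \<in> Obj Simp" using pseudofunctor_rules(1)[OF X] g by auto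
    note sq = culf_square[OF X Z st g]
    show "homotopy_pullback (Gpd X (Cod Simp g)) (Gpd X (Dom Simp g)) (Gpd Z (Cod Simp g)) (Gpd Z (Dom Simp g))
          (Act X g) (Cpt (compP Simp X Z \<tau> \<sigma>) (Cod Simp g)) (Cpt (compP Simp X Z \<tau> \<sigma>) (Dom Simp g)) (Act Z g) (Nat (compP
              Simp X Z \<tau> \<sigma>) g)"
      using square_paste[OF culf_square[OF X Y s g] culf_square[OF Y Z t g] sq[unfolded compP_simps(1)[OF d(1)]
          compP_simps(1)[OF d(2)]]]
        \<sigma> \<tau> gg g d unfolding culf_def by simp
  qed
qed

lemma decomposition_space_pseudofunctor: "decomposition_space X \<Longrightarrow> pseudofunctor Simp X"
  by (simp add: decomposition_space_def)

lemma culf_pseudonatural: "culf X Y \<tau> \<Longrightarrow> pseudonatural Simp X Y \<tau>"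
  by (simp add: culf_def)

lemma category_Dcmp: "category Dcmp"
  unfolding Dcmp_def
proof (rule category_mk_cat, goal_cases)
  case (1 x) then show ?case by (intro culf_idP decomposition_space_pseudofunctor)
next
  case (2 x y z f g) then show ?case by (intro culf_compP decomposition_space_pseudofunctor)
next
  case (3 x y f) then show ?case
    by (intro conjI compP_idP idP_compP) (auto dest: decomposition_space_pseudofunctor culf_pseudonatural)
next
  case (4 x y z w f g h) then show ?case
    by (intro compP_assoc[symmetric] decomposition_space_pseudofunctor culf_pseudonatural)
qed

section \<open>Strong monoidal functors\<close>

text \<open>The functor rules for a product source, with pairs taken apart into the form in which
  \<open>fa T (f, g)\<close> occurs. The last rule fuses two composable tensors; the longer
  calculations keep it out of the rewriting set and apply it at chosen places.\<close>

lemma bifunctor_rules: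
  assumes "is_functor (prodC C D) E T"
  shows "category E" "\<And>x y. x \<in> Obj C \<Longrightarrow> y \<in> Obj D \<Longrightarrow> fo T (x, y) \<in> Obj E"
    "\<And>f g. f \<in> Arr C \<Longrightarrow> g \<in> Arr D \<Longrightarrow> fa T (f, g) \<in> Arr E"
    "\<And>f g. f \<in> Arr C \<Longrightarrow> g \<in> Arr D \<Longrightarrow> Dom E (fa T (f, g)) = fo T (Dom C f, Dom D g)"
    "\<And>f g. f \<in> Arr C \<Longrightarrow> g \<in> Arr D \<Longrightarrow> Cod E (fa T (f, g)) = fo T (Cod C f, Cod D g)"
    "\<And>x y. x \<in> Obj C \<Longrightarrow> y \<in> Obj D \<Longrightarrow> fa T (Id C x, Id D y) = Id E (fo T (x, y))"
    "\<And>f g f' g'. f \<in> Arr C \<Longrightarrow> f' \<in> Arr C \<Longrightarrow> Cod C f = Dom C f' \<Longrightarrow> g \<in> Arr D \<Longrightarrow> g' \<in> Arr D \<Longrightarrow> Cod D g = Dom D g' \<Longrightarrow>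
       Cmp E (fa T (f', g')) (fa T (f, g)) = fa T (Cmp C f' f, Cmp D g' g)"
proof -
  note r = functor_rules[OF assms]
  show "category E" by (rule r)
  { fix x y assume "x \<in> Obj C" "y \<in> Obj D"
    then have "(x, y) \<in> Obj (prodC C D)" by simp
    from r(3)[OF this] r(7)[OF this] show "fo T (x, y) \<in> Obj E" "fa T (Id C x, Id D y) = Id E (fo T (x, y))" by auto }
  { fix f g assume "f \<in> Arr C" "g \<in> Arr D"
    then have fg: "(f, g) \<in> Arr (prodC C D)" by simp
    from r(4-6)[OF fg] show "fa T (f, g) \<in> Arr E" "Dom E (fa T (f, g)) = fo T (Dom C f, Dom D g)"
      "Cod E (fa T (f, g)) = fo T (Cod C f, Cod D g)" by auto
    fix f' g' assume "f' \<in> Arr C" "g' \<in> Arr D" "Cod C f = Dom C f'" "Cod D g = Dom D g'"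
    then show "Cmp E (fa T (f', g')) (fa T (f, g)) = fa T (Cmp C f' f, Cmp D g' g)"
      using r(8)[OF fg, of "(f', g')"] by simp }
qed

text \<open>The composite functors in the definition evaluate to iterated tensors, so that
  naturality of the constraints becomes equations between arrows that rewriting can use.\<close>

lemma monoidal_category_rules:
  assumes "monoidal_category M"
  shows "category (MC M)" "is_functor (prodC (MC M) (MC M)) (MC M) (Ten M)" "One M \<in> Obj (MC M)"
    "\<And>x y z. x \<in> Obj (MC M) \<Longrightarrow> y \<in> Obj (MC M) \<Longrightarrow> z \<in> Obj (MC M) \<Longrightarrow>
       Asc M ((x, y), z) \<in> Arr (MC M) \<and> Dom (MC M) (Asc M ((x, y), z)) = fo (Ten M) (fo (Ten M) (x, y), z) \<and>
       Cod (MC M) (Asc M ((x, y), z)) = fo (Ten M) (x, fo (Ten M) (y, z)) \<and> iso (MC M) (Asc M ((x, y), z))"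
    "\<And>f g h. f \<in> Arr (MC M) \<Longrightarrow> g \<in> Arr (MC M) \<Longrightarrow> h \<in> Arr (MC M) \<Longrightarrow>
       Cmp (MC M) (Asc M ((Cod (MC M) f, Cod (MC M) g), Cod (MC M) h)) (fa (Ten M) (fa (Ten M) (f, g), h)) =
       Cmp (MC M) (fa (Ten M) (f, fa (Ten M) (g, h))) (Asc M ((Dom (MC M) f, Dom (MC M) g), Dom (MC M) h))"
    "\<And>x. x \<in> Obj (MC M) \<Longrightarrow> LUn M x \<in> Arr (MC M) \<and> Dom (MC M) (LUn M x) = fo (Ten M) (One M, x) \<and>
      Cod (MC M) (LUn M x) = x \<and> iso (MC M) (LUn M x)"
    "\<And>x. x \<in> Obj (MC M) \<Longrightarrow> RUn M x \<in> Arr (MC M) \<and> Dom (MC M) (RUn M x) = fo (Ten M) (x, One M) \<and>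
      Cod (MC M) (RUn M x) = x \<and> iso (MC M) (RUn M x)"
    "\<And>f. f \<in> Arr (MC M) \<Longrightarrow> Cmp (MC M) (LUn M (Cod (MC M) f)) (fa (Ten M) (Id (MC M) (One M), f)) =
      Cmp (MC M) f (LUn M (Dom (MC M) f))"
    "\<And>f. f \<in> Arr (MC M) \<Longrightarrow> Cmp (MC M) (RUn M (Cod (MC M) f)) (fa (Ten M) (f, Id (MC M) (One M))) =
      Cmp (MC M) f (RUn M (Dom (MC M) f))"
    "pentagon M" "triangle M"
proof -
  note a = assms[unfolded monoidal_category_def Let_def]
  show c: "category (MC M)" and T: "is_functor (prodC (MC M) (MC M)) (MC M) (Ten M)" and o: "One M \<in> Obj (MC M)" and
      "pentagon M" "triangle M"
    using a by auto
  note b = bifunctor_rules[OF T]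
  have n: "nat_iso (prodC (prodC (MC M) (MC M)) (MC M)) (MC M)
    (compF (prodC (prodC (MC M) (MC M)) (MC M)) (Ten M) (prodF (prodC (MC M) (MC M)) (MC M) (Ten M) (idF (MC M))))
    (compF (prodC (prodC (MC M) (MC M)) (MC M)) (Ten M) (compF (prodC (prodC (MC M) (MC M)) (MC M))
      (prodF (MC M) (prodC (MC M) (MC M)) (idF (MC M)) (Ten M)) (assocF (MC M) (MC M) (MC M)))) (Asc M)"
    using a by auto
  have l: "nat_iso (MC M) (MC M) (compF (MC M) (Ten M) (insLF (MC M) (MC M) (One M))) (idF (MC M)) (LUn M)"
    and r: "nat_iso (MC M) (MC M) (compF (MC M) (Ten M) (insRF (MC M) (MC M) (One M))) (idF (MC M)) (RUn M)" using a by auto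
  { fix x y z assume "x \<in> Obj (MC M)" "y \<in> Obj (MC M)" "z \<in> Obj (MC M)"
    then show "Asc M ((x, y), z) \<in> Arr (MC M) \<and> Dom (MC M) (Asc M ((x, y), z)) = fo (Ten M) (fo (Ten M) (x, y), z) \<and>
       Cod (MC M) (Asc M ((x, y), z)) = fo (Ten M) (x, fo (Ten M) (y, z)) \<and> iso (MC M) (Asc M ((x, y), z))"
      using nat_iso_rules(1-4)[OF n, of "((x, y), z)"] by simp }
  { fix f g h assume "f \<in> Arr (MC M)" "g \<in> Arr (MC M)" "h \<in> Arr (MC M)"
    then show "Cmp (MC M) (Asc M ((Cod (MC M) f, Cod (MC M) g), Cod (MC M) h)) (fa (Ten M) (fa (Ten M) (f, g), h)) =
       Cmp (MC M) (fa (Ten M) (f, fa (Ten M) (g, h))) (Asc M ((Dom (MC M) f, Dom (MC M) g), Dom (MC M) h))"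
      using nat_iso_rules(5)[OF n, of "((f, g), h)"] by simp }
  { fix x assume "x \<in> Obj (MC M)"
    then show "LUn M x \<in> Arr (MC M) \<and> Dom (MC M) (LUn M x) = fo (Ten M) (One M, x) \<and>
      Cod (MC M) (LUn M x) = x \<and> iso (MC M) (LUn M x)"
      "RUn M x \<in> Arr (MC M) \<and> Dom (MC M) (RUn M x) = fo (Ten M) (x, One M) \<and>
      Cod (MC M) (RUn M x) = x \<and> iso (MC M) (RUn M x)"
      using nat_iso_rules(1-4)[OF l, of x] nat_iso_rules(1-4)[OF r, of x] by simp_all }
  { fix f assume "f \<in> Arr (MC M)"
    then show "Cmp (MC M) (LUn M (Cod (MC M) f)) (fa (Ten M) (Id (MC M) (One M), f)) = Cmp (MC M) f (LUn M (Dom (MC M) f))"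
     "Cmp (MC M) (RUn M (Cod (MC M) f)) (fa (Ten M) (f, Id (MC M) (One M))) = Cmp (MC M) f (RUn M (Dom (MC M) f))"
      using nat_iso_rules(5)[OF l, of f] nat_iso_rules(5)[OF r, of f] by simp_all }
qed

lemma strong_monoidal_rules:
  assumes "strong_monoidal M N \<Phi>"
  shows "is_functor (MC M) (MC N) (SF \<Phi>)"
    "\<And>x y. x \<in> Obj (MC M) \<Longrightarrow> y \<in> Obj (MC M) \<Longrightarrow> F2 \<Phi> (x, y) \<in> Arr (MC N) \<and>
       Dom (MC N) (F2 \<Phi> (x, y)) = fo (Ten N) (fo (SF \<Phi>) x, fo (SF \<Phi>) y) \<and>
       Cod (MC N) (F2 \<Phi> (x, y)) = fo (SF \<Phi>) (fo (Ten M) (x, y)) \<and> iso (MC N) (F2 \<Phi> (x, y))"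
    "\<And>f g. f \<in> Arr (MC M) \<Longrightarrow> g \<in> Arr (MC M) \<Longrightarrow>
       Cmp (MC N) (F2 \<Phi> (Cod (MC M) f, Cod (MC M) g)) (fa (Ten N) (fa (SF \<Phi>) f, fa (SF \<Phi>) g)) =
       Cmp (MC N) (fa (SF \<Phi>) (fa (Ten M) (f, g))) (F2 \<Phi> (Dom (MC M) f, Dom (MC M) g))"
    "F2 \<Phi> \<in> extensional (Obj (MC M) \<times> Obj (MC M))"
    "F0 \<Phi> \<in> Arr (MC N)" "Dom (MC N) (F0 \<Phi>) = One N" "Cod (MC N) (F0 \<Phi>) = fo (SF \<Phi>) (One M)" "iso (MC N) (F0 \<Phi>)"
    "\<And>x y z. x \<in> Obj (MC M) \<Longrightarrow> y \<in> Obj (MC M) \<Longrightarrow> z \<in> Obj (MC M) \<Longrightarrow>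
      Cmp (MC N) (Cmp (MC N) (fa (SF \<Phi>) (Asc M ((x, y), z))) (F2 \<Phi> (fo (Ten M) (x, y), z))) (fa (Ten N) (F2 \<Phi> (x, y), Id (MC
          N) (fo (SF \<Phi>) z))) =
      Cmp (MC N) (Cmp (MC N) (F2 \<Phi> (x, fo (Ten M) (y, z))) (fa (Ten N) (Id (MC N) (fo (SF \<Phi>) x), F2 \<Phi> (y, z))))
        (Asc N ((fo (SF \<Phi>) x, fo (SF \<Phi>) y), fo (SF \<Phi>) z))"
    "\<And>x. x \<in> Obj (MC M) \<Longrightarrow> Cmp (MC N) (Cmp (MC N) (fa (SF \<Phi>) (LUn M x)) (F2 \<Phi> (One M, x))) (fa (Ten N) (F0 \<Phi>, Id (MC N) (fo
        (SF \<Phi>) x))) = LUn N (fo (SF \<Phi>) x)"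
    "\<And>x. x \<in> Obj (MC M) \<Longrightarrow> Cmp (MC N) (Cmp (MC N) (fa (SF \<Phi>) (RUn M x)) (F2 \<Phi> (x, One M))) (fa (Ten N) (Id (MC N) (fo (SF \<Phi>)
        x), F0 \<Phi>)) = RUn N (fo (SF \<Phi>) x)"
proof -
  note a = assms[unfolded strong_monoidal_def Let_def in_hom]
  show F: "is_functor (MC M) (MC N) (SF \<Phi>)" and "F0 \<Phi> \<in> Arr (MC N)" "Dom (MC N) (F0 \<Phi>) = One N" "Cod (MC N) (F0 \<Phi>) = fo (SF
      \<Phi>) (One M)" "iso (MC N) (F0 \<Phi>)"
    using a by auto
  have n: "nat_iso (prodC (MC M) (MC M)) (MC N) (compF (prodC (MC M) (MC M)) (Ten N) (prodF (MC M) (MC M) (SF \<Phi>) (SF \<Phi>)))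
       (compF (prodC (MC M) (MC M)) (SF \<Phi>) (Ten M)) (F2 \<Phi>)" using a by auto
  show "F2 \<Phi> \<in> extensional (Obj (MC M) \<times> Obj (MC M))" using nat_iso_rules(6)[OF n] by simp
  { fix x y assume "x \<in> Obj (MC M)" "y \<in> Obj (MC M)"
    then show "F2 \<Phi> (x, y) \<in> Arr (MC N) \<and>
       Dom (MC N) (F2 \<Phi> (x, y)) = fo (Ten N) (fo (SF \<Phi>) x, fo (SF \<Phi>) y) \<and>
       Cod (MC N) (F2 \<Phi> (x, y)) = fo (SF \<Phi>) (fo (Ten M) (x, y)) \<and> iso (MC N) (F2 \<Phi> (x, y))"
      using nat_iso_rules(1-4)[OF n, of "(x, y)"] by simp }
  { fix f g assume "f \<in> Arr (MC M)" "g \<in> Arr (MC M)"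
    then show "Cmp (MC N) (F2 \<Phi> (Cod (MC M) f, Cod (MC M) g)) (fa (Ten N) (fa (SF \<Phi>) f, fa (SF \<Phi>) g)) =
       Cmp (MC N) (fa (SF \<Phi>) (fa (Ten M) (f, g))) (F2 \<Phi> (Dom (MC M) f, Dom (MC M) g))"
      using nat_iso_rules(5)[OF n, of "(f, g)"] by simp }
qed (use assms in \<open>simp_all add: strong_monoidal_def Let_def\<close>)

lemma strong_monoidalI:
  assumes M: "is_functor (prodC (MC M) (MC M)) (MC M) (Ten M)" and N: "is_functor (prodC (MC N) (MC N)) (MC N) (Ten N)"
    and F: "is_functor (MC M) (MC N) (SF \<Phi>)"
    and "\<And>x y. x \<in> Obj (MC M) \<Longrightarrow> y \<in> Obj (MC M) \<Longrightarrow> F2 \<Phi> (x, y) \<in> Arr (MC N) \<and>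
       Dom (MC N) (F2 \<Phi> (x, y)) = fo (Ten N) (fo (SF \<Phi>) x, fo (SF \<Phi>) y) \<and>
       Cod (MC N) (F2 \<Phi> (x, y)) = fo (SF \<Phi>) (fo (Ten M) (x, y)) \<and> iso (MC N) (F2 \<Phi> (x, y))"
    "\<And>f g. f \<in> Arr (MC M) \<Longrightarrow> g \<in> Arr (MC M) \<Longrightarrow>
       Cmp (MC N) (F2 \<Phi> (Cod (MC M) f, Cod (MC M) g)) (fa (Ten N) (fa (SF \<Phi>) f, fa (SF \<Phi>) g)) =
       Cmp (MC N) (fa (SF \<Phi>) (fa (Ten M) (f, g))) (F2 \<Phi> (Dom (MC M) f, Dom (MC M) g))"
    "F2 \<Phi> \<in> extensional (Obj (MC M) \<times> Obj (MC M))"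
    "F0 \<Phi> \<in> hom (MC N) (One N) (fo (SF \<Phi>) (One M))" "iso (MC N) (F0 \<Phi>)"
    "\<And>x y z. x \<in> Obj (MC M) \<Longrightarrow> y \<in> Obj (MC M) \<Longrightarrow> z \<in> Obj (MC M) \<Longrightarrow>
      Cmp (MC N) (Cmp (MC N) (fa (SF \<Phi>) (Asc M ((x, y), z))) (F2 \<Phi> (fo (Ten M) (x, y), z))) (fa (Ten N) (F2 \<Phi> (x, y), Id (MC
          N) (fo (SF \<Phi>) z))) =
      Cmp (MC N) (Cmp (MC N) (F2 \<Phi> (x, fo (Ten M) (y, z))) (fa (Ten N) (Id (MC N) (fo (SF \<Phi>) x), F2 \<Phi> (y, z))))
        (Asc N ((fo (SF \<Phi>) x, fo (SF \<Phi>) y), fo (SF \<Phi>) z))"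
    "\<And>x. x \<in> Obj (MC M) \<Longrightarrow> Cmp (MC N) (Cmp (MC N) (fa (SF \<Phi>) (LUn M x)) (F2 \<Phi> (One M, x))) (fa (Ten N) (F0 \<Phi>, Id (MC N) (fo
        (SF \<Phi>) x))) = LUn N (fo (SF \<Phi>) x)"
    "\<And>x. x \<in> Obj (MC M) \<Longrightarrow> Cmp (MC N) (Cmp (MC N) (fa (SF \<Phi>) (RUn M x)) (F2 \<Phi> (x, One M))) (fa (Ten N) (Id (MC N) (fo (SF \<Phi>)
        x), F0 \<Phi>)) = RUn N (fo (SF \<Phi>) x)"
  shows "strong_monoidal M N \<Phi>"
proof -
  note f = functor_rules[OF F] and b = bifunctor_rules[OF M] bifunctor_rules[OF N]
  have "nat_iso (prodC (MC M) (MC M)) (MC N) (compF (prodC (MC M) (MC M)) (Ten N) (prodF (MC M) (MC M) (SF \<Phi>) (SF \<Phi>)))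
       (compF (prodC (MC M) (MC M)) (SF \<Phi>) (Ten M)) (F2 \<Phi>)"
  proof (rule nat_isoI)
    fix z assume "z \<in> Obj (prodC (MC M) (MC M))"
    then obtain x y where "z = (x, y)" "x \<in> Obj (MC M)" "y \<in> Obj (MC M)" by auto
    with assms(4)[of x y] show "F2 \<Phi> z \<in> Arr (MC N) \<and>
         Dom (MC N) (F2 \<Phi> z) = fo (compF (prodC (MC M) (MC M)) (Ten N) (prodF (MC M) (MC M) (SF \<Phi>) (SF \<Phi>))) z \<and>
         Cod (MC N) (F2 \<Phi> z) = fo (compF (prodC (MC M) (MC M)) (SF \<Phi>) (Ten M)) z \<and> iso (MC N) (F2 \<Phi> z)" by simp
  next
    fix z assume "z \<in> Arr (prodC (MC M) (MC M))"
    then obtain x y where "z = (x, y)" "x \<in> Arr (MC M)" "y \<in> Arr (MC M)" by auto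
    with assms(5)[of x y] show "F2 \<Phi> (Cod (prodC (MC M) (MC M)) z) \<cdot>\<^bsub>MC N\<^esub> fa (compF (prodC (MC M) (MC M)) (Ten N) (prodF (MC
        M) (MC M) (SF \<Phi>) (SF \<Phi>))) z =
         fa (compF (prodC (MC M) (MC M)) (SF \<Phi>) (Ten M)) z \<cdot>\<^bsub>MC N\<^esub> F2 \<Phi> (Dom (prodC (MC M) (MC M)) z)" by simp
  qed (simp add: assms(6))
  then show ?thesis unfolding strong_monoidal_def Let_def using assms by auto
qed

section \<open>Identities and composites of strong monoidal functors\<close>

lemma id_smf_simps [simp]:
  "SF (id_smf M) = idF (MC M)" "F0 (id_smf M) = Id (MC M) (One M)"
  "x \<in> Obj (MC M) \<Longrightarrow> y \<in> Obj (MC M) \<Longrightarrow> F2 (id_smf M) (x, y) = Id (MC M) (fo (Ten M) (x, y))"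
  "F2 (id_smf M) \<in> extensional (Obj (MC M) \<times> Obj (MC M))"
  by (simp_all add: id_smf_def Let_def)

lemma comp_smf_simps [simp]:
  "SF (comp_smf M N P \<Psi> \<Phi>) = compF (MC M) (SF \<Psi>) (SF \<Phi>)"
  "F0 (comp_smf M N P \<Psi> \<Phi>) = Cmp (MC P) (fa (SF \<Psi>) (F0 \<Phi>)) (F0 \<Psi>)"
  "x \<in> Obj (MC M) \<Longrightarrow> y \<in> Obj (MC M) \<Longrightarrow> F2 (comp_smf M N P \<Psi> \<Phi>) (x, y) =
     Cmp (MC P) (fa (SF \<Psi>) (F2 \<Phi> (x, y))) (F2 \<Psi> (fo (SF \<Phi>) x, fo (SF \<Phi>) y))"
  "F2 (comp_smf M N P \<Psi> \<Phi>) \<in> extensional (Obj (MC M) \<times> Obj (MC M))"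
  by (simp_all add: comp_smf_def Let_def)

lemma smf_eqI:
  assumes "SF \<Phi> = SF \<Psi>" "F0 \<Phi> = F0 \<Psi>" "F2 \<Phi> \<in> extensional (A \<times> B)" "F2 \<Psi> \<in> extensional (A \<times> B)"
    "\<And>x y. x \<in> A \<Longrightarrow> y \<in> B \<Longrightarrow> F2 \<Phi> (x, y) = F2 \<Psi> (x, y)"
  shows "\<Phi> = (\<Psi> :: ('o, 'm, 'p, 'n) smf)"
proof (rule smf.equality)
  show "F2 \<Phi> = F2 \<Psi>" using assms(3,4) by (rule extensionalityI) (use assms(5) in auto)
qed (use assms in auto)

lemma strong_monoidal_id:
  assumes M: "monoidal_category M"
  shows "strong_monoidal M M (id_smf M)"
proof -
  note m = monoidal_category_rules[OF M]
  note b = bifunctor_rules[OF m(2)]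
  show ?thesis
    by (rule strong_monoidalI[OF m(2) m(2)]) (auto simp: m(1,3,4,6,7) b in_hom functor_idF iso_Id)
qed

text \<open>The structure map of the composite is \<open>\<nu>\<close> followed by the image of
  \<open>\<mu>\<close> under \<open>G\<close>. Each coherence law is the image under
  \<open>G\<close> of the law for \<open>\<Phi>\<close> combined with the law for
  \<open>\<Psi>\<close>; naturality of \<open>\<nu>\<close> is what moves the image of
  \<open>\<mu>\<close> out of the tensor product.\<close>

lemma strong_monoidal_comp:
  assumes M: "monoidal_category M" and N: "monoidal_category N" and P: "monoidal_category P"
    and \<Phi>: "strong_monoidal M N \<Phi>" and \<Psi>: "strong_monoidal N P \<Psi>"
  shows "strong_monoidal M P (comp_smf M N P \<Psi> \<Phi>)"
proof -
  define C where "C = MC M" define D where "D = MC N" define E where "E = MC P"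
  define F where "F = SF \<Phi>" define G where "G = SF \<Psi>"
  define \<mu> where "\<mu> = F2 \<Phi>" define \<nu> where "\<nu> = F2 \<Psi>"
  define tM where "tM = fo (Ten M)" define tN where "tN = fo (Ten N)" define tP where "tP = fo (Ten P)"
  define TM where "TM = fa (Ten M)" define TN where "TN = fa (Ten N)" define TP where "TP = fa (Ten P)"
  note fold = C_def[symmetric] D_def[symmetric] E_def[symmetric] F_def[symmetric] G_def[symmetric] \<mu>_def[symmetric]
      \<nu>_def[symmetric]
    tM_def[symmetric] tN_def[symmetric] tP_def[symmetric] TM_def[symmetric] TN_def[symmetric] TP_def[symmetric]
  note m = monoidal_category_rules[OF M] and n = monoidal_category_rules[OF N] and p = monoidal_category_rules[OF P]
  note s = strong_monoidal_rules[OF \<Phi>, unfolded fold] and t = strong_monoidal_rules[OF \<Psi>, unfolded fold]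
  note bM = bifunctor_rules[OF m(2), unfolded fold] and bN = bifunctor_rules[OF n(2), unfolded fold] and bP =
      bifunctor_rules[OF p(2), unfolded fold]
  note F = functor_rules[OF s(1)] and G = functor_rules[OF t(1)]
  note mm = m(3,4,6,7)[unfolded fold] and nn = n(3,4,6,7)[unfolded fold] and pp = p(3,4,6,7)[unfolded fold]
  note c = F(1,2) G(2)
  note all = F G mm nn pp s(2,5-8) t(2,5-8) bM(2-6) bN(2-6) bP(2-6)
  note G_iso = functor_iso[OF t(1)]
  note cs = comp_smf_simps(3)[where M = M and N = N and P = P and \<Psi> = \<Psi> and \<Phi> = \<Phi>, unfolded fold]
  have GF_nat: "Cmp E (Cmp E (fa G (\<mu> (Cod C f, Cod C g))) (\<nu> (fo F (Cod C f), fo F (Cod C g)))) (TP (fa G (fa F f), fa G (fa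
      F g))) =
    Cmp E (fa G (fa F (TM (f, g)))) (Cmp E (fa G (\<mu> (Dom C f, Dom C g))) (\<nu> (fo F (Dom C f), fo F (Dom C g))))"
    if f: "f \<in> Arr C" "g \<in> Arr C" for f g
  proof -
    have "Cmp E (Cmp E (fa G (\<mu> (Cod C f, Cod C g))) (\<nu> (fo F (Cod C f), fo F (Cod C g)))) (TP (fa G (fa F f), fa G (fa F
        g))) =
      Cmp E (fa G (\<mu> (Cod C f, Cod C g))) (Cmp E (\<nu> (Cod D (fa F f), Cod D (fa F g))) (TP (fa G (fa F f), fa G (fa F g))))"
      using f c by (simp add: all)
    also have "\<dots> = Cmp E (fa G (Cmp D (\<mu> (Cod C f, Cod C g)) (TN (fa F f, fa F g)))) (\<nu> (Dom D (fa F f), Dom D (fa F g)))"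
      unfolding t(3)[OF F(4)[OF f(1)] F(4)[OF f(2)]] using f c by (simp add: all)
    also have "\<dots> = Cmp E (fa G (fa F (TM (f, g)))) (Cmp E (fa G (\<mu> (Dom C f, Dom C g))) (\<nu> (fo F (Dom C f), fo F (Dom C
        g))))"
      unfolding s(3)[OF f] using f c by (simp add: all)
    finally show ?thesis .
  qed
  \<comment> \<open>Naturality of \<open>\<nu>\<close> with one tensor factor held at an identity,
    the form in which \<open>\<nu>\<close> slides past \<open>\<mu>\<close> and past the unit
    map.\<close>
  have \<nu>1: "Cmp E (\<nu> (y, z)) (TP (fa G f, Id E (fo G z))) = Cmp E (fa G (TN (f, Id D z))) (\<nu> (x, z))"
    if "f \<in> Arr D" "Dom D f = x" "Cod D f = y" "z \<in> Obj D" for f x y z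
    using t(3)[of f "Id D z"] that c by (simp add: all)
  have \<nu>2: "Cmp E (\<nu> (z, y)) (TP (Id E (fo G z), fa G f)) = Cmp E (fa G (TN (Id D z, f))) (\<nu> (z, x))"
    if "f \<in> Arr D" "Dom D f = x" "Cod D f = y" "z \<in> Obj D" for f x y z
    using t(3)[of "Id D z" f] that c by (simp add: all)
  have TP1: "TP (Cmp E g f, Id E z) = Cmp E (TP (g, Id E z)) (TP (f, Id E z))"
    "TP (Id E z, Cmp E g f) = Cmp E (TP (Id E z, g)) (TP (Id E z, f))"
    if "f \<in> Arr E" "g \<in> Arr E" "Cod E f = Dom E g" "z \<in> Obj E" for f g z
    using bP(7)[of f g "Id E z" "Id E z"] bP(7)[of "Id E z" "Id E z" f g] that c by simp_all
  show ?thesis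
  proof (rule strong_monoidalI[OF m(2) p(2), of "comp_smf M N P \<Psi> \<Phi>", unfolded comp_smf_simps(1,2) fold])
    show "is_functor C E (compF C G F)" by (rule functor_compF[OF s(1) t(1)])
    show "F2 (comp_smf M N P \<Psi> \<Phi>) \<in> extensional (Obj C \<times> Obj C)" by (simp add: C_def)
    show "Cmp E (fa G (F0 \<Phi>)) (F0 \<Psi>) \<in> hom E (One P) (fo (compF C G F) (One M))" "iso E (Cmp E (fa G (F0 \<Phi>)) (F0 \<Psi>))"
      using c by (auto simp: in_hom all intro!: iso_Cmp G_iso)
    show "F2 (comp_smf M N P \<Psi> \<Phi>) (x, y) \<in> Arr E \<and> Dom E (F2 (comp_smf M N P \<Psi> \<Phi>) (x, y)) = tP (fo (compF C G F) x, fo (compF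
        C G F) y) \<and>
       Cod E (F2 (comp_smf M N P \<Psi> \<Phi>) (x, y)) = fo (compF C G F) (tM (x, y)) \<and> iso E (F2 (comp_smf M N P \<Psi> \<Phi>) (x, y))"
      if "x \<in> Obj C" "y \<in> Obj C" for x y
      using that c by (auto simp: cs all intro!: iso_Cmp G_iso)
    show "Cmp E (F2 (comp_smf M N P \<Psi> \<Phi>) (Cod C f, Cod C g)) (TP (fa (compF C G F) f, fa (compF C G F) g)) =
       Cmp E (fa (compF C G F) (TM (f, g))) (F2 (comp_smf M N P \<Psi> \<Phi>) (Dom C f, Dom C g))"
      if f: "f \<in> Arr C" "g \<in> Arr C" for f g
      using GF_nat[OF f] f c by (simp add: cs bM)
  next
    fix x y z assume x: "x \<in> Obj C" "y \<in> Obj C" "z \<in> Obj C"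
    let ?x = "fo F x" and ?y = "fo F y" and ?z = "fo F z"
    have X: "?x \<in> Obj D" "?y \<in> Obj D" "?z \<in> Obj D" using x by (simp_all add: all)
    \<comment> \<open>Functoriality of the tensor splits the composite structure map, and
      \<open>\<nu>1\<close> then exposes the left side of the associativity law of
      \<open>\<Phi>\<close> inside \<open>fa G\<close>. The law of \<open>\<Psi>\<close> applies to
      what remains, and \<open>\<nu>2\<close> reassembles the composite structure map on the other
      side.\<close>
    have "Cmp E (Cmp E (fa G (fa F (Asc M ((x, y), z)))) (Cmp E (fa G (\<mu> (tM (x, y), z))) (\<nu> (fo F (tM (x, y)), ?z))))
        (TP (Cmp E (fa G (\<mu> (x, y))) (\<nu> (?x, ?y)), Id E (fo G ?z))) =
      Cmp E (fa G (fa F (Asc M ((x, y), z)))) (Cmp E (fa G (\<mu> (tM (x, y), z)))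
        (Cmp E (Cmp E (\<nu> (fo F (tM (x, y)), ?z)) (TP (fa G (\<mu> (x, y)), Id E (fo G ?z)))) (TP (\<nu> (?x, ?y), Id E (fo G ?z)))))"
      using x X c by (simp add: all TP1)
    also have "Cmp E (\<nu> (fo F (tM (x, y)), ?z)) (TP (fa G (\<mu> (x, y)), Id E (fo G ?z))) =
       Cmp E (fa G (TN (\<mu> (x, y), Id D ?z))) (\<nu> (tN (?x, ?y), ?z))"
      using x X by (intro \<nu>1) (simp_all add: all)
    also have "Cmp E (fa G (fa F (Asc M ((x, y), z)))) (Cmp E (fa G (\<mu> (tM (x, y), z))) (Cmp E (Cmp E (fa G (TN (\<mu> (x, y), Id
        D ?z))) (\<nu> (tN (?x, ?y), ?z))) (TP (\<nu> (?x, ?y), Id E (fo G ?z))))) =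
      Cmp E (fa G (Cmp D (Cmp D (fa F (Asc M ((x, y), z))) (\<mu> (tM (x, y), z))) (TN (\<mu> (x, y), Id D ?z)))) (Cmp E (\<nu> (tN (?x,
          ?y), ?z)) (TP (\<nu> (?x, ?y), Id E (fo G ?z))))"
      using x X c by (simp add: all)
    also have "\<dots> = Cmp E (fa G (\<mu> (x, tM (y, z)))) (Cmp E (fa G (TN (Id D ?x, \<mu> (y, z))))
       (Cmp E (Cmp E (fa G (Asc N ((?x, ?y), ?z))) (\<nu> (tN (?x, ?y), ?z))) (TP (\<nu> (?x, ?y), Id E (fo G ?z)))))"
      unfolding s(9)[OF x] using x X c by (simp add: all)
    also have "\<dots> = Cmp E (fa G (\<mu> (x, tM (y, z)))) (Cmp E (Cmp E (fa G (TN (Id D ?x, \<mu> (y, z)))) (\<nu> (?x, tN (?y, ?z))))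
       (Cmp E (TP (Id E (fo G ?x), \<nu> (?y, ?z))) (Asc P ((fo G ?x, fo G ?y), fo G ?z))))"
      unfolding t(9)[OF X] using x X c by (simp add: all)
    also have "Cmp E (fa G (TN (Id D ?x, \<mu> (y, z)))) (\<nu> (?x, tN (?y, ?z))) = Cmp E (\<nu> (?x, fo F (tM (y, z)))) (TP (Id E (fo G
        ?x), fa G (\<mu> (y, z))))"
      using x X by (intro \<nu>2[symmetric]) (simp_all add: all)
    also have "Cmp E (fa G (\<mu> (x, tM (y, z)))) (Cmp E (Cmp E (\<nu> (?x, fo F (tM (y, z)))) (TP (Id E (fo G ?x), fa G (\<mu> (y,
        z)))))
       (Cmp E (TP (Id E (fo G ?x), \<nu> (?y, ?z))) (Asc P ((fo G ?x, fo G ?y), fo G ?z)))) =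
      Cmp E (Cmp E (Cmp E (fa G (\<mu> (x, tM (y, z)))) (\<nu> (?x, fo F (tM (y, z))))) (TP (Id E (fo G ?x), Cmp E (fa G (\<mu> (y, z)))
          (\<nu> (?y, ?z)))))
       (Asc P ((fo G ?x, fo G ?y), fo G ?z))"
      using x X c by (simp add: all TP1)
    finally show "Cmp E (Cmp E (fa (compF C G F) (Asc M ((x, y), z))) (F2 (comp_smf M N P \<Psi> \<Phi>) (tM (x, y), z)))
        (TP (F2 (comp_smf M N P \<Psi> \<Phi>) (x, y), Id E (fo (compF C G F) z))) =
      Cmp E (Cmp E (F2 (comp_smf M N P \<Psi> \<Phi>) (x, tM (y, z))) (TP (Id E (fo (compF C G F) x), F2 (comp_smf M N P \<Psi> \<Phi>) (y, z))))
       (Asc P ((fo (compF C G F) x, fo (compF C G F) y), fo (compF C G F) z))"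
      using x X c by (simp add: cs bM(2) mm)
  next
    fix x assume x: "x \<in> Obj C"
    let ?x = "fo F x" and ?o = "One M"
    have X: "?x \<in> Obj D" using x by (simp add: all)
    have "Cmp E (Cmp E (fa G (fa F (LUn M x))) (Cmp E (fa G (\<mu> (?o, x))) (\<nu> (fo F ?o, ?x)))) (TP (Cmp E (fa G (F0 \<Phi>)) (F0 \<Psi>),
        Id E (fo G ?x))) =
      Cmp E (fa G (fa F (LUn M x))) (Cmp E (fa G (\<mu> (?o, x))) (Cmp E (Cmp E (\<nu> (fo F ?o, ?x)) (TP (fa G (F0 \<Phi>), Id E (fo G
          ?x)))) (TP (F0 \<Psi>, Id E (fo G ?x)))))"
      using x X c by (simp add: all TP1)
    also have "Cmp E (\<nu> (fo F ?o, ?x)) (TP (fa G (F0 \<Phi>), Id E (fo G ?x))) = Cmp E (fa G (TN (F0 \<Phi>, Id D ?x))) (\<nu> (One N,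
        ?x))"
      using x X by (intro \<nu>1) (simp_all add: all)
    also have "Cmp E (fa G (fa F (LUn M x))) (Cmp E (fa G (\<mu> (?o, x))) (Cmp E (Cmp E (fa G (TN (F0 \<Phi>, Id D ?x))) (\<nu> (One N,
        ?x))) (TP (F0 \<Psi>, Id E (fo G ?x))))) =
      Cmp E (Cmp E (fa G (Cmp D (Cmp D (fa F (LUn M x)) (\<mu> (?o, x))) (TN (F0 \<Phi>, Id D ?x)))) (\<nu> (One N, ?x))) (TP (F0 \<Psi>, Id E
          (fo G ?x)))"
      using x X c by (simp add: all)
    also have "\<dots> = LUn P (fo G ?x)" unfolding s(10)[OF x] t(10)[OF X] ..
    finally show "Cmp E (Cmp E (fa (compF C G F) (LUn M x)) (F2 (comp_smf M N P \<Psi> \<Phi>) (?o, x))) (TP (Cmp E (fa G (F0 \<Phi>)) (F0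
        \<Psi>), Id E (fo (compF C G F) x))) =
      LUn P (fo (compF C G F) x)"
      using x X c by (simp add: cs mm)
    have "Cmp E (Cmp E (fa G (fa F (RUn M x))) (Cmp E (fa G (\<mu> (x, ?o))) (\<nu> (?x, fo F ?o)))) (TP (Id E (fo G ?x), Cmp E (fa G
        (F0 \<Phi>)) (F0 \<Psi>))) =
      Cmp E (fa G (fa F (RUn M x))) (Cmp E (fa G (\<mu> (x, ?o))) (Cmp E (Cmp E (\<nu> (?x, fo F ?o)) (TP (Id E (fo G ?x), fa G (F0
          \<Phi>)))) (TP (Id E (fo G ?x), F0 \<Psi>))))"
      using x X c by (simp add: all TP1)
    also have "Cmp E (\<nu> (?x, fo F ?o)) (TP (Id E (fo G ?x), fa G (F0 \<Phi>))) = Cmp E (fa G (TN (Id D ?x, F0 \<Phi>))) (\<nu> (?x, One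
        N))"
      using x X by (intro \<nu>2) (simp_all add: all)
    also have "Cmp E (fa G (fa F (RUn M x))) (Cmp E (fa G (\<mu> (x, ?o))) (Cmp E (Cmp E (fa G (TN (Id D ?x, F0 \<Phi>))) (\<nu> (?x, One
        N))) (TP (Id E (fo G ?x), F0 \<Psi>)))) =
      Cmp E (Cmp E (fa G (Cmp D (Cmp D (fa F (RUn M x)) (\<mu> (x, ?o))) (TN (Id D ?x, F0 \<Phi>)))) (\<nu> (?x, One N))) (TP (Id E (fo G
          ?x), F0 \<Psi>))"
      using x X c by (simp add: all)
    also have "\<dots> = RUn P (fo G ?x)" unfolding s(11)[OF x] t(11)[OF X] ..
    finally show "Cmp E (Cmp E (fa (compF C G F) (RUn M x)) (F2 (comp_smf M N P \<Psi> \<Phi>) (x, ?o))) (TP (Id E (fo (compF C G F)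
        x), Cmp E (fa G (F0 \<Phi>)) (F0 \<Psi>))) =
      RUn P (fo (compF C G F) x)"
      using x X c by (simp add: cs mm)
  qed
qed

lemma comp_smf_id:
  assumes M: "monoidal_category M" and N: "monoidal_category N" and \<Phi>: "strong_monoidal M N \<Phi>"
  shows "comp_smf M M N \<Phi> (id_smf M) = \<Phi>" "comp_smf M N N (id_smf N) \<Phi> = \<Phi>"
proof -
  note s = strong_monoidal_rules[OF \<Phi>] and m = monoidal_category_rules[OF M] and n = monoidal_category_rules[OF N]
  note f = functor_rules[OF s(1)] and b = bifunctor_rules[OF m(2)] bifunctor_rules[OF n(2)]
  show "comp_smf M M N \<Phi> (id_smf M) = \<Phi>"
    by (rule smf_eqI) (auto simp: compF_idF[OF s(1)] f b m(3) s(2,5-7) intro: s(4))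
  show "comp_smf M N N (id_smf N) \<Phi> = \<Phi>"
    by (rule smf_eqI) (auto simp: idF_compF[OF s(1)] f b n(3) s(2,5-7) intro: s(4))
qed

lemma comp_smf_assoc:
  assumes "monoidal_category M" "monoidal_category N" "monoidal_category P" "monoidal_category Q"
    and \<Phi>: "strong_monoidal M N \<Phi>" and \<Psi>: "strong_monoidal N P \<Psi>" and \<Xi>: "strong_monoidal P Q \<Xi>"
  shows "comp_smf M N Q (comp_smf N P Q \<Xi> \<Psi>) \<Phi> = comp_smf M P Q \<Xi> (comp_smf M N P \<Psi> \<Phi>)"
proof -
  note s = strong_monoidal_rules[OF \<Phi>] and t = strong_monoidal_rules[OF \<Psi>] and u = strong_monoidal_rules[OF \<Xi>]
  note b = assms(1-4)[THEN monoidal_category_rules(2), THEN bifunctor_rules(2)] assms(1-4)[THEN monoidal_category_rules(3)]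
  note f = functor_rules[OF s(1)] functor_rules[OF t(1)] functor_rules[OF u(1)]
  show ?thesis
    by (rule smf_eqI[of _ _ "Obj (MC M)" "Obj (MC M)"]) (simp_all add: compF_assoc[OF s(1)] f b s(2,5-7) t(2,5-7) u(2,5-7))
qed

section \<open>The category of monoidal decomposition spaces\<close>

lemma prodX_simps [simp]:
  "Gpd (prodX C X Y) c = prodC (Gpd X c) (Gpd Y c)"
  "Act (prodX C X Y) a = prodF (Gpd X (Cod C a)) (Gpd Y (Cod C a)) (Act X a) (Act Y a)"
  "u \<in> Obj (Gpd X (Cod C b)) \<Longrightarrow> v \<in> Obj (Gpd Y (Cod C b)) \<Longrightarrow> CmpI (prodX C X Y) a b (u, v) = (CmpI X a b u, CmpI Y a b v)"
  "u \<in> Obj (Gpd X c) \<Longrightarrow> v \<in> Obj (Gpd Y c) \<Longrightarrow> IdI (prodX C X Y) c (u, v) = (IdI X c u, IdI Y c v)"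
  by (simp_all add: prodX_def)

lemma oneX_simps [simp]:
  "Gpd oneX c = oneC" "Act oneX a = idF oneC" "CmpI oneX a b u = ()" "IdI oneX c u = ()"
  by (simp_all add: oneX_def)

lemma prodP_simps [simp]:
  "c \<in> Obj C \<Longrightarrow> Cpt (prodP C X Y \<sigma> \<tau>) c = prodF (Gpd X c) (Gpd Y c) (Cpt \<sigma> c) (Cpt \<tau> c)"
  "a \<in> Arr C \<Longrightarrow> u \<in> Obj (Gpd X (Cod C a)) \<Longrightarrow> v \<in> Obj (Gpd Y (Cod C a)) \<Longrightarrow>
     Nat (prodP C X Y \<sigma> \<tau>) a (u, v) = (Nat \<sigma> a u, Nat \<tau> a v)"
  "Cpt (prodP C X Y \<sigma> \<tau>) \<in> extensional (Obj C)" "Nat (prodP C X Y \<sigma> \<tau>) \<in> extensional (Arr C)"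
  "a \<in> Arr C \<Longrightarrow> Nat (prodP C X Y \<sigma> \<tau>) a \<in> extensional (Obj (Gpd X (Cod C a)) \<times> Obj (Gpd Y (Cod C a)))"
  by (simp_all add: prodP_def)

text \<open>The multiplication of a monoidal pseudo-functor has a product as source; here its typing
  and naturality are stated for pairs taken apart.\<close>

lemma pseudonatural_prodX_rules:
  assumes "pseudonatural C (prodX C X X) X T"
  shows "\<And>c. c \<in> Obj C \<Longrightarrow> is_functor (prodC (Gpd X c) (Gpd X c)) (Gpd X c) (Cpt T c)"
    "\<And>a x y. a \<in> Arr C \<Longrightarrow> x \<in> Obj (Gpd X (Cod C a)) \<Longrightarrow> y \<in> Obj (Gpd X (Cod C a)) \<Longrightarrow>
       Nat T a (x, y) \<in> Arr (Gpd X (Dom C a))"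
    "\<And>a x y. a \<in> Arr C \<Longrightarrow> x \<in> Obj (Gpd X (Cod C a)) \<Longrightarrow> y \<in> Obj (Gpd X (Cod C a)) \<Longrightarrow>
       Dom (Gpd X (Dom C a)) (Nat T a (x, y)) = fo (Cpt T (Dom C a)) (fo (Act X a) x, fo (Act X a) y)"
    "\<And>a x y. a \<in> Arr C \<Longrightarrow> x \<in> Obj (Gpd X (Cod C a)) \<Longrightarrow> y \<in> Obj (Gpd X (Cod C a)) \<Longrightarrow>
       Cod (Gpd X (Dom C a)) (Nat T a (x, y)) = fo (Act X a) (fo (Cpt T (Cod C a)) (x, y))"
    "\<And>a f g. pseudofunctor C X \<Longrightarrow> a \<in> Arr C \<Longrightarrow> f \<in> Arr (Gpd X (Cod C a)) \<Longrightarrow> g \<in> Arr (Gpd X (Cod C a)) \<Longrightarrow>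
       Cmp (Gpd X (Dom C a)) (Nat T a (Cod (Gpd X (Cod C a)) f, Cod (Gpd X (Cod C a)) g))
         (fa (Cpt T (Dom C a)) (fa (Act X a) f, fa (Act X a) g)) =
       Cmp (Gpd X (Dom C a)) (fa (Act X a) (fa (Cpt T (Cod C a)) (f, g)))
         (Nat T a (Dom (Gpd X (Cod C a)) f, Dom (Gpd X (Cod C a)) g))"
proof -
  note t = pseudonatural_rules[OF assms]
  show "\<And>c. c \<in> Obj C \<Longrightarrow> is_functor (prodC (Gpd X c) (Gpd X c)) (Gpd X c) (Cpt T c)" using t(3) by simp
  { fix a x y assume a: "a \<in> Arr C" and x: "x \<in> Obj (Gpd X (Cod C a))" "y \<in> Obj (Gpd X (Cod C a))"
    then have "(x, y) \<in> Obj (Gpd (prodX C X X) (Cod C a))" by simp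
    from t(5-7)[OF a this] x show "Nat T a (x, y) \<in> Arr (Gpd X (Dom C a))"
      "Dom (Gpd X (Dom C a)) (Nat T a (x, y)) = fo (Cpt T (Dom C a)) (fo (Act X a) x, fo (Act X a) y)"
      "Cod (Gpd X (Dom C a)) (Nat T a (x, y)) = fo (Act X a) (fo (Cpt T (Cod C a)) (x, y))" by auto }
  fix a f g assume X: "pseudofunctor C X" and a: "a \<in> Arr C" and f: "f \<in> Arr (Gpd X (Cod C a))" "g \<in> Arr (Gpd X (Cod C a))"
  note r = pseudofunctor_rules[OF X]
  have fg: "(f, g) \<in> Arr (Gpd (prodX C X X) (Cod C a))" using f by simp
  have "is_functor (Gpd (prodX C X X) (Cod C a)) (Gpd (prodX C X X) (Dom C a)) (Act (prodX C X X) a)"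
    using functor_prodF[OF r(3)[OF a] r(3)[OF a]] by simp
  from t(8)[OF a this t(3) fg] a f r(1) show "Cmp (Gpd X (Dom C a)) (Nat T a (Cod (Gpd X (Cod C a)) f, Cod (Gpd X (Cod C a))
      g))
         (fa (Cpt T (Dom C a)) (fa (Act X a) f, fa (Act X a) g)) =
       Cmp (Gpd X (Dom C a)) (fa (Act X a) (fa (Cpt T (Cod C a)) (f, g)))
         (Nat T a (Dom (Gpd X (Cod C a)) f, Dom (Gpd X (Cod C a)) g))" by simp
qed

lemma modification_rules:
  assumes "modification C X Y \<sigma> \<tau> \<Gamma>"
  shows "\<Gamma> \<in> extensional (Obj C)" "\<And>c. c \<in> Obj C \<Longrightarrow> nat_iso (Gpd X c) (Gpd Y c) (Cpt \<sigma> c) (Cpt \<tau> c) (\<Gamma> c)"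
    "\<And>a u. a \<in> Arr C \<Longrightarrow> u \<in> Obj (Gpd X (Cod C a)) \<Longrightarrow>
        Cmp (Gpd Y (Dom C a)) (Nat \<tau> a u) (\<Gamma> (Dom C a) (fo (Act X a) u)) =
        Cmp (Gpd Y (Dom C a)) (fa (Act Y a) (\<Gamma> (Cod C a) u)) (Nat \<sigma> a u)"
  using assms unfolding modification_def by auto

lemma level_simps [simp]:
  "MC (level M c) = Gpd (Und M) c" "Ten (level M c) = Cpt (Mul M) c" "One (level M c) = fo (Cpt (Uni M) c) ()"
  "Asc (level M c) = AscM M c" "LUn (level M c) = LUnM M c" "RUn (level M c) = RUnM M c"
  by (simp_all add: level_def)

lemma levelF_simps [simp]:
  "SF (levelF \<Phi> c) = Cpt (MF \<Phi>) c" "F2 (levelF \<Phi> c) = M2 \<Phi> c" "F0 (levelF \<Phi> c) = M0 \<Phi> c ()"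
  by (simp_all add: levelF_def)

lemma monoidal_psh_rules:
  assumes "monoidal_psh C M"
  shows "pseudofunctor C (Und M)" "pseudonatural C (prodX C (Und M) (Und M)) (Und M) (Mul M)"
    "pseudonatural C oneX (Und M) (Uni M)" "\<And>c. c \<in> Obj C \<Longrightarrow> monoidal_category (level M c)"
  using assms by (simp_all add: monoidal_psh_def Let_def)

text \<open>The levelwise naturality of the two modifications is already contained in
  \<open>strong_monoidal\<close> at each level. What remains of them is extensionality and
  compatibility with the action of arrows, and only these are checked for identities and
  composites.\<close>

lemma monoidal_pnt_iff:
  assumes M: "monoidal_psh C M" and N: "monoidal_psh C N"
  shows "monoidal_pnt C M N \<Phi> \<longleftrightarrow> pseudonatural C (Und M) (Und N) (MF \<Phi>) \<and>
    M2 \<Phi> \<in> extensional (Obj C) \<and> M0 \<Phi> \<in> extensional (Obj C) \<and>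
    (\<forall>c \<in> Obj C. strong_monoidal (level M c) (level N c) (levelF \<Phi> c)) \<and>
    (\<forall>a \<in> Arr C. \<forall>x \<in> Obj (Gpd (Und M) (Cod C a)). \<forall>y \<in> Obj (Gpd (Und M) (Cod C a)).
      Cmp (Gpd (Und N) (Dom C a)) (Cmp (Gpd (Und N) (Dom C a)) (Nat (MF \<Phi>) a (fo (Cpt (Mul M) (Cod C a)) (x, y)))
        (fa (Cpt (MF \<Phi>) (Dom C a)) (Nat (Mul M) a (x, y)))) (M2 \<Phi> (Dom C a) (fo (Act (Und M) a) x, fo (Act (Und M) a) y)) =
      Cmp (Gpd (Und N) (Dom C a)) (fa (Act (Und N) a) (M2 \<Phi> (Cod C a) (x, y)))
       (Cmp (Gpd (Und N) (Dom C a)) (Nat (Mul N) a (fo (Cpt (MF \<Phi>) (Cod C a)) x, fo (Cpt (MF \<Phi>) (Cod C a)) y))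
        (fa (Cpt (Mul N) (Dom C a)) (Nat (MF \<Phi>) a x, Nat (MF \<Phi>) a y)))) \<and>
    (\<forall>a \<in> Arr C. Cmp (Gpd (Und N) (Dom C a)) (Cmp (Gpd (Und N) (Dom C a)) (Nat (MF \<Phi>) a (fo (Cpt (Uni M) (Cod C a)) ()))
        (fa (Cpt (MF \<Phi>) (Dom C a)) (Nat (Uni M) a ()))) (M0 \<Phi> (Dom C a) ()) =
      Cmp (Gpd (Und N) (Dom C a)) (fa (Act (Und N) a) (M0 \<Phi> (Cod C a) ())) (Nat (Uni N) a ()))"
    (is "_ \<longleftrightarrow> ?pn \<and> ?e2 \<and> ?e0 \<and> ?sm \<and> ?q2 \<and> ?q0")
proof (cases "?pn \<and> ?sm")
  \<comment> \<open>In the other case both sides are false, since each of them contains the two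
    conditions.\<close>
  case True
  then have sm: "\<And>c. c \<in> Obj C \<Longrightarrow> strong_monoidal (level M c) (level N c) (levelF \<Phi> c)" and pn: ?pn by auto
  note m = monoidal_psh_rules[OF M] and n = monoidal_psh_rules[OF N]
  have C: "category C" by (rule pseudofunctor_rules[OF m(1)])
  let ?X = "Und M" and ?Y = "Und N"
  have ni: "nat_iso (prodC (Gpd ?X c) (Gpd ?X c)) (Gpd ?Y c)
      (compF (prodC (Gpd ?X c) (Gpd ?X c)) (Cpt (Mul N) c) (prodF (Gpd ?X c) (Gpd ?X c) (Cpt (MF \<Phi>) c) (Cpt (MF \<Phi>) c)))
      (compF (prodC (Gpd ?X c) (Gpd ?X c)) (Cpt (MF \<Phi>) c) (Cpt (Mul M) c)) (M2 \<Phi> c)" if "c \<in> Obj C" for c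
    using sm[OF that] unfolding strong_monoidal_def Let_def by simp
  \<comment> \<open>On the one-object category naturality is a condition at an identity, and
    functors preserve identities.\<close>
  have ni0: "nat_iso oneC (Gpd ?Y c) (Cpt (Uni N) c) (compF oneC (Cpt (MF \<Phi>) c) (Cpt (Uni M) c)) (M0 \<Phi> c)" if c: "c \<in> Obj C"
      for c
  proof -
    note s = strong_monoidal_rules(5-8)[OF sm[OF c], simplified]
    have "is_functor oneC (Gpd ?Y c) (Cpt (Uni N) c)" "is_functor oneC (Gpd ?X c) (Cpt (Uni M) c)" "is_functor (Gpd ?X c)
        (Gpd ?Y c) (Cpt (MF \<Phi>) c)"
      using pseudonatural_rules(3)[OF m(3) c] pseudonatural_rules(3)[OF n(3) c] pseudonatural_rules(3)[OF pn c] by simp_all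
    note f = functor_rules[OF this(1)] functor_rules[OF this(2)] functor_rules[OF this(3)]
    have i: "fa (Cpt (Uni N) c) () = Id (Gpd ?Y c) (fo (Cpt (Uni N) c) ())" "fa (Cpt (Uni M) c) () = Id (Gpd ?X c) (fo (Cpt
        (Uni M) c) ())"
      using f(7)[of "()"] f(15)[of "()"] by simp_all
    show ?thesis
      by (rule nat_isoI) (use f s in \<open>simp_all add: i extensional_def\<close>)
  qed
  have "modification C (prodX C ?X ?X) ?Y (compP C (prodX C ?X ?X) ?Y (Mul N) (prodP C ?X ?X (MF \<Phi>) (MF \<Phi>)))
     (compP C (prodX C ?X ?X) ?Y (MF \<Phi>) (Mul M)) (M2 \<Phi>) \<longleftrightarrow> ?e2 \<and> ?q2"
    unfolding modification_def using ni C by (auto simp: Ball_def)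
  moreover have "modification C oneX ?Y (Uni N) (compP C oneX ?Y (MF \<Phi>) (Uni M)) (M0 \<Phi>) \<longleftrightarrow> ?e0 \<and> ?q0"
    unfolding modification_def using ni0 C by (auto simp: Ball_def)
  ultimately show ?thesis unfolding monoidal_pnt_def Let_def using True by blast
qed (auto simp: monoidal_pnt_def Let_def)

lemma id_monpnt_simps [simp]:
  "MF (id_monpnt C M) = idP C (Und M)" "c \<in> Obj C \<Longrightarrow> levelF (id_monpnt C M) c = id_smf (level M c)"
  "c \<in> Obj C \<Longrightarrow> M2 (id_monpnt C M) c = F2 (id_smf (level M c))"
  "c \<in> Obj C \<Longrightarrow> M0 (id_monpnt C M) c () = Id (Gpd (Und M) c) (fo (Cpt (Uni M) c) ())"
  "M2 (id_monpnt C M) \<in> extensional (Obj C)" "M0 (id_monpnt C M) \<in> extensional (Obj C)"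
  by (simp_all add: id_monpnt_def levelF_def id_smf_def Let_def)

lemma comp_monpnt_simps [simp]:
  "MF (comp_monpnt C M N P \<Psi> \<Phi>) = compP C (Und M) (Und P) (MF \<Psi>) (MF \<Phi>)"
  "c \<in> Obj C \<Longrightarrow> levelF (comp_monpnt C M N P \<Psi> \<Phi>) c = comp_smf (level M c) (level N c) (level P c) (levelF \<Psi> c) (levelF \<Phi> c)"
  "c \<in> Obj C \<Longrightarrow> M2 (comp_monpnt C M N P \<Psi> \<Phi>) c = F2 (comp_smf (level M c) (level N c) (level P c) (levelF \<Psi> c) (levelF \<Phi> c))"
  "c \<in> Obj C \<Longrightarrow> M0 (comp_monpnt C M N P \<Psi> \<Phi>) c () = Cmp (Gpd (Und P) c) (fa (Cpt (MF \<Psi>) c) (M0 \<Phi> c ())) (M0 \<Psi> c ())"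
  "M2 (comp_monpnt C M N P \<Psi> \<Phi>) \<in> extensional (Obj C)" "M0 (comp_monpnt C M N P \<Psi> \<Phi>) \<in> extensional (Obj C)"
  by (simp_all add: comp_monpnt_def levelF_def comp_smf_def Let_def)

lemma monpnt_eqI:
  assumes "MF \<Phi> = MF \<Psi>" "M2 \<Phi> \<in> extensional A" "M2 \<Psi> \<in> extensional A" "M0 \<Phi> \<in> extensional A" "M0 \<Psi> \<in> extensional A"
    "\<And>c. c \<in> A \<Longrightarrow> levelF \<Phi> c = levelF \<Psi> c"
  shows "\<Phi> = (\<Psi> :: ('c, 'k, 'o, 'm, 'p, 'n) monpnt)"
proof (rule monpnt.equality)
  have "M2 \<Phi> c = M2 \<Psi> c" "M0 \<Phi> c () = M0 \<Psi> c ()" if "c \<in> A" for c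
    using assms(6)[OF that] by (simp_all add: levelF_def)
  then have "\<And>c. c \<in> A \<Longrightarrow> M2 \<Phi> c = M2 \<Psi> c" "\<And>c. c \<in> A \<Longrightarrow> M0 \<Phi> c = M0 \<Psi> c"
    by (auto intro: ext)
  then show "M2 \<Phi> = M2 \<Psi>" "M0 \<Phi> = M0 \<Psi>"
    using extensionalityI[OF assms(2,3)] extensionalityI[OF assms(4,5)] by blast+
qed (use assms in auto)

lemma monoidal_pnt_id:
  assumes M: "monoidal_psh C M"
  shows "monoidal_pnt C M M (id_monpnt C M)"
proof -
  note m = monoidal_psh_rules[OF M]
  note r = pseudofunctor_rules[OF m(1)] and t = pseudonatural_prodX_rules[OF m(2)] and u = pseudonatural_rules[OF m(3),
      simplified]
  show ?thesis unfolding monoidal_pnt_iff[OF M M]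
  proof (intro conjI ballI)
    show "pseudonatural C (Und M) (Und M) (MF (id_monpnt C M))"
      by (simp add: pseudonatural_idP[OF m(1)])
    show "strong_monoidal (level M c) (level M c) (levelF (id_monpnt C M) c)" if "c \<in> Obj C" for c
      using strong_monoidal_id[OF m(4)] that by simp
    fix a assume a: "a \<in> Arr C"
    have d: "Dom C a \<in> Obj C" "Cod C a \<in> Obj C" using a r(1) by auto
    note f = functor_rules[OF r(3)[OF a]] bifunctor_rules[OF t(1)[OF d(1)]] bifunctor_rules[OF t(1)[OF d(2)]]
       functor_rules[OF u(3)[OF d(1)]] functor_rules[OF u(3)[OF d(2)]]
    show "Cmp (Gpd (Und M) (Dom C a)) (Cmp (Gpd (Und M) (Dom C a)) (Nat (MF (id_monpnt C M)) a (fo (Cpt (Uni M) (Cod C a))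
        ()))
        (fa (Cpt (MF (id_monpnt C M)) (Dom C a)) (Nat (Uni M) a ()))) (M0 (id_monpnt C M) (Dom C a) ()) =
      Cmp (Gpd (Und M) (Dom C a)) (fa (Act (Und M) a) (M0 (id_monpnt C M) (Cod C a) ())) (Nat (Uni M) a ())"
      using a d by (simp add: f u)
    fix x y assume "x \<in> Obj (Gpd (Und M) (Cod C a))" "y \<in> Obj (Gpd (Und M) (Cod C a))"
    then show "Cmp (Gpd (Und M) (Dom C a)) (Cmp (Gpd (Und M) (Dom C a)) (Nat (MF (id_monpnt C M)) a (fo (Cpt (Mul M) (Cod C
        a)) (x, y)))
        (fa (Cpt (MF (id_monpnt C M)) (Dom C a)) (Nat (Mul M) a (x, y)))) (M2 (id_monpnt C M) (Dom C a) (fo (Act (Und M) a)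
            x, fo (Act (Und M) a) y)) =
      Cmp (Gpd (Und M) (Dom C a)) (fa (Act (Und M) a) (M2 (id_monpnt C M) (Cod C a) (x, y)))
       (Cmp (Gpd (Und M) (Dom C a)) (Nat (Mul M) a (fo (Cpt (MF (id_monpnt C M)) (Cod C a)) x, fo (Cpt (MF (id_monpnt C M))
           (Cod C a)) y))
        (fa (Cpt (Mul M) (Dom C a)) (Nat (MF (id_monpnt C M)) a x, Nat (MF (id_monpnt C M)) a y)))"
      using a d by (simp add: f t)
  qed simp_all
qed

text \<open>Each level is a composite of strong monoidal functors. Compatibility with an arrow
  \<open>a\<close> pastes the square of \<open>\<Phi>\<close>, mapped by the underlying
  transformation of \<open>\<Psi>\<close>, with the square of \<open>\<Psi>\<close>; between them
  stand two interchanges by naturality.\<close>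

lemma monoidal_pnt_comp:
  assumes M: "monoidal_psh C M" and N: "monoidal_psh C N" and P: "monoidal_psh C P"
    and \<Phi>: "monoidal_pnt C M N \<Phi>" and \<Psi>: "monoidal_pnt C N P \<Psi>"
  shows "monoidal_pnt C M P (comp_monpnt C M N P \<Psi> \<Phi>)"
proof -
  note m = monoidal_psh_rules[OF M] and n = monoidal_psh_rules[OF N] and p = monoidal_psh_rules[OF P]
  note rM = pseudofunctor_rules[OF m(1)] and rN = pseudofunctor_rules[OF n(1)] and rP = pseudofunctor_rules[OF p(1)]
  note tM = pseudonatural_prodX_rules[OF m(2)] and tN = pseudonatural_prodX_rules[OF n(2)] and tP =
      pseudonatural_prodX_rules[OF p(2)]
  note uM = pseudonatural_rules[OF m(3), simplified] and uN = pseudonatural_rules[OF n(3), simplified] and uP =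
      pseudonatural_rules[OF p(3), simplified]
  note ph = \<Phi>[unfolded monoidal_pnt_iff[OF M N]] and ps = \<Psi>[unfolded monoidal_pnt_iff[OF N P]]
  have F: "pseudonatural C (Und M) (Und N) (MF \<Phi>)" and G: "pseudonatural C (Und N) (Und P) (MF \<Psi>)"
    and sF: "\<And>c. c \<in> Obj C \<Longrightarrow> strong_monoidal (level M c) (level N c) (levelF \<Phi> c)"
    and sG: "\<And>c. c \<in> Obj C \<Longrightarrow> strong_monoidal (level N c) (level P c) (levelF \<Psi> c)" using ph ps by auto
  note nF = pseudonatural_rules[OF F] and nG = pseudonatural_rules[OF G]
  have C: "category C" by (rule rM)
  show ?thesis unfolding monoidal_pnt_iff[OF M P]
  proof (intro conjI ballI)
    show "pseudonatural C (Und M) (Und P) (MF (comp_monpnt C M N P \<Psi> \<Phi>))"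
      by (simp add: pseudonatural_compP[OF m(1) n(1) p(1) F G])
    show "strong_monoidal (level M c) (level P c) (levelF (comp_monpnt C M N P \<Psi> \<Phi>) c)" if "c \<in> Obj C" for c
      using strong_monoidal_comp[OF m(4) n(4) p(4) sF sG] that by simp
    fix a assume a: "a \<in> Arr C"
    define d where "d = Dom C a" define e where "e = Cod C a"
    have d: "d \<in> Obj C" "e \<in> Obj C" using a C by (auto simp: d_def e_def)
    have gp: "category (Gpd (Und M) d)" "category (Gpd (Und N) d)" "category (Gpd (Und P) d)" using d rM rN rP by auto
    note de = d_def[symmetric] e_def[symmetric]
    note f = functor_rules[OF rM(3)[OF a], unfolded de] functor_rules[OF rN(3)[OF a], unfolded de] functor_rules[OF rP(3)[OF
        a], unfolded de]
       functor_rules[OF nF(3)[OF d(1)]] functor_rules[OF nF(3)[OF d(2)]] functor_rules[OF nG(3)[OF d(1)]] functor_rules[OF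
           nG(3)[OF d(2)]]
       functor_rules[OF uM(3)[OF d(1)]] functor_rules[OF uM(3)[OF d(2)]] functor_rules[OF uN(3)[OF d(1)]] functor_rules[OF
           uN(3)[OF d(2)]]
       functor_rules[OF uP(3)[OF d(1)]] functor_rules[OF uP(3)[OF d(2)]]
    note b = bifunctor_rules(1-6)[OF tM(1)[OF d(1)]] bifunctor_rules(1-6)[OF tM(1)[OF d(2)]]
      bifunctor_rules(1-6)[OF tN(1)[OF d(1)]] bifunctor_rules(1-6)[OF tN(1)[OF d(2)]]
      bifunctor_rules(1-6)[OF tP(1)[OF d(1)]] bifunctor_rules(1-6)[OF tP(1)[OF d(2)]]
    note ty = nF(5-7)[OF a, unfolded de] nG(5-7)[OF a, unfolded de] tM(2-4)[OF a, unfolded de] tN(2-4)[OF a, unfolded de]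
        tP(2-4)[OF a, unfolded de]
      uM(5-7)[OF a, unfolded de] uN(5-7)[OF a, unfolded de] uP(5-7)[OF a, unfolded de]
    note st = strong_monoidal_rules(2)[OF sF[OF d(1)], simplified] strong_monoidal_rules(2)[OF sF[OF d(2)], simplified]
      strong_monoidal_rules(2)[OF sG[OF d(1)], simplified] strong_monoidal_rules(2)[OF sG[OF d(2)], simplified]
      strong_monoidal_rules(5-7)[OF sF[OF d(1)], simplified] strong_monoidal_rules(5-7)[OF sF[OF d(2)], simplified]
      strong_monoidal_rules(5-7)[OF sG[OF d(1)], simplified] strong_monoidal_rules(5-7)[OF sG[OF d(2)], simplified]
    note all = f b ty st
    have qF: "\<And>x y. x \<in> Obj (Gpd (Und M) e) \<Longrightarrow> y \<in> Obj (Gpd (Und M) e) \<Longrightarrow>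
      Cmp (Gpd (Und N) d) (Cmp (Gpd (Und N) d) (Nat (MF \<Phi>) a (fo (Cpt (Mul M) e) (x, y)))
        (fa (Cpt (MF \<Phi>) d) (Nat (Mul M) a (x, y)))) (M2 \<Phi> d (fo (Act (Und M) a) x, fo (Act (Und M) a) y)) =
      Cmp (Gpd (Und N) d) (fa (Act (Und N) a) (M2 \<Phi> e (x, y)))
       (Cmp (Gpd (Und N) d) (Nat (Mul N) a (fo (Cpt (MF \<Phi>) e) x, fo (Cpt (MF \<Phi>) e) y))
        (fa (Cpt (Mul N) d) (Nat (MF \<Phi>) a x, Nat (MF \<Phi>) a y)))" using ph a unfolding d_def e_def by blast
    have qG: "\<And>x y. x \<in> Obj (Gpd (Und N) e) \<Longrightarrow> y \<in> Obj (Gpd (Und N) e) \<Longrightarrow>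
      Cmp (Gpd (Und P) d) (Cmp (Gpd (Und P) d) (Nat (MF \<Psi>) a (fo (Cpt (Mul N) e) (x, y)))
        (fa (Cpt (MF \<Psi>) d) (Nat (Mul N) a (x, y)))) (M2 \<Psi> d (fo (Act (Und N) a) x, fo (Act (Und N) a) y)) =
      Cmp (Gpd (Und P) d) (fa (Act (Und P) a) (M2 \<Psi> e (x, y)))
       (Cmp (Gpd (Und P) d) (Nat (Mul P) a (fo (Cpt (MF \<Psi>) e) x, fo (Cpt (MF \<Psi>) e) y))
        (fa (Cpt (Mul P) d) (Nat (MF \<Psi>) a x, Nat (MF \<Psi>) a y)))" using ps a unfolding d_def e_def by blast
    have q0F: "Cmp (Gpd (Und N) d) (Cmp (Gpd (Und N) d) (Nat (MF \<Phi>) a (fo (Cpt (Uni M) e) ()))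
        (fa (Cpt (MF \<Phi>) d) (Nat (Uni M) a ()))) (M0 \<Phi> d ()) =
      Cmp (Gpd (Und N) d) (fa (Act (Und N) a) (M0 \<Phi> e ())) (Nat (Uni N) a ())" using ph a unfolding d_def e_def by blast
    have q0G: "Cmp (Gpd (Und P) d) (Cmp (Gpd (Und P) d) (Nat (MF \<Psi>) a (fo (Cpt (Uni N) e) ()))
        (fa (Cpt (MF \<Psi>) d) (Nat (Uni N) a ()))) (M0 \<Psi> d ()) =
      Cmp (Gpd (Und P) d) (fa (Act (Und P) a) (M0 \<Psi> e ())) (Nat (Uni P) a ())" using ps a unfolding d_def e_def by blast
    \<comment> \<open>Naturality of the cell of \<open>\<Psi>\<close> with named endpoints, to be
      applied at the unit map and at the structure map of \<open>\<Phi>\<close>.\<close>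
    have Gnat: "Cmp (Gpd (Und P) d) (Nat (MF \<Psi>) a z) (fa (Cpt (MF \<Psi>) d) (fa (Act (Und N) a) h)) =
       Cmp (Gpd (Und P) d) (fa (Act (Und P) a) (fa (Cpt (MF \<Psi>) e) h)) (Nat (MF \<Psi>) a y)"
      if "h \<in> Arr (Gpd (Und N) e)" "Dom (Gpd (Und N) e) h = y" "Cod (Gpd (Und N) e) h = z" for h y z
      using nG(8)[OF a rN(3)[OF a] nG(3)[of "Cod C a"], unfolded de, OF d(2)] that by auto
    let ?F = "Cpt (MF \<Phi>)" and ?G = "Cpt (MF \<Psi>)" and ?P = "Gpd (Und P) d" and ?NF = "Nat (MF \<Phi>) a" and ?NG = "Nat (MF \<Psi>) a"
    let ?c = "comp_monpnt C M N P \<Psi> \<Phi>"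
    have "Cmp ?P (Cmp ?P (Nat (MF ?c) a (fo (Cpt (Uni M) e) ())) (fa (Cpt (MF ?c) d) (Nat (Uni M) a ()))) (M0 ?c d ()) =
      Cmp ?P (?NG (fo (?F e) (fo (Cpt (Uni M) e) ()))) (Cmp ?P (fa (?G d) (Cmp (Gpd (Und N) d) (Cmp (Gpd (Und N) d) (?NF (fo
          (Cpt (Uni M) e) ()))
        (fa (?F d) (Nat (Uni M) a ()))) (M0 \<Phi> d ()))) (M0 \<Psi> d ()))"
      using a d gp by (simp add: all de)
    also have "\<dots> = Cmp ?P (Cmp ?P (?NG (fo (?F e) (fo (Cpt (Uni M) e) ()))) (fa (?G d) (fa (Act (Und N) a) (M0 \<Phi> e ()))))
        (Cmp ?P (fa (?G d) (Nat (Uni N) a ())) (M0 \<Psi> d ()))"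
      unfolding q0F using a d gp by (simp add: all)
    also have "Cmp ?P (?NG (fo (?F e) (fo (Cpt (Uni M) e) ()))) (fa (?G d) (fa (Act (Und N) a) (M0 \<Phi> e ()))) =
      Cmp ?P (fa (Act (Und P) a) (fa (?G e) (M0 \<Phi> e ()))) (?NG (fo (Cpt (Uni N) e) ()))"
      by (rule Gnat) (simp_all add: all)
    also have "Cmp ?P (Cmp ?P (fa (Act (Und P) a) (fa (?G e) (M0 \<Phi> e ()))) (?NG (fo (Cpt (Uni N) e) ())))
        (Cmp ?P (fa (?G d) (Nat (Uni N) a ())) (M0 \<Psi> d ())) =
      Cmp ?P (fa (Act (Und P) a) (fa (?G e) (M0 \<Phi> e ()))) (Cmp ?P (Cmp ?P (?NG (fo (Cpt (Uni N) e) ())) (fa (?G d) (Nat (Uni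
          N) a ()))) (M0 \<Psi> d ()))"
      using a d gp by (simp add: all)
    also have "\<dots> = Cmp ?P (fa (Act (Und P) a) (M0 ?c e ())) (Nat (Uni P) a ())"
      unfolding q0G using a d gp by (simp add: all)
    finally show "Cmp (Gpd (Und P) (Dom C a)) (Cmp (Gpd (Und P) (Dom C a)) (Nat (MF ?c) a (fo (Cpt (Uni M) (Cod C a)) ()))
        (fa (Cpt (MF ?c) (Dom C a)) (Nat (Uni M) a ()))) (M0 ?c (Dom C a) ()) =
      Cmp (Gpd (Und P) (Dom C a)) (fa (Act (Und P) a) (M0 ?c (Cod C a) ())) (Nat (Uni P) a ())" unfolding de .
    fix x y assume "x \<in> Obj (Gpd (Und M) (Cod C a))" "y \<in> Obj (Gpd (Und M) (Cod C a))"
    then have x: "x \<in> Obj (Gpd (Und M) e)" "y \<in> Obj (Gpd (Und M) e)" by (simp_all add: de)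
    let ?x = "fo (?F e) x" and ?y = "fo (?F e) y" and ?x' = "fo (Act (Und M) a) x" and ?y' = "fo (Act (Und M) a) y"
    have X: "?x \<in> Obj (Gpd (Und N) e)" "?y \<in> Obj (Gpd (Und N) e)" using x by (simp_all add: all)
    let ?t = "fo (Cpt (Mul M) e) (x, y)"
    have "Cmp ?P (Cmp ?P (Nat (MF ?c) a ?t) (fa (Cpt (MF ?c) d) (Nat (Mul M) a (x, y)))) (M2 ?c d (?x', ?y')) =
      Cmp ?P (?NG (fo (?F e) ?t)) (Cmp ?P (fa (?G d) (Cmp (Gpd (Und N) d) (Cmp (Gpd (Und N) d) (?NF ?t)
        (fa (?F d) (Nat (Mul M) a (x, y)))) (M2 \<Phi> d (?x', ?y')))) (M2 \<Psi> d (fo (?F d) ?x', fo (?F d) ?y')))"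
      using a d gp x by (simp add: all de)
    also have "\<dots> = Cmp ?P (Cmp ?P (?NG (fo (?F e) ?t)) (fa (?G d) (fa (Act (Und N) a) (M2 \<Phi> e (x, y)))))
        (Cmp ?P (fa (?G d) (Nat (Mul N) a (?x, ?y))) (Cmp ?P (fa (?G d) (fa (Cpt (Mul N) d) (?NF x, ?NF y))) (M2 \<Psi> d (fo (?F
            d) ?x', fo (?F d) ?y'))))"
      unfolding qF[OF x] using a d gp x X by (simp add: all)
    also have "Cmp ?P (?NG (fo (?F e) ?t)) (fa (?G d) (fa (Act (Und N) a) (M2 \<Phi> e (x, y)))) =
      Cmp ?P (fa (Act (Und P) a) (fa (?G e) (M2 \<Phi> e (x, y)))) (?NG (fo (Cpt (Mul N) e) (?x, ?y)))"
      by (rule Gnat) (use x in \<open>simp_all add: all\<close>)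
    \<comment> \<open>The second interchange: the structure map of \<open>\<Psi>\<close> is natural
      at the pair of naturality cells of \<open>\<Phi>\<close>.\<close>
    also have "Cmp ?P (fa (?G d) (fa (Cpt (Mul N) d) (?NF x, ?NF y))) (M2 \<Psi> d (fo (?F d) ?x', fo (?F d) ?y')) =
      Cmp ?P (M2 \<Psi> d (fo (Act (Und N) a) ?x, fo (Act (Und N) a) ?y)) (fa (Cpt (Mul P) d) (fa (?G d) (?NF x), fa (?G d) (?NF
          y)))"
      using strong_monoidal_rules(3)[OF sG[OF d(1)], simplified, of "?NF x" "?NF y"] x by (simp add: all)
    also have "Cmp ?P (Cmp ?P (fa (Act (Und P) a) (fa (?G e) (M2 \<Phi> e (x, y)))) (?NG (fo (Cpt (Mul N) e) (?x, ?y))))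
       (Cmp ?P (fa (?G d) (Nat (Mul N) a (?x, ?y))) (Cmp ?P (M2 \<Psi> d (fo (Act (Und N) a) ?x, fo (Act (Und N) a) ?y)) (fa (Cpt
           (Mul P) d) (fa (?G d) (?NF x), fa (?G d) (?NF y))))) =
      Cmp ?P (fa (Act (Und P) a) (fa (?G e) (M2 \<Phi> e (x, y)))) (Cmp ?P (Cmp ?P (Cmp ?P (?NG (fo (Cpt (Mul N) e) (?x, ?y)))
       (fa (?G d) (Nat (Mul N) a (?x, ?y)))) (M2 \<Psi> d (fo (Act (Und N) a) ?x, fo (Act (Und N) a) ?y))) (fa (Cpt (Mul P) d) (fa
           (?G d) (?NF x), fa (?G d) (?NF y))))"
      using a d gp x X by (simp add: all)
    also have "\<dots> = Cmp ?P (fa (Act (Und P) a) (fa (?G e) (M2 \<Phi> e (x, y)))) (Cmp ?P (fa (Act (Und P) a) (M2 \<Psi> e (?x, ?y)))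
      (Cmp ?P (Nat (Mul P) a (fo (?G e) ?x, fo (?G e) ?y)) (Cmp ?P (fa (Cpt (Mul P) d) (?NG ?x, ?NG ?y)) (fa (Cpt (Mul P) d)
          (fa (?G d) (?NF x), fa (?G d) (?NF y))))))"
      unfolding qG[OF X] using a d gp x X by (simp add: all)
    also have "Cmp ?P (fa (Cpt (Mul P) d) (?NG ?x, ?NG ?y)) (fa (Cpt (Mul P) d) (fa (?G d) (?NF x), fa (?G d) (?NF y))) =
      fa (Cpt (Mul P) d) (Nat (MF ?c) a x, Nat (MF ?c) a y)"
      using bifunctor_rules(7)[OF tP(1)[OF d(1)], of "fa (?G d) (?NF x)" "?NG ?x" "fa (?G d) (?NF y)" "?NG ?y"] a d gp x X by
          (simp add: all de)
    also have "Cmp ?P (fa (Act (Und P) a) (fa (?G e) (M2 \<Phi> e (x, y)))) (Cmp ?P (fa (Act (Und P) a) (M2 \<Psi> e (?x, ?y)))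
      (Cmp ?P (Nat (Mul P) a (fo (?G e) ?x, fo (?G e) ?y)) (fa (Cpt (Mul P) d) (Nat (MF ?c) a x, Nat (MF ?c) a y)))) =
      Cmp ?P (fa (Act (Und P) a) (M2 ?c e (x, y)))
       (Cmp ?P (Nat (Mul P) a (fo (Cpt (MF ?c) e) x, fo (Cpt (MF ?c) e) y)) (fa (Cpt (Mul P) d) (Nat (MF ?c) a x, Nat (MF ?c)
           a y)))"
      using a d gp x X by (simp add: all de)
    finally show "Cmp (Gpd (Und P) (Dom C a)) (Cmp (Gpd (Und P) (Dom C a)) (Nat (MF ?c) a (fo (Cpt (Mul M) (Cod C a)) (x,
        y)))
        (fa (Cpt (MF ?c) (Dom C a)) (Nat (Mul M) a (x, y)))) (M2 ?c (Dom C a) (?x', ?y')) =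
      Cmp (Gpd (Und P) (Dom C a)) (fa (Act (Und P) a) (M2 ?c (Cod C a) (x, y)))
       (Cmp (Gpd (Und P) (Dom C a)) (Nat (Mul P) a (fo (Cpt (MF ?c) (Cod C a)) x, fo (Cpt (MF ?c) (Cod C a)) y))
        (fa (Cpt (Mul P) (Dom C a)) (Nat (MF ?c) a x, Nat (MF ?c) a y)))" unfolding de .
  qed simp_all
qed

lemma comp_monpnt_id:
  assumes M: "monoidal_psh C M" and N: "monoidal_psh C N" and \<Phi>: "monoidal_pnt C M N \<Phi>"
  shows "comp_monpnt C M M N \<Phi> (id_monpnt C M) = \<Phi>" "comp_monpnt C M N N (id_monpnt C N) \<Phi> = \<Phi>"
proof -
  note m = monoidal_psh_rules[OF M] and n = monoidal_psh_rules[OF N]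
  note p = \<Phi>[unfolded monoidal_pnt_iff[OF M N]]
  have "levelF (comp_monpnt C M M N \<Phi> (id_monpnt C M)) c = levelF \<Phi> c"
    "levelF (comp_monpnt C M N N (id_monpnt C N) \<Phi>) c = levelF \<Phi> c" if c: "c \<in> Obj C" for c
    using comp_smf_id[OF m(4)[OF c] n(4)[OF c], of "levelF \<Phi> c"] p c by simp_all
  then show "comp_monpnt C M M N \<Phi> (id_monpnt C M) = \<Phi>" "comp_monpnt C M N N (id_monpnt C N) \<Phi> = \<Phi>"
    using p compP_idP[OF m(1) n(1)] idP_compP[OF m(1) n(1)]
    by (auto intro!: monpnt_eqI[where A = "Obj C"] simp del: comp_monpnt_simps(2))
qed

lemma comp_monpnt_assoc:
  assumes M: "monoidal_psh C M" and N: "monoidal_psh C N" and P: "monoidal_psh C P" and Q: "monoidal_psh C Q"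
    and \<Phi>: "monoidal_pnt C M N \<Phi>" and \<Psi>: "monoidal_pnt C N P \<Psi>" and \<Xi>: "monoidal_pnt C P Q \<Xi>"
  shows "comp_monpnt C M N Q (comp_monpnt C N P Q \<Xi> \<Psi>) \<Phi> = comp_monpnt C M P Q \<Xi> (comp_monpnt C M N P \<Psi> \<Phi>)"
proof -
  note m = monoidal_psh_rules[OF M] monoidal_psh_rules[OF N] monoidal_psh_rules[OF P] monoidal_psh_rules[OF Q]
  note p = \<Phi>[unfolded monoidal_pnt_iff[OF M N]] \<Psi>[unfolded monoidal_pnt_iff[OF N P]] \<Xi>[unfolded monoidal_pnt_iff[OF P Q]]
  have "levelF (comp_monpnt C M N Q (comp_monpnt C N P Q \<Xi> \<Psi>) \<Phi>) c = levelF (comp_monpnt C M P Q \<Xi> (comp_monpnt C M N P \<Psi> \<Phi>))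
      c"
    if c: "c \<in> Obj C" for c
    using comp_smf_assoc[OF m(4,8,12,16)[OF c]] p c by simp
  then show ?thesis
    by (intro monpnt_eqI[where A = "Obj C"]) (use p in \<open>simp_all add: compP_assoc[OF m(1,5,9,13)]\<close>)
qed

lemma category_MonDcmp: "category MonDcmp"
  unfolding MonDcmp_def
proof (rule category_mk_cat, goal_cases)
  case (1 M)
  then have M: "monoidal_psh Simp M" by (simp add: monoidal_decomposition_space_def)
  then show ?case using monoidal_pnt_id[OF M] culf_idP[OF monoidal_psh_rules(1)[OF M]] by simp
next
  case (2 M N P \<Phi> \<Psi>)
  then have "monoidal_psh Simp M" "monoidal_psh Simp N" "monoidal_psh Simp P" by (simp_all add:
      monoidal_decomposition_space_def)
  then show ?case using 2(4,5) monoidal_pnt_comp[of Simp M N P \<Phi> \<Psi>]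
      culf_compP[of "Und M" "Und N" "Und P" "MF \<Phi>" "MF \<Psi>"] by (simp add: monoidal_psh_rules(1))
next
  case (3 M N \<Phi>)
  then have "monoidal_psh Simp M" "monoidal_psh Simp N" by (simp_all add: monoidal_decomposition_space_def)
  with 3 show ?case by (simp add: comp_monpnt_id)
next
  case (4 M N P Q \<Phi> \<Psi> \<Xi>)
  then have "monoidal_psh Simp M" "monoidal_psh Simp N" "monoidal_psh Simp P" "monoidal_psh Simp Q"
    by (simp_all add: monoidal_decomposition_space_def)
  with 4 show ?case by (simp add: comp_monpnt_assoc)
qed

section \<open>Pseudo-functors with cancellable lifts\<close>

text \<open>Not phrased through \<open>is_functor\<close>: one shape map serves all objects
  \<open>c\<close> at once, so it cannot be extensional on the carrier of each groupoid.\<close>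

definition faithful_over :: "('o, 'm) cat \<Rightarrow> ('p, 'n) cat \<Rightarrow> ('o, 'm, 'p, 'n) ftr \<Rightarrow> bool" where
  "faithful_over G T U \<longleftrightarrow>
     (\<forall>x \<in> Obj G. fo U x \<in> Obj T \<and> fa U (Id G x) = Id T (fo U x)) \<and>
     (\<forall>f \<in> Arr G. fa U f \<in> Arr T \<and> Dom T (fa U f) = fo U (Dom G f) \<and> Cod T (fa U f) = fo U (Cod G f)) \<and>
     (\<forall>f \<in> Arr G. \<forall>g \<in> Arr G. Cod G f = Dom G g \<longrightarrow> fa U (Cmp G g f) = Cmp T (fa U g) (fa U f)) \<and>
     (\<forall>f \<in> Arr G. \<forall>g \<in> Arr G. Dom G f = Dom G g \<and> Cod G f = Cod G g \<and> fa U f = fa U g \<longrightarrow> f = g)"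

definition monic_category :: "('o, 'm) cat \<Rightarrow> bool" where
  "monic_category T \<longleftrightarrow> category T \<and> (\<forall>f \<in> Arr T. \<forall>g \<in> Arr T. \<forall>h \<in> Arr T.
     Dom T f = Dom T g \<and> Cod T f = Dom T h \<and> Cod T g = Dom T h \<and> Cmp T h f = Cmp T h g \<longrightarrow> f = g)"

text \<open>\<open>Lift S a t\<close> is an arrow from the shape of \<open>a* t\<close> to the shape of \<open>t\<close>. Since the arrows of the
  base are monic and shapes are faithful, an equation between arrows into \<open>a* t\<close> can be checked on
  shapes after composition with the lift; this reduces all coherence conditions to equations
  in the base.\<close>

record ('k, 'o, 'm, 'p, 'n) lsys =
  Base :: "('p, 'n) cat"
  Shape :: "('o, 'm, 'p, 'n) ftr"
  Lift :: "'k \<Rightarrow> 'o \<Rightarrow> 'n"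

abbreviation sho :: "('k, 'o, 'm, 'p, 'n) lsys \<Rightarrow> 'o \<Rightarrow> 'p" where "sho S \<equiv> fo (Shape S)"
abbreviation sha :: "('k, 'o, 'm, 'p, 'n) lsys \<Rightarrow> 'm \<Rightarrow> 'n" where "sha S \<equiv> fa (Shape S)"

text \<open>For the action and the coherence cells only the types and the composites with the lifts
  are prescribed. Functoriality of \<open>Act\<close>, naturality of the cells and their coherence
  equations are consequences, so an instance needs no coherence calculation of its own.\<close>

locale lifted =
  fixes C :: "('c, 'k) cat" and X :: "('c, 'k, 'o, 'm) psh" and S :: "('k, 'o, 'm, 'p, 'n) lsys"
  assumes category_C: "category C"
    and monic: "monic_category (Base S)"
    and groupoid_Gpd: "\<And>c. c \<in> Obj C \<Longrightarrow> groupoid (Gpd X c)"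
    and faithful: "\<And>c. c \<in> Obj C \<Longrightarrow> faithful_over (Gpd X c) (Base S) (Shape S)"
    and Act_ext: "\<And>a. a \<in> Arr C \<Longrightarrow> fo (Act X a) \<in> extensional (Obj (Gpd X (Cod C a)))"
      "\<And>a. a \<in> Arr C \<Longrightarrow> fa (Act X a) \<in> extensional (Arr (Gpd X (Cod C a)))"
    and Act_obj: "\<And>a t. a \<in> Arr C \<Longrightarrow> t \<in> Obj (Gpd X (Cod C a)) \<Longrightarrow> fo (Act X a) t \<in> Obj (Gpd X (Dom C a))"
    and Act_arr: "\<And>a f. a \<in> Arr C \<Longrightarrow> f \<in> Arr (Gpd X (Cod C a)) \<Longrightarrow> fa (Act X a) f \<in>
       hom (Gpd X (Dom C a)) (fo (Act X a) (Dom (Gpd X (Cod C a)) f)) (fo (Act X a) (Cod (Gpd X (Cod C a)) f))"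
    and Lift: "\<And>a t. a \<in> Arr C \<Longrightarrow> t \<in> Obj (Gpd X (Cod C a)) \<Longrightarrow> Lift S a t \<in> hom (Base S) (sho S (fo (Act X a) t)) (sho S t)"
    and Lift_nat: "\<And>a f. a \<in> Arr C \<Longrightarrow> f \<in> Arr (Gpd X (Cod C a)) \<Longrightarrow>
       Cmp (Base S) (Lift S a (Cod (Gpd X (Cod C a)) f)) (sha S (fa (Act X a) f)) =
       Cmp (Base S) (sha S f) (Lift S a (Dom (Gpd X (Cod C a)) f))"
    and CmpI_ext: "\<And>a b. a \<in> Arr C \<Longrightarrow> b \<in> Arr C \<Longrightarrow> Cod C a = Dom C b \<Longrightarrow> CmpI X a b \<in> extensional (Obj (Gpd X (Cod C b)))"
    and CmpI: "\<And>a b t. a \<in> Arr C \<Longrightarrow> b \<in> Arr C \<Longrightarrow> Cod C a = Dom C b \<Longrightarrow> t \<in> Obj (Gpd X (Cod C b)) \<Longrightarrow>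
       CmpI X a b t \<in> hom (Gpd X (Dom C a)) (fo (Act X a) (fo (Act X b) t)) (fo (Act X (Cmp C b a)) t)"
    and CmpI_lift: "\<And>a b t. a \<in> Arr C \<Longrightarrow> b \<in> Arr C \<Longrightarrow> Cod C a = Dom C b \<Longrightarrow> t \<in> Obj (Gpd X (Cod C b)) \<Longrightarrow>
       Cmp (Base S) (Lift S (Cmp C b a) t) (sha S (CmpI X a b t)) =
       Cmp (Base S) (Lift S b t) (Lift S a (fo (Act X b) t))"
    and IdI_ext: "\<And>c. c \<in> Obj C \<Longrightarrow> IdI X c \<in> extensional (Obj (Gpd X c))"
    and IdI: "\<And>c t. c \<in> Obj C \<Longrightarrow> t \<in> Obj (Gpd X c) \<Longrightarrow> IdI X c t \<in> hom (Gpd X c) t (fo (Act X (Id C c)) t)"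
    and IdI_lift: "\<And>c t. c \<in> Obj C \<Longrightarrow> t \<in> Obj (Gpd X c) \<Longrightarrow>
       Cmp (Base S) (Lift S (Id C c) t) (sha S (IdI X c t)) = Id (Base S) (sho S t)"
begin

lemma category_Base: "category (Base S)"
  using monic by (simp add: monic_category_def)

lemma shape:
  assumes "c \<in> Obj C"
  shows "x \<in> Obj (Gpd X c) \<Longrightarrow> sho S x \<in> Obj (Base S)"
    "x \<in> Obj (Gpd X c) \<Longrightarrow> sha S (Id (Gpd X c) x) = Id (Base S) (sho S x)"
    "f \<in> Arr (Gpd X c) \<Longrightarrow> sha S f \<in> Arr (Base S)"
    "f \<in> Arr (Gpd X c) \<Longrightarrow> Dom (Base S) (sha S f) = sho S (Dom (Gpd X c) f)"
    "f \<in> Arr (Gpd X c) \<Longrightarrow> Cod (Base S) (sha S f) = sho S (Cod (Gpd X c) f)"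
    "f \<in> Arr (Gpd X c) \<Longrightarrow> g \<in> Arr (Gpd X c) \<Longrightarrow> Cod (Gpd X c) f = Dom (Gpd X c) g \<Longrightarrow>
       sha S (Cmp (Gpd X c) g f) = Cmp (Base S) (sha S g) (sha S f)"
  using faithful[OF assms] by (auto simp: faithful_over_def)

lemma shape_eqI:
  assumes "c \<in> Obj C" "f \<in> Arr (Gpd X c)" "g \<in> Arr (Gpd X c)" "Dom (Gpd X c) f = Dom (Gpd X c) g"
    "Cod (Gpd X c) f = Cod (Gpd X c) g" "sha S f = sha S g"
  shows "f = g"
  using faithful[OF assms(1)] assms(2-) by (auto simp: faithful_over_def)

lemma monicD:
  assumes "Cmp (Base S) h f = Cmp (Base S) h g" "f \<in> Arr (Base S)" "g \<in> Arr (Base S)" "h \<in> Arr (Base S)"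
     "Dom (Base S) f = Dom (Base S) g" "Cod (Base S) f = Dom (Base S) h" "Cod (Base S) g = Dom (Base S) h"
  shows "f = g"
  using monic assms unfolding monic_category_def by auto

lemma lift_cancel:
  assumes a: "a \<in> Arr C" and t: "t \<in> Obj (Gpd X (Cod C a))" and f: "f \<in> Arr (Gpd X (Dom C a))" "g \<in> Arr (Gpd X (Dom C a))"
    "Dom (Gpd X (Dom C a)) f = Dom (Gpd X (Dom C a)) g" "Cod (Gpd X (Dom C a)) f = fo (Act X a) t" "Cod (Gpd X (Dom C a)) g =
        fo (Act X a) t"
    and e: "Cmp (Base S) (Lift S a t) (sha S f) = Cmp (Base S) (Lift S a t) (sha S g)"
  shows "f = g"
proof -
  have d: "Dom C a \<in> Obj C" using a category_C by simp
  have "sha S f = sha S g"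
    using e by (rule monicD) (use Lift[OF a t] f in \<open>auto simp: shape[OF d] in_hom\<close>)
  then show ?thesis using shape_eqI[OF d] f by auto
qed

text \<open>By \<open>Lift_nat\<close>, both sides of each functor law have the same composite with
  the lift, and the lift can be cancelled.\<close>

lemma Act_functor:
  assumes a: "a \<in> Arr C"
  shows "is_functor (Gpd X (Cod C a)) (Gpd X (Dom C a)) (Act X a)"
proof -
  let ?G = "Gpd X (Cod C a)" and ?H = "Gpd X (Dom C a)" and ?T = "Base S"
  have d: "Dom C a \<in> Obj C" "Cod C a \<in> Obj C" using a category_C by auto
  have c: "category ?G" "category ?H" "category ?T" using d groupoid_Gpd category_Base by auto
  note r = Act_obj[OF a] Act_arr[OF a, unfolded in_hom] Lift[OF a, unfolded in_hom] shape[OF d(1)] shape[OF d(2)]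
  show ?thesis
  proof (rule functorI)
    fix x assume x: "x \<in> Obj ?G"
    show "fa (Act X a) (Id ?G x) = Id ?H (fo (Act X a) x)"
      by (rule lift_cancel[OF a x]) (use x c Lift_nat[OF a, of "Id ?G x"] in \<open>simp_all add: r\<close>)
  next
    fix f g assume f: "f \<in> Arr ?G" "g \<in> Arr ?G" "Cod ?G f = Dom ?G g"
    have "Cmp ?T (Lift S a (Cod ?G g)) (sha S (fa (Act X a) (Cmp ?G g f))) = Cmp ?T (Cmp ?T (sha S g) (sha S f)) (Lift S a
        (Dom ?G f))"
      using Lift_nat[OF a, of "Cmp ?G g f"] f c by (simp add: r)
    also have "\<dots> = Cmp ?T (sha S g) (Cmp ?T (Lift S a (Cod ?G f)) (sha S (fa (Act X a) f)))"
      unfolding Lift_nat[OF a f(1)] using f c by (simp add: r)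
    also have "\<dots> = Cmp ?T (Cmp ?T (sha S g) (Lift S a (Dom ?G g))) (sha S (fa (Act X a) f))"
      using f c by (simp add: r)
    also have "\<dots> = Cmp ?T (Lift S a (Cod ?G g)) (sha S (Cmp ?H (fa (Act X a) g) (fa (Act X a) f)))"
      unfolding Lift_nat[OF a f(2), symmetric] using f c by (simp add: r)
    finally show "fa (Act X a) (Cmp ?G g f) = Cmp ?H (fa (Act X a) g) (fa (Act X a) f)"
      using f c by (intro lift_cancel[OF a, of "Cod ?G g"]) (simp_all add: r)
  qed (use c Act_ext[OF a] in \<open>auto simp: r\<close>)
qed

text \<open>Each axiom equates two arrows with the same endpoints into the restriction of some
  object. Composed with the lift of that restriction, both sides become one composite of lifts and
  shapes in the base, and \<open>lift_cancel\<close> concludes.\<close>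

lemma pseudofunctor: "pseudofunctor C X"
  unfolding pseudofunctor_def
proof (intro conjI ballI impI category_C groupoid_Gpd Act_functor; (elim conjE)?)
  let ?T = "Base S"
  { fix a b assume a: "a \<in> Arr C" and b: "b \<in> Arr C" and e: "Cod C a = Dom C b"
    define d where "d = Dom C a" define k where "k = Cod C b" define m where "m = Cod C a"
    have d: "d \<in> Obj C" "m \<in> Obj C" "k \<in> Obj C" using a b category_C by (auto simp: d_def k_def m_def)
    have me: "Dom C b = m" using e by (simp add: m_def)
    note de = d_def[symmetric] k_def[symmetric] m_def[symmetric] me
    have c: "category (Gpd X d)" "category (Gpd X m)" "category (Gpd X k)" "category ?T" using d groupoid_Gpd category_Base
        by auto
    have ba: "Cmp C b a \<in> Arr C" "Dom C (Cmp C b a) = d" "Cod C (Cmp C b a) = k" using a b e category_C by (auto simp: de)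
    note f = functor_rules[OF Act_functor[OF a], unfolded de] functor_rules[OF Act_functor[OF b], unfolded de]
      functor_rules[OF Act_functor[OF ba(1)], unfolded ba]
    note r = f CmpI[OF a b e, unfolded in_hom de] Lift[OF a, unfolded in_hom de] Lift[OF b, unfolded in_hom de]
      Lift[OF ba(1), unfolded in_hom ba] shape[OF d(1)] shape[OF d(2)] shape[OF d(3)]
    note lc = lift_cancel[OF ba(1), unfolded ba]
    \<comment> \<open>Under the lift along the composite, both sides become the shape of
      \<open>h\<close> preceded by the lifts along \<open>b\<close> and \<open>a\<close>.\<close>
    show "nat_iso (Gpd X (Cod C b)) (Gpd X (Dom C a))
          (compF (Gpd X (Cod C b)) (Act X a) (Act X b)) (Act X (Cmp C b a)) (CmpI X a b)"
      unfolding de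
    proof (rule nat_isoI)
      fix h assume h: "h \<in> Arr (Gpd X k)"
      let ?y = "Cod (Gpd X k) h" and ?x = "Dom (Gpd X k) h"
      have y: "?y \<in> Obj (Gpd X k)" "?x \<in> Obj (Gpd X k)" using h c by auto
      note r' = CmpI_lift[OF a b e, unfolded de]
      have "Cmp ?T (Lift S (Cmp C b a) ?y) (sha S (Cmp (Gpd X d) (CmpI X a b ?y) (fa (Act X a) (fa (Act X b) h)))) =
        Cmp ?T (Cmp ?T (Lift S (Cmp C b a) ?y) (sha S (CmpI X a b ?y))) (sha S (fa (Act X a) (fa (Act X b) h)))"
        using h y c by (simp add: r)
      also have "\<dots> = Cmp ?T (Lift S b ?y) (Cmp ?T (Lift S a (Cod (Gpd X m) (fa (Act X b) h))) (sha S (fa (Act X a) (fa (Act X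
          b) h))))"
        unfolding r'[OF y(1)] using h y c by (simp add: r)
      also have "Cmp ?T (Lift S a (Cod (Gpd X m) (fa (Act X b) h))) (sha S (fa (Act X a) (fa (Act X b) h))) =
         Cmp ?T (sha S (fa (Act X b) h)) (Lift S a (fo (Act X b) ?x))"
        using Lift_nat[OF a, of "fa (Act X b) h"] h by (simp add: de f)
      also have "Cmp ?T (Lift S b ?y) (Cmp ?T (sha S (fa (Act X b) h)) (Lift S a (fo (Act X b) ?x))) =
        Cmp ?T (Cmp ?T (Lift S b ?y) (sha S (fa (Act X b) h))) (Lift S a (fo (Act X b) ?x))"
        using h y c by (simp add: r)
      also have "\<dots> = Cmp ?T (sha S h) (Cmp ?T (Lift S b ?x) (Lift S a (fo (Act X b) ?x)))"
        unfolding Lift_nat[OF b, unfolded de, OF h] using h y c by (simp add: r)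
      also have "\<dots> = Cmp ?T (Cmp ?T (sha S h) (Lift S (Cmp C b a) ?x)) (sha S (CmpI X a b ?x))"
        unfolding r'[OF y(2), symmetric] using h y c by (simp add: r)
      also have "\<dots> = Cmp ?T (Lift S (Cmp C b a) ?y) (sha S (Cmp (Gpd X d) (fa (Act X (Cmp C b a)) h) (CmpI X a b ?x)))"
        unfolding Lift_nat[OF ba(1), unfolded ba, OF h, symmetric] using h y c by (simp add: r)
      finally have "Cmp (Gpd X d) (CmpI X a b ?y) (fa (Act X a) (fa (Act X b) h)) = Cmp (Gpd X d) (fa (Act X (Cmp C b a)) h)
          (CmpI X a b ?x)"
        using h y c by (intro lc[OF y(1)]) (simp_all add: r)
      then show "CmpI X a b ?y \<cdot>\<^bsub>Gpd X d\<^esub> fa (compF (Gpd X k) (Act X a) (Act X b)) h = fa (Act X (Cmp C b a)) h \<cdot>\<^bsub>Gpd X d\<^esub>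
          CmpI X a b ?x"
        using h by simp
    qed (use CmpI_ext[OF a b e] groupoid_Gpd[OF d(1)] in \<open>auto simp: r de\<close>)
    \<comment> \<open>Associativity of the composition cells: under the lift both sides become the
      successive lifts along \<open>z\<close>, \<open>b\<close> and \<open>a\<close>.\<close>
    { fix z assume z: "z \<in> Arr C" and ze: "Cod C b = Dom C z"
      define l where "l = Cod C z"
      have kz: "Dom C z = k" using ze by (simp add: k_def)
      have l: "l \<in> Obj C" using z category_C by (auto simp: l_def)
      have cl: "category (Gpd X l)" using l groupoid_Gpd by auto
      have zb: "Cmp C z b \<in> Arr C" "Dom C (Cmp C z b) = m" "Cod C (Cmp C z b) = l"
        and zba: "Cmp C z (Cmp C b a) \<in> Arr C" "Dom C (Cmp C z (Cmp C b a)) = d" "Cod C (Cmp C z (Cmp C b a)) = l"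
        using a b z e ze category_C by (auto simp: de l_def kz)
      have as: "Cmp C (Cmp C z b) a = Cmp C z (Cmp C b a)" using a b z e ze category_C by simp
      have ce: "Cod C a = Dom C (Cmp C z b)" "Cod C (Cmp C b a) = Dom C z" using zb ba kz by (auto simp: m_def)
      note g = functor_rules[OF Act_functor[OF z], unfolded kz l_def[symmetric]] functor_rules[OF Act_functor[OF zb(1)],
          unfolded zb]
        functor_rules[OF Act_functor[OF zba(1)], unfolded zba]
      note r2 = r g CmpI[OF b z ze, unfolded in_hom de l_def[symmetric]] CmpI[OF a zb(1) ce(1), unfolded in_hom de zb as]
        CmpI[OF ba(1) z ce(2), unfolded in_hom ba l_def[symmetric]]
        Lift[OF z, unfolded in_hom kz l_def[symmetric]] Lift[OF zb(1), unfolded in_hom zb] Lift[OF zba(1), unfolded in_hom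
            zba] shape[OF l]
      note k1 = CmpI_lift[OF a zb(1) ce(1), unfolded de zb as] and k2 = CmpI_lift[OF b z ze, unfolded de l_def[symmetric]]
        and k3 = CmpI_lift[OF ba(1) z ce(2), unfolded ba l_def[symmetric]] and k4 = CmpI_lift[OF a b e, unfolded de]
      fix u assume "u \<in> Obj (Gpd X (Cod C z))"
      then have u: "u \<in> Obj (Gpd X l)" by (simp add: l_def)
      let ?L = "Lift S (Cmp C z (Cmp C b a)) u"
      have "Cmp ?T ?L (sha S (Cmp (Gpd X d) (CmpI X a (Cmp C z b) u) (fa (Act X a) (CmpI X b z u)))) =
        Cmp ?T (Cmp ?T ?L (sha S (CmpI X a (Cmp C z b) u))) (sha S (fa (Act X a) (CmpI X b z u)))"
        using u c cl by (simp add: r2)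
      also have "\<dots> = Cmp ?T (Lift S (Cmp C z b) u) (Cmp ?T (Lift S a (Cod (Gpd X m) (CmpI X b z u))) (sha S (fa (Act X a)
          (CmpI X b z u))))"
        unfolding k1[OF u] using u c cl by (simp add: r2)
      also have "Cmp ?T (Lift S a (Cod (Gpd X m) (CmpI X b z u))) (sha S (fa (Act X a) (CmpI X b z u))) =
         Cmp ?T (sha S (CmpI X b z u)) (Lift S a (fo (Act X b) (fo (Act X z) u)))"
        using Lift_nat[OF a, of "CmpI X b z u"] u by (simp add: de r2)
      also have "Cmp ?T (Lift S (Cmp C z b) u) (Cmp ?T (sha S (CmpI X b z u)) (Lift S a (fo (Act X b) (fo (Act X z) u)))) =
        Cmp ?T (Cmp ?T (Lift S (Cmp C z b) u) (sha S (CmpI X b z u))) (Lift S a (fo (Act X b) (fo (Act X z) u)))"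
        using u c cl by (simp add: r2)
      also have "\<dots> = Cmp ?T (Lift S z u) (Cmp ?T (Lift S b (fo (Act X z) u)) (Lift S a (fo (Act X b) (fo (Act X z) u))))"
        unfolding k2[OF u] using u c cl by (simp add: r2)
      also have "\<dots> = Cmp ?T (Cmp ?T (Lift S z u) (Lift S (Cmp C b a) (fo (Act X z) u))) (sha S (CmpI X a b (fo (Act X z)
          u)))"
        using k4[of "fo (Act X z) u"] u c cl by (simp add: r2)
      also have "\<dots> = Cmp ?T ?L (sha S (Cmp (Gpd X d) (CmpI X (Cmp C b a) z u) (CmpI X a b (fo (Act X z) u))))"
        unfolding k3[OF u, symmetric] using u c cl by (simp add: r2)
      finally have "Cmp (Gpd X d) (CmpI X a (Cmp C z b) u) (fa (Act X a) (CmpI X b z u)) =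
           Cmp (Gpd X d) (CmpI X (Cmp C b a) z u) (CmpI X a b (fo (Act X z) u))"
        using u c cl by (intro lift_cancel[OF zba(1), unfolded zba, of u]) (simp_all add: r2)
      then show "CmpI X a (z \<cdot>\<^bsub>C\<^esub> b) u \<cdot>\<^bsub>Gpd X (Dom C a)\<^esub> fa (Act X a) (CmpI X b z u) =
           CmpI X (b \<cdot>\<^bsub>C\<^esub> a) z u \<cdot>\<^bsub>Gpd X (Dom C a)\<^esub> CmpI X a b (fo (Act X z) u)" unfolding de . } }
  { fix c assume c: "c \<in> Obj C"
    have i: "Id C c \<in> Arr C" "Dom C (Id C c) = c" "Cod C (Id C c) = c" using c category_C by auto
    have ct: "category (Gpd X c)" "category ?T" using c groupoid_Gpd category_Base by auto
    note r = functor_rules[OF Act_functor[OF i(1)], unfolded i] IdI[OF c, unfolded in_hom] Lift[OF i(1), unfolded in_hom i]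
        shape[OF c]
    show "nat_iso (Gpd X c) (Gpd X c) (idF (Gpd X c)) (Act X (Id C c)) (IdI X c)"
    proof (rule nat_isoI)
      fix h assume h: "h \<in> Arr (Gpd X c)"
      let ?y = "Cod (Gpd X c) h" and ?x = "Dom (Gpd X c) h"
      have y: "?y \<in> Obj (Gpd X c)" "?x \<in> Obj (Gpd X c)" using h ct by auto
      have "Cmp ?T (Lift S (Id C c) ?y) (sha S (Cmp (Gpd X c) (IdI X c ?y) h)) = Cmp ?T (Cmp ?T (Lift S (Id C c) ?y) (sha S
          (IdI X c ?y))) (sha S h)"
        using h y ct by (simp add: r)
      also have "\<dots> = Cmp ?T (sha S h) (Cmp ?T (Lift S (Id C c) ?x) (sha S (IdI X c ?x)))"
        unfolding IdI_lift[OF c y(1)] IdI_lift[OF c y(2)] using h y ct by (simp add: r)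
      also have "\<dots> = Cmp ?T (Cmp ?T (sha S h) (Lift S (Id C c) ?x)) (sha S (IdI X c ?x))"
        using h y ct by (simp add: r)
      also have "\<dots> = Cmp ?T (Lift S (Id C c) ?y) (sha S (Cmp (Gpd X c) (fa (Act X (Id C c)) h) (IdI X c ?x)))"
        unfolding Lift_nat[OF i(1), unfolded i, OF h, symmetric] using h y ct by (simp add: r)
      finally have "Cmp (Gpd X c) (IdI X c ?y) h = Cmp (Gpd X c) (fa (Act X (Id C c)) h) (IdI X c ?x)"
        using h y ct by (intro lift_cancel[OF i(1), unfolded i, OF y(1)]) (simp_all add: r)
      then show "IdI X c ?y \<cdot>\<^bsub>Gpd X c\<^esub> fa (idF (Gpd X c)) h = fa (Act X (Id C c)) h \<cdot>\<^bsub>Gpd X c\<^esub> IdI X c ?x"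
        using h by simp
    qed (use IdI_ext[OF c] groupoid_Gpd[OF c] in \<open>auto simp: r\<close>) }
  fix a u assume a: "a \<in> Arr C" and u: "u \<in> Obj (Gpd X (Cod C a))"
  have d: "Dom C a \<in> Obj C" "Cod C a \<in> Obj C" using a category_C by auto
  have ct: "category (Gpd X (Dom C a))" "category (Gpd X (Cod C a))" "category ?T" using d groupoid_Gpd category_Base by auto
  have i: "Id C (Dom C a) \<in> Arr C" "Dom C (Id C (Dom C a)) = Dom C a" "Cod C (Id C (Dom C a)) = Dom C a" "Cmp C a (Id C (Dom
      C a)) = a"
    and j: "Id C (Cod C a) \<in> Arr C" "Cod C a = Dom C (Id C (Cod C a))" "Cod C (Id C (Cod C a)) = Cod C a" "Cmp C (Id C (Cod C
        a)) a = a"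
    using a d category_C by auto
  note f = functor_rules[OF Act_functor[OF a]] functor_rules[OF Act_functor[OF i(1)], unfolded i] functor_rules[OF
      Act_functor[OF j(1)], folded j(2), unfolded j(3)]
  note r = f IdI[OF d(1), unfolded in_hom] IdI[OF d(2), unfolded in_hom] Lift[OF a, unfolded in_hom]
    Lift[OF i(1), unfolded in_hom i] Lift[OF j(1), unfolded in_hom j(3)] shape[OF d(1)] shape[OF d(2)]
    CmpI[OF i(1) a i(3), unfolded in_hom i(2,4)] CmpI[OF a j(1) j(2), unfolded in_hom j(3,4)]
  have au: "fo (Act X a) u \<in> Obj (Gpd X (Dom C a))" using u by (simp add: r)
  \<comment> \<open>In each unit law the composite with \<open>Lift S a u\<close> collapses to
    \<open>Lift S a u\<close> itself, because \<open>IdI_lift\<close> cancels the unit cell against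
    the lift along an identity.\<close>
  show "Cmp (Gpd X (Dom C a)) (CmpI X (Id C (Dom C a)) a u) (IdI X (Dom C a) (fo (Act X a) u)) = Id (Gpd X (Dom C a)) (fo
      (Act X a) u)"
  proof (rule lift_cancel[OF a u])
    have "Cmp ?T (Lift S a u) (sha S (Cmp (Gpd X (Dom C a)) (CmpI X (Id C (Dom C a)) a u) (IdI X (Dom C a) (fo (Act X a)
        u)))) =
      Cmp ?T (Cmp ?T (Lift S a u) (sha S (CmpI X (Id C (Dom C a)) a u))) (sha S (IdI X (Dom C a) (fo (Act X a) u)))"
      using u d ct by (simp add: r)
    also have "\<dots> = Cmp ?T (Lift S a u) (Cmp ?T (Lift S (Id C (Dom C a)) (fo (Act X a) u)) (sha S (IdI X (Dom C a) (fo (Act X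
        a) u))))"
      unfolding CmpI_lift[OF i(1) a i(3), unfolded i, OF u] using u d ct by (simp add: r)
    also have "\<dots> = Cmp ?T (Lift S a u) (sha S (Id (Gpd X (Dom C a)) (fo (Act X a) u)))"
      unfolding IdI_lift[OF d(1) au] using u by (simp add: r)
    finally show "Cmp ?T (Lift S a u) (sha S (Cmp (Gpd X (Dom C a)) (CmpI X (Id C (Dom C a)) a u) (IdI X (Dom C a) (fo (Act X
        a) u)))) =
      Cmp ?T (Lift S a u) (sha S (Id (Gpd X (Dom C a)) (fo (Act X a) u)))" .
  qed (use u d ct in \<open>simp_all add: r\<close>)
  show "Cmp (Gpd X (Dom C a)) (CmpI X a (Id C (Cod C a)) u) (fa (Act X a) (IdI X (Cod C a) u)) = Id (Gpd X (Dom C a)) (fo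
      (Act X a) u)"
  proof (rule lift_cancel[OF a u])
    have "Cmp ?T (Lift S a u) (sha S (Cmp (Gpd X (Dom C a)) (CmpI X a (Id C (Cod C a)) u) (fa (Act X a) (IdI X (Cod C a)
        u)))) =
      Cmp ?T (Cmp ?T (Lift S a u) (sha S (CmpI X a (Id C (Cod C a)) u))) (sha S (fa (Act X a) (IdI X (Cod C a) u)))"
      using u d ct by (simp add: r)
    also have "\<dots> = Cmp ?T (Lift S (Id C (Cod C a)) u) (Cmp ?T (Lift S a (fo (Act X (Id C (Cod C a))) u)) (sha S (fa (Act X a)
        (IdI X (Cod C a) u))))"
      unfolding CmpI_lift[OF a j(1) j(2), unfolded j(3,4), OF u] using u d ct by (simp add: r)
    also have "Cmp ?T (Lift S a (fo (Act X (Id C (Cod C a))) u)) (sha S (fa (Act X a) (IdI X (Cod C a) u))) =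
      Cmp ?T (sha S (IdI X (Cod C a) u)) (Lift S a u)"
      using Lift_nat[OF a, of "IdI X (Cod C a) u"] u by (simp add: r)
    also have "Cmp ?T (Lift S (Id C (Cod C a)) u) (Cmp ?T (sha S (IdI X (Cod C a) u)) (Lift S a u)) =
      Cmp ?T (Cmp ?T (Lift S (Id C (Cod C a)) u) (sha S (IdI X (Cod C a) u))) (Lift S a u)"
      using u d ct by (simp add: r)
    also have "\<dots> = Cmp ?T (Lift S a u) (sha S (Id (Gpd X (Dom C a)) (fo (Act X a) u)))"
      unfolding IdI_lift[OF d(2) u] using u ct by (simp add: r)
    finally show "Cmp ?T (Lift S a u) (sha S (Cmp (Gpd X (Dom C a)) (CmpI X a (Id C (Cod C a)) u) (fa (Act X a) (IdI X (Cod C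
        a) u)))) =
      Cmp ?T (Lift S a u) (sha S (Id (Gpd X (Dom C a)) (fo (Act X a) u)))" .
  qed (use u d ct in \<open>simp_all add: r\<close>)
qed

end

section \<open>Products of lifted pseudo-functors and the terminal one\<close>

definition prodS :: "('k, 'o, 'm, 'p, 'n) lsys \<Rightarrow> ('k, 'o2, 'm2, 'p2, 'n2) lsys \<Rightarrow> ('k, 'o \<times> 'o2, 'm \<times> 'm2, 'p \<times> 'p2, 'n \<times> 'n2)
    lsys" where
  "prodS S S' = \<lparr> Base = prodC (Base S) (Base S'),
     Shape = \<lparr> fo = map_prod (sho S) (sho S'), fa = map_prod (sha S) (sha S') \<rparr>,
     Lift = (\<lambda>a (x, y). (Lift S a x, Lift S' a y)) \<rparr>"

definition oneS :: "('k, unit, unit, unit, unit) lsys" where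
  "oneS = \<lparr> Base = oneC, Shape = idF oneC, Lift = (\<lambda>_ _. ()) \<rparr>"

lemma prodS_simps [simp]:
  "Base (prodS S S') = prodC (Base S) (Base S')" "sho (prodS S S') (x, y) = (sho S x, sho S' y)"
  "sha (prodS S S') (f, g) = (sha S f, sha S' g)" "Lift (prodS S S') a (x, y) = (Lift S a x, Lift S' a y)"
  by (simp_all add: prodS_def)

lemma oneS_simps [simp]: "Base oneS = oneC" "sho oneS x = ()" "sha oneS f = ()" "Lift oneS a x = ()"
  by (simp_all add: oneS_def)

lemma lifted_prodX:
  assumes "lifted C X S" "lifted C Y S'"
  shows "lifted C (prodX C X Y) (prodS S S')"
proof -
  interpret X: lifted C X S by fact
  interpret Y: lifted C Y S' by fact
  have C: "category C" by (rule X.category_C)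
  have m: "monic_category (prodC (Base S) (Base S'))"
    using X.monic Y.monic unfolding monic_category_def by (auto simp: Ball_def) blast+
  show ?thesis
  proof
    fix c assume c: "c \<in> Obj C"
    show "groupoid (Gpd (prodX C X Y) c)" using X.groupoid_Gpd[OF c] Y.groupoid_Gpd[OF c] by simp
    show "faithful_over (Gpd (prodX C X Y) c) (Base (prodS S S')) (Shape (prodS S S'))"
      unfolding faithful_over_def
      by (auto simp: X.shape[OF c] Y.shape[OF c] intro: X.shape_eqI[OF c] Y.shape_eqI[OF c])
    show "IdI (prodX C X Y) c \<in> extensional (Obj (Gpd (prodX C X Y) c))" by (simp add: prodX_def)
    fix t assume "t \<in> Obj (Gpd (prodX C X Y) c)"
    then show "IdI (prodX C X Y) c t \<in> hom (Gpd (prodX C X Y) c) t (fo (Act (prodX C X Y) (Id C c)) t)"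
      "Cmp (Base (prodS S S')) (Lift (prodS S S') (Id C c) t) (sha (prodS S S') (IdI (prodX C X Y) c t)) = Id (Base (prodS S
          S')) (sho (prodS S S') t)"
      using X.IdI[OF c] Y.IdI[OF c] X.IdI_lift[OF c] Y.IdI_lift[OF c] C c by (auto simp: in_hom)
  next
    fix a assume a: "a \<in> Arr C"
    have d: "Dom C a \<in> Obj C" "Cod C a \<in> Obj C" using C a by auto
    have ct: "category (Gpd X (Cod C a))" "category (Gpd Y (Cod C a))" using X.groupoid_Gpd Y.groupoid_Gpd d by auto
    show "fo (Act (prodX C X Y) a) \<in> extensional (Obj (Gpd (prodX C X Y) (Cod C a)))"
      "fa (Act (prodX C X Y) a) \<in> extensional (Arr (Gpd (prodX C X Y) (Cod C a)))" by simp_all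
    { fix t assume "t \<in> Obj (Gpd (prodX C X Y) (Cod C a))"
      then show "fo (Act (prodX C X Y) a) t \<in> Obj (Gpd (prodX C X Y) (Dom C a))"
        "Lift (prodS S S') a t \<in> hom (Base (prodS S S')) (sho (prodS S S') (fo (Act (prodX C X Y) a) t)) (sho (prodS S S')
            t)"
        using X.Act_obj[OF a] Y.Act_obj[OF a] X.Lift[OF a] Y.Lift[OF a] by (auto simp: in_hom) }
    { fix f assume "f \<in> Arr (Gpd (prodX C X Y) (Cod C a))"
      then show "fa (Act (prodX C X Y) a) f \<in> hom (Gpd (prodX C X Y) (Dom C a))
          (fo (Act (prodX C X Y) a) (Dom (Gpd (prodX C X Y) (Cod C a)) f)) (fo (Act (prodX C X Y) a) (Cod (Gpd (prodX C X Y)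
              (Cod C a)) f))"
        "Cmp (Base (prodS S S')) (Lift (prodS S S') a (Cod (Gpd (prodX C X Y) (Cod C a)) f)) (sha (prodS S S') (fa (Act
            (prodX C X Y) a) f)) =
         Cmp (Base (prodS S S')) (sha (prodS S S') f) (Lift (prodS S S') a (Dom (Gpd (prodX C X Y) (Cod C a)) f))"
        using X.Act_arr[OF a] Y.Act_arr[OF a] X.Lift_nat[OF a] Y.Lift_nat[OF a] ct by (auto simp: in_hom) }
    fix b assume b: "b \<in> Arr C" "Cod C a = Dom C b"
    show "CmpI (prodX C X Y) a b \<in> extensional (Obj (Gpd (prodX C X Y) (Cod C b)))" by (simp add: prodX_def)
    fix t assume "t \<in> Obj (Gpd (prodX C X Y) (Cod C b))"
    then obtain x y where t: "t = (x, y)" "x \<in> Obj (Gpd X (Cod C b))" "y \<in> Obj (Gpd Y (Cod C b))" by auto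
    have bo: "fo (Act X b) x \<in> Obj (Gpd X (Dom C b))" "fo (Act Y b) y \<in> Obj (Gpd Y (Dom C b))"
      using X.Act_obj[OF b(1)] Y.Act_obj[OF b(1)] t by auto
    show "CmpI (prodX C X Y) a b t \<in> hom (Gpd (prodX C X Y) (Dom C a)) (fo (Act (prodX C X Y) a) (fo (Act (prodX C X Y) b)
        t)) (fo (Act (prodX C X Y) (Cmp C b a)) t)"
      "Cmp (Base (prodS S S')) (Lift (prodS S S') (Cmp C b a) t) (sha (prodS S S') (CmpI (prodX C X Y) a b t)) =
       Cmp (Base (prodS S S')) (Lift (prodS S S') b t) (Lift (prodS S S') a (fo (Act (prodX C X Y) b) t))"
      using X.CmpI[OF a b] Y.CmpI[OF a b] X.CmpI_lift[OF a b] Y.CmpI_lift[OF a b] t a b C bo by (auto simp: in_hom)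
  qed (simp_all add: C m)
qed

lemma lifted_oneX:
  assumes "category C"
  shows "lifted C oneX oneS"
  by unfold_locales (auto simp: assms monic_category_def faithful_over_def in_hom idF_def)

text \<open>The transformation \<open>\<tau>\<close> lies over a functor \<open>F\<close> of bases
  that is the same at every \<open>c\<close>. The last equation determines the naturality cells,
  since lifts are monic; this is why neither naturality nor coherence appears in the
  definition.\<close>

definition lifted_map :: "('c, 'k) cat \<Rightarrow> ('c, 'k, 'o, 'm) psh \<Rightarrow> ('k, 'o, 'm, 'p, 'n) lsys \<Rightarrow> ('c, 'k, 'o2, 'm2) psh \<Rightarrow>
    ('k, 'o2, 'm2, 'p2, 'n2) lsys \<Rightarrow> ('p, 'n, 'p2, 'n2) ftr \<Rightarrow> ('c, 'k, 'o, 'm, 'o2, 'm2) pnt \<Rightarrow> bool" where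
  "lifted_map C X S Y S' F \<tau> \<longleftrightarrow> is_functor (Base S) (Base S') F \<and>
    Cpt \<tau> \<in> extensional (Obj C) \<and> Nat \<tau> \<in> extensional (Arr C) \<and>
    (\<forall>c \<in> Obj C. fo (Cpt \<tau> c) \<in> extensional (Obj (Gpd X c)) \<and> fa (Cpt \<tau> c) \<in> extensional (Arr (Gpd X c)) \<and>
      (\<forall>x \<in> Obj (Gpd X c). fo (Cpt \<tau> c) x \<in> Obj (Gpd Y c) \<and> sho S' (fo (Cpt \<tau> c) x) = fo F (sho S x)) \<and>
      (\<forall>f \<in> Arr (Gpd X c). fa (Cpt \<tau> c) f \<in> hom (Gpd Y c) (fo (Cpt \<tau> c) (Dom (Gpd X c) f)) (fo (Cpt \<tau> c) (Cod (Gpd X c) f)) \<and>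
         sha S' (fa (Cpt \<tau> c) f) = fa F (sha S f))) \<and>
    (\<forall>a \<in> Arr C. Nat \<tau> a \<in> extensional (Obj (Gpd X (Cod C a))) \<and> (\<forall>x \<in> Obj (Gpd X (Cod C a)).
      Nat \<tau> a x \<in> hom (Gpd Y (Dom C a)) (fo (Cpt \<tau> (Dom C a)) (fo (Act X a) x)) (fo (Act Y a) (fo (Cpt \<tau> (Cod C a)) x)) \<and>
      Cmp (Base S') (Lift S' a (fo (Cpt \<tau> (Cod C a)) x)) (sha S' (Nat \<tau> a x)) = fa F (Lift S a x)))"

lemma lifted_map_rules:
  assumes "lifted_map C X S Y S' F \<tau>"
  shows "is_functor (Base S) (Base S') F" "Cpt \<tau> \<in> extensional (Obj C)" "Nat \<tau> \<in> extensional (Arr C)"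
    "\<And>c. c \<in> Obj C \<Longrightarrow> fo (Cpt \<tau> c) \<in> extensional (Obj (Gpd X c))" "\<And>c. c \<in> Obj C \<Longrightarrow> fa (Cpt \<tau> c) \<in> extensional (Arr (Gpd X c))"
    "\<And>c x. c \<in> Obj C \<Longrightarrow> x \<in> Obj (Gpd X c) \<Longrightarrow> fo (Cpt \<tau> c) x \<in> Obj (Gpd Y c)"
    "\<And>c x. c \<in> Obj C \<Longrightarrow> x \<in> Obj (Gpd X c) \<Longrightarrow> sho S' (fo (Cpt \<tau> c) x) = fo F (sho S x)"
    "\<And>c f. c \<in> Obj C \<Longrightarrow> f \<in> Arr (Gpd X c) \<Longrightarrow> fa (Cpt \<tau> c) f \<in> Arr (Gpd Y c)"
    "\<And>c f. c \<in> Obj C \<Longrightarrow> f \<in> Arr (Gpd X c) \<Longrightarrow> Dom (Gpd Y c) (fa (Cpt \<tau> c) f) = fo (Cpt \<tau> c) (Dom (Gpd X c) f)"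
    "\<And>c f. c \<in> Obj C \<Longrightarrow> f \<in> Arr (Gpd X c) \<Longrightarrow> Cod (Gpd Y c) (fa (Cpt \<tau> c) f) = fo (Cpt \<tau> c) (Cod (Gpd X c) f)"
    "\<And>c f. c \<in> Obj C \<Longrightarrow> f \<in> Arr (Gpd X c) \<Longrightarrow> sha S' (fa (Cpt \<tau> c) f) = fa F (sha S f)"
    "\<And>a. a \<in> Arr C \<Longrightarrow> Nat \<tau> a \<in> extensional (Obj (Gpd X (Cod C a)))"
    "\<And>a x. a \<in> Arr C \<Longrightarrow> x \<in> Obj (Gpd X (Cod C a)) \<Longrightarrow> Nat \<tau> a x \<in> Arr (Gpd Y (Dom C a))"
    "\<And>a x. a \<in> Arr C \<Longrightarrow> x \<in> Obj (Gpd X (Cod C a)) \<Longrightarrow> Dom (Gpd Y (Dom C a)) (Nat \<tau> a x) = fo (Cpt \<tau> (Dom C a)) (fo (Act X a) x)"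
    "\<And>a x. a \<in> Arr C \<Longrightarrow> x \<in> Obj (Gpd X (Cod C a)) \<Longrightarrow> Cod (Gpd Y (Dom C a)) (Nat \<tau> a x) = fo (Act Y a) (fo (Cpt \<tau> (Cod C a)) x)"
    "\<And>a x. a \<in> Arr C \<Longrightarrow> x \<in> Obj (Gpd X (Cod C a)) \<Longrightarrow>
      Cmp (Base S') (Lift S' a (fo (Cpt \<tau> (Cod C a)) x)) (sha S' (Nat \<tau> a x)) = fa F (Lift S a x)"
  using assms unfolding lifted_map_def in_hom by auto

text \<open>The lift equation trades a naturality cell followed by a lift of \<open>Y\<close> for
  the image under \<open>F\<close> of a lift of \<open>X\<close>. Both sides of each axiom then
  become the image under \<open>F\<close> of one composite in \<open>Base S\<close>, where the lift
  laws of \<open>X\<close> apply.\<close>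

lemma lifted_map_pseudonatural:
  assumes "lifted C X S" "lifted C Y S'" and \<tau>: "lifted_map C X S Y S' F \<tau>"
  shows "pseudonatural C X Y \<tau>"
proof -
  interpret X: lifted C X S by fact
  interpret Y: lifted C Y S' by fact
  note t = lifted_map_rules[OF \<tau>]
  note F = functor_rules[OF t(1)]
  have C: "category C" by (rule X.category_C)
  let ?T = "Base S'"
  have fu: "is_functor (Gpd X c) (Gpd Y c) (Cpt \<tau> c)" if c: "c \<in> Obj C" for c
  proof -
    note r = X.shape[OF c] Y.shape[OF c] X.groupoid_Gpd[OF c] Y.groupoid_Gpd[OF c]
    show ?thesis
    proof (rule functorI)
      show "fa (Cpt \<tau> c) (Id (Gpd X c) x) = Id (Gpd Y c) (fo (Cpt \<tau> c) x)" if "x \<in> Obj (Gpd X c)" for x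
        by (rule Y.shape_eqI[OF c]) (use that c in \<open>simp_all add: r t(6-11) F\<close>)
      show "fa (Cpt \<tau> c) (Cmp (Gpd X c) g f) = Cmp (Gpd Y c) (fa (Cpt \<tau> c) g) (fa (Cpt \<tau> c) f)"
        if "f \<in> Arr (Gpd X c)" "g \<in> Arr (Gpd X c)" "Cod (Gpd X c) f = Dom (Gpd X c) g" for f g
        by (rule Y.shape_eqI[OF c]) (use that c in \<open>simp_all add: r t(6-11) F\<close>)
    qed (use c in \<open>simp_all add: r t(4-11)\<close>)
  qed
  show ?thesis
  proof (rule pseudonaturalI[OF X.pseudofunctor Y.pseudofunctor t(2) t(3) fu t(12)])
    fix a assume a: "a \<in> Arr C"
    define d where "d = Dom C a" define e where "e = Cod C a"
    have d: "d \<in> Obj C" "e \<in> Obj C" using C a by (auto simp: d_def e_def)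
    note de = d_def[symmetric] e_def[symmetric]
    note f = functor_rules[OF X.Act_functor[OF a], unfolded de] functor_rules[OF Y.Act_functor[OF a], unfolded de]
      functor_rules[OF fu[OF d(1)]] functor_rules[OF fu[OF d(2)]]
    note r = f F X.Lift[OF a, unfolded in_hom de] Y.Lift[OF a, unfolded in_hom de] X.shape[OF d(1)] X.shape[OF d(2)]
        Y.shape[OF d(1)] Y.shape[OF d(2)]
       t(13-15)[OF a, unfolded de] t(7,11)[OF d(1)] t(7,11)[OF d(2)] Y.category_Base
    { fix u assume "u \<in> Obj (Gpd X (Cod C a))"
      then show "Nat \<tau> a u \<in> Arr (Gpd Y (Dom C a)) \<and>
         Dom (Gpd Y (Dom C a)) (Nat \<tau> a u) = fo (Cpt \<tau> (Dom C a)) (fo (Act X a) u) \<and>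
         Cod (Gpd Y (Dom C a)) (Nat \<tau> a u) = fo (Act Y a) (fo (Cpt \<tau> (Cod C a)) u)"
        using t(13-15)[OF a] by auto }
    { fix h assume "h \<in> Arr (Gpd X (Cod C a))"
      then have h: "h \<in> Arr (Gpd X e)" by (simp add: de)
      let ?x = "Dom (Gpd X e) h" and ?y = "Cod (Gpd X e) h"
      have x: "?x \<in> Obj (Gpd X e)" "?y \<in> Obj (Gpd X e)" using h f by auto
      note n = t(16)[OF a, unfolded de]
      have "Cmp ?T (Lift S' a (fo (Cpt \<tau> e) ?y)) (sha S' (Cmp (Gpd Y d) (Nat \<tau> a ?y) (fa (Cpt \<tau> d) (fa (Act X a) h)))) =
        Cmp ?T (Cmp ?T (Lift S' a (fo (Cpt \<tau> e) ?y)) (sha S' (Nat \<tau> a ?y))) (fa F (sha S (fa (Act X a) h)))"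
        using h x by (simp add: r)
      also have "\<dots> = fa F (Cmp (Base S) (Lift S a ?y) (sha S (fa (Act X a) h)))"
        unfolding n[OF x(2)] using h x by (simp add: r)
      also have "\<dots> = Cmp ?T (fa F (sha S h)) (Cmp ?T (Lift S' a (fo (Cpt \<tau> e) ?x)) (sha S' (Nat \<tau> a ?x)))"
        unfolding X.Lift_nat[OF a, unfolded de, OF h] n[OF x(1)] using h x by (simp add: r)
      also have "\<dots> = Cmp ?T (Cmp ?T (sha S' (fa (Cpt \<tau> e) h)) (Lift S' a (Dom (Gpd Y e) (fa (Cpt \<tau> e) h)))) (sha S' (Nat \<tau> a
          ?x))"
        using h x by (simp add: r)
      also have "\<dots> = Cmp ?T (Lift S' a (fo (Cpt \<tau> e) ?y)) (sha S' (Cmp (Gpd Y d) (fa (Act Y a) (fa (Cpt \<tau> e) h)) (Nat \<tau> a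
          ?x)))"
        unfolding Y.Lift_nat[OF a, unfolded de, OF f(28)[OF h], symmetric] using h x by (simp add: r)
      finally have "Cmp (Gpd Y d) (Nat \<tau> a ?y) (fa (Cpt \<tau> d) (fa (Act X a) h)) = Cmp (Gpd Y d) (fa (Act Y a) (fa (Cpt \<tau> e)
          h)) (Nat \<tau> a ?x)"
        using h x by (intro Y.lift_cancel[OF a, unfolded de, of "fo (Cpt \<tau> e) ?y"]) (simp_all add: r)
      then show "Cmp (Gpd Y (Dom C a)) (Nat \<tau> a (Cod (Gpd X (Cod C a)) h)) (fa (Cpt \<tau> (Dom C a)) (fa (Act X a) h)) =
         Cmp (Gpd Y (Dom C a)) (fa (Act Y a) (fa (Cpt \<tau> (Cod C a)) h)) (Nat \<tau> a (Dom (Gpd X (Cod C a)) h))" unfolding de . }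
    fix b u assume b: "b \<in> Arr C" "Cod C a = Dom C b" and "u \<in> Obj (Gpd X (Cod C b))"
    define k where "k = Cod C b"
    have k: "k \<in> Obj C" using C b by (auto simp: k_def)
    have be: "Dom C b = e" using b by (simp add: de)
    have u: "u \<in> Obj (Gpd X k)" using \<open>u \<in> _\<close> by (simp add: k_def)
    note dk = de be k_def[symmetric]
    have ba: "Cmp C b a \<in> Arr C" "Dom C (Cmp C b a) = d" "Cod C (Cmp C b a) = k" using a b C by (auto simp: dk)
    note g = functor_rules[OF X.Act_functor[OF b(1)], unfolded dk] functor_rules[OF Y.Act_functor[OF b(1)], unfolded dk]
      functor_rules[OF X.Act_functor[OF ba(1)], unfolded ba] functor_rules[OF Y.Act_functor[OF ba(1)], unfolded ba]
          functor_rules[OF fu[OF k]]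
    note r2 = r g t(13-15)[OF b(1), unfolded dk] t(13-15)[OF ba(1), unfolded ba] X.CmpI[OF a b, unfolded in_hom dk] Y.CmpI[OF
        a b, unfolded in_hom dk]
       X.Lift[OF b(1), unfolded in_hom dk] Y.Lift[OF b(1), unfolded in_hom dk] X.Lift[OF ba(1), unfolded in_hom ba] Y.Lift[OF
           ba(1), unfolded in_hom ba]
       X.shape[OF k] Y.shape[OF k] t(7,11)[OF k]
    let ?u = "fo (Cpt \<tau> k) u" and ?L = "Lift S' (Cmp C b a) (fo (Cpt \<tau> k) u)"
    have U: "?u \<in> Obj (Gpd Y k)" "fo (Act X b) u \<in> Obj (Gpd X e)" using u by (simp_all add: r2)
    have "Cmp ?T ?L (sha S' (Cmp (Gpd Y d) (Nat \<tau> (Cmp C b a) u) (fa (Cpt \<tau> d) (CmpI X a b u)))) =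
      Cmp ?T (Cmp ?T ?L (sha S' (Nat \<tau> (Cmp C b a) u))) (fa F (sha S (CmpI X a b u)))"
      using u by (simp add: r2)
    also have "\<dots> = fa F (Cmp (Base S) (Lift S (Cmp C b a) u) (sha S (CmpI X a b u)))"
      unfolding t(16)[OF ba(1), unfolded ba, OF u] using u by (simp add: r2)
    also have "\<dots> = Cmp ?T (fa F (Lift S b u)) (fa F (Lift S a (fo (Act X b) u)))"
      unfolding X.CmpI_lift[OF a b, unfolded dk, OF u] using u by (simp add: r2)
    also have "\<dots> = Cmp ?T (Cmp ?T (Lift S' b ?u) (sha S' (Nat \<tau> b u))) (Cmp ?T (Lift S' a (fo (Cpt \<tau> e) (fo (Act X b) u)))
        (sha S' (Nat \<tau> a (fo (Act X b) u))))"
      unfolding t(16)[OF a, unfolded dk, OF U(2)] t(16)[OF b(1), unfolded dk, OF u] ..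
    also have "\<dots> = Cmp ?T (Lift S' b ?u) (Cmp ?T (Cmp ?T (sha S' (Nat \<tau> b u)) (Lift S' a (Dom (Gpd Y e) (Nat \<tau> b u)))) (sha
        S' (Nat \<tau> a (fo (Act X b) u))))"
      using u U by (simp add: r2)
    \<comment> \<open>Naturality of the lift along \<open>a\<close> at the cell
      \<open>Nat \<tau> b u\<close>, which brings the cell under \<open>Act Y a\<close> as the axiom
      demands.\<close>
    also have "Cmp ?T (sha S' (Nat \<tau> b u)) (Lift S' a (Dom (Gpd Y e) (Nat \<tau> b u))) = Cmp ?T (Lift S' a (Cod (Gpd Y e) (Nat \<tau>
        b u))) (sha S' (fa (Act Y a) (Nat \<tau> b u)))"
      using Y.Lift_nat[OF a, unfolded dk, of "Nat \<tau> b u"] u by (simp add: r2)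
    also have "Cmp ?T (Lift S' b ?u) (Cmp ?T (Cmp ?T (Lift S' a (Cod (Gpd Y e) (Nat \<tau> b u))) (sha S' (fa (Act Y a) (Nat \<tau> b
        u)))) (sha S' (Nat \<tau> a (fo (Act X b) u)))) =
      Cmp ?T (Cmp ?T (Lift S' b ?u) (Lift S' a (fo (Act Y b) ?u))) (Cmp ?T (sha S' (fa (Act Y a) (Nat \<tau> b u))) (sha S' (Nat \<tau>
          a (fo (Act X b) u))))"
      using u U by (simp add: r2)
    also have "\<dots> = Cmp ?T ?L (sha S' (Cmp (Gpd Y d) (Cmp (Gpd Y d) (CmpI Y a b ?u) (fa (Act Y a) (Nat \<tau> b u))) (Nat \<tau> a (fo
        (Act X b) u))))"
      unfolding Y.CmpI_lift[OF a b, unfolded dk, OF U(1), symmetric] using u U by (simp add: r2)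
    finally have "Cmp (Gpd Y d) (Nat \<tau> (Cmp C b a) u) (fa (Cpt \<tau> d) (CmpI X a b u)) =
       Cmp (Gpd Y d) (Cmp (Gpd Y d) (CmpI Y a b ?u) (fa (Act Y a) (Nat \<tau> b u))) (Nat \<tau> a (fo (Act X b) u))"
      using u U by (intro Y.lift_cancel[OF ba(1), unfolded ba, of ?u]) (simp_all add: r2)
    then show "Cmp (Gpd Y (Dom C a)) (Nat \<tau> (Cmp C b a) u) (fa (Cpt \<tau> (Dom C a)) (CmpI X a b u)) =
       Cmp (Gpd Y (Dom C a)) (Cmp (Gpd Y (Dom C a)) (CmpI Y a b (fo (Cpt \<tau> (Cod C b)) u)) (fa (Act Y a) (Nat \<tau> b u)))
             (Nat \<tau> a (fo (Act X b) u))" unfolding dk .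
  next
    fix c u assume c: "c \<in> Obj C" and u: "u \<in> Obj (Gpd X c)"
    have i: "Id C c \<in> Arr C" "Dom C (Id C c) = c" "Cod C (Id C c) = c" using c C by auto
    note r = F functor_rules[OF X.Act_functor[OF i(1)], unfolded i] functor_rules[OF Y.Act_functor[OF i(1)], unfolded i]
        functor_rules[OF fu[OF c]]
      X.IdI[OF c, unfolded in_hom] Y.IdI[OF c, unfolded in_hom] X.Lift[OF i(1), unfolded in_hom i] Y.Lift[OF i(1), unfolded
          in_hom i]
      X.shape[OF c] Y.shape[OF c] t(7,11)[OF c] t(13-15)[OF i(1), unfolded i] Y.category_Base
    let ?L = "Lift S' (Id C c) (fo (Cpt \<tau> c) u)"
    have "Cmp ?T ?L (sha S' (Cmp (Gpd Y c) (Nat \<tau> (Id C c) u) (fa (Cpt \<tau> c) (IdI X c u)))) =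
      Cmp ?T (Cmp ?T ?L (sha S' (Nat \<tau> (Id C c) u))) (fa F (sha S (IdI X c u)))"
      using u by (simp add: r)
    also have "\<dots> = fa F (Cmp (Base S) (Lift S (Id C c) u) (sha S (IdI X c u)))"
      unfolding t(16)[OF i(1), unfolded i, OF u] using u by (simp add: r)
    also have "\<dots> = Cmp ?T ?L (sha S' (IdI Y c (fo (Cpt \<tau> c) u)))"
      unfolding X.IdI_lift[OF c u] Y.IdI_lift[OF c r(27)[OF u]] using u by (simp add: r)
    finally show "Cmp (Gpd Y c) (Nat \<tau> (Id C c) u) (fa (Cpt \<tau> c) (IdI X c u)) = IdI Y c (fo (Cpt \<tau> c) u)"
      using u by (intro Y.lift_cancel[OF i(1), unfolded i, of "fo (Cpt \<tau> c) u"]) (simp_all add: r)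
  qed
qed

lemma lifted_map_idP:
  assumes "lifted C X S"
  shows "lifted_map C X S X S (idF (Base S)) (idP C X)"
proof -
  interpret lifted C X S by fact
  have C: "category C" by (rule category_C)
  have "is_functor (Base S) (Base S) (idF (Base S))" by (rule functor_idF[OF category_Base])
  then show ?thesis unfolding lifted_map_def in_hom
    using C by (auto simp: groupoid_Gpd shape Act_obj Lift[unfolded in_hom] category_Base)
qed

text \<open>The lift equation of \<open>\<tau>\<close> absorbs its cell and leaves the image under
  \<open>G\<close> of the lift equation of \<open>\<sigma>\<close>.\<close>

lemma lifted_map_compP:
  assumes "lifted C X S" "lifted C Y S'" "lifted C Z S''"
    and \<sigma>: "lifted_map C X S Y S' F \<sigma>" and \<tau>: "lifted_map C Y S' Z S'' G \<tau>"
  shows "lifted_map C X S Z S'' (compF (Base S) G F) (compP C X Z \<tau> \<sigma>)"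
proof -
  interpret X: lifted C X S by fact
  interpret Y: lifted C Y S' by fact
  interpret Z: lifted C Z S'' by fact
  have C: "category C" by (rule X.category_C)
  note s = lifted_map_rules[OF \<sigma>] and t = lifted_map_rules[OF \<tau>]
  note n = pseudonatural_rules[OF lifted_map_pseudonatural[OF assms(1,2) \<sigma>]] pseudonatural_rules[OF
      lifted_map_pseudonatural[OF assms(2,3) \<tau>]]
  have "is_functor (Base S) (Base S'') (compF (Base S) G F)" by (rule functor_compF[OF s(1) t(1)])
  moreover have "Nat (compP C X Z \<tau> \<sigma>) a x \<in> hom (Gpd Z (Dom C a)) (fo (Cpt (compP C X Z \<tau> \<sigma>) (Dom C a)) (fo (Act X a) x))
        (fo (Act Z a) (fo (Cpt (compP C X Z \<tau> \<sigma>) (Cod C a)) x)) \<and>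
      Cmp (Base S'') (Lift S'' a (fo (Cpt (compP C X Z \<tau> \<sigma>) (Cod C a)) x)) (sha S'' (Nat (compP C X Z \<tau> \<sigma>) a x)) = fa (compF
          (Base S) G F) (Lift S a x)"
     if a: "a \<in> Arr C" and x: "x \<in> Obj (Gpd X (Cod C a))" for a x
  proof -
    have d: "Dom C a \<in> Obj C" "Cod C a \<in> Obj C" using C a by auto
    note f = functor_rules[OF X.Act_functor[OF a]] functor_rules[OF Y.Act_functor[OF a]] functor_rules[OF Z.Act_functor[OF
        a]]
      functor_rules[OF n(3)[OF d(1)]] functor_rules[OF n(3)[OF d(2)]] functor_rules[OF n(13)[OF d(1)]] functor_rules[OF
          n(13)[OF d(2)]]
    note r = f s(13-15)[OF a] t(13-15)[OF a] Z.Lift[OF a, unfolded in_hom] Y.Lift[OF a, unfolded in_hom] X.Lift[OF a,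
        unfolded in_hom]
      Z.shape[OF d(1)] Y.shape[OF d(1)] t(11)[OF d(1)] functor_rules[OF t(1)] functor_rules[OF s(1)] t(7)[OF d(2)] t(7)[OF
          d(1)] s(7)[OF d(2)] s(7)[OF d(1)]
    have "Cmp (Base S'') (Lift S'' a (fo (Cpt \<tau> (Cod C a)) (fo (Cpt \<sigma> (Cod C a)) x)))
       (sha S'' (Cmp (Gpd Z (Dom C a)) (Nat \<tau> a (fo (Cpt \<sigma> (Cod C a)) x)) (fa (Cpt \<tau> (Dom C a)) (Nat \<sigma> a x)))) =
      Cmp (Base S'') (Cmp (Base S'') (Lift S'' a (fo (Cpt \<tau> (Cod C a)) (fo (Cpt \<sigma> (Cod C a)) x))) (sha S'' (Nat \<tau> a (fo (Cpt
          \<sigma> (Cod C a)) x))))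
        (fa G (sha S' (Nat \<sigma> a x)))"
      using x d by (simp add: r Z.category_Base)
    also have "\<dots> = fa G (Cmp (Base S') (Lift S' a (fo (Cpt \<sigma> (Cod C a)) x)) (sha S' (Nat \<sigma> a x)))"
      using x d t(16)[OF a, of "fo (Cpt \<sigma> (Cod C a)) x"] by (simp add: r)
    also have "\<dots> = fa G (fa F (Lift S a x))" unfolding s(16)[OF a x] ..
    finally show ?thesis using a x d by (simp add: r in_hom)
  qed
  ultimately show ?thesis unfolding lifted_map_def
    using C by (auto simp: s(6-11) t(6-11) in_hom X.shape X.groupoid_Gpd simp del: compP_simps(2))
qed

lemma lifted_map_prodP:
  assumes "lifted C X S" "lifted C Y T"
    and \<sigma>: "lifted_map C X S X' S' F \<sigma>" and \<tau>: "lifted_map C Y T Y' T' G \<tau>"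
  shows "lifted_map C (prodX C X Y) (prodS S T) (prodX C X' Y') (prodS S' T') (prodF (Base S) (Base T) F G) (prodP C X Y \<sigma>
      \<tau>)"
proof -
  interpret X: lifted C X S by fact
  interpret Y: lifted C Y T by fact
  have C: "category C" by (rule X.category_C)
  note s = lifted_map_rules[OF \<sigma>] and t = lifted_map_rules[OF \<tau>]
  have "is_functor (prodC (Base S) (Base T)) (prodC (Base S') (Base T')) (prodF (Base S) (Base T) F G)"
    by (rule functor_prodF[OF s(1) t(1)])
  then show ?thesis unfolding lifted_map_def in_hom
    using C by (auto simp: s(6-16) t(6-16) X.shape Y.shape X.groupoid_Gpd Y.groupoid_Gpd X.Act_obj Y.Act_obj X.Lift[unfolded
        in_hom] Y.Lift[unfolded in_hom])
qed

section \<open>Rebracketing and insertion of the unit as lifted maps\<close>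

lemma assocP_simps [simp]:
  "c \<in> Obj C \<Longrightarrow> Cpt (assocP C X) c = assocF (Gpd X c) (Gpd X c) (Gpd X c)"
  "Cpt (assocP C X) \<in> extensional (Obj C)" "Nat (assocP C X) \<in> extensional (Arr C)"
  "a \<in> Arr C \<Longrightarrow> Nat (assocP C X) a \<in> extensional ((Obj (Gpd X (Cod C a)) \<times> Obj (Gpd X (Cod C a))) \<times> Obj (Gpd X (Cod C a)))"
  "a \<in> Arr C \<Longrightarrow> x \<in> Obj (Gpd X (Cod C a)) \<Longrightarrow> y \<in> Obj (Gpd X (Cod C a)) \<Longrightarrow> z \<in> Obj (Gpd X (Cod C a)) \<Longrightarrow>
     Nat (assocP C X) a ((x, y), z) = (Id (Gpd X (Dom C a)) (fo (Act X a) x), Id (Gpd X (Dom C a)) (fo (Act X a) y), Id (Gpd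
         X (Dom C a)) (fo (Act X a) z))"
  by (simp_all add: assocP_def Let_def prodX_def)

lemma insP_simps [simp]:
  "c \<in> Obj C \<Longrightarrow> Cpt (insLP C X) c = insLF (Gpd X c) oneC ()"
  "Cpt (insLP C X) \<in> extensional (Obj C)" "Nat (insLP C X) \<in> extensional (Arr C)"
  "a \<in> Arr C \<Longrightarrow> Nat (insLP C X) a \<in> extensional (Obj (Gpd X (Cod C a)))"
  "a \<in> Arr C \<Longrightarrow> x \<in> Obj (Gpd X (Cod C a)) \<Longrightarrow> Nat (insLP C X) a x = ((), Id (Gpd X (Dom C a)) (fo (Act X a) x))"
  "c \<in> Obj C \<Longrightarrow> Cpt (insRP C X) c = insRF (Gpd X c) oneC ()"
  "Cpt (insRP C X) \<in> extensional (Obj C)" "Nat (insRP C X) \<in> extensional (Arr C)"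
  "a \<in> Arr C \<Longrightarrow> Nat (insRP C X) a \<in> extensional (Obj (Gpd X (Cod C a)))"
  "a \<in> Arr C \<Longrightarrow> x \<in> Obj (Gpd X (Cod C a)) \<Longrightarrow> Nat (insRP C X) a x = (Id (Gpd X (Dom C a)) (fo (Act X a) x), ())"
  by (simp_all add: insLP_def insRP_def)

lemma assocF_ext:
  "fo (assocF C D E) \<in> extensional ((Obj C \<times> Obj D) \<times> Obj E)" "fa (assocF C D E) \<in> extensional ((Arr C \<times> Arr D) \<times> Arr E)"
  by (simp_all add: assocF_def prodC_def)

lemma lifted_map_assocP:
  assumes "lifted C X S"
  shows "lifted_map C (prodX C (prodX C X X) X) (prodS (prodS S S) S) (prodX C X (prodX C X X)) (prodS S (prodS S S))
    (assocF (Base S) (Base S) (Base S)) (assocP C X)"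
proof -
  interpret lifted C X S by fact
  have C: "category C" by (rule category_C)
  have "is_functor (prodC (prodC (Base S) (Base S)) (Base S)) (prodC (Base S) (prodC (Base S) (Base S))) (assocF (Base S)
      (Base S) (Base S))"
    by (rule functor_assocF) (rule category_Base)+
  then show ?thesis unfolding lifted_map_def in_hom
    using C by (auto simp: shape groupoid_Gpd Act_obj Lift[unfolded in_hom] category_Base assocF_ext)
qed

lemma insF_ext: "fo (insLF C D e) \<in> extensional (Obj C)" "fa (insLF C D e) \<in> extensional (Arr C)"
  "fo (insRF C D e) \<in> extensional (Obj C)" "fa (insRF C D e) \<in> extensional (Arr C)"
  by (simp_all add: insLF_def insRF_def)

lemma lifted_map_insP:
  assumes "lifted C X S"
  shows "lifted_map C X S (prodX C oneX X) (prodS oneS S) (insLF (Base S) oneC ()) (insLP C X)"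
    "lifted_map C X S (prodX C X oneX) (prodS S oneS) (insRF (Base S) oneC ()) (insRP C X)"
proof -
  interpret lifted C X S by fact
  have C: "category C" by (rule category_C)
  have "is_functor (Base S) (prodC oneC (Base S)) (insLF (Base S) oneC ())" "is_functor (Base S) (prodC (Base S) oneC) (insRF
      (Base S) oneC ())"
    by (rule functor_insF; simp add: category_Base)+
  then show "lifted_map C X S (prodX C oneX X) (prodS oneS S) (insLF (Base S) oneC ()) (insLP C X)"
    "lifted_map C X S (prodX C X oneX) (prodS S oneS) (insRF (Base S) oneC ()) (insRP C X)"
    unfolding lifted_map_def in_hom
    using C by (auto simp: shape groupoid_Gpd Act_obj Lift[unfolded in_hom] category_Base insF_ext)
qed

text \<open>A natural family \<open>\<gamma>\<close> in the base becomes a modification as soon as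
  its members lift to arrows with the right endpoints. Under the lift, both sides of the
  modification square become \<open>\<gamma>\<close> after the image under \<open>F\<close> of
  \<open>Lift S a u\<close>.\<close>

lemma lifted_modification:
  assumes "lifted C X S" "lifted C Y S'"
    and \<sigma>: "lifted_map C X S Y S' F \<sigma>" and \<tau>: "lifted_map C X S Y S' G \<tau>"
    and \<gamma>: "\<And>x. x \<in> Obj (Base S) \<Longrightarrow> \<gamma> x \<in> hom (Base S') (fo F x) (fo G x)"
      "\<And>h. h \<in> Arr (Base S) \<Longrightarrow> Cmp (Base S') (\<gamma> (Cod (Base S) h)) (fa F h) = Cmp (Base S') (fa G h) (\<gamma> (Dom (Base S) h))"
    and \<Gamma>_ext: "\<Gamma> \<in> extensional (Obj C)" "\<And>c. c \<in> Obj C \<Longrightarrow> \<Gamma> c \<in> extensional (Obj (Gpd X c))"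
    and \<Gamma>: "\<And>c x. c \<in> Obj C \<Longrightarrow> x \<in> Obj (Gpd X c) \<Longrightarrow> \<Gamma> c x \<in> hom (Gpd Y c) (fo (Cpt \<sigma> c) x) (fo (Cpt \<tau> c) x)"
    and \<Gamma>_shape: "\<And>c x. c \<in> Obj C \<Longrightarrow> x \<in> Obj (Gpd X c) \<Longrightarrow> sha S' (\<Gamma> c x) = \<gamma> (sho S x)"
  shows "modification C X Y \<sigma> \<tau> \<Gamma>"
  unfolding modification_def
proof (intro conjI ballI \<Gamma>_ext)
  interpret X: lifted C X S by fact
  interpret Y: lifted C Y S' by fact
  have C: "category C" by (rule X.category_C)
  note s = lifted_map_rules[OF \<sigma>] and t = lifted_map_rules[OF \<tau>]
  note n = pseudonatural_rules[OF lifted_map_pseudonatural[OF assms(1,2) \<sigma>]] pseudonatural_rules[OF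
      lifted_map_pseudonatural[OF assms(1,2) \<tau>]]
  note F = functor_rules[OF s(1)] functor_rules[OF t(1)]
  let ?T = "Base S'"
  { fix c assume c: "c \<in> Obj C"
    note r = functor_rules[OF n(3)[OF c]] functor_rules[OF n(13)[OF c]] X.shape[OF c] Y.shape[OF c] s(11)[OF c] t(11)[OF c]
        \<Gamma>[OF c, unfolded in_hom] \<Gamma>_shape[OF c] \<gamma>(2)
      X.groupoid_Gpd[OF c] Y.groupoid_Gpd[OF c]
    show "nat_iso (Gpd X c) (Gpd Y c) (Cpt \<sigma> c) (Cpt \<tau> c) (\<Gamma> c)"
    proof (rule nat_isoI)
      fix f assume f: "f \<in> Arr (Gpd X c)"
      then show "Cmp (Gpd Y c) (\<Gamma> c (Cod (Gpd X c) f)) (fa (Cpt \<sigma> c) f) = Cmp (Gpd Y c) (fa (Cpt \<tau> c) f) (\<Gamma> c (Dom (Gpd X c)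
          f))"
        using \<gamma>(2)[of "sha S f"] by (intro Y.shape_eqI[OF c]) (simp_all add: r)
    qed (use \<Gamma>_ext(2)[OF c] in \<open>simp_all add: r\<close>) }
  fix a u assume a: "a \<in> Arr C" and u: "u \<in> Obj (Gpd X (Cod C a))"
  have d: "Dom C a \<in> Obj C" "Cod C a \<in> Obj C" using C a by auto
  note f = functor_rules[OF X.Act_functor[OF a]] functor_rules[OF Y.Act_functor[OF a]]
      functor_rules[OF n(3)[OF d(1)]] functor_rules[OF n(3)[OF d(2)]] functor_rules[OF n(13)[OF d(1)]] functor_rules[OF
          n(13)[OF d(2)]]
  note r = f F \<Gamma>[OF d(1), unfolded in_hom] \<Gamma>[OF d(2), unfolded in_hom] X.shape[OF d(1)] X.shape[OF d(2)] Y.shape[OF d(1)]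
      Y.shape[OF d(2)]
      s(7,11)[OF d(1)] t(7,11)[OF d(1)] s(7,11)[OF d(2)] t(7,11)[OF d(2)] \<Gamma>_shape[OF d(1)] \<Gamma>_shape[OF d(2)]
      X.Lift[OF a, unfolded in_hom] Y.Lift[OF a, unfolded in_hom] s(13-15)[OF a] t(13-15)[OF a] Y.category_Base \<gamma>(1)[unfolded
          in_hom]
  let ?L = "Lift S' a (fo (Cpt \<tau> (Cod C a)) u)"
  have u': "fo (Act X a) u \<in> Obj (Gpd X (Dom C a))" using u by (simp add: f)
  have "Cmp ?T ?L (sha S' (Cmp (Gpd Y (Dom C a)) (Nat \<tau> a u) (\<Gamma> (Dom C a) (fo (Act X a) u)))) =
    Cmp ?T (Cmp ?T ?L (sha S' (Nat \<tau> a u))) (\<gamma> (sho S (fo (Act X a) u)))"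
    using u u' by (simp add: r)
  also have "\<dots> = Cmp ?T (\<gamma> (sho S u)) (fa F (Lift S a u))"
    unfolding t(16)[OF a u] using \<gamma>(2)[of "Lift S a u"] u by (simp add: r)
  also have "\<dots> = Cmp ?T (Cmp ?T (sha S' (\<Gamma> (Cod C a) u)) (Lift S' a (Dom (Gpd Y (Cod C a)) (\<Gamma> (Cod C a) u)))) (sha S' (Nat \<sigma>
      a u))"
    unfolding s(16)[OF a u, symmetric] using u u' by (simp add: r)
  also have "Cmp ?T (sha S' (\<Gamma> (Cod C a) u)) (Lift S' a (Dom (Gpd Y (Cod C a)) (\<Gamma> (Cod C a) u))) =
     Cmp ?T (Lift S' a (Cod (Gpd Y (Cod C a)) (\<Gamma> (Cod C a) u))) (sha S' (fa (Act Y a) (\<Gamma> (Cod C a) u)))"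
    using u by (intro Y.Lift_nat[OF a, symmetric]) (simp add: r)
  also have "Cmp ?T (Cmp ?T (Lift S' a (Cod (Gpd Y (Cod C a)) (\<Gamma> (Cod C a) u))) (sha S' (fa (Act Y a) (\<Gamma> (Cod C a) u)))) (sha
      S' (Nat \<sigma> a u)) =
    Cmp ?T ?L (sha S' (Cmp (Gpd Y (Dom C a)) (fa (Act Y a) (\<Gamma> (Cod C a) u)) (Nat \<sigma> a u)))"
    using u u' by (simp add: r del: \<Gamma>_shape)
  finally show "Cmp (Gpd Y (Dom C a)) (Nat \<tau> a u) (\<Gamma> (Dom C a) (fo (Act X a) u)) = Cmp (Gpd Y (Dom C a)) (fa (Act Y a) (\<Gamma>
      (Cod C a) u)) (Nat \<sigma> a u)"
    using u u' by (intro Y.lift_cancel[OF a, of "fo (Cpt \<tau> (Cod C a)) u"]) (simp_all add: r)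
qed

text \<open>With identity lifts, generic maps act trivially on shapes. Faithfulness of shapes then
  gives uniqueness of fillers, \<open>full\<close> their existence, and \<open>surj\<close> lifts
  objects strictly, so that one of the two comparison arrows can be an identity and the other one
  has the shape of \<open>\<gamma>\<close>.\<close>

lemma lifted_culf:
  assumes "lifted Simp X S" "lifted Simp Y S'" and \<tau>: "lifted_map Simp X S Y S' F \<tau>"
    and LX: "\<And>g t. generic g \<Longrightarrow> t \<in> Obj (Gpd X (Cod Simp g)) \<Longrightarrow> Lift S g t = Id (Base S) (sho S t)"
    and LY: "\<And>g t. generic g \<Longrightarrow> t \<in> Obj (Gpd Y (Cod Simp g)) \<Longrightarrow> Lift S' g t = Id (Base S') (sho S' t)"
    and full: "\<And>g x y u v. generic g \<Longrightarrow> x \<in> Obj (Gpd X (Cod Simp g)) \<Longrightarrow> y \<in> Obj (Gpd X (Cod Simp g)) \<Longrightarrow>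
      u \<in> hom (Gpd X (Dom Simp g)) (fo (Act X g) x) (fo (Act X g) y) \<Longrightarrow>
      v \<in> hom (Gpd Y (Cod Simp g)) (fo (Cpt \<tau> (Cod Simp g)) x) (fo (Cpt \<tau> (Cod Simp g)) y) \<Longrightarrow> sha S' v = fa F (sha S u) \<Longrightarrow>
      \<exists>w \<in> hom (Gpd X (Cod Simp g)) x y. sha S w = sha S u"
    and surj: "\<And>g a b \<gamma>. generic g \<Longrightarrow> a \<in> Obj (Gpd X (Dom Simp g)) \<Longrightarrow> b \<in> Obj (Gpd Y (Cod Simp g)) \<Longrightarrow>
      \<gamma> \<in> hom (Gpd Y (Dom Simp g)) (fo (Cpt \<tau> (Dom Simp g)) a) (fo (Act Y g) b) \<Longrightarrow>
      \<exists>x \<in> Obj (Gpd X (Cod Simp g)). fo (Act X g) x = a \<and>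
        (\<exists>v \<in> hom (Gpd Y (Cod Simp g)) (fo (Cpt \<tau> (Cod Simp g)) x) b. sha S' v = sha S' \<gamma>)"
  shows "culf X Y \<tau>"
  unfolding culf_def
proof (intro conjI allI impI)
  interpret X: lifted Simp X S by fact
  interpret Y: lifted Simp Y S' by fact
  have C: "category Simp" by (rule X.category_C)
  show pn: "pseudonatural Simp X Y \<tau>" by (rule lifted_map_pseudonatural[OF assms(1,2) \<tau>])
  fix g assume gg: "generic g"
  then have g: "g \<in> Arr Simp" by (rule generic_Arr)
  have d: "Dom Simp g \<in> Obj Simp" "Cod Simp g \<in> Obj Simp" using C g by auto
  note t = lifted_map_rules[OF \<tau>] and n = pseudonatural_rules[OF pn]
  define A where "A = Gpd X (Dom Simp g)" define P where "P = Gpd X (Cod Simp g)"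
  define E where "E = Gpd Y (Dom Simp g)" define B where "B = Gpd Y (Cod Simp g)"
  define p where "p = Act X g" define q where "q = Cpt \<tau> (Cod Simp g)" define f where "f = Cpt \<tau> (Dom Simp g)" define h where
      "h = Act Y g"
  define \<theta> where "\<theta> = Nat \<tau> g"
  note fd = A_def[symmetric] P_def[symmetric] E_def[symmetric] B_def[symmetric] p_def[symmetric] q_def[symmetric]
      f_def[symmetric] h_def[symmetric] \<theta>_def[symmetric]
  note fu = functor_rules[OF X.Act_functor[OF g], unfolded fd] functor_rules[OF Y.Act_functor[OF g], unfolded fd]
    functor_rules[OF n(3)[OF d(1)], unfolded fd] functor_rules[OF n(3)[OF d(2)], unfolded fd] functor_rules[OF t(1)]
  note sh = X.shape[OF d(1), unfolded fd] X.shape[OF d(2), unfolded fd] Y.shape[OF d(1), unfolded fd] Y.shape[OF d(2),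
      unfolded fd]
    t(7,11)[OF d(1), unfolded fd] t(7,11)[OF d(2), unfolded fd]
  note nt = t(13-15)[OF g, unfolded fd]
  \<comment> \<open>Identity lifts mean that a generic map preserves the shapes of objects and, by
    naturality of lifts, those of arrows.\<close>
  have sp: "sho S (fo p x) = sho S x" if "x \<in> Obj P" for x
    using X.Lift[OF g, of x] LX[OF gg, of x] that X.category_Base sh unfolding fd in_hom by simp
  have sho_h: "sho S' (fo h x) = sho S' x" if "x \<in> Obj B" for x
    using Y.Lift[OF g, of x] LY[OF gg, of x] that Y.category_Base sh unfolding fd in_hom by simp
  have sap: "sha S (fa p w) = sha S w" if w: "w \<in> Arr P" for w
    using X.Lift_nat[OF g, of w] LX[OF gg] w X.category_Base unfolding fd by (simp add: fu sh sp)
  have sah: "sha S' (fa h w) = sha S' w" if w: "w \<in> Arr B" for w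
    using Y.Lift_nat[OF g, of w] LY[OF gg] w Y.category_Base unfolding fd by (simp add: fu sh sho_h)
  \<comment> \<open>The lift equation of \<open>\<tau>\<close> with identities as lifts on both
    sides leaves an identity as the shape of the naturality cell.\<close>
  have st: "sha S' (\<theta> x) = Id (Base S') (fo F (sho S x))" if "x \<in> Obj P" for x
    using t(16)[OF g, of x] LX[OF gg, of x] LY[OF gg, of "fo q x"] that Y.category_Base unfolding fd by (simp add: fu sh nt
        sho_h)
  show "homotopy_pullback (Gpd X (Cod Simp g)) (Gpd X (Dom Simp g)) (Gpd Y (Cod Simp g)) (Gpd Y (Dom Simp g))
          (Act X g) (Cpt \<tau> (Cod Simp g)) (Cpt \<tau> (Dom Simp g)) (Act Y g) (Nat \<tau> g)"
    unfolding square.homotopy_pullback_iff[OF culf_square[OF X.pseudofunctor Y.pseudofunctor pn g]] unfolding fd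
  proof (intro conjI ballI impI)
    fix x y u v assume x: "x \<in> Obj P" and y: "y \<in> Obj P" and u: "u \<in> hom A (fo p x) (fo p y)" and v: "v \<in> hom B (fo q x) (fo
        q y)"
      and e: "Cmp E (\<theta> y) (fa f u) = Cmp E (fa h v) (\<theta> x)"
    \<comment> \<open>The compatibility equation of the square read on shapes, where the naturality
      cells disappear.\<close>
    have uv: "sha S' v = fa F (sha S u)"
      using arg_cong[OF e, of "sha S'"] x y u v Y.category_Base by (simp add: in_hom fu sh nt st sp sah)
    obtain w where w: "w \<in> hom P x y" "sha S w = sha S u"
      using full[OF gg, of x y u v] x y u v uv unfolding fd by blast
    have pw: "fa p w = u"
      by (rule X.shape_eqI[OF d(1), unfolded fd]) (use w u in \<open>auto simp: in_hom fu sap\<close>)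
    have qw: "fa q w = v"
      by (rule Y.shape_eqI[OF d(2), unfolded fd]) (use w v uv in \<open>auto simp: in_hom fu sh\<close>)
    show "\<exists>!w. w \<in> hom P x y \<and> fa p w = u \<and> fa q w = v"
    proof (rule ex1I[of _ w])
      fix w' assume w': "w' \<in> hom P x y \<and> fa p w' = u \<and> fa q w' = v"
      show "w' = w"
        by (rule X.shape_eqI[OF d(2), unfolded fd]) (use w w' sap in \<open>auto simp: in_hom\<close>)
    qed (use w pw qw in blast)
  next
    fix a b \<gamma> assume a: "a \<in> Obj A" and b: "b \<in> Obj B" and \<gamma>: "\<gamma> \<in> hom E (fo f a) (fo h b)"
    then obtain x v where x: "x \<in> Obj P" "fo p x = a" and v: "v \<in> hom B (fo q x) b" "sha S' v = sha S' \<gamma>"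
      using surj[OF gg, of a b \<gamma>] unfolding fd by blast
    \<comment> \<open>Because \<open>x\<close> restricts to \<open>a\<close> exactly, the identity
      of \<open>a\<close> serves as the first comparison arrow.\<close>
    have "Cmp E \<gamma> (fa f (Id A a)) = Cmp E (fa h v) (\<theta> x)"
      by (rule Y.shape_eqI[OF d(1), unfolded fd])
        (use x a b v \<gamma> Y.category_Base sp[OF x(1)] in \<open>auto simp: in_hom fu sh nt st sah\<close>)
    moreover have "Id A a \<in> hom A (fo p x) a" using x a fu by (simp add: in_hom)
    ultimately show "\<exists>x\<in>Obj P. \<exists>u\<in>hom A (fo p x) a. \<exists>v\<in>hom B (fo q x) b. Cmp E \<gamma> (fa f u) = Cmp E (fa h v) (\<theta> x)"
      using x v by blast
  qed
qed

section \<open>Monoidal structures from lifts\<close>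

text \<open>The unit of the base monoidal category as a functor from the one-object category; the
  unit transformation \<open>Uni\<close> will lie over it.\<close>

definition constF :: "('p, 'n) cat \<Rightarrow> 'p \<Rightarrow> (unit, unit, 'p, 'n) ftr" where
  "constF D e = \<lparr> fo = (\<lambda>_. e), fa = (\<lambda>_. Id D e) \<rparr>"

lemma constF_simps [simp]: "fo (constF D e) x = e" "fa (constF D e) f = Id D e"
  by (simp_all add: constF_def)

lemma functor_constF: "category D \<Longrightarrow> e \<in> Obj D \<Longrightarrow> is_functor oneC D (constF D e)"
  by (rule functorI) (auto simp: extensional_def)

text \<open>The base is itself a monoidal category \<open>N\<close>, and each constraint of
  \<open>M\<close> has a constraint of \<open>N\<close> as its shape. Only endpoints and shapes of
  the constraints are prescribed; naturality, pentagon and triangle are inherited from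
  \<open>N\<close> through faithfulness.\<close>

locale lifted_monoidal = lifted C "Und M" S
  for C :: "('c, 'k) cat" and M :: "('c, 'k, 'o, 'm) monpsh" and S :: "('k, 'o, 'm, 'p, 'n) lsys" +
  fixes N :: "('p, 'n) moncat"
  assumes N: "monoidal_category N" and Base: "Base S = MC N"
    and Mul: "lifted_map C (prodX C (Und M) (Und M)) (prodS S S) (Und M) S (Ten N) (Mul M)"
    and Uni: "lifted_map C oneX oneS (Und M) S (constF (MC N) (One N)) (Uni M)"
    and ext: "AscM M \<in> extensional (Obj C)" "LUnM M \<in> extensional (Obj C)" "RUnM M \<in> extensional (Obj C)"
      "\<And>c. c \<in> Obj C \<Longrightarrow> AscM M c \<in> extensional ((Obj (Gpd (Und M) c) \<times> Obj (Gpd (Und M) c)) \<times> Obj (Gpd (Und M) c))"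
      "\<And>c. c \<in> Obj C \<Longrightarrow> LUnM M c \<in> extensional (Obj (Gpd (Und M) c))"
      "\<And>c. c \<in> Obj C \<Longrightarrow> RUnM M c \<in> extensional (Obj (Gpd (Und M) c))"
    and AscM: "\<And>c x y z. c \<in> Obj C \<Longrightarrow> x \<in> Obj (Gpd (Und M) c) \<Longrightarrow> y \<in> Obj (Gpd (Und M) c) \<Longrightarrow> z \<in> Obj (Gpd (Und M) c) \<Longrightarrow>
      AscM M c ((x, y), z) \<in> hom (Gpd (Und M) c) (fo (Cpt (Mul M) c) (fo (Cpt (Mul M) c) (x, y), z))
         (fo (Cpt (Mul M) c) (x, fo (Cpt (Mul M) c) (y, z))) \<and> sha S (AscM M c ((x, y), z)) = Asc N ((sho S x, sho S y), sho
             S z)"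
    and LUnM: "\<And>c x. c \<in> Obj C \<Longrightarrow> x \<in> Obj (Gpd (Und M) c) \<Longrightarrow>
      LUnM M c x \<in> hom (Gpd (Und M) c) (fo (Cpt (Mul M) c) (fo (Cpt (Uni M) c) (), x)) x \<and> sha S (LUnM M c x) = LUn N (sho S
          x)"
    and RUnM: "\<And>c x. c \<in> Obj C \<Longrightarrow> x \<in> Obj (Gpd (Und M) c) \<Longrightarrow>
      RUnM M c x \<in> hom (Gpd (Und M) c) (fo (Cpt (Mul M) c) (x, fo (Cpt (Uni M) c) ())) x \<and> sha S (RUnM M c x) = RUn N (sho S
          x)"
begin

lemma lifted_self: "lifted C (Und M) S" ..

lemma level_typing:
  assumes c: "c \<in> Obj C"
  shows "is_functor (prodC (Gpd (Und M) c) (Gpd (Und M) c)) (Gpd (Und M) c) (Cpt (Mul M) c)"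
    "fo (Cpt (Uni M) c) () \<in> Obj (Gpd (Und M) c)" "sho S (fo (Cpt (Uni M) c) ()) = One N"
    "\<And>x y. x \<in> Obj (Gpd (Und M) c) \<Longrightarrow> y \<in> Obj (Gpd (Und M) c) \<Longrightarrow> sho S (fo (Cpt (Mul M) c) (x, y)) = fo (Ten N) (sho S x, sho S
        y)"
    "\<And>f g. f \<in> Arr (Gpd (Und M) c) \<Longrightarrow> g \<in> Arr (Gpd (Und M) c) \<Longrightarrow> sha S (fa (Cpt (Mul M) c) (f, g)) = fa (Ten N) (sha S f, sha S
        g)"
  using pseudonatural_rules(3)[OF lifted_map_pseudonatural[OF lifted_prodX[OF lifted_self lifted_self] lifted_self Mul] c]
    lifted_map_rules(6,7)[OF Uni c, of "()"] lifted_map_rules(7)[OF Mul c] lifted_map_rules(11)[OF Mul c]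
  by simp_all

lemma monoidal_psh: "monoidal_psh C M"
proof -
  note l1 = lifted_self and l2 = lifted_prodX[OF lifted_self lifted_self]
  note l3 = lifted_prodX[OF l2 l1] and l3' = lifted_prodX[OF l1 l2] and lo = lifted_oneX[OF category_C]
  note li = lifted_map_idP[OF l1]
  note m = monoidal_category_rules[OF N]
  note b = bifunctor_rules[OF m(2)]
  have psMul: "pseudonatural C (prodX C (Und M) (Und M)) (Und M) (Mul M)" by (rule lifted_map_pseudonatural[OF l2 l1 Mul])
  have psUni: "pseudonatural C oneX (Und M) (Uni M)" by (rule lifted_map_pseudonatural[OF lo l1 Uni])
  let ?X = "Und M" let ?X2 = "prodX C ?X ?X" let ?X3 = "prodX C ?X2 ?X"
  \<comment> \<open>Source and target of the associator are composites of lifted maps, and they lie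
    over exactly the two functors between which \<open>Asc N\<close> is natural.\<close>
  have mA: "modification C ?X3 ?X (compP C ?X3 ?X (Mul M) (prodP C ?X2 ?X (Mul M) (idP C ?X)))
       (compP C ?X3 ?X (Mul M) (compP C ?X3 ?X2 (prodP C ?X ?X2 (idP C ?X) (Mul M)) (assocP C ?X))) (AscM M)"
    by (rule lifted_modification[OF l3 l1 lifted_map_compP[OF l3 l2 l1 lifted_map_prodP[OF l2 l1 Mul li] Mul]
        lifted_map_compP[OF l3 l2 l1 lifted_map_compP[OF l3 l3' l2 lifted_map_assocP[OF l1] lifted_map_prodP[OF l1 l2 li
            Mul]] Mul], of "Asc N"])
      (use ext AscM category_C m(4,5) groupoid_Gpd in \<open>auto simp: in_hom Base\<close>)
  have mL: "modification C ?X ?X (compP C ?X ?X (Mul M) (compP C ?X ?X2 (prodP C oneX ?X (Uni M) (idP C ?X)) (insLP C ?X)))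
      (idP C ?X) (LUnM M)"
    by (rule lifted_modification[OF l1 l1 lifted_map_compP[OF l1 l2 l1 lifted_map_compP[OF l1 lifted_prodX[OF lo l1] l2
        lifted_map_insP(1)[OF l1] lifted_map_prodP[OF lo l1 Uni li]] Mul]
        li, of "LUn N"])
      (use ext LUnM category_C m(6,8) groupoid_Gpd in \<open>auto simp: in_hom Base\<close>)
  have mR: "modification C ?X ?X (compP C ?X ?X (Mul M) (compP C ?X ?X2 (prodP C ?X oneX (idP C ?X) (Uni M)) (insRP C ?X)))
      (idP C ?X) (RUnM M)"
    by (rule lifted_modification[OF l1 l1 lifted_map_compP[OF l1 l2 l1 lifted_map_compP[OF l1 lifted_prodX[OF l1 lo] l2
        lifted_map_insP(2)[OF l1] lifted_map_prodP[OF l1 lo li Uni]] Mul]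
        li, of "RUn N"])
      (use ext RUnM category_C m(7,9) groupoid_Gpd in \<open>auto simp: in_hom Base\<close>)
  have "monoidal_category (level M c)" if c: "c \<in> Obj C" for c
  proof -
    note lt = level_typing[OF c]
    note bf = bifunctor_rules(1-6)[OF lt(1)]
    have Gc: "category (Gpd ?X c)" using groupoid_Gpd[OF c] by simp
    have fi: "is_functor (Gpd ?X c) (Gpd ?X c) (idF (Gpd ?X c))" by (rule functor_idF[OF Gc])
    have fo: "is_functor oneC (Gpd ?X c) (Cpt (Uni M) c)" using pseudonatural_rules(3)[OF psUni c] by simp
    have u: "fa (Cpt (Uni M) c) () = Id (Gpd ?X c) (fo (Cpt (Uni M) c) ())" using functor_rules(7)[OF fo, of "()"] by simp
    have nA: "nat_iso (prodC (prodC (Gpd ?X c) (Gpd ?X c)) (Gpd ?X c)) (Gpd ?X c)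
       (compF (prodC (prodC (Gpd ?X c) (Gpd ?X c)) (Gpd ?X c)) (Cpt (Mul M) c) (prodF (prodC (Gpd ?X c) (Gpd ?X c)) (Gpd ?X
           c) (Cpt (Mul M) c) (idF (Gpd ?X c))))
       (compF (prodC (prodC (Gpd ?X c) (Gpd ?X c)) (Gpd ?X c)) (Cpt (Mul M) c)
         (compF (prodC (prodC (Gpd ?X c) (Gpd ?X c)) (Gpd ?X c)) (prodF (Gpd ?X c) (prodC (Gpd ?X c) (Gpd ?X c)) (idF (Gpd ?X
             c)) (Cpt (Mul M) c)) (assocF (Gpd ?X c) (Gpd ?X c) (Gpd ?X c)))) (AscM M c)"
      using modification_rules(2)[OF mA c] c by simp
    \<comment> \<open>The unit law of a level inserts the unit object directly, whereas the
      modification inserts the point and then applies \<open>Uni\<close>. The equations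
      \<open>eL\<close> and \<open>eR\<close> identify the two composites.\<close>
    have eL: "compF (Gpd ?X c) (prodF oneC (Gpd ?X c) (Cpt (Uni M) c) (idF (Gpd ?X c))) (insLF (Gpd ?X c) oneC ()) =
       insLF (Gpd ?X c) (Gpd ?X c) (fo (Cpt (Uni M) c) ())"
      by (rule ftr_eqI[of _ "Obj (Gpd ?X c)" _ "Arr (Gpd ?X c)"]) (simp_all add: insF_ext u)
    have eR: "compF (Gpd ?X c) (prodF (Gpd ?X c) oneC (idF (Gpd ?X c)) (Cpt (Uni M) c)) (insRF (Gpd ?X c) oneC ()) =
       insRF (Gpd ?X c) (Gpd ?X c) (fo (Cpt (Uni M) c) ())"
      by (rule ftr_eqI[of _ "Obj (Gpd ?X c)" _ "Arr (Gpd ?X c)"]) (simp_all add: insF_ext u)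
    have nL: "nat_iso (Gpd ?X c) (Gpd ?X c) (compF (Gpd ?X c) (Cpt (Mul M) c) (insLF (Gpd ?X c) (Gpd ?X c) (fo (Cpt (Uni M)
        c) ()))) (idF (Gpd ?X c)) (LUnM M c)"
      using modification_rules(2)[OF mL c] c by (simp add: eL)
    have nR: "nat_iso (Gpd ?X c) (Gpd ?X c) (compF (Gpd ?X c) (Cpt (Mul M) c) (insRF (Gpd ?X c) (Gpd ?X c) (fo (Cpt (Uni M)
        c) ()))) (idF (Gpd ?X c)) (RUnM M c)"
      using modification_rules(2)[OF mR c] c by (simp add: eR)
    note r = shape[OF c] lt(2-5) bf AscM[OF c, unfolded in_hom] LUnM[OF c, unfolded in_hom] RUnM[OF c, unfolded in_hom] Base
    have "pentagon (level M c)"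
      unfolding pentagon_def Let_def level_simps
    proof (intro ballI)
      fix w x y z assume o: "w \<in> Obj (Gpd ?X c)" "x \<in> Obj (Gpd ?X c)" "y \<in> Obj (Gpd ?X c)" "z \<in> Obj (Gpd ?X c)"
      \<comment> \<open>On shapes the equation is the pentagon of \<open>N\<close> at the shapes of
        the four objects, and shapes are faithful.\<close>
      have "sho S w \<in> Obj (MC N)" "sho S x \<in> Obj (MC N)" "sho S y \<in> Obj (MC N)" "sho S z \<in> Obj (MC N)"
        using o shape(1)[OF c] by (simp_all add: Base)
      with m(10) have pe: "Cmp (MC N) (Asc N ((sho S w, sho S x), fo (Ten N) (sho S y, sho S z))) (Asc N ((fo (Ten N) (sho S
          w, sho S x), sho S y), sho S z)) =
         Cmp (MC N) (Cmp (MC N) (fa (Ten N) (Id (MC N) (sho S w), Asc N ((sho S x, sho S y), sho S z))) (Asc N ((sho S w, fo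
             (Ten N) (sho S x, sho S y)), sho S z)))
           (fa (Ten N) (Asc N ((sho S w, sho S x), sho S y), Id (MC N) (sho S z)))"
        unfolding pentagon_def Let_def by blast
      show "Cmp (Gpd ?X c) (AscM M c ((w, x), fo (Cpt (Mul M) c) (y, z))) (AscM M c ((fo (Cpt (Mul M) c) (w, x), y), z)) =
         Cmp (Gpd ?X c) (Cmp (Gpd ?X c) (fa (Cpt (Mul M) c) (Id (Gpd ?X c) w, AscM M c ((x, y), z))) (AscM M c ((w, fo (Cpt
             (Mul M) c) (x, y)), z)))
           (fa (Cpt (Mul M) c) (AscM M c ((w, x), y), Id (Gpd ?X c) z))"
        by (rule shape_eqI[OF c]) (use o pe Gc m(1) in \<open>simp_all add: r del: category_rules(11)\<close>)
    qed
    moreover have "triangle (level M c)"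
      unfolding triangle_def Let_def level_simps
    proof (intro ballI)
      fix x y assume o: "x \<in> Obj (Gpd ?X c)" "y \<in> Obj (Gpd ?X c)"
      have "sho S x \<in> Obj (MC N)" "sho S y \<in> Obj (MC N)" using o shape(1)[OF c] by (simp_all add: Base)
      with m(11) have tr: "Cmp (MC N) (fa (Ten N) (Id (MC N) (sho S x), LUn N (sho S y))) (Asc N ((sho S x, One N), sho S y))
          = fa (Ten N) (RUn N (sho S x), Id (MC N) (sho S y))"
        unfolding triangle_def Let_def by blast
      show "Cmp (Gpd ?X c) (fa (Cpt (Mul M) c) (Id (Gpd ?X c) x, LUnM M c y)) (AscM M c ((x, fo (Cpt (Uni M) c) ()), y)) = fa
          (Cpt (Mul M) c) (RUnM M c x, Id (Gpd ?X c) y)"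
        by (rule shape_eqI[OF c]) (use o tr Gc m(1) in \<open>simp_all add: r\<close>)
    qed
    ultimately show ?thesis
      unfolding monoidal_category_def Let_def level_simps using Gc lt(1,2) nA nL nR by blast
  qed
  then show ?thesis
    unfolding monoidal_psh_def Let_def using pseudofunctor psMul psUni mA mL mR by blast
qed

end

text \<open>The transfer used in \<open>monoidal_psh\<close>, now for maps: the structure maps have
  those of \<open>\<phi>\<close> as shapes, so the modification squares come from naturality of
  \<open>F2 \<phi>\<close> and the coherence laws from those of \<open>\<phi>\<close>.\<close>

lemma lifted_monoidal_pnt:
  assumes "lifted_monoidal C M S N" "lifted_monoidal C M' S' N'"
    and F: "lifted_map C (Und M) S (Und M') S' (SF \<phi>) (MF \<Phi>)" and \<phi>: "strong_monoidal N N' \<phi>"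
    and ext: "M2 \<Phi> \<in> extensional (Obj C)" "M0 \<Phi> \<in> extensional (Obj C)"
       "\<And>c. c \<in> Obj C \<Longrightarrow> M2 \<Phi> c \<in> extensional (Obj (Gpd (Und M) c) \<times> Obj (Gpd (Und M) c))"
    and M2: "\<And>c x y. c \<in> Obj C \<Longrightarrow> x \<in> Obj (Gpd (Und M) c) \<Longrightarrow> y \<in> Obj (Gpd (Und M) c) \<Longrightarrow>
       M2 \<Phi> c (x, y) \<in> hom (Gpd (Und M') c) (fo (Cpt (Mul M') c) (fo (Cpt (MF \<Phi>) c) x, fo (Cpt (MF \<Phi>) c) y))
         (fo (Cpt (MF \<Phi>) c) (fo (Cpt (Mul M) c) (x, y))) \<and> sha S' (M2 \<Phi> c (x, y)) = F2 \<phi> (sho S x, sho S y)"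
    and M0: "\<And>c. c \<in> Obj C \<Longrightarrow> M0 \<Phi> c () \<in> hom (Gpd (Und M') c) (fo (Cpt (Uni M') c) ()) (fo (Cpt (MF \<Phi>) c) (fo (Cpt (Uni M) c)
        ())) \<and> sha S' (M0 \<Phi> c ()) = F0 \<phi>"
  shows "monoidal_pnt C M M' \<Phi>"
proof -
  interpret X: lifted_monoidal C M S N by fact
  interpret Y: lifted_monoidal C M' S' N' by fact
  let ?X = "Und M" let ?Y = "Und M'" let ?X2 = "prodX C ?X ?X"
  note l1 = X.lifted_self and l2 = lifted_prodX[OF X.lifted_self X.lifted_self] and lo = lifted_oneX[OF X.category_C]
    and k1 = Y.lifted_self and k2 = lifted_prodX[OF Y.lifted_self Y.lifted_self]
  have pn: "pseudonatural C ?X ?Y (MF \<Phi>)" by (rule lifted_map_pseudonatural[OF l1 k1 F])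
  note s = strong_monoidal_rules[OF \<phi>]
  note f = functor_rules[OF s(1)] and m = monoidal_category_rules[OF X.N] and m' = monoidal_category_rules[OF Y.N]
  note b = bifunctor_rules[OF m(2)] bifunctor_rules[OF m'(2)]
  have mod2: "modification C ?X2 ?Y (compP C ?X2 ?Y (Mul M') (prodP C ?X ?X (MF \<Phi>) (MF \<Phi>))) (compP C ?X2 ?Y (MF \<Phi>) (Mul M))
      (M2 \<Phi>)"
    by (rule lifted_modification[OF l2 k1 lifted_map_compP[OF l2 k2 k1 lifted_map_prodP[OF l1 l1 F F] Y.Mul]
        lifted_map_compP[OF l2 l1 k1 X.Mul F], of "F2 \<phi>"])
      (use ext M2 s(2,3) X.category_C in \<open>auto simp: in_hom X.Base Y.Base f b\<close>)
  \<comment> \<open>Over the one-object base a natural family is a single arrow, here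
    \<open>F0 \<phi>\<close>.\<close>
  have mod0: "modification C oneX ?Y (Uni M') (compP C oneX ?Y (MF \<Phi>) (Uni M)) (M0 \<Phi>)"
    by (rule lifted_modification[OF lo k1 Y.Uni lifted_map_compP[OF lo l1 k1 X.Uni F], of "\<lambda>_. F0 \<phi>"])
      (use ext M0 s(5-7) f m m' X.category_C in \<open>auto simp: in_hom X.Base Y.Base extensional_def\<close>)
  have "strong_monoidal (level M c) (level M' c) (levelF \<Phi> c)" if c: "c \<in> Obj C" for c
  proof -
    note lt = X.level_typing[OF c] and lt' = Y.level_typing[OF c]
    have fu: "is_functor (Gpd ?X c) (Gpd ?Y c) (Cpt (MF \<Phi>) c)" by (rule pseudonatural_rules(3)[OF pn c])
    note r = functor_rules[OF fu] X.shape[OF c] Y.shape[OF c] lt(2-5) lt'(2-5) bifunctor_rules(1-6)[OF lt(1)]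
        bifunctor_rules(1-6)[OF lt'(1)]
      X.AscM[OF c, unfolded in_hom] X.LUnM[OF c, unfolded in_hom] X.RUnM[OF c, unfolded in_hom] Y.AscM[OF c, unfolded in_hom]
          Y.LUnM[OF c, unfolded in_hom] Y.RUnM[OF c, unfolded in_hom]
      X.Base Y.Base M2[OF c, unfolded in_hom] M0[OF c, unfolded in_hom] lifted_map_rules(7,11)[OF F c]
    have nI: "nat_iso (prodC (Gpd ?X c) (Gpd ?X c)) (Gpd ?Y c)
      (compF (prodC (Gpd ?X c) (Gpd ?X c)) (Cpt (Mul M') c) (prodF (Gpd ?X c) (Gpd ?X c) (Cpt (MF \<Phi>) c) (Cpt (MF \<Phi>) c)))
      (compF (prodC (Gpd ?X c) (Gpd ?X c)) (Cpt (MF \<Phi>) c) (Cpt (Mul M) c)) (M2 \<Phi> c)"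
      using modification_rules(2)[OF mod2 c] c by simp
    show ?thesis unfolding strong_monoidal_def Let_def level_simps levelF_simps
    proof (intro conjI ballI)
      show "M0 \<Phi> c () \<in> hom (Gpd ?Y c) (fo (Cpt (Uni M') c) ()) (fo (Cpt (MF \<Phi>) c) (fo (Cpt (Uni M) c) ()))" using M0[OF c]
          by blast
      then show "iso (Gpd ?Y c) (M0 \<Phi> c ())" using Y.groupoid_Gpd[OF c] by (simp add: in_hom)
    next
      fix x y z assume o: "x \<in> Obj (Gpd ?X c)" "y \<in> Obj (Gpd ?X c)" "z \<in> Obj (Gpd ?X c)"
      have o': "sho S x \<in> Obj (MC N)" "sho S y \<in> Obj (MC N)" "sho S z \<in> Obj (MC N)" using o X.shape(1)[OF c] by (simp_all
          add: X.Base)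
      show "Cmp (Gpd ?Y c) (Cmp (Gpd ?Y c) (fa (Cpt (MF \<Phi>) c) (AscM M c ((x, y), z))) (M2 \<Phi> c (fo (Cpt (Mul M) c) (x, y),
          z)))
           (fa (Cpt (Mul M') c) (M2 \<Phi> c (x, y), Id (Gpd ?Y c) (fo (Cpt (MF \<Phi>) c) z))) =
         Cmp (Gpd ?Y c) (Cmp (Gpd ?Y c) (M2 \<Phi> c (x, fo (Cpt (Mul M) c) (y, z))) (fa (Cpt (Mul M') c) (Id (Gpd ?Y c) (fo (Cpt
             (MF \<Phi>) c) x), M2 \<Phi> c (y, z))))
           (AscM M' c ((fo (Cpt (MF \<Phi>) c) x, fo (Cpt (MF \<Phi>) c) y), fo (Cpt (MF \<Phi>) c) z))"
        by (rule Y.shape_eqI[OF c]) (use o s(9)[OF o'] in \<open>simp_all add: r del: category_rules(11)\<close>)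
    next
      fix x assume o: "x \<in> Obj (Gpd ?X c)"
      have o': "sho S x \<in> Obj (MC N)" using o X.shape(1)[OF c] by (simp add: X.Base)
      show "Cmp (Gpd ?Y c) (Cmp (Gpd ?Y c) (fa (Cpt (MF \<Phi>) c) (LUnM M c x)) (M2 \<Phi> c (fo (Cpt (Uni M) c) (), x)))
           (fa (Cpt (Mul M') c) (M0 \<Phi> c (), Id (Gpd ?Y c) (fo (Cpt (MF \<Phi>) c) x))) = LUnM M' c (fo (Cpt (MF \<Phi>) c) x)"
        by (rule Y.shape_eqI[OF c]) (use o s(10)[OF o'] in \<open>simp_all add: r del: category_rules(11)\<close>)
      show "Cmp (Gpd ?Y c) (Cmp (Gpd ?Y c) (fa (Cpt (MF \<Phi>) c) (RUnM M c x)) (M2 \<Phi> c (x, fo (Cpt (Uni M) c) ())))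
           (fa (Cpt (Mul M') c) (Id (Gpd ?Y c) (fo (Cpt (MF \<Phi>) c) x), M0 \<Phi> c ())) = RUnM M' c (fo (Cpt (MF \<Phi>) c) x)"
        by (rule Y.shape_eqI[OF c]) (use o s(11)[OF o'] in \<open>simp_all add: r del: category_rules(11)\<close>)
    qed (use fu nI in auto)
  qed
  then show ?thesis unfolding monoidal_pnt_def Let_def using pn mod2 mod0 by blast
qed

section \<open>The simplex category\<close>

lemma Simp_simps:
  "Obj Simp = UNIV"
  "(m, a, n) \<in> Arr Simp \<longleftrightarrow> a \<in> {0..m} \<rightarrow>\<^sub>E {0..n} \<and> mono_on {0..m} a"
  "Dom Simp (m, a, n) = m" "Cod Simp (m, a, n) = n"
  "Id Simp n = (n, \<lambda>i \<in> {0..n}. i, n)"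
  "Cmp Simp (m', b, n) (l, a, m) = (l, compose {0..l} b a, n)"
  by (auto simp: Simp_def mk_cat_simps)

lemma category_Simp: "category Simp"
  unfolding Simp_def
proof (rule category_mk_cat, goal_cases)
  case (1 x) then show ?case by (auto simp: mono_on_def)
next
  case (2 x y z f g) then show ?case
    by (auto simp: mono_on_def compose_def PiE_iff Pi_iff extensional_def)
next
  case (3 x y f) then show ?case
    by (auto simp: compose_def PiE_iff fun_eq_iff extensional_def)
next
  case (4 x y z w f g h) then show ?case
    by (auto simp: compose_def PiE_iff fun_eq_iff)
qed

text \<open>Each step raises the value by at least one, starting from a value that is at least
  \<open>0\<close>. This is the rigidity of finite linear orders.\<close>

lemma mono_on_ge_self:
  fixes a :: "nat \<Rightarrow> nat"
  assumes "mono_on {0..m} a" "inj_on a {0..m}" "i \<le> m"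
  shows "i \<le> a i"
  using assms(3)
proof (induction i)
  case (Suc i)
  have "a i \<le> a (Suc i)" using assms(1) Suc.prems by (auto simp: mono_on_def)
  moreover have "a i \<noteq> a (Suc i)" using assms(2) Suc.prems by (auto dest: inj_onD)
  ultimately show ?case using Suc by auto
qed simp

text \<open>The map \<open>a\<close> and its inverse \<open>b\<close> are injective and monotone, so
  \<open>i \<le> a i\<close> and \<open>a i \<le> b (a i) = i\<close>. Hence objects defined by a
  universal property in the simplex category are unique on the nose.\<close>

lemma iso_Simp:
  assumes "(m, a, n) \<in> Arr Simp" "(n, b, m) \<in> Arr Simp"
    and "Cmp Simp (n, b, m) (m, a, n) = Id Simp m" "Cmp Simp (m, a, n) (n, b, m) = Id Simp n"
  shows "(m, a, n) = Id Simp m"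
proof -
  have "compose {0..m} b a = (\<lambda>i\<in>{0..m}. i)" "compose {0..n} a b = (\<lambda>i\<in>{0..n}. i)"
    using assms(3,4) by (simp_all add: Simp_simps)
  from fun_cong[OF this(1)] fun_cong[OF this(2)] have ba: "\<And>i. i \<le> m \<Longrightarrow> b (a i) = i" and ab: "\<And>i. i \<le> n \<Longrightarrow> a (b i) = i"
    by (auto simp: compose_def restrict_def split: if_splits) (metis atLeastAtMost_iff le0)+
  have inj: "inj_on a {0..m}" "inj_on b {0..n}" using ba ab by (metis atLeastAtMost_iff inj_onI)+
  have ty: "a i \<le> n" if "i \<le> m" for i using assms(1) that by (auto simp: Simp_simps PiE_iff)
  have ty': "b i \<le> m" if "i \<le> n" for i using assms(2) that by (auto simp: Simp_simps PiE_iff)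
  have a_id: "a i = i" if "i \<le> m" for i
  proof -
    have "i \<le> a i" using mono_on_ge_self[of m a] assms(1) inj that by (simp add: Simp_simps)
    moreover have "a i \<le> b (a i)" using mono_on_ge_self[of n b] assms(2) inj ty[OF that] by (simp add: Simp_simps)
    ultimately show ?thesis using ba[OF that] by simp
  qed
  have "b n \<ge> n" using mono_on_ge_self[of n b] assms(2) inj by (simp add: Simp_simps)
  then have "n = m" using a_id[of m] ty[of m] ty'[of n] by simp
  moreover have "a = (\<lambda>i\<in>{0..m}. i)"
    using a_id assms(1) by (auto simp: Simp_simps PiE_iff extensional_def fun_eq_iff)
  ultimately show ?thesis by (simp add: Simp_simps)
qed

text \<open>The block of the source that contains layer \<open>j\<close> of the target: the joint
  effect of \<open>under_free\<close> on the free part and \<open>under_generic\<close> on the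
  generic part of an arbitrary arrow. It is meaningful for \<open>a 0 < j\<close> and
  \<open>j \<le> a m\<close>, the layers that survive the restriction.\<close>

definition idx :: "simp_arr \<Rightarrow> nat \<Rightarrow> nat" where
  "idx = (\<lambda>(m, a, n). \<lambda>j. THE i. i \<in> {1..m} \<and> a (i - 1) < j \<and> j \<le> a i)"

text \<open>The half-open blocks \<open>(a (i - 1), a i]\<close> partition
  \<open>(a 0, a m]\<close>; the block of \<open>j\<close> is the least \<open>i\<close> with
  \<open>j \<le> a i\<close>.\<close>

lemma ex_idx:
  fixes a :: "nat \<Rightarrow> nat"
  assumes "mono_on {0..m} a" "a 0 < j" "j \<le> a m"
  shows "\<exists>!i. i \<in> {1..m} \<and> a (i - 1) < j \<and> j \<le> a i"
proof -
  define i where "i = (LEAST i. j \<le> a i)"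
  have j: "j \<le> a i" unfolding i_def using assms(3) by (rule LeastI)
  have im: "i \<le> m" unfolding i_def using assms(3) by (rule Least_le)
  \<comment> \<open>Positivity comes from \<open>a 0 < j\<close>, so that \<open>i - 1\<close> is a
    true predecessor.\<close>
  have i0: "i \<noteq> 0" using j assms(2) by (metis leD)
  have "\<not> j \<le> a (i - 1)" using not_less_Least[of "i - 1" "\<lambda>i. j \<le> a i"] i0 by (simp add: i_def)
  then have i: "i \<in> {1..m} \<and> a (i - 1) < j \<and> j \<le> a i" using j im i0 by auto
  have am: "a x \<le> a y" if "x \<le> y" "y \<le> m" for x y using assms(1) that by (auto simp: mono_on_def)
  have "k = i" if k: "k \<in> {1..m} \<and> a (k - 1) < j \<and> j \<le> a k" for k
  proof (rule ccontr)
    assume "k \<noteq> i"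
    then have "k \<le> i - 1 \<or> i \<le> k - 1" by linarith
    then have "a k \<le> a (i - 1) \<or> a i \<le> a (k - 1)"
      using i k am[of k "i - 1"] am[of i "k - 1"] by (meson atLeastAtMost_iff diff_le_self le_trans)
    then show False using i k by linarith
  qed
  then show ?thesis using i by blast
qed

lemma idx_props:
  assumes "(m, a, n) \<in> Arr Simp" "a 0 < j" "j \<le> a m"
  shows "idx (m, a, n) j \<in> {1..m}" "a (idx (m, a, n) j - 1) < j" "j \<le> a (idx (m, a, n) j)"
proof -
  have "mono_on {0..m} a" using assms(1) by (simp add: Simp_simps)
  from theI'[OF ex_idx[OF this assms(2,3)]] show "idx (m, a, n) j \<in> {1..m}" "a (idx (m, a, n) j - 1) < j" "j \<le> a (idx (m, a,
      n) j)"
    unfolding idx_def by auto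
qed

lemma idx_eqI:
  assumes "(m, a, n) \<in> Arr Simp" "i \<in> {1..m}" "a (i - 1) < j" "j \<le> a i"
  shows "idx (m, a, n) j = i"
proof -
  have mo: "mono_on {0..m} a" using assms(1) by (simp add: Simp_simps)
  have "a 0 \<le> a (i - 1)" "a i \<le> a m" using mo assms(2) by (auto simp: mono_on_def)
  then have "\<exists>!i. i \<in> {1..m} \<and> a (i - 1) < j \<and> j \<le> a i" using assms(3,4) by (intro ex_idx mo) auto
  then show ?thesis unfolding idx_def using assms by (auto intro!: the1_equality)
qed

lemma idx_Id: "0 < j \<Longrightarrow> j \<le> n \<Longrightarrow> idx (Id Simp n) j = j"
  unfolding Simp_simps by (rule idx_eqI) (auto simp: Simp_simps mono_on_def)

text \<open>Contravariant functoriality of \<open>idx\<close>. If \<open>i\<close> is the block of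
  \<open>j\<close> under \<open>b\<close> and \<open>k\<close> that of \<open>i\<close> under
  \<open>a\<close>, then applying \<open>b\<close> to \<open>a (k - 1) \<le> i - 1\<close> and to
  \<open>i \<le> a k\<close> encloses \<open>j\<close> in block \<open>k\<close> of the composite.
  The first two claims place \<open>i\<close> in the range where \<open>idx\<close> along
  \<open>a\<close> is meaningful.\<close>

lemma idx_comp:
  assumes a: "(l, a, m) \<in> Arr Simp" and b: "(m, b, n) \<in> Arr Simp" and j: "b (a 0) < j" "j \<le> b (a l)"
  shows "a 0 < idx (m, b, n) j" "idx (m, b, n) j \<le> a l" "idx (l, a, m) (idx (m, b, n) j) = idx (l, compose {0..l} b a, n) j"
proof -
  have mo: "mono_on {0..l} a" "mono_on {0..m} b" and ty: "\<And>i. i \<le> l \<Longrightarrow> a i \<le> m" using a b by (auto simp: Simp_simps PiE_iff)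
  have ba: "(l, compose {0..l} b a, n) \<in> Arr Simp"
    using category_rules(6)[OF category_Simp a b] by (simp add: Simp_simps)
  have "b 0 \<le> b (a 0)" "b (a l) \<le> b m" using mo ty by (auto simp: mono_on_def)
  then have i: "idx (m, b, n) j \<in> {1..m}" "b (idx (m, b, n) j - 1) < j" "j \<le> b (idx (m, b, n) j)"
    using idx_props[OF b, of j] j by auto
  have bm: "b x \<le> b y" if "x \<le> y" "y \<le> m" for x y using mo that by (auto simp: mono_on_def)
  let ?i = "idx (m, b, n) j"
  show a0: "a 0 < ?i"
  proof (rule ccontr)
    assume "\<not> a 0 < ?i"
    then have "b ?i \<le> b (a 0)" using bm[of ?i "a 0"] ty[of 0] by simp
    then show False using i j by simp
  qed
  show al: "?i \<le> a l"
  proof (rule ccontr)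
    assume "\<not> ?i \<le> a l"
    then have "b (a l) \<le> b (?i - 1)" using bm[of "a l" "?i - 1"] i(1) by simp
    then show False using i j by simp
  qed
  let ?k = "idx (l, a, m) ?i"
  note k = idx_props[OF a a0 al]
  have kl: "?k \<le> l" using k by simp
  have "b (a (?k - 1)) \<le> b (?i - 1)" using bm[of "a (?k - 1)" "?i - 1"] k i(1) by simp
  moreover have "b ?i \<le> b (a ?k)" using bm[of ?i "a ?k"] k ty[OF kl] by simp
  ultimately show "?k = idx (l, compose {0..l} b a, n) j"
    using i k kl by (intro idx_eqI[OF ba, symmetric]) (auto simp: compose_def)
qed

text \<open>The pushout is \<open>[k]\<close> with its interval from \<open>c\<close> to
  \<open>c + n\<close> replaced by \<open>[m]\<close>. \<open>F'\<close> includes the new interval;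
  \<open>G'\<close> is the identity up to \<open>c\<close>, a shifted copy of \<open>g\<close> on
  the interval, and a shift by \<open>m - n\<close> beyond it. Written as \<open>i + m - n\<close>
  and \<open>k + m - n\<close>, the natural subtraction is exact, since \<open>n \<le> i\<close> in
  that branch and \<open>n \<le> k\<close>.\<close>

lemma pushout_generic_free:
  assumes g: "generic (n, g, m)" and f: "free (n, f, k)"
  defines "c \<equiv> f 0" and "l \<equiv> k + m - n"
  defines "F' \<equiv> (m, \<lambda>j \<in> {0..m}. j + c, l)"
    and "G' \<equiv> (k, \<lambda>i \<in> {0..k}. if i \<le> c then i else if i \<le> c + n then c + g (i - c) else i + m - n, l)"
  shows "c + n \<le> k" "\<forall>i \<le> n. f i = i + c" "pushout Simp (n, g, m) (n, f, k) F' G'"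
proof -
  have ga: "(n, g, m) \<in> Arr Simp" "g 0 = 0" "g n = m" and fa: "(n, f, k) \<in> Arr Simp" "\<And>i. i < n \<Longrightarrow> f (i + 1) = f i + 1"
    using g f by (auto simp: generic_def free_def)
  have fi: "f i = i + c" if "i \<le> n" for i
    using that by (induction i) (auto simp: c_def fa(2)[unfolded Suc_eq_plus1[symmetric]])
  then show "\<forall>i \<le> n. f i = i + c" by blast
  have "f n \<le> k" using fa(1) by (simp add: Simp_simps PiE_iff)
  then show ck: "c + n \<le> k" using fi[of n] by simp
  have gm: "g i \<le> g j" if "i \<le> j" "j \<le> n" for i j using ga(1) that by (auto simp: Simp_simps mono_on_def)
  have gle: "g i \<le> m" if "i \<le> n" for i using gm[OF that] ga by simp
  have gle': "g (i - c) \<le> m" if "i \<le> c + n" for i using gle[of "i - c"] that by simp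
  define G where "G = (\<lambda>i \<in> {0..k}. if i \<le> c then i else if i \<le> c + n then c + g (i - c) else i + m - n)"
  define F where "F = (\<lambda>j \<in> {0..m}. j + c)"
  have FG: "F' = (m, F, l)" "G' = (k, G, l)" unfolding F'_def G'_def F_def G_def by auto
  have Fa: "(m, F, l) \<in> Arr Simp" using ck by (auto simp: Simp_simps F_def l_def mono_on_def)
  have "G i \<le> G j" if "i \<le> j" "j \<le> k" for i j
    using that ck gm[of "i - c" "j - c"] gle' by (fastforce simp: G_def)
  moreover have "G i \<le> l" if "i \<le> k" for i
    using that ck gle' by (fastforce simp: G_def l_def)
  ultimately have Ga: "(k, G, l) \<in> Arr Simp" by (auto simp: Simp_simps mono_on_def G_def[symmetric] PiE_iff) (auto simp:
      G_def)
  have com: "Cmp Simp (m, F, l) (n, g, m) = Cmp Simp (k, G, l) (n, f, k)"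
    using fi ck gle ga(2) by (auto simp: Simp_simps compose_def F_def G_def fun_eq_iff restrict_def)
  show "pushout Simp (n, g, m) (n, f, k) F' G'"
    unfolding pushout_def FG
  proof (intro conjI ballI impI)
    fix h \<kappa> assume h0: "h \<in> Arr Simp" and \<kappa>0: "\<kappa> \<in> Arr Simp"
      and e: "Dom Simp h = Cod Simp (n, g, m) \<and> Dom Simp \<kappa> = Cod Simp (n, f, k) \<and> Cod Simp h = Cod Simp \<kappa> \<and>
        Cmp Simp h (n, g, m) = Cmp Simp \<kappa> (n, f, k)"
    obtain h' r where h: "h = (m, h', r)" using e by (cases h) (auto simp: Simp_simps)
    obtain \<kappa>' where \<kappa>: "\<kappa> = (k, \<kappa>', r)" using e by (cases \<kappa>) (auto simp: Simp_simps h)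
    have hm: "\<And>i j. i \<le> j \<Longrightarrow> j \<le> m \<Longrightarrow> h' i \<le> h' j" "\<And>j. j \<le> m \<Longrightarrow> h' j \<le> r" and he: "h' \<in> extensional {0..m}"
      using h0 by (auto simp: h Simp_simps mono_on_def PiE_iff)
    have km: "\<And>i j. i \<le> j \<Longrightarrow> j \<le> k \<Longrightarrow> \<kappa>' i \<le> \<kappa>' j" "\<And>j. j \<le> k \<Longrightarrow> \<kappa>' j \<le> r" and ke: "\<kappa>' \<in> extensional {0..k}"
      using \<kappa>0 by (auto simp: \<kappa> Simp_simps mono_on_def PiE_iff)
    have hk: "h' (g i) = \<kappa>' (i + c)" if "i \<le> n" for i
    proof -
      have "compose {0..n} h' g i = compose {0..n} \<kappa>' f i" using e by (simp add: h \<kappa> Simp_simps)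
      then show ?thesis using that fi by (simp add: compose_def)
    qed
    \<comment> \<open>The given maps agree at the two ends of the interval, so the three pieces of
      \<open>t\<close> fit together at \<open>c\<close> and \<open>c + m\<close>.\<close>
    have hk0: "\<kappa>' c = h' 0" and hkn: "\<kappa>' (c + n) = h' m" using hk[of 0] hk[of n] ga by (simp_all add: add.commute)
    define t where "t = (\<lambda>s \<in> {0..l}. if s \<le> c then \<kappa>' s else if s \<le> c + m then h' (s - c) else \<kappa>' (s + n - m))"
    have tm: "t s \<le> t s'" if "s \<le> s'" "s' \<le> l" for s s'
    proof -
      \<comment> \<open>The cases record the positions of \<open>s\<close> and \<open>s'\<close>
        relative to the two seams. Monotonicity across a seam passes through the common value
        there.\<close>
      consider "s' \<le> c" | "s \<le> c" "c < s'" "s' \<le> c + m" | "s \<le> c" "c + m < s'" | "c < s" "s' \<le> c + m"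
        | "c < s" "s \<le> c + m" "c + m < s'" | "c + m < s" using that by linarith
      then show ?thesis
      proof cases
        case 1 then show ?thesis using that km ck by (simp add: t_def l_def)
      next
        case 2
        then have "\<kappa>' s \<le> \<kappa>' c" "h' 0 \<le> h' (s' - c)" using km(1) hm(1) ck by auto
        then show ?thesis using 2 that hk0 by (simp add: t_def)
      next
        case 3
        then have "\<kappa>' s \<le> \<kappa>' (s' + n - m)" using km(1) that ck by (intro km(1)) (auto simp: l_def)
        then show ?thesis using 3 that by (simp add: t_def)
      next
        case 4 then show ?thesis using that hm by (simp add: t_def)
      next
        case 5
        have "h' (s - c) \<le> h' m" "\<kappa>' (c + n) \<le> \<kappa>' (s' + n - m)" using 5 that ck by (auto simp: l_def intro!: hm(1) km(1))
        then show ?thesis using 5 that hkn by (simp add: t_def)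
      next
        case 6
        have "\<kappa>' (s + n - m) \<le> \<kappa>' (s' + n - m)" using 6 that ck by (intro km(1)) (auto simp: l_def)
        then show ?thesis using 6 that by (simp add: t_def)
      qed
    qed
    have tr: "t s \<le> r" if "s \<le> l" for s
      using that ck km(2)[of s] hm(2)[of "s - c"] km(2)[of "s + n - m"] by (auto simp: t_def l_def)
    have ta: "(l, t, r) \<in> Arr Simp" using tm tr by (auto simp: Simp_simps mono_on_def PiE_iff) (auto simp: t_def)
    have tF: "compose {0..m} t F = h'"
    proof
      fix j show "compose {0..m} t F j = h' j"
        using he hk0 ck by (cases "j \<le> m") (auto simp: compose_def F_def t_def l_def extensional_def)
    qed
    have tG: "compose {0..k} t G = \<kappa>'"
    proof
      fix i show "compose {0..k} t G i = \<kappa>' i"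
      proof (cases "i \<le> k")
        case True
        consider "i \<le> c" | "c < i" "i \<le> c + n" | "c + n < i" by linarith
        then show ?thesis
        proof cases
          case 1 then show ?thesis using True ck by (auto simp add: compose_def G_def t_def l_def)
        next
          case 2
          have "g (i - c) \<le> m" "h' (g (i - c)) = \<kappa>' i" using gle[of "i - c"] hk[of "i - c"] 2 by auto
          then show ?thesis using 2 True ck hk0 by (auto simp: compose_def G_def t_def l_def)
        next
          case 3
          then have "i + m - n + n - m = i" "\<not> i + m - n \<le> c + m" "\<not> i + m - n \<le> c" "i + m - n \<le> l"
            using True by (auto simp: l_def)
          then show ?thesis using 3 True by (simp add: compose_def G_def t_def)
        qed
      qed (use ke in \<open>auto simp: compose_def extensional_def\<close>)
    qed
    show "\<exists>!t. t \<in> hom Simp (Cod Simp (m, F, l)) (Cod Simp h) \<and> Cmp Simp t (m, F, l) = h \<and> Cmp Simp t (k, G, l) = \<kappa>"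
    proof (rule ex1I[of _ "(l, t, r)"])
      show "(l, t, r) \<in> hom Simp (Cod Simp (m, F, l)) (Cod Simp h) \<and> Cmp Simp (l, t, r) (m, F, l) = h \<and> Cmp Simp (l, t, r)
          (k, G, l) = \<kappa>"
        using ta tF tG by (simp add: in_hom Simp_simps(3-) h \<kappa>)
    next
      fix t0 assume t0: "t0 \<in> hom Simp (Cod Simp (m, F, l)) (Cod Simp h) \<and> Cmp Simp t0 (m, F, l) = h \<and> Cmp Simp t0 (k, G, l)
          = \<kappa>"
      then obtain u where u: "t0 = (l, u, r)" by (cases t0) (auto simp: in_hom Simp_simps h)
      \<comment> \<open>\<open>F\<close> covers the interval from \<open>c\<close> to
        \<open>c + m\<close> and \<open>G\<close> the points outside it, so the two equations
        determine \<open>u\<close> on all of \<open>{0..l}\<close>.\<close>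
      have uF: "u (j + c) = h' j" if "j \<le> m" for j
        using t0 that by (auto simp: u h Simp_simps compose_def F_def fun_eq_iff restrict_def split: if_splits)
      have uG: "u (G i) = \<kappa>' i" if "i \<le> k" for i
        using t0 that by (auto simp: u \<kappa> Simp_simps compose_def fun_eq_iff restrict_def split: if_splits)
      have "u s = t s" for s
      proof (cases "s \<le> l")
        case True
        consider "s \<le> c" | "c < s" "s \<le> c + m" | "c + m < s" by linarith
        then show ?thesis
        proof cases
          case 1 then show ?thesis using uG[of s] True ck by (simp add: G_def t_def)
        next
          case 2 then show ?thesis using uF[of "s - c"] True by (simp add: t_def)
        next
          case 3
          then have "s + n - m + m - n = s" "\<not> s + n - m \<le> c + n" "\<not> s + n - m \<le> c" "s + n - m \<le> k" "\<not> s \<le> c"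
            using True ck by (auto simp: l_def)
          then show ?thesis using uG[of "s + n - m"] 3 True by (simp add: G_def t_def)
        qed
      next
        case False
        then show ?thesis using t0 by (auto simp: u in_hom Simp_simps PiE_iff extensional_def t_def)
      qed
      then show "t0 = (l, t, r)" by (simp add: u fun_eq_iff)
    qed
  qed (use ga fa Fa Ga com in \<open>simp_all add: Simp_simps(3,4)\<close>)
qed

lemma ex1_eq: "\<exists>!x. P x \<Longrightarrow> P a \<Longrightarrow> P b \<Longrightarrow> a = b"
  by blast

text \<open>Two pushouts of the same pair are connected by mutually inverse arrows, which are
  identities by \<open>iso_Simp\<close>. The explicit square therefore represents every pushout in
  the definition of a decomposition space.\<close>

lemma pushout_Simp_unique:
  assumes p: "pushout Simp g f f' g'" and q: "pushout Simp g f f'' g''"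
  shows "f' = f'' \<and> g' = g''"
proof -
  note C = category_Simp
  have p': "f' \<in> Arr Simp" "g' \<in> Arr Simp" "Dom Simp f' = Cod Simp g" "Dom Simp g' = Cod Simp f" "Cod Simp f' = Cod Simp g'"
      "Cmp Simp f' g = Cmp Simp g' f"
    and q': "f'' \<in> Arr Simp" "g'' \<in> Arr Simp" "Dom Simp f'' = Cod Simp g" "Dom Simp g'' = Cod Simp f" "Cod Simp f'' = Cod
        Simp g''" "Cmp Simp f'' g = Cmp Simp g'' f"
    using p q by (auto simp: pushout_def)
  have pu: "\<exists>!t. t \<in> hom Simp (Cod Simp f') (Cod Simp h) \<and> Cmp Simp t f' = h \<and> Cmp Simp t g' = k"
    if "h \<in> Arr Simp" "k \<in> Arr Simp" "Dom Simp h = Cod Simp g" "Dom Simp k = Cod Simp f" "Cod Simp h = Cod Simp k" "Cmp Simp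
        h g = Cmp Simp k f" for h k
    using p that unfolding pushout_def by blast
  have qu: "\<exists>!t. t \<in> hom Simp (Cod Simp f'') (Cod Simp h) \<and> Cmp Simp t f'' = h \<and> Cmp Simp t g'' = k"
    if "h \<in> Arr Simp" "k \<in> Arr Simp" "Dom Simp h = Cod Simp g" "Dom Simp k = Cod Simp f" "Cod Simp h = Cod Simp k" "Cmp Simp
        h g = Cmp Simp k f" for h k
    using q that unfolding pushout_def by blast
  from pu[OF q'(1-6)] obtain t where t: "t \<in> Arr Simp" "Dom Simp t = Cod Simp f'" "Cod Simp t = Cod Simp f''" "Cmp Simp t f'
      = f''" "Cmp Simp t g' = g''"
    unfolding in_hom by blast
  from qu[OF p'(1-6)] obtain s where s: "s \<in> Arr Simp" "Dom Simp s = Cod Simp f''" "Cod Simp s = Cod Simp f'" "Cmp Simp s f''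
      = f'" "Cmp Simp s g'' = g'"
    unfolding in_hom by blast
  have "Cmp Simp (Cmp Simp s t) f' = f'" "Cmp Simp (Cmp Simp s t) g' = g'" "Cmp Simp (Cmp Simp t s) f'' = f''" "Cmp Simp (Cmp
      Simp t s) g'' = g''"
    using s t p' q' C by simp_all
  moreover have "Cmp Simp s t \<in> hom Simp (Cod Simp f') (Cod Simp f')" "Id Simp (Cod Simp f') \<in> hom Simp (Cod Simp f') (Cod
      Simp f')"
    "Cmp Simp t s \<in> hom Simp (Cod Simp f'') (Cod Simp f'')" "Id Simp (Cod Simp f'') \<in> hom Simp (Cod Simp f'') (Cod Simp f'')"
    using s t p' q' C by (simp_all add: in_hom)
  moreover have "Cmp Simp (Id Simp (Cod Simp f')) f' = f'" "Cmp Simp (Id Simp (Cod Simp f')) g' = g'" "Cmp Simp (Id Simp (Cod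
      Simp f'')) f'' = f''" "Cmp Simp (Id Simp (Cod Simp f'')) g'' = g''"
    using p' q' C by simp_all
  ultimately have st: "Cmp Simp s t = Id Simp (Cod Simp f')" "Cmp Simp t s = Id Simp (Cod Simp f'')"
    by (auto intro: ex1_eq[OF pu[OF p'(1-6)]] ex1_eq[OF qu[OF q'(1-6)]])
  obtain a b l l' where e: "t = (l, a, l')" "s = (l', b, l)" using s t p' q' by (cases s, cases t) (auto simp: Simp_simps)
  have "t = Id Simp l"
    using iso_Simp[of l a l' b] s(1) t(1-3) st s(2,3) by (simp add: e Simp_simps(3,4))
  then have "t = Id Simp (Cod Simp f')" using t(2) by (simp add: e Simp_simps)
  then show ?thesis using t p' C by simp
qed

section \<open>Restriction species\<close>

lemma FinInj_simps:
  "Obj FinInj = {A. finite A}"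
  "(A, f, B) \<in> Arr FinInj \<longleftrightarrow> finite A \<and> finite B \<and> f \<in> A \<rightarrow>\<^sub>E B \<and> inj_on f A"
  "Dom FinInj (A, f, B) = A" "Cod FinInj (A, f, B) = B"
  "Id FinInj A = (A, \<lambda>x \<in> A. x, A)"
  "Cmp FinInj (B', g, C) (A, f, B) = (A, compose A g f, C)"
  by (auto simp: FinInj_def mk_cat_simps)

lemma category_RSp: "category RSp"
  unfolding RSp_def
proof (rule category_mk_cat, goal_cases)
  case (1 R)
  then have P: "is_functor (Tot R) FinInj (Prj R)" by (simp add: restriction_species_def right_fibration_def)
  then show ?case by (simp add: rspecies_morphism_def functor_idF compF_idF functor_rules(1)[OF P])
next
  case (2 R S T F G)
  then show ?case using functor_compF[of "Tot R" "Tot S" F "Tot T" G]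
    compF_assoc[of "Tot R" "Tot S" F "Prj T" G]
    by (auto simp: rspecies_morphism_def)
next
  case (3 R S F) then show ?case
    using compF_idF[of "Tot R" "Tot S" F] idF_compF[of "Tot R" "Tot S" F] by (simp add: rspecies_morphism_def)
next
  case (4 R S T U F G H) then show ?case using compF_assoc[of "Tot R" "Tot S" F H G] by (simp add: rspecies_morphism_def)
qed

lemma category_MonRSp: "category MonRSp"
  unfolding MonRSp_def
proof (rule category_mk_cat, goal_cases)
  case (1 R)
  then have M: "monoidal_category (MTot R)" and R: "restriction_species (underlying_rspecies R)"
    by (simp_all add: monoidal_restriction_species_def)
  have P: "is_functor (MC (MTot R)) FinInj (SF (MPrj R))" using R by (simp add: restriction_species_def right_fibration_def
      underlying_rspecies_def)
  show ?case using strong_monoidal_id[OF M]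
    by (simp add: mrspecies_morphism_def rspecies_morphism_def underlying_rspecies_def functor_idF compF_idF[OF P]
        functor_rules(1)[OF P])
next
  case (2 R S T F G)
  then have m: "monoidal_category (MTot R)" "monoidal_category (MTot S)" "monoidal_category (MTot T)"
    by (simp_all add: monoidal_restriction_species_def)
  show ?case using 2(4,5) strong_monoidal_comp[OF m, of F G]
    compF_assoc[of "MC (MTot R)" "MC (MTot S)" "SF F" "SF (MPrj T)" "SF G"] functor_compF[of "MC (MTot R)" "MC (MTot S)" "SF
        F" "MC (MTot T)" "SF G"]
    by (auto simp: mrspecies_morphism_def rspecies_morphism_def underlying_rspecies_def)
next
  case (3 R S F) then show ?case
    by (simp add: mrspecies_morphism_def comp_smf_id monoidal_restriction_species_def)
next
  case (4 R S T U F G H) then show ?case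
    by (simp add: mrspecies_morphism_def comp_smf_assoc monoidal_restriction_species_def)
qed

abbreviation und :: "('a, 'o, 'm) rspecies \<Rightarrow> 'o \<Rightarrow> 'a elt set" where "und R X \<equiv> fo (Prj R) X"
abbreviation pm :: "('a, 'o, 'm) rspecies \<Rightarrow> 'm \<Rightarrow> 'a elt \<Rightarrow> 'a elt" where "pm R u \<equiv> map_of_inj (fa (Prj R) u)"

section \<open>Arrows of the total category of a restriction species\<close>

locale species =
  fixes R :: "('a, 'o, 'm) rspecies"
  assumes R: "restriction_species R"
begin

abbreviation "T \<equiv> Tot R"

lemma P: "is_functor T FinInj (Prj R)"
  using R by (simp add: restriction_species_def right_fibration_def)

lemma category_T: "category T"
  by (rule functor_rules(1)[OF P])

lemma finite_und: "X \<in> Obj T \<Longrightarrow> finite (und R X)"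
  using functor_rules(3)[OF P, of X] by (simp add: FinInj_simps)

lemma fa_P: "u \<in> Arr T \<Longrightarrow> fa (Prj R) u = (und R (Dom T u), pm R u, und R (Cod T u))"
  using functor_rules(5,6)[OF P, of u] by (cases "fa (Prj R) u") (auto simp: FinInj_simps)

lemma pm_arr:
  assumes "u \<in> Arr T"
  shows "pm R u \<in> und R (Dom T u) \<rightarrow>\<^sub>E und R (Cod T u)" "inj_on (pm R u) (und R (Dom T u))"
proof -
  have "(und R (Dom T u), pm R u, und R (Cod T u)) \<in> Arr FinInj"
    unfolding fa_P[OF assms, symmetric] by (rule functor_rules(4)[OF P assms])
  then show "pm R u \<in> und R (Dom T u) \<rightarrow>\<^sub>E und R (Cod T u)" "inj_on (pm R u) (und R (Dom T u))"
    by (simp_all only: FinInj_simps)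
qed

lemma pm_in: "u \<in> Arr T \<Longrightarrow> x \<in> und R (Dom T u) \<Longrightarrow> pm R u x \<in> und R (Cod T u)"
  using pm_arr(1) by blast

lemma pm_inj: "u \<in> Arr T \<Longrightarrow> x \<in> und R (Dom T u) \<Longrightarrow> y \<in> und R (Dom T u) \<Longrightarrow> pm R u x = pm R u y \<longleftrightarrow> x = y"
  using pm_arr(2) by (auto dest: inj_onD)

lemma pm_comp:
  assumes "u \<in> Arr T" "v \<in> Arr T" "Cod T u = Dom T v"
  shows "pm R (Cmp T v u) = compose (und R (Dom T u)) (pm R v) (pm R u)"
proof -
  have "fa (Prj R) (Cmp T v u) = Cmp FinInj (fa (Prj R) v) (fa (Prj R) u)" by (rule functor_rules(8)[OF P assms])
  also have "\<dots> = (und R (Dom T u), compose (und R (Dom T u)) (pm R v) (pm R u), und R (Cod T v))"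
    by (subst fa_P[OF assms(1)], subst fa_P[OF assms(2)]) (simp add: FinInj_simps)
  finally show ?thesis by simp
qed

lemma pm_comp_apply:
  assumes "u \<in> Arr T" "v \<in> Arr T" "Cod T u = Dom T v" "x \<in> und R (Dom T u)"
  shows "pm R (Cmp T v u) x = pm R v (pm R u x)"
  using pm_comp[OF assms(1-3)] assms(4) by (simp add: compose_def)

lemma pm_Id: "X \<in> Obj T \<Longrightarrow> x \<in> und R X \<Longrightarrow> pm R (Id T X) x = x"
  using functor_rules(7)[OF P, of X] by (simp add: FinInj_simps)

lemma fa_P_eqI:
  assumes "u \<in> Arr T" "v \<in> Arr T" "Dom T u = Dom T v" "Cod T u = Cod T v"
    "\<And>x. x \<in> und R (Dom T u) \<Longrightarrow> pm R u x = pm R v x"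
  shows "fa (Prj R) u = fa (Prj R) v"
proof -
  have "pm R u = pm R v"
    by (rule extensionalityI[of _ "und R (Dom T u)"]) (use pm_arr[OF assms(1)] pm_arr[OF assms(2)] assms(3-5) in \<open>auto simp:
        PiE_iff\<close>)
  then have "(und R (Dom T u), pm R u, und R (Cod T u)) = (und R (Dom T v), pm R v, und R (Cod T v))"
    using assms(3,4) by simp
  then show ?thesis by (simp only: fa_P[OF assms(1), symmetric] fa_P[OF assms(2), symmetric])
qed

lemma cartesian_lift:
  assumes "X \<in> Obj T" "f \<in> Arr FinInj" "Cod FinInj f = und R X"
  shows "\<exists>u. cartesian T FinInj (Prj R) u \<and> Cod T u = X \<and> fa (Prj R) u = f"
  using R assms unfolding restriction_species_def right_fibration_def by blast

text \<open>The fibre keeps composition, identities and endpoints and only cuts down objects and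
  arrows, so an inverse found in the fibre is an inverse in \<open>T\<close>.\<close>

lemma vertical_inverse:
  assumes "t \<in> Arr T" "fa (Prj R) t = Id FinInj A" "A \<in> Obj FinInj"
  shows "\<exists>s. is_inverse T t s \<and> fa (Prj R) s = Id FinInj A"
proof -
  have "groupoid (fibre T FinInj (Prj R) A)"
    using R assms(3) by (simp add: restriction_species_def right_fibration_def)
  moreover have "t \<in> Arr (fibre T FinInj (Prj R) A)" using assms(1,2) by (simp add: fibre_def)
  ultimately have "iso (fibre T FinInj (Prj R) A) t" by (rule groupoid_iso)
  then obtain s where "is_inverse (fibre T FinInj (Prj R) A) t s" unfolding iso_def by blast
  then have "is_inverse T t s \<and> fa (Prj R) s = Id FinInj A" by (simp add: is_inverse_def fibre_def in_hom)
  then show ?thesis by blast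
qed

text \<open>Compare \<open>u\<close> with a cartesian lift \<open>u'\<close> of the same arrow of
  the base. Then \<open>u\<close> is \<open>u'\<close> preceded by a vertical arrow
  \<open>t\<close>, and \<open>t\<close> is invertible because fibres are groupoids. Factorisations
  through \<open>u'\<close> are carried over to \<open>u\<close> by the inverse
  \<open>s\<close>.\<close>

lemma all_cartesian:
  assumes u: "u \<in> Arr T"
  shows "cartesian T FinInj (Prj R) u"
proof -
  note r = functor_rules[OF P]
  note c = r(2)
  obtain u' where u': "cartesian T FinInj (Prj R) u'" "Cod T u' = Cod T u" "fa (Prj R) u' = fa (Prj R) u"
    using cartesian_lift[of "Cod T u" "fa (Prj R) u"] u category_T r by auto
  have ua: "u' \<in> Arr T" using u'(1) by (simp add: cartesian_def)
  have du: "und R (Dom T u') = und R (Dom T u)" using r(5)[OF u] r(5)[OF ua] u'(3) by simp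
  have A: "und R (Dom T u) \<in> Obj FinInj" using r(3) u category_T by simp
  let ?I = "Id FinInj (und R (Dom T u))"
  have "?I \<in> hom FinInj (und R (Dom T u)) (und R (Dom T u'))" "Cmp FinInj (fa (Prj R) u') ?I = fa (Prj R) u"
    using A c r(4,5)[OF ua] u'(3) du by (auto simp: in_hom)
  then obtain t where t: "t \<in> hom T (Dom T u) (Dom T u')" "fa (Prj R) t = ?I" "Cmp T u' t = u"
    using u'(1,2) u unfolding cartesian_def by metis
  obtain s where s: "is_inverse T t s" "fa (Prj R) s = ?I" using vertical_inverse[OF _ t(2) A] t(1) by (auto simp: in_hom)
  have st: "s \<in> Arr T" "Dom T s = Dom T u'" "Cod T s = Dom T u" "Cmp T s t = Id T (Dom T u)" "Cmp T t s = Id T (Dom T u')"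
    using s t by (auto simp: is_inverse_def in_hom)
  show ?thesis unfolding cartesian_def
  proof (intro conjI ballI impI u)
    fix v w assume v: "v \<in> Arr T" and w: "w \<in> hom FinInj (und R (Dom T v)) (und R (Dom T u))"
      and e: "Cod T v = Cod T u \<and> Cmp FinInj (fa (Prj R) u) w = fa (Prj R) v"
    have ex: "\<exists>!t. t \<in> hom T (Dom T v) (Dom T u') \<and> fa (Prj R) t = w \<and> Cmp T u' t = v"
      using u' v w e du unfolding cartesian_def by simp
    then obtain k where k: "k \<in> hom T (Dom T v) (Dom T u')" "fa (Prj R) k = w" "Cmp T u' k = v" by blast
    have w': "w \<in> Arr FinInj" "Cod FinInj w = und R (Dom T u)" using w by (auto simp: in_hom)
    show "\<exists>!t. t \<in> hom T (Dom T v) (Dom T u) \<and> fa (Prj R) t = w \<and> Cmp T u t = v"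
    proof (rule ex1I[of _ "Cmp T s k"])
      have "Cmp T (Cmp T u' t) (Cmp T s k) = Cmp T u' (Cmp T (Cmp T t s) k)"
        using t(1) k(1) st(1-3) category_T ua by (simp add: in_hom)
      then have "Cmp T u (Cmp T s k) = Cmp T u' (Cmp T (Cmp T t s) k)" unfolding t(3) .
      also have "\<dots> = v" unfolding st(5) using k category_T by (simp add: in_hom)
      finally show "Cmp T s k \<in> hom T (Dom T v) (Dom T u) \<and> fa (Prj R) (Cmp T s k) = w \<and> Cmp T u (Cmp T s k) = v"
        using k st category_T s(2) w' c by (simp add: in_hom r)
      fix x assume x: "x \<in> hom T (Dom T v) (Dom T u) \<and> fa (Prj R) x = w \<and> Cmp T u x = v"
      have "Cmp T (Cmp T u' t) x = Cmp T u' (Cmp T t x)"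
        using t(1) x category_T ua by (simp add: in_hom)
      then have "Cmp T u' (Cmp T t x) = Cmp T u x" unfolding t(3) ..
      then have "Cmp T t x = k" using x t k category_T ex w' c by (intro ex1_eq[OF ex]) (auto simp: in_hom r)
      then have "Cmp T s k = Cmp T (Cmp T s t) x" using x t st(1-3) category_T by (auto simp: in_hom)
      then show "x = Cmp T s k" unfolding st(4) using x category_T by (simp add: in_hom)
    qed
  qed
qed

text \<open>Underlying functions are injective, so \<open>f\<close> and \<open>g\<close> have the
  same projection. Both are then the unique factorisation of their common composite with
  \<open>h\<close> through the cartesian arrow \<open>h\<close> over that projection.\<close>

lemma monic_T: "monic_category T"
  unfolding monic_category_def
proof (intro conjI ballI impI category_T)
  fix f g h assume a: "f \<in> Arr T" "g \<in> Arr T" "h \<in> Arr T"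
    and e: "Dom T f = Dom T g \<and> Cod T f = Dom T h \<and> Cod T g = Dom T h \<and> Cmp T h f = Cmp T h g"
  have "fa (Prj R) f = fa (Prj R) g"
  proof (rule fa_P_eqI)
    fix x assume x: "x \<in> und R (Dom T f)"
    then have "pm R h (pm R f x) = pm R h (pm R g x)"
      using pm_comp_apply[of f h x] pm_comp_apply[of g h x] a e by auto
    then show "pm R f x = pm R g x" using pm_inj[OF a(3)] pm_in[OF a(1)] pm_in[OF a(2)] x e by (metis)
  qed (use a e in auto)
  moreover have "\<exists>!t. t \<in> hom T (Dom T (Cmp T h f)) (Dom T h) \<and> fa (Prj R) t = fa (Prj R) f \<and> Cmp T h t = Cmp T h f"
    by (rule all_cartesian[OF a(3), unfolded cartesian_def, THEN conjunct2, rule_format])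
      (use a e[THEN conjunct1] e[THEN conjunct2, THEN conjunct1] category_T functor_rules[OF P] in \<open>auto simp: in_hom\<close>)
  ultimately show "f = g" using a e category_T by (elim ex1_eq) (simp_all add: in_hom)
qed

lemma monicD:
  assumes "Cmp T h f = Cmp T h g" "f \<in> Arr T" "g \<in> Arr T" "h \<in> Arr T"
     "Dom T f = Dom T g" "Cod T f = Dom T h" "Cod T g = Dom T h"
  shows "f = g"
  using monic_T assms unfolding monic_category_def by auto

text \<open>The image condition allows \<open>h\<close> to be factored through \<open>l\<close> in
  \<open>FinInj\<close>, by means of \<open>?w\<close>; cartesianness of \<open>l\<close> lifts this
  factorisation to the total category.\<close>

lemma fill_ex:
  assumes l: "l \<in> Arr T" and h: "h \<in> Arr T" and e: "Cod T l = Cod T h" and sub: "pm R h ` und R (Dom T h) \<subseteq> pm R l ` und R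
      (Dom T l)"
  shows "\<exists>t. t \<in> hom T (Dom T h) (Dom T l) \<and> Cmp T l t = h"
proof -
  note r = functor_rules[OF P]
  let ?A = "und R (Dom T h)" and ?B = "und R (Dom T l)"
  let ?w = "(?A, \<lambda>x \<in> ?A. the_inv_into ?B (pm R l) (pm R h x), ?B)"
  have inv: "the_inv_into ?B (pm R l) (pm R h x) \<in> ?B" "pm R l (the_inv_into ?B (pm R l) (pm R h x)) = pm R h x" if "x \<in> ?A"
      for x
    using that sub pm_arr(2)[OF l] by (auto intro!: the_inv_into_into f_the_inv_into_f)
  have inj: "inj_on (\<lambda>x \<in> ?A. the_inv_into ?B (pm R l) (pm R h x)) ?A"
  proof (rule inj_onI)
    fix x y assume xy: "x \<in> ?A" "y \<in> ?A" "(\<lambda>x \<in> ?A. the_inv_into ?B (pm R l) (pm R h x)) x = (\<lambda>x \<in> ?A. the_inv_into ?B (pm R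
        l) (pm R h x)) y"
    then have "the_inv_into ?B (pm R l) (pm R h x) = the_inv_into ?B (pm R l) (pm R h y)" by simp
    then have "pm R h x = pm R h y" using inv(2)[OF xy(1)] inv(2)[OF xy(2)] by metis
    then show "x = y" using pm_inj[OF h] xy by simp
  qed
  have w: "?w \<in> hom FinInj ?A ?B"
    using inv inj finite_und category_T l h by (auto simp: in_hom FinInj_simps)
  have "compose ?A (pm R l) (\<lambda>x \<in> ?A. the_inv_into ?B (pm R l) (pm R h x)) = pm R h"
    using inv pm_arr(1)[OF h] by (auto simp: compose_def fun_eq_iff PiE_iff extensional_def)
  then have "Cmp FinInj (?B, pm R l, und R (Cod T l)) ?w = (?A, pm R h, und R (Cod T h))"
    by (simp only: FinInj_simps e)
  then have "Cmp FinInj (fa (Prj R) l) ?w = fa (Prj R) h"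
    by (simp only: fa_P[OF l, symmetric] fa_P[OF h, symmetric])
  then show ?thesis
    using all_cartesian[OF l, unfolded cartesian_def] w h e by metis
qed

lemma fill_unique:
  assumes "l \<in> Arr T" "t \<in> Arr T" "Cod T t = Dom T l" "Cmp T l t = h"
  shows "fill R l h = t"
  unfolding fill_def
proof (rule the_equality)
  show "t \<in> hom T (Dom T h) (Dom T l) \<and> Cmp T l t = h" using assms category_T by (auto simp: in_hom)
  show "s = t" if "s \<in> hom T (Dom T h) (Dom T l) \<and> Cmp T l s = h" for s
    by (rule monicD[of l]) (use that assms category_T in \<open>auto simp: in_hom\<close>)
qed

lemma fill:
  assumes l: "l \<in> Arr T" and h: "h \<in> Arr T" and e: "Cod T l = Cod T h" and sub: "pm R h ` und R (Dom T h) \<subseteq> pm R l ` und R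
      (Dom T l)"
  shows "fill R l h \<in> Arr T" "Dom T (fill R l h) = Dom T h" "Cod T (fill R l h) = Dom T l" "Cmp T l (fill R l h) = h"
    "\<And>x. x \<in> und R (Dom T h) \<Longrightarrow> pm R l (pm R (fill R l h) x) = pm R h x"
proof -
  obtain t where t: "t \<in> hom T (Dom T h) (Dom T l)" "Cmp T l t = h" using fill_ex[OF assms] by blast
  then have f: "fill R l h = t" using l by (intro fill_unique) (auto simp: in_hom)
  show *: "fill R l h \<in> Arr T" "Dom T (fill R l h) = Dom T h" "Cod T (fill R l h) = Dom T l" "Cmp T l (fill R l h) = h"
    using t by (auto simp: f in_hom)
  show "pm R l (pm R (fill R l h) x) = pm R h x" if "x \<in> und R (Dom T h)" for x
    using pm_comp_apply[OF *(1) l *(3), of x] * that by simp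
qed

text \<open>Underlying functions are injective in any case. Given surjectivity, the identity of the
  codomain is filled through \<open>u\<close>, which yields a right inverse, and it is also a left
  inverse because \<open>u\<close> is monic.\<close>

lemma iso_iff:
  assumes u: "u \<in> Arr T"
  shows "iso T u \<longleftrightarrow> pm R u ` und R (Dom T u) = und R (Cod T u)"
proof
  assume "iso T u"
  then obtain v where "is_inverse T u v" unfolding iso_def by blast
  then have v: "v \<in> Arr T" "Dom T v = Cod T u" "Cod T v = Dom T u" "Cmp T u v = Id T (Cod T u)"
    by (auto simp: is_inverse_def in_hom)
  have "x \<in> pm R u ` und R (Dom T u)" if "x \<in> und R (Cod T u)" for x
    using pm_comp_apply[OF v(1) u v(3), of x] pm_Id[of "Cod T u" x] pm_in[OF v(1), of x] that v category_T u by (metis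
        category_rules(2) image_eqI)
  then show "pm R u ` und R (Dom T u) = und R (Cod T u)" using pm_in[OF u] by blast
next
  assume a: "pm R u ` und R (Dom T u) = und R (Cod T u)"
  have i: "Id T (Cod T u) \<in> Arr T" "Dom T (Id T (Cod T u)) = Cod T u" "Cod T (Id T (Cod T u)) = Cod T u" using u category_T
      by auto
  have "\<exists>t. t \<in> hom T (Dom T (Id T (Cod T u))) (Dom T u) \<and> Cmp T u t = Id T (Cod T u)"
    by (rule fill_ex) (use u i a pm_in[OF i(1)] in auto)
  then obtain t where t: "t \<in> Arr T" "Dom T t = Cod T u" "Cod T t = Dom T u" "Cmp T u t = Id T (Cod T u)"
    using i by (auto simp: in_hom)
  have "Cmp T u (Cmp T t u) = Cmp T (Cmp T u t) u" using t(1-3) u category_T by simp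
  then have "Cmp T u (Cmp T t u) = Cmp T u (Id T (Dom T u))" unfolding t(4) using u category_T by simp
  then have "Cmp T t u = Id T (Dom T u)" by (rule monicD) (use t u category_T in auto)
  then have "is_inverse T u t" using t u by (simp add: is_inverse_def in_hom)
  then show "iso T u" unfolding iso_def by blast
qed

text \<open>Both branches of the definition lift the inclusion of \<open>B\<close>: an identity if
  \<open>B\<close> is everything, a chosen cartesian arrow otherwise.\<close>

lemma res_lift:
  assumes X: "X \<in> Obj T" and B: "B \<subseteq> und R X"
  shows "res_lift R X B \<in> Arr T" "Cod T (res_lift R X B) = X" "und R (Dom T (res_lift R X B)) = B"
    "\<And>x. x \<in> B \<Longrightarrow> pm R (res_lift R X B) x = x"
proof -
  note r = functor_rules[OF P]
  have "res_lift R X B \<in> Arr T \<and> Cod T (res_lift R X B) = X \<and> fa (Prj R) (res_lift R X B) = (B, \<lambda>x \<in> B. x, und R X)"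
  proof (cases "B = und R X")
    case True then show ?thesis using X category_T r(7)[OF X] by (simp add: res_lift_def FinInj_simps)
  next
    case False
    have "(B, \<lambda>x \<in> B. x, und R X) \<in> Arr FinInj" using finite_und[OF X] B by (auto simp: FinInj_simps finite_subset
        inj_on_def)
    from someI_ex[OF cartesian_lift[OF X this]] show ?thesis
      using False by (auto simp: res_lift_def FinInj_simps cartesian_def)
  qed
  then show *: "res_lift R X B \<in> Arr T" "Cod T (res_lift R X B) = X" and f: "und R (Dom T (res_lift R X B)) = B"
    "\<And>x. x \<in> B \<Longrightarrow> pm R (res_lift R X B) x = x"
    using r(5)[of "res_lift R X B"] by (auto simp: FinInj_simps)
qed

lemma res_lift_whole: "X \<in> Obj T \<Longrightarrow> res_lift R X (und R X) = Id T X"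
  by (simp add: res_lift_def)

end

text \<open>The projections commute strictly, so \<open>F\<close> changes neither underlying sets
  nor underlying functions, and layerings carry over without transport.\<close>

lemma rspecies_morphism_rules:
  assumes "rspecies_morphism R F S"
  shows "is_functor (Tot R) (Tot S) F" "\<And>X. X \<in> Obj (Tot R) \<Longrightarrow> und S (fo F X) = und R X"
    "\<And>u. u \<in> Arr (Tot R) \<Longrightarrow> pm S (fa F u) = pm R u"
proof -
  have e: "compF (Tot R) (Prj S) F = Prj R" using assms by (simp add: rspecies_morphism_def)
  show "is_functor (Tot R) (Tot S) F" using assms by (simp add: rspecies_morphism_def)
  show "und S (fo F X) = und R X" if "X \<in> Obj (Tot R)" for X using that compF_simps(1)[of X "Tot R" "Prj S" F] by (simp add:
      e)
  show "pm S (fa F u) = pm R u" if "u \<in> Arr (Tot R)" for u using that compF_simps(2)[of u "Tot R" "Prj S" F] by (simp add: e)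
qed

section \<open>Layered structures\<close>

abbreviation lyr :: "('a, 'o) lay \<Rightarrow> 'a elt \<Rightarrow> nat" where "lyr t \<equiv> fst (snd t)"
abbreviation str :: "('a, 'o) lay \<Rightarrow> 'o" where "str t \<equiv> snd (snd t)"

lemma Lay_simps:
  "t \<in> Obj (Lay R n) \<longleftrightarrow> finite (fst t) \<and> lyr t \<in> fst t \<rightarrow>\<^sub>E {1..n} \<and> str t \<in> Obj (Tot R) \<and> und R (str t) = fst t"
  "(s, u, t) \<in> Arr (Lay R n) \<longleftrightarrow> s \<in> Obj (Lay R n) \<and> t \<in> Obj (Lay R n) \<and> u \<in> hom (Tot R) (str s) (str t) \<and> iso (Tot R) u \<and>
     (\<forall>x \<in> fst s. lyr t (pm R u x) = lyr s x)"
  "Dom (Lay R n) (s, u, t) = s" "Cod (Lay R n) (s, u, t) = t"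
  "Id (Lay R n) t = (t, Id (Tot R) (str t), t)"
  "Cmp (Lay R n) (t', v, r) (s, u, t) = (s, Cmp (Tot R) v u, r)"
  by (cases s; cases t; auto simp: Lay_def mk_cat_simps)+

text \<open>The shape of \<open>(s, u, t)\<close> is \<open>u\<close> alone. The layerings impose a
  condition on the arrow but contribute no data to it, which makes shapes faithful.\<close>

definition LayS :: "('a, 'o, 'm) rspecies \<Rightarrow> (simp_arr, ('a, 'o) lay, ('a, 'o, 'm) lay_arr, 'o, 'm) lsys" where
  "LayS R = \<lparr> Base = Tot R, Shape = \<lparr> fo = str, fa = (\<lambda>(s, u, t). u) \<rparr>, Lift = act_lift R \<rparr>"

lemma LayS_simps [simp]:
  "Base (LayS R) = Tot R" "sho (LayS R) t = str t" "sha (LayS R) (s, u, t) = u" "Lift (LayS R) a t = act_lift R a t"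
  by (simp_all add: LayS_def)

text \<open>The elements retained by \<open>a\<close>. Here \<open>fst (snd a)\<close> is the
  monotone map and \<open>fst a\<close> the top element of its source, so the bounds are the first
  and the last value of the map.\<close>

definition part :: "simp_arr \<Rightarrow> ('a, 'o) lay \<Rightarrow> 'a elt set" where
  "part a t = {x \<in> fst t. fst (snd a) 0 < lyr t x \<and> lyr t x \<le> fst (snd a) (fst a)}"

text \<open>Dissolves the factorisation into a generic and a free part: the shift introduced by the
  free part cancels against the one in the generic part, which leaves \<open>part\<close> and
  \<open>idx\<close>. Later arguments work with this description only.\<close>

lemma act_lay_eq:
  assumes a: "a \<in> Arr Simp"
  shows "fst (act_lay R a t) = part a t" "lyr (act_lay R a t) = (\<lambda>x \<in> part a t. idx a (lyr t x))"
    "str (act_lay R a t) = restrict_to R (str t) (part a t)" "act_lift R a t = res_lift R (str t) (part a t)"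
proof -
  obtain m \<alpha> n where e: "a = (m, \<alpha>, n)" by (cases a)
  have mo: "mono_on {0..m} \<alpha>" using a by (simp add: e Simp_simps)
  obtain A p X where t: "t = (A, p, X)" by (cases t)
  let ?d = "\<alpha> m - \<alpha> 0"
  \<comment> \<open>Layers are numbered from \<open>1\<close>, so the free part reaches exactly the
    layers above \<open>\<alpha> 0\<close> up to \<open>\<alpha> m\<close>.\<close>
  have im: "(\<lambda>i\<in>{1..?d}. i + \<alpha> 0) ` {1..?d} = {\<alpha> 0 <.. \<alpha> m}"
  proof
    show "{\<alpha> 0 <.. \<alpha> m} \<subseteq> (\<lambda>i\<in>{1..?d}. i + \<alpha> 0) ` {1..?d}"
    proof
      fix j assume "j \<in> {\<alpha> 0 <.. \<alpha> m}"
      then show "j \<in> (\<lambda>i\<in>{1..?d}. i + \<alpha> 0) ` {1..?d}" by (intro image_eqI[of _ _ "j - \<alpha> 0"]) auto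
    qed
  qed auto
  have uf: "under_free (free_part a) = (\<lambda>i\<in>{1..?d}. i + \<alpha> 0)" "fst (free_part a) = ?d"
    by (auto simp: under_free_def free_part_def e)
  have pt: "{x \<in> A. p x \<in> {\<alpha> 0 <.. \<alpha> m}} = part a t" by (auto simp: part_def e t)
  have th: "(THE i. i \<in> {1..?d} \<and> (\<lambda>i\<in>{1..?d}. i + \<alpha> 0) i = j) = j - \<alpha> 0" if "j \<in> {\<alpha> 0 <.. \<alpha> m}" for j
    using that by (intro the_equality) auto
  have af: "act_free R (free_part a) t = (part a t, \<lambda>x \<in> part a t. THE i. i \<in> {1..?d} \<and> (\<lambda>i\<in>{1..?d}. i + \<alpha> 0) i = p x,
      restrict_to R X (part a t))"
    by (simp only: t act_free_def prod.case Let_def uf im pt[unfolded t])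
  \<comment> \<open>Subtracting \<open>\<alpha> 0\<close> on all sides leaves the block of
    \<open>j\<close> unchanged; monotonicity of \<open>\<alpha>\<close> keeps the natural
    subtraction exact.\<close>
  have ug: "under_generic (generic_part a) (j - \<alpha> 0) = idx a j" if j: "j \<in> {\<alpha> 0 <.. \<alpha> m}" for j
  proof -
    have "(i \<in> {1..m} \<and> (\<lambda>i\<in>{0..m}. \<alpha> i - \<alpha> 0) (i - 1) < j - \<alpha> 0 \<and> j - \<alpha> 0 \<le> (\<lambda>i\<in>{0..m}. \<alpha> i - \<alpha> 0) i) \<longleftrightarrow> (i \<in> {1..m} \<and> \<alpha> (i -
        1) < j \<and> j \<le> \<alpha> i)" for i
    proof (cases "i \<in> {1..m}")
      case True
      then have "\<alpha> 0 \<le> \<alpha> (i - 1)" "\<alpha> 0 \<le> \<alpha> i" using mo by (auto simp: mono_on_def)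
      then show ?thesis using True j by auto
    qed auto
    moreover have "j - \<alpha> 0 \<in> {1..?d}" using j by auto
    ultimately show ?thesis by (simp add: under_generic_def generic_part_def e idx_def)
  qed
  have "compose (part a t) (under_generic (generic_part a)) (\<lambda>x \<in> part a t. THE i. i \<in> {1..?d} \<and> (\<lambda>i\<in>{1..?d}. i + \<alpha> 0) i = p
      x) = (\<lambda>x \<in> part a t. idx a (p x))"
    using ug th by (auto simp: compose_def fun_eq_iff part_def e t restrict_def)
  then have "act_lay R a t = (part a t, \<lambda>x \<in> part a t. idx a (p x), restrict_to R X (part a t))"
    unfolding act_lay_def af by (simp add: act_generic_def)
  then show *: "fst (act_lay R a t) = part a t" "lyr (act_lay R a t) = (\<lambda>x \<in> part a t. idx a (lyr t x))"
    "str (act_lay R a t) = restrict_to R (str t) (part a t)" by (simp_all add: t)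
  show "act_lift R a t = res_lift R (str t) (part a t)" by (simp add: act_lift_def *)
qed

lemma part_generic:
  assumes "generic g" "t \<in> Obj (Lay R (Cod Simp g))"
  shows "part g t = fst t"
  using assms by (cases g) (force simp: generic_def Simp_simps part_def Lay_simps PiE_iff)

text \<open>Acting by \<open>b\<close> and then by \<open>a\<close> retains the same elements in the
  same layers as acting by the composite, strictly. Only the chosen restrictions of the structure
  can differ, so the composition cells have identities as underlying functions.\<close>

lemma part_comp:
  assumes a: "a \<in> Arr Simp" and b: "b \<in> Arr Simp" and e: "Cod Simp a = Dom Simp b"
  shows "part a (act_lay R b t) = part (Cmp Simp b a) t" "part (Cmp Simp b a) t \<subseteq> part b t"
    "\<And>x. x \<in> part (Cmp Simp b a) t \<Longrightarrow> idx a (idx b (lyr t x)) = idx (Cmp Simp b a) (lyr t x)"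
proof -
  obtain l \<alpha> m where a': "a = (l, \<alpha>, m)" by (cases a)
  obtain \<beta> n where b': "b = (m, \<beta>, n)" using e by (cases b) (auto simp: a' Simp_simps)
  have bm: "\<beta> x \<le> \<beta> y" if "x \<le> y" "y \<le> m" for x y using b that by (auto simp: b' Simp_simps mono_on_def)
  have am: "\<alpha> i \<le> m" if "i \<le> l" for i using a that by (auto simp: a' Simp_simps PiE_iff)
  have c: "Cmp Simp b a = (l, compose {0..l} \<beta> \<alpha>, n)" by (simp add: a' b' Simp_simps)
  note ix = idx_comp[OF a[unfolded a'] b[unfolded b']]
  have pc: "part (Cmp Simp b a) t = {x \<in> fst t. \<beta> (\<alpha> 0) < lyr t x \<and> lyr t x \<le> \<beta> (\<alpha> l)}"
    by (simp add: part_def c compose_def)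
  show sub: "part (Cmp Simp b a) t \<subseteq> part b t"
    using bm[of 0 "\<alpha> 0"] bm[of "\<alpha> l" m] am[of 0] am[of l] unfolding pc by (auto simp: part_def b')
  show "\<And>x. x \<in> part (Cmp Simp b a) t \<Longrightarrow> idx a (idx b (lyr t x)) = idx (Cmp Simp b a) (lyr t x)"
    unfolding c using ix(3) by (simp add: pc[unfolded c] a' b')
  have "\<alpha> 0 < idx b j \<and> idx b j \<le> \<alpha> l \<longleftrightarrow> \<beta> (\<alpha> 0) < j \<and> j \<le> \<beta> (\<alpha> l)" if j: "\<beta> 0 < j" "j \<le> \<beta> m" for j
  proof
    assume i: "\<alpha> 0 < idx b j \<and> idx b j \<le> \<alpha> l"
    note ip = idx_props[OF b[unfolded b'] j, folded b']
    have "\<beta> (\<alpha> 0) \<le> \<beta> (idx b j - 1)" "\<beta> (idx b j) \<le> \<beta> (\<alpha> l)" using i ip am[of l] by (auto intro!: bm)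
    then show "\<beta> (\<alpha> 0) < j \<and> j \<le> \<beta> (\<alpha> l)" using ip by auto
  qed (use ix(1,2) in \<open>auto simp: b'\<close>)
  moreover have "part a (act_lay R b t) = {x \<in> part b t. \<alpha> 0 < idx b (lyr t x) \<and> idx b (lyr t x) \<le> \<alpha> l}"
    unfolding part_def[of a "act_lay R b t"] act_lay_eq[OF b] by (auto simp: a')
  moreover have "part b t = {x \<in> fst t. \<beta> 0 < lyr t x \<and> lyr t x \<le> \<beta> m}" by (simp add: part_def b')
  ultimately show "part a (act_lay R b t) = part (Cmp Simp b a) t"
    using sub unfolding pc by blast
qed

lemma part_Id:
  assumes "t \<in> Obj (Lay R n)"
  shows "part (Id Simp n) t = fst t" "\<And>x. x \<in> fst t \<Longrightarrow> idx (Id Simp n) (lyr t x) = lyr t x"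
  using assms by (auto simp: part_def Simp_simps Lay_simps PiE_iff) (force intro!: idx_Id simp: Simp_simps(5)[symmetric])+

section \<open>The groupoids of layered structures and the simplicial action\<close>

context species
begin

lemma lay_objD: "t \<in> Obj (Lay R n) \<Longrightarrow> str t \<in> Obj T" "t \<in> Obj (Lay R n) \<Longrightarrow> und R (str t) = fst t"
  by (auto simp: Lay_simps)

text \<open>By \<open>iso_iff\<close>, invertibility amounts to surjectivity onto the underlying
  set, so it is enough to check that elements are covered and layers are preserved.\<close>

lemma Lay_arrI:
  assumes "s \<in> Obj (Lay R n)" "t \<in> Obj (Lay R n)" "u \<in> hom T (str s) (str t)" "fst t \<subseteq> pm R u ` fst s"
    "\<And>x. x \<in> fst s \<Longrightarrow> lyr t (pm R u x) = lyr s x"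
  shows "(s, u, t) \<in> Arr (Lay R n)"
proof -
  have u: "u \<in> Arr T" "Dom T u = str s" "Cod T u = str t" using assms(3) by (auto simp: in_hom)
  have "pm R u ` und R (str s) = und R (str t)"
    using assms(4) pm_in[OF u(1)] u(2,3) lay_objD(2)[OF assms(1)] lay_objD(2)[OF assms(2)] by auto
  then have "iso T u" using iso_iff[OF u(1)] u(2,3) by simp
  then show ?thesis using assms by (simp add: Lay_simps(2))
qed

lemma Lay_arrD:
  assumes "(s, u, t) \<in> Arr (Lay R n)"
  shows "s \<in> Obj (Lay R n)" "t \<in> Obj (Lay R n)" "u \<in> Arr T" "Dom T u = str s" "Cod T u = str t" "pm R u ` fst s = fst t"
    "\<And>x. x \<in> fst s \<Longrightarrow> lyr t (pm R u x) = lyr s x"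
proof -
  show *: "s \<in> Obj (Lay R n)" "t \<in> Obj (Lay R n)" "u \<in> Arr T" "Dom T u = str s" "Cod T u = str t"
    "\<And>x. x \<in> fst s \<Longrightarrow> lyr t (pm R u x) = lyr s x" using assms by (auto simp: Lay_simps(2) in_hom)
  have "iso T u" using assms by (simp add: Lay_simps(2))
  then show "pm R u ` fst s = fst t" using iso_iff[of u] lay_objD(2)[of s] lay_objD(2)[of t] * by auto
qed

lemma category_Lay: "category (Lay R n)"
  unfolding category_def
proof (intro conjI ballI impI; (elim conjE)?)
  fix f assume f: "f \<in> Arr (Lay R n)"
  obtain s u t where e: "f = (s, u, t)" by (cases f)
  note d = Lay_arrD[OF f[unfolded e]]
  show "Dom (Lay R n) f \<in> Obj (Lay R n)" "Cod (Lay R n) f \<in> Obj (Lay R n)" using d by (simp_all add: e Lay_simps(3,4))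
  show "Cmp (Lay R n) f (Id (Lay R n) (Dom (Lay R n) f)) = f" "Cmp (Lay R n) (Id (Lay R n) (Cod (Lay R n) f)) f = f"
    using d category_T by (simp_all add: e Lay_simps(3-))
  fix g assume g: "g \<in> Arr (Lay R n)" and fg: "Cod (Lay R n) f = Dom (Lay R n) g"
  then obtain v r where e': "g = (t, v, r)" by (cases g) (auto simp: e Lay_simps)
  note d' = Lay_arrD[OF g[unfolded e']]
  have "(s, Cmp T v u, r) \<in> Arr (Lay R n)"
  proof (rule Lay_arrI)
    have ap: "pm R (Cmp T v u) x = pm R v (pm R u x)" if "x \<in> fst s" for x
      using pm_comp_apply[of u v x] d d' that lay_objD(2) by simp
    have "fst r = pm R v ` pm R u ` fst s" using d d' by simp
    also have "\<dots> = pm R (Cmp T v u) ` fst s" using ap by (simp add: image_image)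
    finally show "fst r \<subseteq> pm R (Cmp T v u) ` fst s" by simp
    show "lyr r (pm R (Cmp T v u) x) = lyr s x" if "x \<in> fst s" for x
      using that d d' ap by force
  qed (use d d' category_T in \<open>auto simp: in_hom\<close>)
  then show "Cmp (Lay R n) g f \<in> hom (Lay R n) (Dom (Lay R n) f) (Cod (Lay R n) g)"
    by (simp add: e e' in_hom Lay_simps(3-))
  fix h assume h: "h \<in> Arr (Lay R n)" and gh: "Cod (Lay R n) g = Dom (Lay R n) h"
  then obtain w q where e'': "h = (r, w, q)" by (cases h) (auto simp: e' Lay_simps)
  note d'' = Lay_arrD[OF h[unfolded e'']]
  show "Cmp (Lay R n) h (Cmp (Lay R n) g f) = Cmp (Lay R n) (Cmp (Lay R n) h g) f"
    using d d' d'' category_T by (simp add: e e' e'' Lay_simps(3-))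
next
  fix t assume t: "t \<in> Obj (Lay R n)"
  then have "(t, Id T (str t), t) \<in> Arr (Lay R n)"
    using category_T pm_Id[of "str t"] lay_objD[OF t] by (intro Lay_arrI) (auto simp: in_hom image_iff)
  then show "Id (Lay R n) t \<in> hom (Lay R n) t t" by (simp add: in_hom Lay_simps(3-))
qed

lemma groupoid_Lay: "groupoid (Lay R n)"
  unfolding groupoid_def
proof (intro conjI ballI category_Lay)
  fix f assume f: "f \<in> Arr (Lay R n)"
  obtain s u t where e: "f = (s, u, t)" by (cases f)
  note d = Lay_arrD[OF f[unfolded e]]
  have "iso T u" using f by (simp add: e Lay_simps(2))
  then obtain v where "is_inverse T u v" unfolding iso_def by blast
  then have v: "v \<in> Arr T" "Dom T v = str t" "Cod T v = str s" "Cmp T v u = Id T (str s)" "Cmp T u v = Id T (str t)"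
    using d by (auto simp: is_inverse_def in_hom)
  have vu: "pm R v (pm R u x) = x" if "x \<in> fst s" for x
    using pm_comp_apply[of u v x] pm_Id[of "str s" x] d v that lay_objD[OF d(1)] by simp
  have "(t, v, s) \<in> Arr (Lay R n)"
  proof (rule Lay_arrI)
    have "fst s = pm R v ` pm R u ` fst s" using vu by (simp add: image_image)
    then show "fst s \<subseteq> pm R v ` fst t" using d(6) by simp
    show "lyr s (pm R v x) = lyr t x" if "x \<in> fst t" for x
      using that vu d(7) unfolding d(6)[symmetric] by auto
  qed (use d v in \<open>auto simp: in_hom\<close>)
  then have "is_inverse (Lay R n) f (t, v, s)"
    using f v by (simp add: e is_inverse_def in_hom Lay_simps(3-))
  then show "iso (Lay R n) f" unfolding iso_def by blast
qed

lemma faithful_Lay: "faithful_over (Lay R n) T (Shape (LayS R))"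
  unfolding faithful_over_def
proof (intro conjI ballI impI)
  fix f g assume f: "f \<in> Arr (Lay R n)" and g: "g \<in> Arr (Lay R n)"
  obtain s u t where e: "f = (s, u, t)" by (cases f)
  obtain s' u' t' where e': "g = (s', u', t')" by (cases g)
  note d = Lay_arrD[OF f[unfolded e]]
  show "sha (LayS R) f \<in> Arr T" "Dom T (sha (LayS R) f) = sho (LayS R) (Dom (Lay R n) f)" "Cod T (sha (LayS R) f) = sho (LayS
      R) (Cod (Lay R n) f)"
    using d by (simp_all add: e Lay_simps(3,4))
  show "sha (LayS R) (Cmp (Lay R n) g f) = Cmp T (sha (LayS R) g) (sha (LayS R) f)" by (simp add: e e' Lay_simps)
  show "f = g" if "Dom (Lay R n) f = Dom (Lay R n) g \<and> Cod (Lay R n) f = Cod (Lay R n) g \<and> sha (LayS R) f = sha (LayS R) g"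
    using that by (simp add: e e' Lay_simps)
qed (auto simp: Lay_simps)

lemma act_lift:
  assumes a: "a \<in> Arr Simp" and t: "t \<in> Obj (Lay R (Cod Simp a))"
  shows "act_lift R a t \<in> Arr T" "Cod T (act_lift R a t) = str t" "Dom T (act_lift R a t) = str (act_lay R a t)"
    "und R (str (act_lay R a t)) = part a t" "\<And>x. x \<in> part a t \<Longrightarrow> pm R (act_lift R a t) x = x"
    "act_lay R a t \<in> Obj (Lay R (Dom Simp a))"
proof -
  have "part a t \<subseteq> und R (str t)" using lay_objD(2)[OF t] by (auto simp: part_def)
  note r = res_lift[OF lay_objD(1)[OF t] this]
  show l: "act_lift R a t \<in> Arr T" "Cod T (act_lift R a t) = str t" "Dom T (act_lift R a t) = str (act_lay R a t)"
    "und R (str (act_lay R a t)) = part a t" "\<And>x. x \<in> part a t \<Longrightarrow> pm R (act_lift R a t) x = x"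
    using r by (simp_all add: act_lay_eq[OF a] restrict_to_def)
  have st: "str (act_lay R a t) \<in> Obj T" using l(1,3) category_T by (metis category_rules(1))
  have "idx a (lyr t x) \<in> {1..Dom Simp a}" if "x \<in> part a t" for x
    using that a idx_props(1)[of "fst a" "fst (snd a)" "snd (snd a)"] by (cases a) (auto simp: part_def Simp_simps)
  then have "lyr (act_lay R a t) \<in> part a t \<rightarrow>\<^sub>E {1..Dom Simp a}" unfolding act_lay_eq(2)[OF a] by auto
  moreover have "finite (part a t)" using t by (simp add: Lay_simps part_def)
  ultimately show "act_lay R a t \<in> Obj (Lay R (Dom Simp a))"
    using st l(4) by (simp add: Lay_simps(1) act_lay_eq(1)[OF a])
qed

text \<open>The payoff of the normalisation in \<open>res_lift\<close>: a generic map retains every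
  element, so its lift is an identity and the structure is literally unchanged.\<close>

lemma act_lift_generic:
  assumes g: "generic g" and t: "t \<in> Obj (Lay R (Cod Simp g))"
  shows "act_lift R g t = Id T (str t)" "str (act_lay R g t) = str t" "fst (act_lay R g t) = fst t"
    "\<And>x. x \<in> fst t \<Longrightarrow> lyr (act_lay R g t) x = idx g (lyr t x)"
proof -
  have a: "g \<in> Arr Simp" by (rule generic_Arr[OF g])
  show "act_lift R g t = Id T (str t)"
    using res_lift_whole[OF lay_objD(1)[OF t]] lay_objD(2)[OF t] part_generic[OF g t] by (simp add: act_lay_eq[OF a])
  then show "str (act_lay R g t) = str t" using act_lift(3)[OF a t] category_T lay_objD(1)[OF t] by simp
  show "fst (act_lay R g t) = fst t" "\<And>x. x \<in> fst t \<Longrightarrow> lyr (act_lay R g t) x = idx g (lyr t x)"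
    using part_generic[OF g t] by (simp_all add: act_lay_eq[OF a])
qed

text \<open>The common source of arrows into \<open>act_lay R a t\<close>: the functorial action,
  the coherence cells and the naturality cells below are instances for suitable \<open>h\<close>.
  The lift is an inclusion on underlying sets, so the filled arrow has the same underlying function
  as \<open>h\<close> and inherits its behaviour on layers.\<close>

lemma lay_fill:
  assumes a: "a \<in> Arr Simp" and t: "t \<in> Obj (Lay R (Cod Simp a))" and s: "s \<in> Obj (Lay R (Dom Simp a))"
    and h: "h \<in> hom T (str s) (str t)" and surj: "part a t \<subseteq> pm R h ` fst s"
    and layer: "\<And>x. x \<in> fst s \<Longrightarrow> pm R h x \<in> part a t \<and> idx a (lyr t (pm R h x)) = lyr s x"
  shows "(s, fill R (act_lift R a t) h, act_lay R a t) \<in> Arr (Lay R (Dom Simp a)) \<and>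
    Cmp T (act_lift R a t) (fill R (act_lift R a t) h) = h"
proof (rule conjI)
  note l = act_lift[OF a t]
  have h': "h \<in> Arr T" "Dom T h = str s" "Cod T h = str t" using h by (auto simp: in_hom)
  have im: "pm R (act_lift R a t) ` part a t = part a t" using l(5) by (simp add: image_iff)
  have us: "und R (str s) = fst s" by (rule lay_objD(2)[OF s])
  have "Cod T (act_lift R a t) = Cod T h" "pm R h ` und R (Dom T h) \<subseteq> pm R (act_lift R a t) ` und R (Dom T (act_lift R a t))"
    using l(2-4) h' us im layer by auto
  note ff = fill[OF l(1) h'(1) this]
  have f: "fill R (act_lift R a t) h \<in> Arr T" "Dom T (fill R (act_lift R a t) h) = str s" "Cod T (fill R (act_lift R a t) h)
      = str (act_lay R a t)"
     "Cmp T (act_lift R a t) (fill R (act_lift R a t) h) = h"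
     "\<And>x. x \<in> fst s \<Longrightarrow> pm R (act_lift R a t) (pm R (fill R (act_lift R a t) h) x) = pm R h x"
    using ff l(3) h'(2) us by auto
  have pf: "pm R (fill R (act_lift R a t) h) x = pm R h x" if "x \<in> fst s" for x
    using f(5)[OF that] pm_in[OF f(1), of x] that us l(4,5) by (simp add: f(2,3))
  show "Cmp T (act_lift R a t) (fill R (act_lift R a t) h) = h" by (rule f(4))
  show "(s, fill R (act_lift R a t) h, act_lay R a t) \<in> Arr (Lay R (Dom Simp a))"
  proof (rule Lay_arrI[OF s l(6)])
    show "fill R (act_lift R a t) h \<in> hom T (str s) (str (act_lay R a t))" using f by (simp add: in_hom)
    show "fst (act_lay R a t) \<subseteq> pm R (fill R (act_lift R a t) h) ` fst s"
      using surj pf by (simp add: act_lay_eq(1)[OF a])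
    show "lyr (act_lay R a t) (pm R (fill R (act_lift R a t) h) x) = lyr s x" if "x \<in> fst s" for x
      using layer[OF that] pf[OF that] by (simp add: act_lay_eq(2)[OF a])
  qed
qed

lemma LaySp_simps:
  "Gpd (LaySp R) = Lay R" "fo (Act (LaySp R) a) = (\<lambda>t \<in> Obj (Lay R (Cod Simp a)). act_lay R a t)"
  "fa (Act (LaySp R) a) = (\<lambda>(s, u, t) \<in> Arr (Lay R (Cod Simp a)).
         (act_lay R a s, fill R (act_lift R a t) (Cmp T u (act_lift R a s)), act_lay R a t))"
  "CmpI (LaySp R) a b = (\<lambda>t \<in> Obj (Lay R (Cod Simp b)).
       (act_lay R a (act_lay R b t), fill R (act_lift R (Cmp Simp b a) t) (Cmp T (act_lift R b t) (act_lift R a (act_lay R b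
           t))),
        act_lay R (Cmp Simp b a) t))"
  "IdI (LaySp R) n = (\<lambda>t \<in> Obj (Lay R n). (t, fill R (act_lift R (Id Simp n) t) (Id T (str t)), act_lay R (Id Simp n) t))"
  by (simp_all add: LaySp_def Let_def)

lemma lifted_LaySp: "lifted Simp (LaySp R) (LayS R)"
proof
  show "category Simp" by (rule category_Simp)
  show "monic_category (Base (LayS R))" using monic_T by simp
  show "groupoid (Gpd (LaySp R) c)" for c using groupoid_Lay by (simp add: LaySp_simps)
  show "faithful_over (Gpd (LaySp R) c) (Base (LayS R)) (Shape (LayS R))" for c using faithful_Lay by (simp add: LaySp_simps)
next
  fix a assume a: "a \<in> Arr Simp"
  { fix t assume t: "t \<in> Obj (Gpd (LaySp R) (Cod Simp a))"
    then show "fo (Act (LaySp R) a) t \<in> Obj (Gpd (LaySp R) (Dom Simp a))"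
      "Lift (LayS R) a t \<in> hom (Base (LayS R)) (sho (LayS R) (fo (Act (LaySp R) a) t)) (sho (LayS R) t)"
      using act_lift[OF a] by (simp_all add: LaySp_simps in_hom) }
  { fix f assume "f \<in> Arr (Gpd (LaySp R) (Cod Simp a))"
    then have f: "f \<in> Arr (Lay R (Cod Simp a))" by (simp add: LaySp_simps)
    obtain s u t where e: "f = (s, u, t)" by (cases f)
    note d = Lay_arrD[OF f[unfolded e]]
    note ls = act_lift[OF a d(1)] and lt = act_lift[OF a d(2)]
    have ap: "pm R (Cmp T u (act_lift R a s)) x = pm R u x" if "x \<in> part a s" for x
      using pm_comp_apply[OF ls(1) d(3), of x] ls d that by simp
    have im: "part a t = pm R u ` part a s"
      unfolding part_def d(6)[symmetric] using d(7) by auto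
    \<comment> \<open>The action on an arrow fills \<open>u\<close> preceded by the lift of
      \<open>s\<close>, so naturality of the lifts holds by construction.\<close>
    have F: "(act_lay R a s, fill R (act_lift R a t) (Cmp T u (act_lift R a s)), act_lay R a t) \<in> Arr (Lay R (Dom Simp a)) \<and>
      Cmp T (act_lift R a t) (fill R (act_lift R a t) (Cmp T u (act_lift R a s))) = Cmp T u (act_lift R a s)"
    proof (rule lay_fill[OF a d(2) ls(6)], goal_cases)
      case 1 then show ?case using d ls category_T by (simp add: in_hom)
    next
      case 2 then show ?case using im ap by (simp add: act_lay_eq(1)[OF a])
    next
      case (3 x)
      then have x: "x \<in> part a s" by (simp add: act_lay_eq(1)[OF a])
      then have "x \<in> fst s" by (simp add: part_def)
      then show ?case using x ap im d(7) by (auto simp: act_lay_eq(2)[OF a])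
    qed
    show "fa (Act (LaySp R) a) f \<in> hom (Gpd (LaySp R) (Dom Simp a)) (fo (Act (LaySp R) a) (Dom (Gpd (LaySp R) (Cod Simp a))
        f)) (fo (Act (LaySp R) a) (Cod (Gpd (LaySp R) (Cod Simp a)) f))"
      "Cmp (Base (LayS R)) (Lift (LayS R) a (Cod (Gpd (LaySp R) (Cod Simp a)) f)) (sha (LayS R) (fa (Act (LaySp R) a) f)) =
       Cmp (Base (LayS R)) (sha (LayS R) f) (Lift (LayS R) a (Dom (Gpd (LaySp R) (Cod Simp a)) f))"
      using F f d(1,2) by (simp_all add: e LaySp_simps in_hom Lay_simps(3,4)) }
  fix b assume b: "b \<in> Arr Simp" "Cod Simp a = Dom Simp b"
  fix t assume "t \<in> Obj (Gpd (LaySp R) (Cod Simp b))"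
  then have t: "t \<in> Obj (Lay R (Cod Simp b))" by (simp add: LaySp_simps)
  let ?c = "Cmp Simp b a"
  have c: "?c \<in> Arr Simp" "Cod Simp ?c = Cod Simp b" "Dom Simp ?c = Dom Simp a" using a b category_Simp by auto
  note lb = act_lift[OF b(1) t]
  have bt: "act_lay R b t \<in> Obj (Lay R (Cod Simp a))" using lb(6) b by simp
  note la = act_lift[OF a bt]
  note pc = part_comp(1)[OF a b, where R = R and t = t] part_comp(2)[OF a b, where t = t] part_comp(3)[OF a b, where t = t]
  have ap: "pm R (Cmp T (act_lift R b t) (act_lift R a (act_lay R b t))) x = x" if "x \<in> part ?c t" for x
    using pm_comp_apply[OF la(1) lb(1), of x] la lb that pc by auto
  \<comment> \<open>The composition cell fills the composite of the two lifts; its filling equation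
    is the condition \<open>CmpI_lift\<close>.\<close>
  have F: "(act_lay R a (act_lay R b t), fill R (act_lift R ?c t) (Cmp T (act_lift R b t) (act_lift R a (act_lay R b t))),
      act_lay R ?c t) \<in> Arr (Lay R (Dom Simp ?c))
     \<and> Cmp T (act_lift R ?c t) (fill R (act_lift R ?c t) (Cmp T (act_lift R b t) (act_lift R a (act_lay R b t)))) = Cmp T
         (act_lift R b t) (act_lift R a (act_lay R b t))"
  proof (rule lay_fill[OF c(1)], unfold c)
    show "Cmp T (act_lift R b t) (act_lift R a (act_lay R b t)) \<in> hom T (str (act_lay R a (act_lay R b t))) (str t)"
      using la lb category_T by (simp add: in_hom)
    show "part ?c t \<subseteq> pm R (Cmp T (act_lift R b t) (act_lift R a (act_lay R b t))) ` fst (act_lay R a (act_lay R b t))"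
      using ap pc by (auto simp: act_lay_eq(1)[OF a] image_iff)
    fix x assume "x \<in> fst (act_lay R a (act_lay R b t))"
    then have x: "x \<in> part ?c t" by (simp add: act_lay_eq(1)[OF a] pc)
    then have xb: "x \<in> part b t" using pc(2) by blast
    show "pm R (Cmp T (act_lift R b t) (act_lift R a (act_lay R b t))) x \<in> part ?c t \<and>
         idx ?c (lyr t (pm R (Cmp T (act_lift R b t) (act_lift R a (act_lay R b t))) x)) = lyr (act_lay R a (act_lay R b t))
             x"
      using x xb ap[OF x] pc(3)[OF x] by (simp add: act_lay_eq(2)[OF a] act_lay_eq(2)[OF b(1)] pc(1))
  qed (use t la(6) in simp_all)
  show "CmpI (LaySp R) a b t \<in> hom (Gpd (LaySp R) (Dom Simp a)) (fo (Act (LaySp R) a) (fo (Act (LaySp R) b) t)) (fo (Act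
      (LaySp R) ?c) t)"
    "Cmp (Base (LayS R)) (Lift (LayS R) ?c t) (sha (LayS R) (CmpI (LaySp R) a b t)) =
       Cmp (Base (LayS R)) (Lift (LayS R) b t) (Lift (LayS R) a (fo (Act (LaySp R) b) t))"
    using F t bt c by (simp_all add: LaySp_simps in_hom Lay_simps(3,4))
next
  fix c t assume "t \<in> Obj (Gpd (LaySp R) c)"
  then have t: "t \<in> Obj (Lay R c)" by (simp add: LaySp_simps)
  have i: "Id Simp c \<in> Arr Simp" "Dom Simp (Id Simp c) = c" "Cod Simp (Id Simp c) = c" using category_Simp by (auto simp:
      Simp_simps(1))
  \<comment> \<open>The unit cell fills an identity, which is possible because the identity of
    \<open>[c]\<close> retains every element in its own layer.\<close>
  have "(t, fill R (act_lift R (Id Simp c) t) (Id T (str t)), act_lay R (Id Simp c) t) \<in> Arr (Lay R (Dom Simp (Id Simp c))) \<and>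
    Cmp T (act_lift R (Id Simp c) t) (fill R (act_lift R (Id Simp c) t) (Id T (str t))) = Id T (str t)"
    using t lay_objD[OF t] part_Id[OF t] pm_Id[of "str t"] category_T
    by (intro lay_fill[OF i(1)]; (unfold i)?) (auto simp: in_hom image_iff)
  then show "IdI (LaySp R) c t \<in> hom (Gpd (LaySp R) c) t (fo (Act (LaySp R) (Id Simp c)) t)"
    "Cmp (Base (LayS R)) (Lift (LayS R) (Id Simp c) t) (sha (LayS R) (IdI (LaySp R) c t)) = Id (Base (LayS R)) (sho (LayS R)
        t)"
    using t i by (simp_all add: LaySp_simps in_hom Lay_simps(3,4))
qed (simp_all add: LaySp_simps)

end

section \<open>The decomposition space of a restriction species\<close>

lemma CmpI_natural:
  assumes X: "pseudofunctor C X" and a: "a \<in> Arr C" and b: "b \<in> Arr C" and e: "Cod C a = Dom C b" and h: "h \<in> Arr (Gpd X (Cod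
      C b))"
  shows "Cmp (Gpd X (Dom C a)) (CmpI X a b (Cod (Gpd X (Cod C b)) h)) (fa (Act X a) (fa (Act X b) h)) =
    Cmp (Gpd X (Dom C a)) (fa (Act X (Cmp C b a)) h) (CmpI X a b (Dom (Gpd X (Cod C b)) h))"
proof -
  have "nat_iso (Gpd X (Cod C b)) (Gpd X (Dom C a)) (compF (Gpd X (Cod C b)) (Act X a) (Act X b)) (Act X (Cmp C b a)) (CmpI X
      a b)"
    using X a b e unfolding pseudofunctor_def by blast
  from nat_iso_rules(5)[OF this h] h show ?thesis by simp
qed

text \<open>The filling joins the composition cells of the two factorisations of the diagonal. Both
  are natural, and the one that enters as an inverse is dealt with by conjugation.\<close>

lemma decomposition_square:
  assumes X: "pseudofunctor C X" and a: "g \<in> Arr C" "f \<in> Arr C" "f' \<in> Arr C" "g' \<in> Arr C"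
    and e: "Dom C g = Dom C f" "Cod C g = Dom C f'" "Cod C f = Dom C g'" "Cod C f' = Cod C g'" "Cmp C f' g = Cmp C g' f"
  shows "square (Gpd X (Cod C f')) (Gpd X (Cod C g)) (Gpd X (Cod C f)) (Gpd X (Dom C g))
          (Act X f') (Act X g') (Act X g) (Act X f)
          (\<lambda>x. inverse_arr (Gpd X (Dom C g)) (CmpI X f g' x) \<cdot>\<^bsub>Gpd X (Dom C g)\<^esub> CmpI X g f' x)"
proof -
  note r = pseudofunctor_rules[OF X]
  have d: "Dom C g \<in> Obj C" "Cod C g \<in> Obj C" "Cod C f \<in> Obj C" "Cod C f' \<in> Obj C" using r(1) a by auto
  define E where "E = Gpd X (Dom C g)" define P where "P = Gpd X (Cod C f')"
  have gE: "groupoid E" using r(2) d by (simp add: E_def)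
  have fu: "is_functor P (Gpd X (Cod C g)) (Act X f')" "is_functor P (Gpd X (Cod C f)) (Act X g')"
    "is_functor (Gpd X (Cod C g)) E (Act X g)" "is_functor (Gpd X (Cod C f)) E (Act X f)"
    using r(3)[OF a(1)] r(3)[OF a(2)] r(3)[OF a(3)] r(3)[OF a(4)] by (simp_all add: e E_def P_def)
  note f = functor_rules[OF fu(1)] functor_rules[OF fu(2)] functor_rules[OF fu(3)] functor_rules[OF fu(4)]
  have ac: "is_functor P E (Act X (Cmp C g' f))"
    using r(3)[of "Cmp C g' f"] a e r(1) by (simp add: E_def P_def)
  note fc = functor_rules[OF ac]
  have c1: "CmpI X g f' x \<in> Arr E" "Dom E (CmpI X g f' x) = fo (Act X g) (fo (Act X f') x)" "Cod E (CmpI X g f' x) = fo (Act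
      X (Cmp C g' f)) x"
    if "x \<in> Obj P" for x using r(4-6)[OF a(1) a(3) e(2), of x] that by (simp_all add: E_def P_def e(5))
  have c2: "CmpI X f g' x \<in> Arr E" "Dom E (CmpI X f g' x) = fo (Act X f) (fo (Act X g') x)" "Cod E (CmpI X f g' x) = fo (Act
      X (Cmp C g' f)) x"
    if "x \<in> Obj P" for x using r(4-6)[OF a(2) a(4) e(3), of x] that by (simp_all add: E_def P_def e)
  have nat: "Cmp E (Cmp E (inverse_arr E (CmpI X f g' (Cod P h))) (CmpI X g f' (Cod P h))) (fa (Act X g) (fa (Act X f') h)) =
     Cmp E (fa (Act X f) (fa (Act X g') h)) (Cmp E (inverse_arr E (CmpI X f g' (Dom P h))) (CmpI X g f' (Dom P h)))"
     if h: "h \<in> Arr P" for h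
  proof -
    have o: "Cod P h \<in> Obj P" "Dom P h \<in> Obj P" using f(1) h by auto
    have n1: "Cmp E (CmpI X g f' (Cod P h)) (fa (Act X g) (fa (Act X f') h)) = Cmp E (fa (Act X (Cmp C g' f)) h) (CmpI X g f'
        (Dom P h))"
      using CmpI_natural[OF X a(1) a(3) e(2), of h] h by (simp add: E_def P_def e(5))
    have n2: "Cmp E (CmpI X f g' (Cod P h)) (fa (Act X f) (fa (Act X g') h)) = Cmp E (fa (Act X (Cmp C g' f)) h) (CmpI X f g'
        (Dom P h))"
      using CmpI_natural[OF X a(2) a(4) e(3), of h] h by (simp add: E_def P_def e)
    let ?i = "inverse_arr E (CmpI X f g' (Cod P h))" and ?j = "inverse_arr E (CmpI X f g' (Dom P h))"
    \<comment> \<open>Naturality of the inverse cell, obtained from \<open>n2\<close> by composing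
      with inverses on both sides.\<close>
    have ij: "Cmp E ?i (fa (Act X (Cmp C g' f)) h) = Cmp E (fa (Act X f) (fa (Act X g') h)) ?j"
    proof -
      have "Cmp E ?i (fa (Act X (Cmp C g' f)) h) = Cmp E ?i (Cmp E (Cmp E (fa (Act X (Cmp C g' f)) h) (CmpI X f g' (Dom P
          h))) ?j)"
        using o h gE by (simp add: c2 fc)
      also have "\<dots> = Cmp E (Cmp E ?i (CmpI X f g' (Cod P h))) (Cmp E (fa (Act X f) (fa (Act X g') h)) ?j)"
        unfolding n2[symmetric] using o h gE by (simp add: c2 f del: groupoid_inverse_arr(4))
      also have "\<dots> = Cmp E (fa (Act X f) (fa (Act X g') h)) ?j" using o h gE by (simp add: c2 f)
      finally show ?thesis .
    qed
    have "Cmp E (Cmp E ?i (CmpI X g f' (Cod P h))) (fa (Act X g) (fa (Act X f') h)) = Cmp E ?i (Cmp E (CmpI X g f' (Cod P h))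
        (fa (Act X g) (fa (Act X f') h)))"
      using o h gE by (simp add: c1 c2 f)
    also have "\<dots> = Cmp E (Cmp E ?i (fa (Act X (Cmp C g' f)) h)) (CmpI X g f' (Dom P h))"
      unfolding n1 using o h gE by (simp add: c1 c2 fc)
    also have "\<dots> = Cmp E (fa (Act X f) (fa (Act X g') h)) (Cmp E ?j (CmpI X g f' (Dom P h)))"
      unfolding ij using o h gE by (simp add: c1 c2 f)
    finally show ?thesis .
  qed
  have gr: "groupoid P" "groupoid (Gpd X (Cod C g))" "groupoid (Gpd X (Cod C f))" using r(2) d by (simp_all add: P_def)
  show ?thesis unfolding E_def[symmetric] P_def[symmetric]
    by unfold_locales (use fu gE gr nat in \<open>auto simp: in_hom c1 c2\<close>)
qed

text \<open>The layer maps of the explicit pushout. In the block from \<open>c + 1\<close> to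
  \<open>c + m\<close> the map of \<open>G'\<close> is that of \<open>g\<close> raised by
  \<open>c\<close>; outside it layers are only renumbered, where \<open>j + n - m\<close> undoes the
  shift by \<open>m - n\<close>. The maps of \<open>f\<close> and \<open>F'\<close> just subtract
  \<open>c\<close>.\<close>

lemma pushout_idx:
  assumes g: "generic (n, g, m)" and f: "free (n, f, k)"
  defines "c \<equiv> f 0" and "l \<equiv> k + m - n"
  defines "F' \<equiv> (m, \<lambda>j \<in> {0..m}. j + c, l)"
    and "G' \<equiv> (k, \<lambda>i \<in> {0..k}. if i \<le> c then i else if i \<le> c + n then c + g (i - c) else i + m - n, l)"
  shows "F' \<in> Arr Simp" "generic G'" "\<And>j. c < j \<Longrightarrow> j \<le> c + m \<Longrightarrow> idx F' j = j - c" "\<And>j. c < j \<Longrightarrow> j \<le> c + n \<Longrightarrow> idx (n, f, k) j = j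
      - c"
    "\<And>j. 0 < j \<Longrightarrow> j \<le> c \<Longrightarrow> idx G' j = j" "\<And>j. c + m < j \<Longrightarrow> j \<le> l \<Longrightarrow> idx G' j = j + n - m"
    "\<And>j. c < j \<Longrightarrow> j \<le> c + m \<Longrightarrow> idx G' j = c + idx (n, g, m) (j - c)"
    "part F' t = {x \<in> fst t. c < lyr t x \<and> lyr t x \<le> c + m}" "part (n, f, k) t = {x \<in> fst t. c < lyr t x \<and> lyr t x \<le> c + n}"
proof -
  have p: "c + n \<le> k" "\<And>i. i \<le> n \<Longrightarrow> f i = i + c" "pushout Simp (n, g, m) (n, f, k) F' G'"
    unfolding c_def l_def F'_def G'_def using pushout_generic_free[OF g f] by blast+
  show Fa: "F' \<in> Arr Simp" using p(3) by (simp add: pushout_def)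
  have Ga: "G' \<in> Arr Simp" using p(3) by (simp add: pushout_def)
  have ga: "(n, g, m) \<in> Arr Simp" "g 0 = 0" "g n = m" and fa: "(n, f, k) \<in> Arr Simp" using g f by (auto simp: generic_def
      free_def)
  show "generic G'" unfolding generic_def G'_def
    using Ga ga p(1) by (auto simp: G'_def l_def)
  show "idx F' j = j - c" if "c < j" "j \<le> c + m" for j
    using Fa that unfolding F'_def by (intro idx_eqI) auto
  show "idx (n, f, k) j = j - c" if "c < j" "j \<le> c + n" for j
    using fa that p(2)[of "j - c - 1"] p(2)[of "j - c"] by (intro idx_eqI) auto
  show "idx G' j = j" if "0 < j" "j \<le> c" for j
    using Ga that p(1) unfolding G'_def by (intro idx_eqI) auto
  show "idx G' j = j + n - m" if j: "c + m < j" "j \<le> l" for j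
  proof -
    define i where "i = j + n - m"
    have i: "i \<in> {1..k}" "c + n < i" "i + m - n = j" "i - 1 \<le> k" using j p(1) by (auto simp: l_def i_def)
    \<comment> \<open>At \<open>i - 1 = c + n\<close> the middle branch of \<open>G'\<close> still
      applies; it gives \<open>c + m\<close>, which is below \<open>j\<close>.\<close>
    have "(if i - 1 \<le> c then i - 1 else if i - 1 \<le> c + n then c + g (i - 1 - c) else i - 1 + m - n) < j"
    proof (cases "i - 1 \<le> c + n")
      case True
      then have "i - 1 = c + n" using i(2) by auto
      then show ?thesis using j(1) ga(3) by auto
    next
      case False then show ?thesis using i by auto
    qed
    then show ?thesis unfolding G'_def i_def[symmetric] using Ga i by (intro idx_eqI) (auto simp: G'_def)
  qed
  show "idx G' j = c + idx (n, g, m) (j - c)" if j: "c < j" "j \<le> c + m" for j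
  proof -
    let ?i = "idx (n, g, m) (j - c)"
    have i: "?i \<in> {1..n}" "g (?i - 1) < j - c" "j - c \<le> g ?i" using idx_props[OF ga(1), of "j - c"] ga j by auto
    then have "c + ?i - 1 - c = ?i - 1" "c + ?i - 1 \<le> c \<Longrightarrow> c + ?i - 1 = c" "c + g (?i - 1) < j" "j \<le> c + g ?i" "c + ?i - 1 \<le> c
        + n"
      using j by auto
    then show ?thesis using Ga j p(1) i unfolding G'_def by (intro idx_eqI) auto
  qed
  show "part F' t = {x \<in> fst t. c < lyr t x \<and> lyr t x \<le> c + m}" by (auto simp: part_def F'_def)
  show "part (n, f, k) t = {x \<in> fst t. c < lyr t x \<and> lyr t x \<le> c + n}" using p(2)[of n] by (auto simp: part_def c_def)
qed

context species
begin

interpretation L: lifted Simp "LaySp R" "LayS R" by (rule lifted_LaySp)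

text \<open>In a generic-free pushout the layers of \<open>g'\<close> outside the image of \<open>f\<close> are in bijection with those
  outside the image of \<open>f'\<close>. So a layering over the pushout is glued from layerings of the two
  corners, and an isomorphism over \<open>g'\<close> respects it once its restriction along \<open>f'\<close> does.\<close>

lemma decomposition_space_LaySp: "decomposition_space (LaySp R)"
  unfolding decomposition_space_def
proof (intro conjI allI impI L.pseudofunctor; elim conjE)
  fix g f f' g' assume gg: "generic g" and ff: "free f" and po: "pushout Simp g f f' g'"
  obtain n g0 m where g: "g = (n, g0, m)" by (cases g)
  have "Dom Simp f = n" using po by (simp add: pushout_def g Simp_simps)
  then obtain f0 k where f: "f = (n, f0, k)" by (cases f) (simp add: Simp_simps)
  define c where "c = f0 0" define l where "l = k + m - n"
  define F' where "F' = (m, \<lambda>j \<in> {0..m}. j + c, l)"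
  define G' where "G' = (k, \<lambda>i \<in> {0..k}. if i \<le> c then i else if i \<le> c + n then c + g0 (i - c) else i + m - n, l)"
  note folds = c_def[symmetric] l_def[symmetric] F'_def[symmetric] G'_def[symmetric]
  note px = pushout_generic_free[OF gg[unfolded g] ff[unfolded f], unfolded folds, folded g f]
  note ix = pushout_idx[OF gg[unfolded g] ff[unfolded f], unfolded folds, folded g f]
  \<comment> \<open>Strict uniqueness of pushouts replaces the given square by the explicit
    one.\<close>
  have e: "f' = F'" "g' = G'" using pushout_Simp_unique[OF po px(3)] by auto
  have a: "g \<in> Arr Simp" "f \<in> Arr Simp" "f' \<in> Arr Simp" "g' \<in> Arr Simp"
    and eq: "Dom Simp g = Dom Simp f" "Cod Simp g = Dom Simp f'" "Cod Simp f = Dom Simp g'" "Cod Simp f' = Cod Simp g'" "Cmp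
        Simp f' g = Cmp Simp g' f"
    using po by (auto simp: pushout_def)
  have dm: "Dom Simp g = n" "Cod Simp g = m" "Dom Simp f = n" "Cod Simp f = k" "Dom Simp f' = m" "Cod Simp f' = l" "Dom Simp
      g' = k" "Cod Simp g' = l"
    by (simp_all add: g f e F'_def G'_def Simp_simps(3,4))
  have gg': "generic g'" using ix(2) by (simp add: e)
  have fin: "is_functor (Lay R l) (Lay R m) (Act (LaySp R) f')" "is_functor (Lay R l) (Lay R k) (Act (LaySp R) g')"
    "is_functor (Lay R m) (Lay R n) (Act (LaySp R) g)" "is_functor (Lay R k) (Lay R n) (Act (LaySp R) f)"
    using L.Act_functor[OF a(1)] L.Act_functor[OF a(2)] L.Act_functor[OF a(3)] L.Act_functor[OF a(4)] by (simp_all add: dm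
        LaySp_simps(1))
  note fu = functor_rules[OF fin(1)] functor_rules[OF fin(2)] functor_rules[OF fin(3)] functor_rules[OF fin(4)]
  define \<theta> where "\<theta> = (\<lambda>x. inverse_arr (Lay R n) (CmpI (LaySp R) f g' x) \<cdot>\<^bsub>Lay R n\<^esub> CmpI (LaySp R) g f' x)"
  have sq: "square (Lay R l) (Lay R m) (Lay R k) (Lay R n) (Act (LaySp R) f') (Act (LaySp R) g') (Act (LaySp R) g) (Act
      (LaySp R) f) \<theta>"
    using decomposition_square[OF L.pseudofunctor a eq] by (simp add: dm LaySp_simps(1) \<theta>_def)
  note \<theta> = square.\<theta>[OF sq, unfolded in_hom]
  have sn: "sha (LayS R) h \<in> Arr T" "Dom T (sha (LayS R) h) = str (Dom (Lay R q) h)" "Cod T (sha (LayS R) h) = str (Cod (Lay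
      R q) h)"
    if "h \<in> Arr (Lay R q)" for h q
    using L.shape(3-5)[of q h] that by (simp_all add: Simp_simps(1) LaySp_simps(1))
  note sn' = sn[where q = n] sn[where q = m] sn[where q = k] sn[where q = l]
  have scmp: "sha (LayS R) (Cmp (Lay R q) h' h) = Cmp T (sha (LayS R) h') (sha (LayS R) h)"
    if "h \<in> Arr (Lay R q)" "h' \<in> Arr (Lay R q)" "Cod (Lay R q) h = Dom (Lay R q) h'" for h h' q
    using L.shape(6)[of q h h'] that by (simp add: Simp_simps(1) LaySp_simps(1))
  have act: "fo (Act (LaySp R) f') x = act_lay R f' x" "fo (Act (LaySp R) g') x = act_lay R g' x" if "x \<in> Obj (Lay R l)" for
      x
    using that by (simp_all add: LaySp_simps dm)
  have actg: "fo (Act (LaySp R) g) x = act_lay R g x" if "x \<in> Obj (Lay R m)" for x using that by (simp add: LaySp_simps dm)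
  have actf: "fo (Act (LaySp R) f) x = act_lay R f x" if "x \<in> Obj (Lay R k)" for x using that by (simp add: LaySp_simps dm)
  note lf' = act_lift[OF a(3), unfolded dm] and lf = act_lift[OF a(2), unfolded dm] and lg' = act_lift[OF a(4), unfolded dm]
      and lg = act_lift[OF a(1), unfolded dm]
  note Lg = act_lift_generic[OF gg, unfolded dm] and Lg' = act_lift_generic[OF gg', unfolded dm]
  \<comment> \<open>Generic maps leave the shapes of arrows alone, their lifts being
    identities.\<close>
  have sag: "sha (LayS R) (fa (Act (LaySp R) g) h) = sha (LayS R) h" if h: "h \<in> Arr (Lay R m)" for h
    using L.Lift_nat[OF a(1), of h] h Lg(1) sn[OF h] sn[OF fu(20)[OF h]] category_T category_rules(1,2)[OF category_Lay h]
        lay_objD(1) Lg(2)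
    by (simp add: dm LaySp_simps(1) fu actg)
  have sag': "sha (LayS R) (fa (Act (LaySp R) g') h) = sha (LayS R) h" if h: "h \<in> Arr (Lay R l)" for h
    using L.Lift_nat[OF a(4), of h] h Lg'(1) sn[OF h] sn[OF fu(12)[OF h]] category_T category_rules(1,2)[OF category_Lay h]
        lay_objD(1) Lg'(2)
    by (simp add: dm LaySp_simps(1) fu act)
  have nf': "Cmp T (act_lift R f' (Cod (Lay R l) h)) (sha (LayS R) (fa (Act (LaySp R) f') h)) = Cmp T (sha (LayS R) h)
      (act_lift R f' (Dom (Lay R l) h))"
    if "h \<in> Arr (Lay R l)" for h using L.Lift_nat[OF a(3), of h] that by (simp add: dm LaySp_simps(1))
  have nf: "Cmp T (act_lift R f (Cod (Lay R k) h)) (sha (LayS R) (fa (Act (LaySp R) f) h)) = Cmp T (sha (LayS R) h) (act_lift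
      R f (Dom (Lay R k) h))"
    if "h \<in> Arr (Lay R k)" for h using L.Lift_nat[OF a(2), of h] that by (simp add: dm LaySp_simps(1))
  \<comment> \<open>The filling is identified through its composite with the lift along
    \<open>f\<close>. As the lifts along \<open>g\<close> and \<open>g'\<close> are identities, both
    factorisations of the diagonal leave the lift along \<open>f'\<close>.\<close>
  have L\<theta>: "Cmp T (act_lift R f (act_lay R g' x)) (sha (LayS R) (\<theta> x)) = act_lift R f' x" if x: "x \<in> Obj (Lay R l)" for x
  proof -
    let ?c = "CmpI (LaySp R) f g' x" and ?d = "CmpI (LaySp R) g f' x" and ?h = "Cmp Simp g' f"
    have gx: "act_lay R g' x \<in> Obj (Lay R k)" "act_lay R f' x \<in> Obj (Lay R m)" using x lg'(6) lf'(6) by auto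
    have c: "?c \<in> Arr (Lay R n)" "Dom (Lay R n) ?c = act_lay R f (act_lay R g' x)" "Cod (Lay R n) ?c = fo (Act (LaySp R) ?h)
        x"
      and d: "?d \<in> Arr (Lay R n)" "Dom (Lay R n) ?d = act_lay R g (act_lay R f' x)" "Cod (Lay R n) ?d = fo (Act (LaySp R) ?h)
          x"
      using L.CmpI[OF a(2) a(4) eq(3), of x] L.CmpI[OF a(1) a(3) eq(2), of x] x gx
      by (simp_all add: in_hom dm LaySp_simps(1) eq(5) act actg actf)
    let ?i = "inverse_arr (Lay R n) ?c"
    have i: "?i \<in> Arr (Lay R n)" "Dom (Lay R n) ?i = Cod (Lay R n) ?c" "Cod (Lay R n) ?i = Dom (Lay R n) ?c" "Cmp (Lay R n)
        ?c ?i = Id (Lay R n) (Cod (Lay R n) ?c)"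
      using groupoid_Lay c(1) by auto
    have k1: "Cmp T (act_lift R ?h x) (sha (LayS R) ?c) = Cmp T (act_lift R g' x) (act_lift R f (act_lay R g' x))"
      and k2: "Cmp T (act_lift R ?h x) (sha (LayS R) ?d) = Cmp T (act_lift R f' x) (act_lift R g (act_lay R f' x))"
      using L.CmpI_lift[OF a(2) a(4) eq(3), of x] L.CmpI_lift[OF a(1) a(3) eq(2), of x] x by (simp_all add: dm LaySp_simps(1)
          eq(5) act)
    have hh: "?h \<in> Arr Simp" "Cod Simp ?h = l" "Dom Simp ?h = n" using a eq category_Simp by (simp_all add: dm)
    note lh = act_lift[OF hh(1), unfolded hh(2,3), OF x]
    have hx: "fo (Act (LaySp R) ?h) x = act_lay R ?h x" using x by (simp add: LaySp_simps hh)
    have gm1: "act_lift R g' x = Id T (str x)" "act_lift R g (act_lay R f' x) = Id T (str (act_lay R f' x))" using Lg'(1)[OF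
        x] Lg(1)[OF gx(2)] by auto
    have "act_lift R f (act_lay R g' x) = Cmp T (act_lift R ?h x) (sha (LayS R) ?c)"
      unfolding k1 gm1 using lf[OF gx(1)] Lg'(2)[OF x] category_T by simp
    then have "Cmp T (act_lift R f (act_lay R g' x)) (sha (LayS R) (\<theta> x)) = Cmp T (Cmp T (act_lift R ?h x) (sha (LayS R) ?c))
        (Cmp T (sha (LayS R) ?i) (sha (LayS R) ?d))"
      using i c d by (simp add: \<theta>_def scmp)
    also have "\<dots> = Cmp T (act_lift R ?h x) (Cmp T (sha (LayS R) (Cmp (Lay R n) ?c ?i)) (sha (LayS R) ?d))"
      using i(1-3) c d lh category_T by (simp add: sn' hx scmp)
    also have "\<dots> = act_lift R f' x"
      unfolding i(4) using k2 gm1 lf'[OF x] sn[OF d(1)] d(3) category_T lh lg'(1)[OF x] c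
      by (simp add: Lay_simps(5) hx)
    finally show ?thesis .
  qed
  have rng: "lyr x z \<in> {1..q}" if "x \<in> Obj (Lay R q)" "z \<in> fst x" for x z q
    using that by (auto simp: Lay_simps(1))
  show "homotopy_pullback (Gpd (LaySp R) (Cod Simp f')) (Gpd (LaySp R) (Cod Simp g)) (Gpd (LaySp R) (Cod Simp f)) (Gpd (LaySp
      R) (Dom Simp g))
          (Act (LaySp R) f') (Act (LaySp R) g') (Act (LaySp R) g) (Act (LaySp R) f)
          (\<lambda>x. inverse_arr (Gpd (LaySp R) (Dom Simp g)) (CmpI (LaySp R) f g' x)
             \<cdot>\<^bsub>Gpd (LaySp R) (Dom Simp g)\<^esub> CmpI (LaySp R) g f' x)"
    unfolding dm LaySp_simps(1) \<theta>_def[symmetric] square.homotopy_pullback_iff[OF sq]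
  proof (intro conjI ballI impI)
    fix x y u v assume x: "x \<in> Obj (Lay R l)" and y: "y \<in> Obj (Lay R l)"
      and "u \<in> hom (Lay R m) (fo (Act (LaySp R) f') x) (fo (Act (LaySp R) f') y)"
      and "v \<in> hom (Lay R k) (fo (Act (LaySp R) g') x) (fo (Act (LaySp R) g') y)"
      and q: "Cmp (Lay R n) (\<theta> y) (fa (Act (LaySp R) g) u) = Cmp (Lay R n) (fa (Act (LaySp R) f) v) (\<theta> x)"
    then have u: "u \<in> Arr (Lay R m)" "Dom (Lay R m) u = act_lay R f' x" "Cod (Lay R m) u = act_lay R f' y"
      and v: "v \<in> Arr (Lay R k)" "Dom (Lay R k) v = act_lay R g' x" "Cod (Lay R k) v = act_lay R g' y"
      by (simp_all add: in_hom act)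
    obtain u0 v0 where u0: "u = (act_lay R f' x, u0, act_lay R f' y)" and v0: "v = (act_lay R g' x, v0, act_lay R g' y)"
      using u v by (cases u, cases v) (auto simp: Lay_simps(3,4))
    note du = Lay_arrD[OF u(1)[unfolded u0]] and dv = Lay_arrD[OF v(1)[unfolded v0]]
    have x': "act_lay R g' x \<in> Obj (Lay R k)" "act_lay R g' y \<in> Obj (Lay R k)" using x y lg'(6) by auto
    \<comment> \<open>The compatibility equation carried to the total category, where it says that
      \<open>v0\<close> restricts to \<open>u0\<close> along the lifts of \<open>f'\<close>.\<close>
    have uv: "Cmp T (act_lift R f' y) u0 = Cmp T v0 (act_lift R f' x)"
    proof -
      let ?L = "act_lift R f (act_lay R g' y)"
      have "Cmp T (act_lift R f' y) u0 = Cmp T (Cmp T ?L (sha (LayS R) (\<theta> y))) (sha (LayS R) (fa (Act (LaySp R) g) u))"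
        using L\<theta>[OF y] sag[OF u(1)] by (simp add: u0)
      also have "\<dots> = Cmp T ?L (sha (LayS R) (Cmp (Lay R n) (\<theta> y) (fa (Act (LaySp R) g) u)))"
        using \<theta>[OF y] u fu category_T y lf[OF x'(2)] by (simp add: scmp sn' actf act x')
      also have "\<dots> = Cmp T (Cmp T ?L (sha (LayS R) (fa (Act (LaySp R) f) v))) (sha (LayS R) (\<theta> x))"
        unfolding q using \<theta>[OF x] v fu category_T x lf[OF x'(2)] by (simp add: scmp sn' actf act x')
      also have "\<dots> = Cmp T (Cmp T v0 (act_lift R f (act_lay R g' x))) (sha (LayS R) (\<theta> x))"
        using nf[OF v(1)] by (simp add: v v0[symmetric]) (simp add: v0)
      also have "\<dots> = Cmp T v0 (act_lift R f' x)"
        using \<theta>[OF x] dv category_T x lf[OF x'(1)] L\<theta>[OF x] by (simp add: sn' actf act x')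
      finally show ?thesis .
    qed
    have fx: "fst (act_lay R g' x) = fst x" "fst (act_lay R g' y) = fst y" "str (act_lay R g' x) = str x" "str (act_lay R g'
        y) = str y"
      using Lg'(2,3) x y by auto
    have vu: "pm R v0 z = pm R u0 z" "pm R u0 z \<in> part f' y" if z: "z \<in> part f' x" for z
    proof -
      have zx: "z \<in> und R (str (act_lay R f' x))" using lf'(4)[OF x] z by simp
      then have "pm R u0 z \<in> und R (str (act_lay R f' y))" using pm_in[OF du(3), of z] du by simp
      then show uy: "pm R u0 z \<in> part f' y" using lf'(4)[OF y] by simp
      have "pm R (act_lift R f' y) (pm R u0 z) = pm R v0 (pm R (act_lift R f' x) z)"
        using arg_cong[OF uv, of "\<lambda>h. pm R h z"] pm_comp_apply[OF du(3) lf'(1)[OF y], of z] pm_comp_apply[OF lf'(1)[OF x]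
            dv(3), of z]
          du lf'[OF x] lf'[OF y] zx dv fx z by simp
      then show "pm R v0 z = pm R u0 z" using lf'(5)[OF x z] lf'(5)[OF y uy] by simp
    qed
    \<comment> \<open>The structure part of the filler is \<open>v0\<close> itself; what has to be
      shown is that it respects the layerings over \<open>[l]\<close> and not only those over
      \<open>[k]\<close>.\<close>
    have w: "(x, v0, y) \<in> Arr (Lay R l)"
    proof (rule Lay_arrI[OF x y])
      show "v0 \<in> hom T (str x) (str y)" using dv fx by (simp add: in_hom)
      show "fst y \<subseteq> pm R v0 ` fst x" using dv(6) fx by simp
      fix z assume z: "z \<in> fst x"
      let ?z = "pm R v0 z"
      have z': "?z \<in> fst y" using dv(6) fx z by auto
      have lz: "idx g' (lyr y ?z) = idx g' (lyr x z)" using dv(7)[of z] Lg'(4)[OF x z] Lg'(4)[OF y z'] z fx by simp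
      show "lyr y ?z = lyr x z"
      proof (cases "z \<in> part f' x")
        case True
        have uy: "?z \<in> part f' y" using vu True by simp
        have "idx f' (lyr y ?z) = idx f' (lyr x z)"
          using du(7)[of z] True uy vu[OF True] by (simp add: act_lay_eq[OF a(3)])
        then show ?thesis using True uy ix(3) by (auto simp: e ix(8))
      next
        case False
        \<comment> \<open>The arrow \<open>u0\<close> maps \<open>part f' x\<close> onto
          \<open>part f' y\<close>, and \<open>v0\<close> agrees with it there and is injective;
          hence no element from outside can enter.\<close>
        have "?z \<notin> part f' y"
        proof
          assume "?z \<in> part f' y"
          then have "?z \<in> pm R u0 ` part f' x" using du(6) by (simp add: act_lay_eq(1)[OF a(3)])
          then obtain z2 where z2: "z2 \<in> part f' x" "?z = pm R u0 z2" by blast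
          then have "pm R v0 z2 = ?z" using vu(1)[OF z2(1)] by simp
          moreover have "z2 \<in> fst x" using z2 by (simp add: part_def)
          ultimately have "z2 = z" using pm_inj[OF dv(3), of z2 z] z dv(4) fx lay_objD(2)[OF x] by simp
          then show False using z2 False by simp
        qed
        then have "lyr x z \<in> {1..c} \<union> {c + m<..l}" "lyr y ?z \<in> {1..c} \<union> {c + m<..l}"
          using False rng[OF x z] rng[OF y z'] z z' by (auto simp: e ix(8))
        then show ?thesis using lz px(1) ix(5)[of "lyr x z"] ix(5)[of "lyr y ?z"] ix(6)[of "lyr x z"] ix(6)[of "lyr y ?z"]
            unfolding e
          by (auto simp: l_def)
      qed
    qed
    have ws: "Dom (Lay R l) (x, v0, y) = x" "Cod (Lay R l) (x, v0, y) = y" by (simp_all add: Lay_simps(3,4))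
    have q1: "fa (Act (LaySp R) f') (x, v0, y) = u"
    proof (rule L.lift_cancel[OF a(3), of y, unfolded dm LaySp_simps(1)])
      show "y \<in> Obj (Lay R l)" by (rule y)
      show "Cmp (Base (LayS R)) (Lift (LayS R) f' y) (sha (LayS R) (fa (Act (LaySp R) f') (x, v0, y))) = Cmp (Base (LayS R))
          (Lift (LayS R) f' y) (sha (LayS R) u)"
        using nf'[OF w] uv by (simp add: ws u0)
    qed (use u fu w ws act x y in auto)
    have q2: "fa (Act (LaySp R) g') (x, v0, y) = v"
      by (rule L.shape_eqI[of k, unfolded LaySp_simps(1)]) (use v fu w ws act x y sag'[OF w] in \<open>auto simp: Simp_simps(1)
          v0\<close>)
    show "\<exists>!w. w \<in> hom (Lay R l) x y \<and> fa (Act (LaySp R) f') w = u \<and> fa (Act (LaySp R) g') w = v"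
    proof (rule ex1I[of _ "(x, v0, y)"])
      show "(x, v0, y) \<in> hom (Lay R l) x y \<and> fa (Act (LaySp R) f') (x, v0, y) = u \<and> fa (Act (LaySp R) g') (x, v0, y) = v"
        using w ws q1 q2 by (simp add: in_hom)
      fix w' assume w': "w' \<in> hom (Lay R l) x y \<and> fa (Act (LaySp R) f') w' = u \<and> fa (Act (LaySp R) g') w' = v"
      then obtain w0 where "w' = (x, w0, y)" by (cases w') (auto simp: in_hom Lay_simps(3,4))
      then show "w' = (x, v0, y)" using w' sag'[of w'] by (auto simp: in_hom v0)
    qed
  next
    fix s t \<gamma> assume s: "s \<in> Obj (Lay R m)" and t: "t \<in> Obj (Lay R k)"
      and "\<gamma> \<in> hom (Lay R n) (fo (Act (LaySp R) g) s) (fo (Act (LaySp R) f) t)"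
    then have \<gamma>: "\<gamma> \<in> Arr (Lay R n)" "Dom (Lay R n) \<gamma> = act_lay R g s" "Cod (Lay R n) \<gamma> = act_lay R f t"
      by (simp_all add: in_hom actg actf)
    \<comment> \<open>The glued object takes its structure from \<open>t\<close>, so its comparison
      with \<open>s\<close> runs against \<open>\<gamma>\<close>.\<close>
    let ?\<delta> = "inverse_arr (Lay R n) \<gamma>"
    have \<delta>: "?\<delta> \<in> Arr (Lay R n)" "Dom (Lay R n) ?\<delta> = act_lay R f t" "Cod (Lay R n) ?\<delta> = act_lay R g s" "Cmp (Lay R n) \<gamma> ?\<delta> =
        Id (Lay R n) (act_lay R f t)"
      using groupoid_Lay \<gamma> by auto
    obtain \<gamma>0 d0 where \<gamma>0: "\<gamma> = (act_lay R g s, \<gamma>0, act_lay R f t)" and d0: "?\<delta> = (act_lay R f t, d0, act_lay R g s)"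
      using \<gamma> \<delta> by (cases \<gamma>, cases ?\<delta>) (auto simp: Lay_simps(3,4))
    have dd: "(act_lay R f t, d0, act_lay R g s) \<in> Arr (Lay R n)" using \<delta>(1) by (simp only: d0)
    note d = Lay_arrD[OF dd] and d\<gamma> = Lay_arrD[OF \<gamma>(1)[unfolded \<gamma>0]]
    have \<gamma>d: "Cmp T \<gamma>0 d0 = Id T (str (act_lay R f t))" using \<delta>(4) unfolding d0 by (simp add: \<gamma>0 Lay_simps(5,6))
    have gs: "fst (act_lay R g s) = fst s" "str (act_lay R g s) = str s" using Lg(2,3) s by auto
    let ?B = "part f t"
    have dB: "pm R d0 z \<in> fst s" "idx g (lyr s (pm R d0 z)) = lyr t z - c" if z: "z \<in> ?B" for z
    proof -
      have zf: "z \<in> fst (act_lay R f t)" using z by (simp add: act_lay_eq(1)[OF a(2)])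
      show zs: "pm R d0 z \<in> fst s" using d(6) zf gs by auto
      have "idx g (lyr s (pm R d0 z)) = idx f (lyr t z)"
        using d(7)[OF zf] Lg(4)[OF s zs] z by (simp add: act_lay_eq(2)[OF a(2)])
      then show "idx g (lyr s (pm R d0 z)) = lyr t z - c" using z ix(4) by (simp add: ix(9))
    qed
    \<comment> \<open>The glued layering. On the elements retained by \<open>f\<close> it takes the
      layers of \<open>s\<close>, read through \<open>d0\<close> and raised by \<open>c\<close>; on
      the others it keeps the layer of \<open>t\<close> below the block and shifts it by
      \<open>m - n\<close> above.\<close>
    define r where "r = (\<lambda>z \<in> fst t. if z \<in> ?B then c + lyr s (pm R d0 z) else if lyr t z \<le> c then lyr t z else lyr t z + m -
        n)"
    define x where "x = (fst t, r, str t)"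
    have rB: "c < r z" "r z \<le> c + m" "r z = c + lyr s (pm R d0 z)" if "z \<in> ?B" for z
      using that rng[OF s dB(1)[OF that]] by (auto simp: r_def part_def)
    have rN: "r z \<in> {1..l}" "\<not> (c < r z \<and> r z \<le> c + m)" "idx g' (r z) = lyr t z" if z: "z \<in> fst t" "z \<notin> ?B" for z
    proof -
      have rz: "r z = (if lyr t z \<le> c then lyr t z else lyr t z + m - n)" and tz: "lyr t z \<in> {1..k}" "lyr t z \<le> c \<or> c + n <
          lyr t z"
        using z rng[OF t z(1)] by (auto simp: r_def ix(9))
      show "r z \<in> {1..l}" "\<not> (c < r z \<and> r z \<le> c + m)" using rz tz px(1) by (auto simp: l_def)
      show "idx g' (r z) = lyr t z"
      proof (cases "lyr t z \<le> c")
        case True then show ?thesis using rz tz ix(5)[of "lyr t z"] by (simp add: e)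
      next
        case False
        then have "c + m < lyr t z + m - n" "lyr t z + m - n \<le> l" "lyr t z + m - n + n - m = lyr t z" using tz by (auto simp:
            l_def)
        then show ?thesis using False rz ix(6)[of "lyr t z + m - n"] by (simp add: e)
      qed
    qed
    have rr: "r z \<in> {1..l}" "idx g' (r z) = lyr t z" if z: "z \<in> fst t" for z
    proof -
      show "r z \<in> {1..l}"
        using rB[of z] rN(1)[of z] px(1) z by (cases "z \<in> ?B") (auto simp: l_def)
      show "idx g' (r z) = lyr t z"
      proof (cases "z \<in> ?B")
        case True
        have "idx g' (r z) = c + idx g (r z - c)" using ix(7)[OF rB(1,2)[OF True]] by (simp add: e)
        also have "\<dots> = c + (lyr t z - c)" using dB(2)[OF True] rB(3)[OF True] by simp
        also have "\<dots> = lyr t z" using True by (simp add: ix(9))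
        finally show ?thesis .
      qed (use rN z in blast)
    qed
    have x: "x \<in> Obj (Lay R l)" using t rr(1) by (auto simp: x_def Lay_simps(1)) (auto simp: r_def)
    have gx: "act_lay R g' x = t"
    proof (rule prod_eqI)
      show "fst (act_lay R g' x) = fst t" using Lg'(3)[OF x] by (simp add: x_def)
      show "snd (act_lay R g' x) = snd t"
      proof (rule prod_eqI)
        show "str (act_lay R g' x) = str t" using Lg'(2)[OF x] by (simp add: x_def)
        have "lyr t \<in> extensional (fst t)" using t by (auto simp: Lay_simps(1) PiE_iff)
        then show "lyr (act_lay R g' x) = lyr t"
          unfolding act_lay_eq(2)[OF a(4)] using part_generic[OF gg', unfolded dm, OF x] rr(2)
          by (auto simp: x_def fun_eq_iff extensional_def)
      qed
    qed
    have pB: "part f' x = ?B"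
      using rB rN(2) by (auto simp: e ix(8) x_def) (auto simp: part_def)
    \<comment> \<open>Restricting \<open>x\<close> along \<open>f'\<close> and \<open>t\<close>
      along \<open>f\<close> means restricting the same structure to the same subset, so the chosen
      lifts are literally equal.\<close>
    have lfx: "act_lift R f' x = act_lift R f t" by (simp add: act_lay_eq(4)[OF a(3)] act_lay_eq(4)[OF a(2)] pB) (simp add:
        x_def)
    then have sfx: "str (act_lay R f' x) = str (act_lay R f t)" using lf'(3)[OF x] lf(3)[OF t] by simp
    have u: "(act_lay R f' x, d0, s) \<in> Arr (Lay R m)"
    proof (rule Lay_arrI[OF lf'(6)[OF x] s])
      show "d0 \<in> hom T (str (act_lay R f' x)) (str s)" using d sfx gs by (simp add: in_hom)
      show "fst s \<subseteq> pm R d0 ` fst (act_lay R f' x)" using d(6) gs by (simp add: act_lay_eq(1)[OF a(3)] act_lay_eq(1)[OF a(2)]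
          pB)
      fix z assume "z \<in> fst (act_lay R f' x)"
      then have z: "z \<in> ?B" by (simp add: act_lay_eq(1)[OF a(3)] pB)
      then show "lyr s (pm R d0 z) = lyr (act_lay R f' x) z"
        using ix(3)[OF rB(1,2)[OF z]] rB(3)[OF z] by (simp add: act_lay_eq(2)[OF a(3)] pB e[symmetric]) (simp add: x_def)
    qed
    have us: "Dom (Lay R m) (act_lay R f' x, d0, s) = act_lay R f' x" "Cod (Lay R m) (act_lay R f' x, d0, s) = s" by
        (simp_all add: Lay_simps(3,4))
    \<comment> \<open>Equal lifts force an identity as the shape of \<open>\<theta> x\<close>, which
      is also the shape of \<open>\<gamma>\<close> after the arrow with shape
      \<open>d0\<close>.\<close>
    have "sha (LayS R) (\<theta> x) = Id T (str (act_lay R f t))"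
    proof (rule monicD[of "act_lift R f t"])
      show "Cmp T (act_lift R f t) (sha (LayS R) (\<theta> x)) = Cmp T (act_lift R f t) (Id T (str (act_lay R f t)))"
        using L\<theta>[OF x] lf[OF t] category_T by (simp add: gx lfx)
    qed (use \<theta>[OF x] lf[OF t] lf'[OF x] sfx category_T Lg(2)[OF lf'(6)[OF x]] lay_objD(1)[OF lf(6)[OF t]] in \<open>simp_all add:
        sn' act actf actg x gx t\<close>)
    then have "Cmp (Lay R n) \<gamma> (fa (Act (LaySp R) g) (act_lay R f' x, d0, s)) = \<theta> x"
      using \<theta>[OF x] fu(20)[OF u] fu(21,22)[OF u] us \<gamma> s x t lf'(6)[OF x] sag[OF u] \<gamma>d category_Lay gx
      by (intro L.shape_eqI[of n, unfolded LaySp_simps(1)]) (simp_all add: Simp_simps(1) scmp act actg actf, simp add: \<gamma>0)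
    moreover have "Cmp (Lay R n) (fa (Act (LaySp R) f) (Id (Lay R k) t)) (\<theta> x) = \<theta> x"
      using \<theta>[OF x] t gx fu(31)[OF t] category_Lay by (simp add: act x)
    ultimately show "\<exists>x\<in>Obj (Lay R l). \<exists>u\<in>hom (Lay R m) (fo (Act (LaySp R) f') x) s. \<exists>v\<in>hom (Lay R k) (fo (Act (LaySp R) g')
        x) t.
      Cmp (Lay R n) \<gamma> (fa (Act (LaySp R) g) u) = Cmp (Lay R n) (fa (Act (LaySp R) f) v) (\<theta> x)"
      using x u us gx t category_Lay by (intro bexI[of _ x] bexI[of _ "(act_lay R f' x, d0, s)"] bexI[of _ "Id (Lay R k) t"])
          (auto simp: in_hom act)
  qed
qed

end

section \<open>Maps induced by morphisms of restriction species\<close>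

lemma lay_map_simps [simp]:
  "fst (lay_map F t) = fst t" "lyr (lay_map F t) = lyr t" "str (lay_map F t) = fo F (str t)"
  by (cases t; simp add: lay_map_def)+

lemma part_lay_map [simp]: "part a (lay_map F t) = part a t"
  by (simp add: part_def)

lemma LayMap_simps:
  "fo (Cpt (LayMap R F S) n) = (\<lambda>t \<in> Obj (Lay R n). lay_map F t)"
  "fa (Cpt (LayMap R F S) n) = (\<lambda>(s, u, t) \<in> Arr (Lay R n). (lay_map F s, fa F u, lay_map F t))"
  "Nat (LayMap R F S) = (\<lambda>a \<in> Arr Simp. \<lambda>t \<in> Obj (Lay R (Cod Simp a)).
       (lay_map F (act_lay R a t), fill S (act_lift S a (lay_map F t)) (fa F (act_lift R a t)), act_lay S a (lay_map F t)))"
  by (simp_all add: LayMap_def)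

locale species_map = R: species R + S: species S for R S :: "('a, 'o, 'm) rspecies" +
  fixes F :: "('o, 'm, 'o, 'm) ftr"
  assumes F: "rspecies_morphism R F S"
begin

lemmas F_rules = functor_rules[OF rspecies_morphism_rules(1)[OF F]] rspecies_morphism_rules(2,3)[OF F]

lemma lay_map_obj: "t \<in> Obj (Lay R n) \<Longrightarrow> lay_map F t \<in> Obj (Lay S n)"
  by (simp add: Lay_simps(1) F_rules)

lemma lay_map_arr:
  assumes "(s, u, t) \<in> Arr (Lay R n)"
  shows "(lay_map F s, fa F u, lay_map F t) \<in> Arr (Lay S n)"
proof -
  note d = R.Lay_arrD[OF assms]
  show ?thesis
    by (rule S.Lay_arrI) (use d in \<open>simp_all add: lay_map_obj in_hom F_rules\<close>)
qed

lemma lay_map_fill: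
  assumes a: "a \<in> Arr Simp" and t: "t \<in> Obj (Lay R (Cod Simp a))"
  shows "(lay_map F (act_lay R a t), fill S (act_lift S a (lay_map F t)) (fa F (act_lift R a t)), act_lay S a (lay_map F t))
      \<in> Arr (Lay S (Dom Simp a)) \<and>
    Cmp (Tot S) (act_lift S a (lay_map F t)) (fill S (act_lift S a (lay_map F t)) (fa F (act_lift R a t))) = fa F (act_lift R
        a t)"
proof -
  note l = R.act_lift[OF a t]
  show ?thesis
    by (rule S.lay_fill[OF a lay_map_obj[OF t] lay_map_obj[OF l(6)]])
      (use l(1-5) in \<open>auto simp: in_hom F_rules act_lay_eq(1,2)[OF a] image_iff\<close>)
qed

lemma lifted_map_LayMap: "lifted_map Simp (LaySp R) (LayS R) (LaySp S) (LayS S) F (LayMap R F S)"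
  unfolding lifted_map_def
proof (intro conjI ballI)
  show "is_functor (Base (LayS R)) (Base (LayS S)) F" using rspecies_morphism_rules(1)[OF F] by simp
  fix a t assume a: "a \<in> Arr Simp" and "t \<in> Obj (Gpd (LaySp R) (Cod Simp a))"
  then have t: "t \<in> Obj (Lay R (Cod Simp a))" by (simp add: LaySp_def)
  show "Nat (LayMap R F S) a t \<in> hom (Gpd (LaySp S) (Dom Simp a)) (fo (Cpt (LayMap R F S) (Dom Simp a)) (fo (Act (LaySp R) a)
      t))
     (fo (Act (LaySp S) a) (fo (Cpt (LayMap R F S) (Cod Simp a)) t))"
    "Cmp (Base (LayS S)) (Lift (LayS S) a (fo (Cpt (LayMap R F S) (Cod Simp a)) t)) (sha (LayS S) (Nat (LayMap R F S) a t)) =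
        fa F (Lift (LayS R) a t)"
    using lay_map_fill[OF a t] R.act_lift(6)[OF a t] lay_map_obj[OF t] a t
    by (simp_all add: LayMap_simps R.LaySp_simps S.LaySp_simps in_hom Lay_simps(3,4))
next
  fix c f assume "f \<in> Arr (Gpd (LaySp R) c)"
  then have f: "f \<in> Arr (Lay R c)" by (simp add: LaySp_def)
  then obtain s u t where e: "f = (s, u, t)" by (cases f)
  show "fa (Cpt (LayMap R F S) c) f \<in> hom (Gpd (LaySp S) c) (fo (Cpt (LayMap R F S) c) (Dom (Gpd (LaySp R) c) f)) (fo (Cpt
      (LayMap R F S) c) (Cod (Gpd (LaySp R) c) f))"
    "sha (LayS S) (fa (Cpt (LayMap R F S) c) f) = fa F (sha (LayS R) f)"
    using lay_map_arr[OF f[unfolded e]] f R.Lay_arrD(1,2)[OF f[unfolded e]]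
    by (simp_all add: e LayMap_simps R.LaySp_simps S.LaySp_simps in_hom Lay_simps(3,4))
qed (auto simp: LayMap_simps R.LaySp_simps S.LaySp_simps lay_map_obj, simp add: LayMap_def extensional_def Simp_simps(1))

text \<open>Over a generic map only layerings change, and \<open>F\<close> keeps underlying
  functions. The layer condition for a filler is therefore the one already satisfied by
  \<open>v\<close>, and objects are lifted by pulling a layering back along
  \<open>h\<close>.\<close>

lemma culf_LayMap: "culf (LaySp R) (LaySp S) (LayMap R F S)"
proof (rule lifted_culf[OF R.lifted_LaySp S.lifted_LaySp lifted_map_LayMap]; (unfold R.LaySp_simps(1) S.LaySp_simps(1))?)
  fix g t assume g: "generic g"
  { assume "t \<in> Obj (Lay R (Cod Simp g))"
    then show "Lift (LayS R) g t = Id (Base (LayS R)) (sho (LayS R) t)" using R.act_lift_generic(1)[OF g] by simp }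
  { assume "t \<in> Obj (Lay S (Cod Simp g))"
    then show "Lift (LayS S) g t = Id (Base (LayS S)) (sho (LayS S) t)" using S.act_lift_generic(1)[OF g] by simp }
next
  fix g x y u v assume g: "generic g" and x: "x \<in> Obj (Lay R (Cod Simp g))" and y: "y \<in> Obj (Lay R (Cod Simp g))"
    and u: "u \<in> hom (Lay R (Dom Simp g)) (fo (Act (LaySp R) g) x) (fo (Act (LaySp R) g) y)"
    and v: "v \<in> hom (Lay S (Cod Simp g)) (fo (Cpt (LayMap R F S) (Cod Simp g)) x) (fo (Cpt (LayMap R F S) (Cod Simp g)) y)"
    and uv: "sha (LayS S) v = fa F (sha (LayS R) u)"
  obtain u0 where u0: "u = (act_lay R g x, u0, act_lay R g y)" using u x y by (cases u) (auto simp: in_hom Lay_simps(3,4)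
      R.LaySp_simps)
  have v0: "v = (lay_map F x, fa F u0, lay_map F y)" using v uv x y by (cases v) (auto simp: in_hom Lay_simps(3,4)
      LayMap_simps u0)
  have du: "(act_lay R g x, u0, act_lay R g y) \<in> Arr (Lay R (Dom Simp g))" using u by (simp add: u0 in_hom)
  have dv: "(lay_map F x, fa F u0, lay_map F y) \<in> Arr (Lay S (Cod Simp g))" using v by (simp add: v0 in_hom)
  note d = R.Lay_arrD[OF du] and d' = S.Lay_arrD[OF dv]
  have "(x, u0, y) \<in> Arr (Lay R (Cod Simp g))"
    by (rule R.Lay_arrI[OF x y])
      (use d(3-6) d'(7) R.act_lift_generic[OF g x] R.act_lift_generic[OF g y] in \<open>auto simp: in_hom F_rules\<close>)
  then show "\<exists>w\<in>hom (Lay R (Cod Simp g)) x y. sha (LayS R) w = sha (LayS R) u"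
    by (intro bexI[of _ "(x, u0, y)"]) (simp_all add: u0 in_hom Lay_simps(3,4))
next
  fix g s b \<gamma> assume g: "generic g" and s: "s \<in> Obj (Lay R (Dom Simp g))" and b: "b \<in> Obj (Lay S (Cod Simp g))"
    and \<gamma>: "\<gamma> \<in> hom (Lay S (Dom Simp g)) (fo (Cpt (LayMap R F S) (Dom Simp g)) s) (fo (Act (LaySp S) g) b)"
  have ga: "g \<in> Arr Simp" by (rule generic_Arr[OF g])
  obtain h where h: "\<gamma> = (lay_map F s, h, act_lay S g b)" using \<gamma> s b by (cases \<gamma>) (auto simp: in_hom Lay_simps(3,4)
      LayMap_simps S.LaySp_simps)
  have dh: "(lay_map F s, h, act_lay S g b) \<in> Arr (Lay S (Dom Simp g))" using \<gamma> by (simp add: h in_hom)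
  note d = S.Lay_arrD[OF dh] and lb = S.act_lift_generic[OF g b]
  \<comment> \<open>The layering of \<open>b\<close> pulled back along the underlying function of
    \<open>h\<close>. Applying \<open>idx g\<close> to it returns the layering of \<open>s\<close>,
    because \<open>h\<close> preserves layers.\<close>
  define x where "x = (fst s, \<lambda>z \<in> fst s. lyr b (pm S h z), str s)"
  have hb: "pm S h z \<in> fst b" if "z \<in> fst s" for z using d(6) lb(3) that by auto
  have x: "x \<in> Obj (Lay R (Cod Simp g))" using s b hb by (auto simp: x_def Lay_simps(1) PiE_iff)
  note lx = R.act_lift_generic[OF g x]
  have ax: "act_lay R g x = s"
  proof (rule prod_eqI)
    show "fst (act_lay R g x) = fst s" using lx by (simp add: x_def)
    show "snd (act_lay R g x) = snd s"
    proof (rule prod_eqI)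
      show "str (act_lay R g x) = str s" using lx by (simp add: x_def)
      have "idx g (lyr b (pm S h z)) = lyr s z" if "z \<in> fst s" for z
        using d(7)[of z] lb(4)[OF hb[OF that]] that by simp
      moreover have "lyr s \<in> extensional (fst s)" using s by (auto simp: Lay_simps(1) PiE_iff)
      ultimately show "lyr (act_lay R g x) = lyr s"
        unfolding act_lay_eq(2)[OF ga] part_generic[OF g x] by (auto simp: x_def fun_eq_iff extensional_def)
    qed
  qed
  have "(lay_map F x, h, b) \<in> Arr (Lay S (Cod Simp g))"
    by (rule S.Lay_arrI[OF lay_map_obj[OF x] b]) (use d(3-6) lb in \<open>auto simp: x_def in_hom\<close>)
  then have "fo (Act (LaySp R) g) x = s \<and> (\<exists>v\<in>hom (Lay S (Cod Simp g)) (fo (Cpt (LayMap R F S) (Cod Simp g)) x) b. sha (LayS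
      S) v = sha (LayS S) \<gamma>)"
    using x ax by (intro conjI bexI[of _ "(lay_map F x, h, b)"]) (simp_all add: h in_hom Lay_simps(3,4) LayMap_simps
        R.LaySp_simps)
  then show "\<exists>x\<in>Obj (Lay R (Cod Simp g)). fo (Act (LaySp R) g) x = s \<and> (\<exists>v\<in>hom (Lay S (Cod Simp g)) (fo (Cpt (LayMap R F S)
      (Cod Simp g)) x) b. sha (LayS S) v = sha (LayS S) \<gamma>)"
    using x by blast
qed

end

section \<open>Identities and composites of induced maps\<close>

lemma (in species) lay_map_idF: "t \<in> Obj (Lay R n) \<Longrightarrow> lay_map (idF (Tot R)) t = t"
  by (cases t) (simp add: lay_map_def Lay_simps(1))

lemma (in species) LayMap_idF: "LayMap R (idF (Tot R)) R = idP Simp (LaySp R)"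
proof (rule pnt_eqI[where A = "\<lambda>a. Obj (Lay R (Cod Simp a))"])
  note LayMap_simps [simp] LaySp_simps [simp]
  show "Cpt (LayMap R (idF (Tot R)) R) c = Cpt (idP Simp (LaySp R)) c" for c
  proof (rule ftr_eqI[of _ "Obj (Lay R c)" _ "Arr (Lay R c)"])
    fix f assume f: "f \<in> Arr (Lay R c)"
    obtain s u t where e: "f = (s, u, t)" by (cases f)
    show "fa (Cpt (LayMap R (idF (Tot R)) R) c) f = fa (Cpt (idP Simp (LaySp R)) c) f"
      using f Lay_arrD(1-3)[OF f[unfolded e]] by (simp add: e Simp_simps(1) lay_map_idF)
  qed (simp_all add: Simp_simps(1) lay_map_idF)
  fix a t assume a: "a \<in> Arr Simp" and t: "t \<in> Obj (Lay R (Cod Simp a))"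
  note l = act_lift[OF a t]
  have "fill R (act_lift R a t) (fa (idF (Tot R)) (act_lift R a t)) = Id T (str (act_lay R a t))"
    using l category_T lay_objD(1)[OF l(6)] by (intro fill_unique) simp_all
  then show "Nat (LayMap R (idF (Tot R)) R) a t = Nat (idP Simp (LaySp R)) a t"
    using a t l(6) by (simp add: lay_map_idF Lay_simps(5))
qed (simp_all add: LayMap_simps LaySp_simps extensional_def Simp_simps(1) idP_def)

text \<open>The two naturality cells have the same composite with the lift of \<open>Q\<close>,
  namely the image of the lift of \<open>R\<close> under both functors, and
  \<open>fill_unique\<close> makes them equal.\<close>

lemma LayMap_compF:
  assumes "species_map R S F" "species_map S Q G"
  shows "LayMap R (compF (Tot R) G F) Q = compP Simp (LaySp R) (LaySp Q) (LayMap S G Q) (LayMap R F S)"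
proof -
  interpret F: species_map R S F by fact
  interpret G: species_map S Q G by fact
  note LayMap_simps [simp] F.R.LaySp_simps [simp] F.S.LaySp_simps [simp] G.S.LaySp_simps [simp]
  have lm: "lay_map (compF (Tot R) G F) t = lay_map G (lay_map F t)" if "t \<in> Obj (Lay R n)" for t n
    using that by (cases t) (simp add: lay_map_def Lay_simps(1))
  show ?thesis
  proof (rule pnt_eqI[where A = "\<lambda>a. Obj (Lay R (Cod Simp a))"])
    show "Cpt (LayMap R (compF (Tot R) G F) Q) c = Cpt (compP Simp (LaySp R) (LaySp Q) (LayMap S G Q) (LayMap R F S)) c" for
        c
    proof (rule ftr_eqI[of _ "Obj (Lay R c)" _ "Arr (Lay R c)"])
      fix f assume f: "f \<in> Arr (Lay R c)"
      obtain s u t where e: "f = (s, u, t)" by (cases f)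
      show "fa (Cpt (LayMap R (compF (Tot R) G F) Q) c) f = fa (Cpt (compP Simp (LaySp R) (LaySp Q) (LayMap S G Q) (LayMap R
          F S)) c) f"
        using f F.R.Lay_arrD(1-3)[OF f[unfolded e]] F.lay_map_arr[OF f[unfolded e]] by (simp add: e Simp_simps(1) lm)
    qed (simp_all add: Simp_simps(1) lm F.lay_map_obj)
    fix a t assume a: "a \<in> Arr Simp" and t: "t \<in> Obj (Lay R (Cod Simp a))"
    note l = F.R.act_lift[OF a t] and ft = F.lay_map_obj[OF t]
    note l' = F.S.act_lift[OF a ft] and l'' = G.S.act_lift[OF a G.lay_map_obj[OF ft]]
    note k = F.lay_map_fill[OF a t] and k' = G.lay_map_fill[OF a ft]
    note d = F.S.Lay_arrD[OF conjunct1[OF k]] and d' = G.S.Lay_arrD[OF conjunct1[OF k']]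
    let ?x = "fill S (act_lift S a (lay_map F t)) (fa F (act_lift R a t))" and ?y = "fill Q (act_lift Q a (lay_map G (lay_map
        F t))) (fa G (act_lift S a (lay_map F t)))"
    have "Cmp (Tot Q) (act_lift Q a (lay_map G (lay_map F t))) (Cmp (Tot Q) ?y (fa G ?x)) =
      Cmp (Tot Q) (Cmp (Tot Q) (act_lift Q a (lay_map G (lay_map F t))) ?y) (fa G ?x)"
      using l'' d d' G.S.category_T by (simp add: G.F_rules)
    also have "\<dots> = fa G (Cmp (Tot S) (act_lift S a (lay_map F t)) ?x)"
      unfolding conjunct2[OF k'] using l' d by (simp add: G.F_rules)
    also have "\<dots> = fa (compF (Tot R) G F) (act_lift R a t)"
      unfolding conjunct2[OF k] using l by simp
    finally have "fill Q (act_lift Q a (lay_map G (lay_map F t))) (fa (compF (Tot R) G F) (act_lift R a t)) = Cmp (Tot Q) ?y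
        (fa G ?x)"
      using l'' d d' G.S.category_T by (intro G.S.fill_unique) (simp_all add: G.F_rules)
    then show "Nat (LayMap R (compF (Tot R) G F) Q) a t = Nat (compP Simp (LaySp R) (LaySp Q) (LayMap S G Q) (LayMap R F S))
        a t"
      using a t ft l(6) k category_Simp by (simp add: lm[OF t] lm[OF l(6)] Lay_simps(6))
  qed (simp_all add: extensional_def Simp_simps(1) compP_def)
qed

lemma RSp_simps: "Obj RSp = {R. restriction_species R}"
  "(R, F, S) \<in> Arr RSp \<longleftrightarrow> restriction_species R \<and> restriction_species S \<and> rspecies_morphism R F S"
  "Dom RSp (R, F, S) = R" "Cod RSp (R, F, S) = S" "Id RSp R = (R, idF (Tot R), R)"
  "Cmp RSp (S', G, Q) (R, F, S) = (R, compF (Tot R) G F, Q)"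
  by (auto simp: RSp_def mk_cat_simps)

lemma Dcmp_simps: "Obj Dcmp = {X. decomposition_space X}"
  "(X, \<tau>, Y) \<in> Arr Dcmp \<longleftrightarrow> decomposition_space X \<and> decomposition_space Y \<and> culf X Y \<tau>"
  "Dom Dcmp (X, \<tau>, Y) = X" "Cod Dcmp (X, \<tau>, Y) = Y" "Id Dcmp X = (X, idP Simp X, X)"
  "Cmp Dcmp (Y', \<sigma>, Z) (X, \<tau>, Y) = (X, compP Simp X Z \<sigma> \<tau>, Z)"
  by (auto simp: Dcmp_def mk_cat_simps)

lemma species_map_Arr: "(R, F, S) \<in> Arr RSp \<Longrightarrow> species_map R S F"
  by (simp add: RSp_simps(2) species_map_def species_def species_map_axioms_def)

lemma LayF_simps:
  "R \<in> Obj RSp \<Longrightarrow> fo LayF R = LaySp R" "(R, F, S) \<in> Arr RSp \<Longrightarrow> fa LayF (R, F, S) = (LaySp R, LayMap R F S, LaySp S)"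
  by (simp_all add: LayF_def)

lemma functor_LayF: "is_functor RSp Dcmp LayF"
proof (rule functorI[OF category_RSp category_Dcmp])
  fix R :: "('a, 'o, 'm) rspecies" assume RO: "R \<in> Obj RSp"
  then have "species R" by (simp add: species_def RSp_simps(1))
  then interpret species R .
  show "fo LayF R \<in> Obj Dcmp" using decomposition_space_LaySp by (simp add: LayF_simps(1)[OF RO] Dcmp_simps(1))
  have "Id RSp R \<in> Arr RSp" by (rule category_rules(3)[OF category_RSp RO])
  then show "fa LayF (Id RSp R) = Id Dcmp (fo LayF R)" using RO LayMap_idF by (simp add: RSp_simps(5) LayF_simps
      Dcmp_simps(5))
next
  fix f :: "('a, 'o, 'm) rspecies_arr" assume f: "f \<in> Arr RSp"
  obtain R F S where e: "f = (R, F, S)" by (cases f)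
  interpret species_map R S F by (rule species_map_Arr[OF f[unfolded e]])
  show "fa LayF f \<in> Arr Dcmp \<and> Dom Dcmp (fa LayF f) = fo LayF (Dom RSp f) \<and> Cod Dcmp (fa LayF f) = fo LayF (Cod RSp f)"
    using f culf_LayMap R.decomposition_space_LaySp S.decomposition_space_LaySp R.R S.R
    by (simp add: e LayF_simps Dcmp_simps RSp_simps(1,3,4))
  fix g :: "('a, 'o, 'm) rspecies_arr" assume g: "g \<in> Arr RSp" and fg: "Cod RSp f = Dom RSp g"
  obtain G Q where e': "g = (S, G, Q)" using fg by (cases g) (auto simp: e RSp_simps(3,4))
  have "Cmp RSp g f \<in> Arr RSp" by (rule category_rules(6)[OF category_RSp f g fg])
  then show "fa LayF (Cmp RSp g f) = Cmp Dcmp (fa LayF g) (fa LayF f)"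
    using f g LayMap_compF[OF species_map_Arr[OF f[unfolded e]] species_map_Arr[OF g[unfolded e']]]
    by (simp add: e e' RSp_simps(6) LayF_simps Dcmp_simps(6))
qed (simp_all add: LayF_def)

section \<open>Monoidal restriction species\<close>

text \<open>Evaluates composites from the raw triples, so that equations between coherence arrows of
  \<open>FinInj\<close> can be tested on elements.\<close>

lemma FinInj_Cmp:
  "fst (Cmp FinInj g f) = fst f" "x \<in> fst f \<Longrightarrow> map_of_inj (Cmp FinInj g f) x = map_of_inj g (map_of_inj f x)"
  by (cases g; cases f; simp add: FinInj_simps compose_def)+

lemma dunion_simps [simp]: "Lft x \<in> dunion A B \<longleftrightarrow> x \<in> A" "Rgt x \<in> dunion A B \<longleftrightarrow> x \<in> B"
  by (auto simp: dunion_def)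

lemma dunion_cases:
  assumes "z \<in> dunion A B"
  obtains x where "x \<in> A" "z = Lft x" | y where "y \<in> B" "z = Rgt y"
  using assms by (auto simp: dunion_def)

lemma dunionF_simps:
  "finite A \<Longrightarrow> finite B \<Longrightarrow> fo dunionF (A, B) = dunion A B"
  "f \<in> Arr FinInj \<Longrightarrow> g \<in> Arr FinInj \<Longrightarrow> fst (fa dunionF (f, g)) = dunion (fst f) (fst g)"
  "f \<in> Arr FinInj \<Longrightarrow> g \<in> Arr FinInj \<Longrightarrow> x \<in> fst f \<Longrightarrow> map_of_inj (fa dunionF (f, g)) (Lft x) = Lft (map_of_inj f x)"
  "f \<in> Arr FinInj \<Longrightarrow> g \<in> Arr FinInj \<Longrightarrow> y \<in> fst g \<Longrightarrow> map_of_inj (fa dunionF (f, g)) (Rgt y) = Rgt (map_of_inj g y)"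
  by (cases f; cases g; auto simp: dunionF_def FinInj_simps(1) prodC_def)+

lemma FinInjM_simps: "MC FinInjM = FinInj" "Ten FinInjM = dunionF" "One FinInjM = {}"
  by (simp_all add: FinInjM_def)

lemma FinInjM_coherence:
  assumes "finite A" "finite B" "finite D"
  shows "fst (Asc FinInjM ((A, B), D)) = dunion (dunion A B) D"
    "x \<in> A \<Longrightarrow> map_of_inj (Asc FinInjM ((A, B), D)) (Lft (Lft x)) = Lft x"
    "y \<in> B \<Longrightarrow> map_of_inj (Asc FinInjM ((A, B), D)) (Lft (Rgt y)) = Rgt (Lft y)"
    "z \<in> D \<Longrightarrow> map_of_inj (Asc FinInjM ((A, B), D)) (Rgt z) = Rgt (Rgt z)"
    "x \<in> A \<Longrightarrow> map_of_inj (LUn FinInjM A) (Rgt x) = x" "x \<in> A \<Longrightarrow> map_of_inj (RUn FinInjM A) (Lft x) = x"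
  using assms by (simp_all add: FinInjM_def FinInj_simps(1))

lemma iso_FinInj:
  assumes "iso FinInj f"
  shows "map_of_inj f ` fst f = snd (snd f)"
proof -
  obtain g where g: "is_inverse FinInj f g" using assms unfolding iso_def by blast
  obtain A f0 B where f: "f = (A, f0, B)" by (cases f)
  obtain g0 where g': "g = (B, g0, A)" using g by (cases g) (auto simp: is_inverse_def in_hom f FinInj_simps)
  have ty: "f0 \<in> A \<rightarrow>\<^sub>E B" "g0 \<in> B \<rightarrow>\<^sub>E A" and e: "compose B f0 g0 = (\<lambda>x\<in>B. x)"
    using g by (auto simp: is_inverse_def in_hom f g' FinInj_simps)
  have "f0 (g0 y) = y" if "y \<in> B" for y using fun_cong[OF e, of y] that by (simp add: compose_def)
  then have "B \<subseteq> f0 ` A" using ty(2) by (metis PiE_mem image_eqI subsetI)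
  then show ?thesis using ty(1) by (auto simp: f)
qed

section \<open>The underlying set of a tensor product of structures\<close>

locale mspecies =
  fixes R :: "('a, 'o, 'm) mrspecies"
  assumes R: "monoidal_restriction_species R"
begin

abbreviation "U \<equiv> underlying_rspecies R"
abbreviation "M \<equiv> MTot R"
abbreviation "T \<equiv> MC M"
abbreviation "ten X Y \<equiv> fo (Ten M) (X, Y)"
abbreviation "tar u v \<equiv> fa (Ten M) (u, v)"

lemma U_simps [simp]: "Tot U = T" "SF (MPrj R) = Prj U"
  by (simp_all add: underlying_rspecies_def)

sublocale U: species U
  using R by unfold_locales (simp add: monoidal_restriction_species_def)

lemma M: "monoidal_category M"
  using R by (simp add: monoidal_restriction_species_def)

lemma strong: "strong_monoidal M FinInjM (MPrj R)"
  using R by (simp add: monoidal_restriction_species_def)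

lemmas Pr = functor_rules[OF U.P, simplified]
lemmas category_T = U.category_T[simplified]
lemmas m_rules = monoidal_category_rules[OF M]
lemmas b_rules = bifunctor_rules[OF m_rules(2)]
lemmas s_rules = strong_monoidal_rules[OF strong, unfolded FinInjM_simps U_simps(2)]

text \<open>The coprojections into the underlying set of a tensor product: \<open>Lft\<close> and
  \<open>Rgt\<close> followed by the structure bijection of the projection. With them, statements
  about tensor products are checked on the two summands without inverting that bijection.\<close>

definition lf :: "'o \<Rightarrow> 'o \<Rightarrow> 'a elt \<Rightarrow> 'a elt" where "lf X Y x = map_of_inj (F2 (MPrj R) (X, Y)) (Lft x)"
definition rg :: "'o \<Rightarrow> 'o \<Rightarrow> 'a elt \<Rightarrow> 'a elt" where "rg X Y y = map_of_inj (F2 (MPrj R) (X, Y)) (Rgt y)"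

lemma fin: "X \<in> Obj T \<Longrightarrow> finite (und U X)"
  using U.finite_und[of X] by simp

lemma phi:
  assumes "X \<in> Obj T" "Y \<in> Obj T"
  shows "F2 (MPrj R) (X, Y) \<in> Arr FinInj" "fst (F2 (MPrj R) (X, Y)) = dunion (und U X) (und U Y)"
    "map_of_inj (F2 (MPrj R) (X, Y)) ` dunion (und U X) (und U Y) = und U (ten X Y)"
    "inj_on (map_of_inj (F2 (MPrj R) (X, Y))) (dunion (und U X) (und U Y))"
proof -
  note s = s_rules(2)[OF assms]
  obtain A f B where e: "F2 (MPrj R) (X, Y) = (A, f, B)" by (cases "F2 (MPrj R) (X, Y)")
  have AB: "A = dunion (und U X) (und U Y)" "B = und U (ten X Y)"
    using s fin[OF assms(1)] fin[OF assms(2)] by (auto simp: e FinInj_simps dunionF_simps)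
  show "F2 (MPrj R) (X, Y) \<in> Arr FinInj" using s by simp
  show "fst (F2 (MPrj R) (X, Y)) = dunion (und U X) (und U Y)" by (simp add: e AB)
  show "map_of_inj (F2 (MPrj R) (X, Y)) ` dunion (und U X) (und U Y) = und U (ten X Y)"
    using iso_FinInj[of "F2 (MPrj R) (X, Y)"] s by (simp add: e AB)
  show "inj_on (map_of_inj (F2 (MPrj R) (X, Y))) (dunion (und U X) (und U Y))"
    using conjunct1[OF s] by (simp add: e AB FinInj_simps)
qed

lemma lf_in: "X \<in> Obj T \<Longrightarrow> Y \<in> Obj T \<Longrightarrow> x \<in> und U X \<Longrightarrow> lf X Y x \<in> und U (ten X Y)"
  and rg_in: "X \<in> Obj T \<Longrightarrow> Y \<in> Obj T \<Longrightarrow> y \<in> und U Y \<Longrightarrow> rg X Y y \<in> und U (ten X Y)"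
  using phi(3)[of X Y] by (auto simp: lf_def rg_def)

lemma ten_cases:
  assumes "X \<in> Obj T" "Y \<in> Obj T" "z \<in> und U (ten X Y)"
  obtains x where "x \<in> und U X" "z = lf X Y x" | y where "y \<in> und U Y" "z = rg X Y y"
proof -
  have "z \<in> map_of_inj (F2 (MPrj R) (X, Y)) ` dunion (und U X) (und U Y)" using phi(3) assms by simp
  then obtain w where "w \<in> dunion (und U X) (und U Y)" "z = map_of_inj (F2 (MPrj R) (X, Y)) w" by blast
  then show ?thesis using that by (elim dunion_cases) (auto simp: lf_def rg_def)
qed

lemma U_fst: "u \<in> Arr T \<Longrightarrow> fst (fa (Prj U) u) = und U (Dom T u)"
  using Pr(5)[of u] by (cases "fa (Prj U) u") (auto simp: FinInj_simps)

text \<open>Naturality of the structure map of the projection, evaluated on the left and on the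
  right summand.\<close>

lemma tar_lf:
  assumes u: "u \<in> Arr T" and v: "v \<in> Arr T"
  shows "x \<in> und U (Dom T u) \<Longrightarrow> pm U (tar u v) (lf (Dom T u) (Dom T v) x) = lf (Cod T u) (Cod T v) (pm U u x)"
    "y \<in> und U (Dom T v) \<Longrightarrow> pm U (tar u v) (rg (Dom T u) (Dom T v) y) = rg (Cod T u) (Cod T v) (pm U v y)"
proof -
  note d = category_rules(1)[OF category_T u] category_rules(1)[OF category_T v]
  note dd = dunionF_simps(2-4)[OF Pr(4)[OF u] Pr(4)[OF v]]
  have e: "map_of_inj (Cmp FinInj (F2 (MPrj R) (Cod T u, Cod T v)) (fa dunionF (fa (Prj U) u, fa (Prj U) v))) z =
    map_of_inj (Cmp FinInj (fa (Prj U) (tar u v)) (F2 (MPrj R) (Dom T u, Dom T v))) z" for z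
    using s_rules(3)[OF u v] by simp
  { assume "x \<in> und U (Dom T u)"
    then show "pm U (tar u v) (lf (Dom T u) (Dom T v) x) = lf (Cod T u) (Cod T v) (pm U u x)"
      using e[of "Lft x"] U_fst[OF u] U_fst[OF v] dd phi(2)[OF d] by (simp add: FinInj_Cmp lf_def) }
  { assume "y \<in> und U (Dom T v)"
    then show "pm U (tar u v) (rg (Dom T u) (Dom T v) y) = rg (Cod T u) (Cod T v) (pm U v y)"
      using e[of "Rgt y"] U_fst[OF u] U_fst[OF v] dd phi(2)[OF d] by (simp add: FinInj_Cmp rg_def) }
qed

text \<open>The unit map of the projection is a bijection from the empty set.\<close>

lemma One_und: "und U (One M) = {}"
proof -
  have "One M \<in> Obj T" "iso FinInj (F0 (MPrj R))" "fst (F0 (MPrj R)) = {}" "snd (snd (F0 (MPrj R))) = und U (One M)"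
    using m_rules(3) s_rules(5-8) by (cases "F0 (MPrj R)"; auto simp: FinInj_simps)+
  then show ?thesis using iso_FinInj[of "F0 (MPrj R)"] by simp
qed

text \<open>The associativity law of the strong monoidal projection, evaluated at the three kinds of
  elements of an iterated disjoint union.\<close>

lemma Asc_lf:
  assumes o: "X \<in> Obj T" "Y \<in> Obj T" "Z \<in> Obj T"
  shows "x \<in> und U X \<Longrightarrow> pm U (Asc M ((X, Y), Z)) (lf (ten X Y) Z (lf X Y x)) = lf X (ten Y Z) x"
    "y \<in> und U Y \<Longrightarrow> pm U (Asc M ((X, Y), Z)) (lf (ten X Y) Z (rg X Y y)) = rg X (ten Y Z) (lf Y Z y)"
    "z \<in> und U Z \<Longrightarrow> pm U (Asc M ((X, Y), Z)) (rg (ten X Y) Z z) = rg X (ten Y Z) (rg Y Z z)"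
proof -
  let ?A = "und U X" and ?B = "und U Y" and ?D = "und U Z"
  note t = b_rules(2)[OF o(1,2)] b_rules(2)[OF o(2,3)]
  note f = fin[OF o(1)] fin[OF o(2)] fin[OF o(3)]
  have I: "Id FinInj ?A \<in> Arr FinInj" "Id FinInj ?D \<in> Arr FinInj" "fst (Id FinInj ?A) = ?A" "fst (Id FinInj ?D) = ?D"
    "\<And>x. x \<in> ?A \<Longrightarrow> map_of_inj (Id FinInj ?A) x = x" "\<And>x. x \<in> ?D \<Longrightarrow> map_of_inj (Id FinInj ?D) x = x"
    using f by (auto simp: FinInj_simps inj_on_def)
  note p = phi[OF o(1,2)] phi[OF o(2,3)] phi[OF t(1) o(3)] phi[OF o(1) t(2)]
  note c = FinInjM_coherence[OF f]
  note d1 = dunionF_simps(2-4)[OF p(1) I(2)] and d2 = dunionF_simps(2-4)[OF I(1) p(5)]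
  have e: "map_of_inj (Cmp FinInj (Cmp FinInj (fa (Prj U) (Asc M ((X, Y), Z))) (F2 (MPrj R) (ten X Y, Z))) (fa dunionF (F2
      (MPrj R) (X, Y), Id FinInj ?D))) w =
    map_of_inj (Cmp FinInj (Cmp FinInj (F2 (MPrj R) (X, ten Y Z)) (fa dunionF (Id FinInj ?A, F2 (MPrj R) (Y, Z)))) (Asc
        FinInjM ((?A, ?B), ?D))) w" for w
    using s_rules(9)[OF o] by simp
  { assume x: "x \<in> ?A"
    then have "lf X Y x \<in> und U (ten X Y)" by (rule lf_in[OF o(1,2)])
    then show "pm U (Asc M ((X, Y), Z)) (lf (ten X Y) Z (lf X Y x)) = lf X (ten Y Z) x"
      using e[of "Lft (Lft x)"] x by (simp add: FinInj_Cmp p c d1 d2 I lf_def) }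
  { assume y: "y \<in> ?B"
    then have "rg X Y y \<in> und U (ten X Y)" by (rule rg_in[OF o(1,2)])
    then show "pm U (Asc M ((X, Y), Z)) (lf (ten X Y) Z (rg X Y y)) = rg X (ten Y Z) (lf Y Z y)"
      using e[of "Lft (Rgt y)"] y by (simp add: FinInj_Cmp p c d1 d2 I lf_def rg_def) }
  { assume z: "z \<in> ?D"
    then show "pm U (Asc M ((X, Y), Z)) (rg (ten X Y) Z z) = rg X (ten Y Z) (rg Y Z z)"
      using e[of "Rgt z"] by (simp add: FinInj_Cmp p c d1 d2 I lf_def rg_def) }
qed

lemma Un_lf:
  assumes X: "X \<in> Obj T" and x: "x \<in> und U X"
  shows "pm U (LUn M X) (rg (One M) X x) = x" "pm U (RUn M X) (lf X (One M) x) = x"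
proof -
  let ?A = "und U X"
  note f = fin[OF X]
  have I: "Id FinInj ?A \<in> Arr FinInj" "fst (Id FinInj ?A) = ?A" "map_of_inj (Id FinInj ?A) x = x"
    using f x by (auto simp: FinInj_simps inj_on_def)
  note p = phi[OF m_rules(3) X] phi[OF X m_rules(3)]
  note d1 = dunionF_simps(2-4)[OF s_rules(5) I(1)] and d2 = dunionF_simps(2-4)[OF I(1) s_rules(5)]
  have e: "map_of_inj (Cmp FinInj (Cmp FinInj (fa (Prj U) (LUn M X)) (F2 (MPrj R) (One M, X))) (fa dunionF (F0 (MPrj R), Id
      FinInj ?A))) (Rgt x) =
     map_of_inj (LUn FinInjM ?A) (Rgt x)"
    "map_of_inj (Cmp FinInj (Cmp FinInj (fa (Prj U) (RUn M X)) (F2 (MPrj R) (X, One M))) (fa dunionF (Id FinInj ?A, F0 (MPrj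
        R)))) (Lft x) =
     map_of_inj (RUn FinInjM ?A) (Lft x)"
    using s_rules(10,11)[OF X] by simp_all
  show "pm U (LUn M X) (rg (One M) X x) = x" "pm U (RUn M X) (lf X (One M) x) = x"
    using e x FinInjM_coherence(5,6)[OF f f f x] by (simp_all add: FinInj_Cmp p d1 d2 I lf_def rg_def)
qed

text \<open>Naturality with respect to the restrictions to a point and to the empty set forces any natural
  family of maps \<open>A \<squnion> B \<rightarrow> und (X \<squnion> Y)\<close> to be the structure map of the projection. This is why a
  morphism of monoidal restriction species is automatically compatible with these structure maps.\<close>

lemma structure_unique:
  assumes ty: "\<And>X Y x. X \<in> Obj T \<Longrightarrow> Y \<in> Obj T \<Longrightarrow> x \<in> und U X \<Longrightarrow> l X Y x \<in> und U (ten X Y)"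
      "\<And>X Y y. X \<in> Obj T \<Longrightarrow> Y \<in> Obj T \<Longrightarrow> y \<in> und U Y \<Longrightarrow> r X Y y \<in> und U (ten X Y)"
    and nat: "\<And>u v x. u \<in> Arr T \<Longrightarrow> v \<in> Arr T \<Longrightarrow> x \<in> und U (Dom T u) \<Longrightarrow> pm U (tar u v) (l (Dom T u) (Dom T v) x) = l (Cod T u)
        (Cod T v) (pm U u x)"
      "\<And>u v y. u \<in> Arr T \<Longrightarrow> v \<in> Arr T \<Longrightarrow> y \<in> und U (Dom T v) \<Longrightarrow> pm U (tar u v) (r (Dom T u) (Dom T v) y) = r (Cod T u) (Cod T v)
          (pm U v y)"
    and o: "X \<in> Obj T" "Y \<in> Obj T"
  shows "x \<in> und U X \<Longrightarrow> l X Y x = lf X Y x" "y \<in> und U Y \<Longrightarrow> r X Y y = rg X Y y"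
proof -
  { assume x: "x \<in> und U X"
    let ?u = "res_lift U X {x}" and ?v = "res_lift U Y {}"
    have u: "?u \<in> Arr T" "Cod T ?u = X" "und U (Dom T ?u) = {x}" "pm U ?u x = x"
      and v: "?v \<in> Arr T" "Cod T ?v = Y" "und U (Dom T ?v) = {}"
      using U.res_lift[of X "{x}"] U.res_lift[of Y "{}"] o x by auto
    have d: "Dom T ?u \<in> Obj T" "Dom T ?v \<in> Obj T" using u v category_T by auto
    have "l (Dom T ?u) (Dom T ?v) x \<in> und U (ten (Dom T ?u) (Dom T ?v))" using ty(1)[OF d, of x] u by simp
    \<comment> \<open>With one point on the left and nothing on the right, the tensor product has a
      single element, so both candidates must take that value.\<close>
    then have "l (Dom T ?u) (Dom T ?v) x = lf (Dom T ?u) (Dom T ?v) x"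
      by (rule ten_cases[OF d]) (use u v in auto)
    then show "l X Y x = lf X Y x" using nat(1)[OF u(1) v(1), of x] tar_lf(1)[OF u(1) v(1), of x] u v by simp }
  { assume y: "y \<in> und U Y"
    let ?u = "res_lift U X {}" and ?v = "res_lift U Y {y}"
    have v: "?v \<in> Arr T" "Cod T ?v = Y" "und U (Dom T ?v) = {y}" "pm U ?v y = y"
      and u: "?u \<in> Arr T" "Cod T ?u = X" "und U (Dom T ?u) = {}"
      using U.res_lift[of X "{}"] U.res_lift[of Y "{y}"] o y by auto
    have d: "Dom T ?u \<in> Obj T" "Dom T ?v \<in> Obj T" using u v category_T by auto
    have "r (Dom T ?u) (Dom T ?v) y \<in> und U (ten (Dom T ?u) (Dom T ?v))" using ty(2)[OF d, of y] v by simp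
    then have "r (Dom T ?u) (Dom T ?v) y = rg (Dom T ?u) (Dom T ?v) y"
      by (rule ten_cases[OF d]) (use u v in auto)
    then show "r X Y y = rg X Y y" using nat(2)[OF u(1) v(1), of y] tar_lf(2)[OF u(1) v(1), of y] u v by simp }
qed

section \<open>Tensor products of layered structures and their constraints\<close>

lemma lay_ten_basic:
  assumes s: "s \<in> Obj (Lay U n)" and t: "t \<in> Obj (Lay U n)"
  shows "fst (lay_ten R (s, t)) = und U (ten (str s) (str t))" "str (lay_ten R (s, t)) = ten (str s) (str t)"
    "\<And>x. x \<in> fst s \<Longrightarrow> lyr (lay_ten R (s, t)) (lf (str s) (str t) x) = lyr s x"
    "\<And>y. y \<in> fst t \<Longrightarrow> lyr (lay_ten R (s, t)) (rg (str s) (str t) y) = lyr t y"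
    "lay_ten R (s, t) \<in> Obj (Lay U n)"
proof -
  obtain A p X where s': "s = (A, p, X)" by (cases s)
  obtain B q Y where t': "t = (B, q, Y)" by (cases t)
  have o: "X \<in> Obj T" "Y \<in> Obj T" "und U X = A" "und U Y = B" "p \<in> A \<rightarrow>\<^sub>E {1..n}" "q \<in> B \<rightarrow>\<^sub>E {1..n}"
    using s t by (auto simp: s' t' Lay_simps(1))
  note ph = phi[OF o(1,2), unfolded o(3,4)]
  show f: "fst (lay_ten R (s, t)) = und U (ten (str s) (str t))" and g: "str (lay_ten R (s, t)) = ten (str s) (str t)"
    by (simp_all add: lay_ten_def s' t' Let_def)
  have l: "lyr (lay_ten R (s, t)) (map_of_inj (F2 (MPrj R) (X, Y)) w) = copair p q w" if w: "w \<in> dunion A B" for w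
    using the_inv_into_f_f[OF ph(4) w] ph(3) w o(3,4) by (auto simp: lay_ten_def s' t' Let_def)
  show lx: "lyr (lay_ten R (s, t)) (lf (str s) (str t) x) = lyr s x" if "x \<in> fst s" for x
    using l[of "Lft x"] that by (simp add: lf_def s' t')
  show ly: "lyr (lay_ten R (s, t)) (rg (str s) (str t) y) = lyr t y" if "y \<in> fst t" for y
    using l[of "Rgt y"] that by (simp add: rg_def s' t')
  have "lyr (lay_ten R (s, t)) z \<in> {1..n}" if "z \<in> und U (ten X Y)" for z
    using o(1,2) that by (rule ten_cases) (use o lx ly in \<open>auto simp: s' t' PiE_iff\<close>)
  moreover have "lyr (lay_ten R (s, t)) \<in> extensional (und U (ten X Y))" by (simp add: lay_ten_def s' t' Let_def)
  ultimately show "lay_ten R (s, t) \<in> Obj (Lay U n)"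
    using f g fin[of "ten X Y"] b_rules(2)[OF o(1,2)] by (auto simp: Lay_simps(1) s' t' PiE_iff)
qed

lemma lay_ten_cases:
  assumes s: "s \<in> Obj (Lay U n)" and t: "t \<in> Obj (Lay U n)" and "z \<in> fst (lay_ten R (s, t))"
  obtains x where "x \<in> fst s" "z = lf (str s) (str t) x" | y where "y \<in> fst t" "z = rg (str s) (str t) y"
proof -
  have "str s \<in> Obj T" "str t \<in> Obj T" "und U (str s) = fst s" "und U (str t) = fst t" using s t by (auto simp: Lay_simps(1))
  then show ?thesis using assms(3) ten_cases[of "str s" "str t" z] that lay_ten_basic(1)[OF s t] by metis
qed

lemma lay_one_obj: "lay_one R \<in> Obj (Lay U n)"
  using One_und m_rules(3) by (simp add: lay_one_def Lay_simps(1))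

lemma lay_one_simps: "fst (lay_one R) = {}" "str (lay_one R) = One M"
  by (simp_all add: lay_one_def)

lemma lay_ten_arr:
  assumes "(s, u, s') \<in> Arr (Lay U n)" "(t, v, t') \<in> Arr (Lay U n)"
  shows "(lay_ten R (s, t), tar u v, lay_ten R (s', t')) \<in> Arr (Lay U n)"
proof -
  note d = U.Lay_arrD[OF assms(1), simplified] and e = U.Lay_arrD[OF assms(2), simplified]
  note L = lay_ten_basic[OF d(1) e(1)] and L' = lay_ten_basic[OF d(2) e(2)]
  have us: "und U (str s) = fst s" "und U (str t) = fst t" using d(1) e(1) by (auto simp: Lay_simps(1))
  note tl = tar_lf[OF d(3) e(3), unfolded d(4,5) e(4,5) us]
  show ?thesis
  proof (rule U.Lay_arrI[OF L(5) L'(5)])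
    show "tar u v \<in> hom (Tot U) (str (lay_ten R (s, t))) (str (lay_ten R (s', t')))" using d e b_rules L L' by (simp add:
        in_hom)
    show "fst (lay_ten R (s', t')) \<subseteq> pm U (tar u v) ` fst (lay_ten R (s, t))"
    proof
      fix z assume "z \<in> fst (lay_ten R (s', t'))"
      then show "z \<in> pm U (tar u v) ` fst (lay_ten R (s, t))"
      proof (rule lay_ten_cases[OF d(2) e(2)])
        fix x assume "x \<in> fst s'" "z = lf (str s') (str t') x"
        moreover then obtain w where "w \<in> fst s" "x = pm U u w" using d(6) by auto
        ultimately show ?thesis using tl(1)[of w] lf_in[of "str s" "str t" w] L(1) us d(1) e(1)
          by (intro image_eqI[of _ _ "lf (str s) (str t) w"]) (auto simp: Lay_simps(1))
      next
        fix y assume "y \<in> fst t'" "z = rg (str s') (str t') y"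
        moreover then obtain w where "w \<in> fst t" "y = pm U v w" using e(6) by auto
        ultimately show ?thesis using tl(2)[of w] rg_in[of "str s" "str t" w] L(1) us d(1) e(1)
          by (intro image_eqI[of _ _ "rg (str s) (str t) w"]) (auto simp: Lay_simps(1))
      qed
    qed
    fix z assume "z \<in> fst (lay_ten R (s, t))"
    then show "lyr (lay_ten R (s', t')) (pm U (tar u v) z) = lyr (lay_ten R (s, t)) z"
    proof (rule lay_ten_cases[OF d(1) e(1)])
      fix x assume x: "x \<in> fst s" "z = lf (str s) (str t) x"
      then have "pm U u x \<in> fst s'" using d(6) by auto
      then show ?thesis using x tl(1)[of x] L(3)[of x] L'(3)[of "pm U u x"] d(7)[of x] by simp
    next
      fix x assume x: "x \<in> fst t" "z = rg (str s) (str t) x"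
      then have "pm U v x \<in> fst t'" using e(6) by auto
      then show ?thesis using x tl(2)[of x] L(4)[of x] L'(4)[of "pm U v x"] e(7)[of x] by simp
    qed
  qed
qed

text \<open>Passing to the retained elements commutes with disjoint unions, as \<open>pl\<close> and
  \<open>pr\<close> show on each summand. The tensor of the two lifts therefore covers the retained
  part of the tensor product and can be filled, which yields the naturality cell of the
  multiplication.\<close>

lemma lay_ten_fill:
  assumes a: "a \<in> Arr Simp" and s: "s \<in> Obj (Lay U (Cod Simp a))" and t: "t \<in> Obj (Lay U (Cod Simp a))"
  defines "h \<equiv> tar (act_lift U a s) (act_lift U a t)"
  shows "(lay_ten R (act_lay U a s, act_lay U a t), fill U (act_lift U a (lay_ten R (s, t))) h, act_lay U a (lay_ten R (s,
      t))) \<in> Arr (Lay U (Dom Simp a)) \<and>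
    Cmp T (act_lift U a (lay_ten R (s, t))) (fill U (act_lift U a (lay_ten R (s, t))) h) = h"
proof -
  note ls = U.act_lift[OF a s, simplified] and lt = U.act_lift[OF a t, simplified]
  note L = lay_ten_basic[OF s t] and L' = lay_ten_basic[OF ls(6) lt(6)]
  have us: "str s \<in> Obj T" "str t \<in> Obj T" "und U (str s) = fst s" "und U (str t) = fst t" using s t by (auto simp:
      Lay_simps(1))
  note fa = act_lay_eq(1,2)[OF a, where R = U]
  have tl: "pm U h (lf (str (act_lay U a s)) (str (act_lay U a t)) x) = lf (str s) (str t) x" if "x \<in> part a s" for x
    using tar_lf(1)[OF ls(1) lt(1), of x] ls lt that by (simp add: h_def)
  have tr: "pm U h (rg (str (act_lay U a s)) (str (act_lay U a t)) x) = rg (str s) (str t) x" if "x \<in> part a t" for x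
    using tar_lf(2)[OF ls(1) lt(1), of x] ls lt that by (simp add: h_def)
  have pl: "lf (str s) (str t) x \<in> part a (lay_ten R (s, t)) \<longleftrightarrow> x \<in> part a s" if "x \<in> fst s" for x
    using that L(1,3) lf_in[OF us(1,2), of x] us by (simp add: part_def)
  have pr: "rg (str s) (str t) x \<in> part a (lay_ten R (s, t)) \<longleftrightarrow> x \<in> part a t" if "x \<in> fst t" for x
    using that L(1,4) rg_in[OF us(1,2), of x] us by (simp add: part_def)
  have sub: "x \<in> part a r \<Longrightarrow> x \<in> fst r" for x and r :: "('a, 'o) lay" by (simp add: part_def)
  show ?thesis
  proof (rule U.lay_fill[OF a L(5) L'(5), simplified])
    show "h \<in> hom T (str (lay_ten R (act_lay U a s, act_lay U a t))) (str (lay_ten R (s, t)))"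
      using ls lt b_rules L L' by (simp add: in_hom h_def)
    show "part a (lay_ten R (s, t)) \<subseteq> pm U h ` fst (lay_ten R (act_lay U a s, act_lay U a t))"
    proof
      fix z assume z: "z \<in> part a (lay_ten R (s, t))"
      have ab: "str (act_lay U a s) \<in> Obj T" "str (act_lay U a t) \<in> Obj T" using ls(6) lt(6) by (auto simp: Lay_simps(1))
      from lay_ten_cases[OF s t sub[OF z]] show "z \<in> pm U h ` fst (lay_ten R (act_lay U a s, act_lay U a t))"
      proof cases
        case (1 x)
        then have "x \<in> part a s" using pl z by simp
        then show ?thesis using tl[of x] 1 lf_in[OF ab, of x] ls(4) L'(1)
          by (intro image_eqI[of _ _ "lf (str (act_lay U a s)) (str (act_lay U a t)) x"]) auto
      next
        case (2 x)
        then have "x \<in> part a t" using pr z by simp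
        then show ?thesis using tr[of x] 2 rg_in[OF ab, of x] lt(4) L'(1)
          by (intro image_eqI[of _ _ "rg (str (act_lay U a s)) (str (act_lay U a t)) x"]) auto
      qed
    qed
    fix z assume z: "z \<in> fst (lay_ten R (act_lay U a s, act_lay U a t))"
    from lay_ten_cases[OF ls(6) lt(6) z] show "pm U h z \<in> part a (lay_ten R (s, t)) \<and>
      idx a (lyr (lay_ten R (s, t)) (pm U h z)) = lyr (lay_ten R (act_lay U a s, act_lay U a t)) z"
    proof cases
      case (1 x)
      then have "x \<in> part a s" by (simp add: fa)
      then show ?thesis using 1 tl[of x] pl[of x] sub[of x s] L(3)[of x] L'(3)[of x] by (simp add: fa)
    next
      case (2 x)
      then have "x \<in> part a t" by (simp add: fa)
      then show ?thesis using 2 tr[of x] pr[of x] sub[of x t] L(4)[of x] L'(4)[of x] by (simp add: fa)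
    qed
  qed
qed

text \<open>The underlying set is empty, so all conditions on elements and layers are void.\<close>

lemma lay_one_fill:
  assumes a: "a \<in> Arr Simp"
  shows "(lay_one R, fill U (act_lift U a (lay_one R)) (Id T (One M)), act_lay U a (lay_one R)) \<in> Arr (Lay U (Dom Simp a)) \<and>
    Cmp T (act_lift U a (lay_one R)) (fill U (act_lift U a (lay_one R)) (Id T (One M))) = Id T (One M)"
  by (rule U.lay_fill[OF a lay_one_obj lay_one_obj, simplified])
    (use m_rules(3) category_T in \<open>auto simp: in_hom lay_one_simps part_def\<close>)

text \<open>Layers are compared on the three summands, where both bracketings reduce to the layer in
  \<open>r\<close>, \<open>s\<close> or \<open>t\<close>.\<close>

lemma Asc_arr:
  assumes r: "r \<in> Obj (Lay U n)" and s: "s \<in> Obj (Lay U n)" and t: "t \<in> Obj (Lay U n)"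
  shows "(lay_ten R (lay_ten R (r, s), t), Asc M ((str r, str s), str t), lay_ten R (r, lay_ten R (s, t))) \<in> Arr (Lay U n)"
proof -
  note A = lay_ten_basic[OF r s] and B = lay_ten_basic[OF s t]
  note A' = lay_ten_basic[OF A(5) t] and B' = lay_ten_basic[OF r B(5)]
  have o: "str r \<in> Obj T" "str s \<in> Obj T" "str t \<in> Obj T" "und U (str r) = fst r" "und U (str s) = fst s" "und U (str t) =
      fst t"
    using r s t by (auto simp: Lay_simps(1))
  note asc = Asc_lf[OF o(1-3), unfolded o(4-6)]
  have lr: "lf (str r) (str s) x \<in> fst (lay_ten R (r, s))" if "x \<in> fst r" for x using lf_in[OF o(1,2), of x] that o A(1) by
      simp
  have rr: "rg (str r) (str s) x \<in> fst (lay_ten R (r, s))" if "x \<in> fst s" for x using rg_in[OF o(1,2), of x] that o A(1) by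
      simp
  have ls: "lf (str s) (str t) x \<in> fst (lay_ten R (s, t))" if "x \<in> fst s" for x using lf_in[OF o(2,3), of x] that o B(1) by
      simp
  have rs: "rg (str s) (str t) x \<in> fst (lay_ten R (s, t))" if "x \<in> fst t" for x using rg_in[OF o(2,3), of x] that o B(1) by
      simp
  have oT: "str (lay_ten R (r, s)) \<in> Obj T" "und U (str (lay_ten R (r, s))) = fst (lay_ten R (r, s))" using A(5) by (auto
      simp: Lay_simps(1))
  note l3 = lf_in[OF oT(1) o(3), unfolded oT(2)] and r3 = rg_in[OF oT(1) o(3), unfolded o(6)]
  show ?thesis
  proof (rule U.Lay_arrI[OF A'(5) B'(5)])
    show "Asc M ((str r, str s), str t) \<in> hom (Tot U) (str (lay_ten R (lay_ten R (r, s), t))) (str (lay_ten R (r, lay_ten R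
        (s, t))))"
      using m_rules(4)[OF o(1-3)] A A' B B' by (simp add: in_hom)
    show "fst (lay_ten R (r, lay_ten R (s, t))) \<subseteq> pm U (Asc M ((str r, str s), str t)) ` fst (lay_ten R (lay_ten R (r, s),
        t))"
    proof
      fix z assume z: "z \<in> fst (lay_ten R (r, lay_ten R (s, t)))"
      from lay_ten_cases[OF r B(5) z] show "z \<in> pm U (Asc M ((str r, str s), str t)) ` fst (lay_ten R (lay_ten R (r, s), t))"
      proof cases
        case (1 x)
        then show ?thesis using asc(1)[of x] l3[OF lr, of x] A'(1) A(2) B(2)
          by (intro image_eqI[of _ _ "lf (ten (str r) (str s)) (str t) (lf (str r) (str s) x)"]) auto
      next
        case (2 y)
        from lay_ten_cases[OF s t 2(1)] show ?thesis
        proof cases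
          case (1 x)
          then show ?thesis using 2 asc(2)[of x] l3[OF rr, of x] A'(1) A(2) B(2)
            by (intro image_eqI[of _ _ "lf (ten (str r) (str s)) (str t) (rg (str r) (str s) x)"]) auto
        next
          case (2 x)
          then show ?thesis using \<open>z = _\<close> asc(3)[of x] r3[of x] A'(1) A(2) B(2)
            by (intro image_eqI[of _ _ "rg (ten (str r) (str s)) (str t) x"]) auto
        qed
      qed
    qed
    fix z assume z: "z \<in> fst (lay_ten R (lay_ten R (r, s), t))"
    from lay_ten_cases[OF A(5) t z] show "lyr (lay_ten R (r, lay_ten R (s, t))) (pm U (Asc M ((str r, str s), str t)) z) =
        lyr (lay_ten R (lay_ten R (r, s), t)) z"
    proof cases
      case (1 y)
      from lay_ten_cases[OF r s 1(1)] show ?thesis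
      proof cases
        case (1 x)
        then show ?thesis using \<open>z = _\<close> asc(1)[of x] A'(3)[OF lr, of x] A B B'(3)[of x] by simp
      next
        case (2 x)
        then show ?thesis using \<open>z = _\<close> asc(2)[of x] A'(3)[OF rr, of x] A B B'(4)[OF ls, of x] by simp
      qed
    next
      case (2 x)
      then show ?thesis using asc(3)[of x] A'(4)[of x] A B B'(4)[OF rs, of x] by simp
    qed
  qed
qed

text \<open>The unit contributes no elements, so only the summand of \<open>t\<close> has to be
  examined.\<close>

lemma Un_arr:
  assumes t: "t \<in> Obj (Lay U n)"
  shows "(lay_ten R (lay_one R, t), LUn M (str t), t) \<in> Arr (Lay U n)" "(lay_ten R (t, lay_one R), RUn M (str t), t) \<in> Arr
      (Lay U n)"
proof -
  have o: "str t \<in> Obj T" "und U (str t) = fst t" using t by (auto simp: Lay_simps(1))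
  note L = lay_ten_basic[OF lay_one_obj t] and L' = lay_ten_basic[OF t lay_one_obj]
  note un = Un_lf[OF o(1), unfolded o(2)]
  show "(lay_ten R (lay_one R, t), LUn M (str t), t) \<in> Arr (Lay U n)"
  proof (rule U.Lay_arrI[OF L(5) t])
    show "LUn M (str t) \<in> hom (Tot U) (str (lay_ten R (lay_one R, t))) (str t)" using m_rules(6)[OF o(1)] L by (simp add:
        in_hom lay_one_simps)
    show "fst t \<subseteq> pm U (LUn M (str t)) ` fst (lay_ten R (lay_one R, t))"
    proof
      fix x assume "x \<in> fst t"
      then show "x \<in> pm U (LUn M (str t)) ` fst (lay_ten R (lay_one R, t))"
        using un(1) rg_in[OF m_rules(3) o(1), of x] o L(1) by (intro image_eqI[of _ _ "rg (One M) (str t) x"]) (auto simp: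
            lay_one_simps)
    qed
    fix z assume z: "z \<in> fst (lay_ten R (lay_one R, t))"
    from lay_ten_cases[OF lay_one_obj t z] show "lyr t (pm U (LUn M (str t)) z) = lyr (lay_ten R (lay_one R, t)) z"
      by cases (use un L(4) in \<open>auto simp: lay_one_simps\<close>)
  qed
  show "(lay_ten R (t, lay_one R), RUn M (str t), t) \<in> Arr (Lay U n)"
  proof (rule U.Lay_arrI[OF L'(5) t])
    show "RUn M (str t) \<in> hom (Tot U) (str (lay_ten R (t, lay_one R))) (str t)" using m_rules(7)[OF o(1)] L' by (simp add:
        in_hom lay_one_simps)
    show "fst t \<subseteq> pm U (RUn M (str t)) ` fst (lay_ten R (t, lay_one R))"
    proof
      fix x assume "x \<in> fst t"
      then show "x \<in> pm U (RUn M (str t)) ` fst (lay_ten R (t, lay_one R))"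
        using un(2) lf_in[OF o(1) m_rules(3), of x] o L'(1) by (intro image_eqI[of _ _ "lf (str t) (One M) x"]) (auto simp:
            lay_one_simps)
    qed
    fix z assume z: "z \<in> fst (lay_ten R (t, lay_one R))"
    from lay_ten_cases[OF t lay_one_obj z] show "lyr t (pm U (RUn M (str t)) z) = lyr (lay_ten R (t, lay_one R)) z"
      by cases (use un L'(3) in \<open>auto simp: lay_one_simps\<close>)
  qed
qed

end

text \<open>Every natural number is an object of the simplex category, so extensionality over its
  objects is no restriction.\<close>

lemma extensional_UNIV: "f \<in> extensional UNIV"
  by (simp add: extensional_def)

section \<open>The monoidal decomposition space of a monoidal restriction species\<close>

context mspecies
begin

lemma LayM_simps:
  "Und (LayM R) = LaySp U"
  "fo (Cpt (Mul (LayM R)) n) = (\<lambda>(s, t) \<in> Obj (Lay U n) \<times> Obj (Lay U n). lay_ten R (s, t))"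
  "fa (Cpt (Mul (LayM R)) n) = (\<lambda>((s, u, s'), (t, v, t')) \<in> Arr (Lay U n) \<times> Arr (Lay U n). (lay_ten R (s, t), tar u v,
      lay_ten R (s', t')))"
  "Nat (Mul (LayM R)) = (\<lambda>a \<in> Arr Simp. \<lambda>(s, t) \<in> Obj (Lay U (Cod Simp a)) \<times> Obj (Lay U (Cod Simp a)).
     (lay_ten R (act_lay U a s, act_lay U a t),
      fill U (act_lift U a (lay_ten R (s, t))) (tar (act_lift U a s) (act_lift U a t)), act_lay U a (lay_ten R (s, t))))"
  "Cpt (Uni (LayM R)) n = \<lparr> fo = (\<lambda>_. lay_one R), fa = (\<lambda>_. (lay_one R, Id T (One M), lay_one R)) \<rparr>"
  "Nat (Uni (LayM R)) = (\<lambda>a \<in> Arr Simp. \<lambda>_.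
     (lay_one R, fill U (act_lift U a (lay_one R)) (Id T (One M)), act_lay U a (lay_one R)))"
  "AscM (LayM R) n = (\<lambda>((r, s), t) \<in> (Obj (Lay U n) \<times> Obj (Lay U n)) \<times> Obj (Lay U n).
     (lay_ten R (lay_ten R (r, s), t), Asc M ((str r, str s), str t), lay_ten R (r, lay_ten R (s, t))))"
  "LUnM (LayM R) n = (\<lambda>t \<in> Obj (Lay U n). (lay_ten R (lay_one R, t), LUn M (str t), t))"
  "RUnM (LayM R) n = (\<lambda>t \<in> Obj (Lay U n). (lay_ten R (t, lay_one R), RUn M (str t), t))"
  by (simp_all add: LayM_def Let_def prodC_def)

lemma lifted_map_Mul:
  "lifted_map Simp (prodX Simp (LaySp U) (LaySp U)) (prodS (LayS U) (LayS U)) (LaySp U) (LayS U) (Ten M) (Mul (LayM R))"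
  unfolding lifted_map_def
proof (intro conjI ballI)
  show "is_functor (Base (prodS (LayS U) (LayS U))) (Base (LayS U)) (Ten M)" using m_rules(2) by simp
  note LayM_simps [simp] U.LaySp_simps [simp]
  fix c
  show "fo (Cpt (Mul (LayM R)) c) \<in> extensional (Obj (Gpd (prodX Simp (LaySp U) (LaySp U)) c))"
    "fa (Cpt (Mul (LayM R)) c) \<in> extensional (Arr (Gpd (prodX Simp (LaySp U) (LaySp U)) c))" by simp_all
  { fix x assume "x \<in> Obj (Gpd (prodX Simp (LaySp U) (LaySp U)) c)"
    then obtain s t where x: "x = (s, t)" "s \<in> Obj (Lay U c)" "t \<in> Obj (Lay U c)" by auto
    then show "fo (Cpt (Mul (LayM R)) c) x \<in> Obj (Gpd (LaySp U) c)" "sho (LayS U) (fo (Cpt (Mul (LayM R)) c) x) = fo (Ten M)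
        (sho (prodS (LayS U) (LayS U)) x)"
      using lay_ten_basic[OF x(2,3)] by simp_all }
  { fix f assume "f \<in> Arr (Gpd (prodX Simp (LaySp U) (LaySp U)) c)"
    then obtain s u s' t v t' where f: "f = ((s, u, s'), (t, v, t'))" "(s, u, s') \<in> Arr (Lay U c)" "(t, v, t') \<in> Arr (Lay U
        c)" by auto
    then show "fa (Cpt (Mul (LayM R)) c) f \<in> hom (Gpd (LaySp U) c) (fo (Cpt (Mul (LayM R)) c) (Dom (Gpd (prodX Simp (LaySp U)
        (LaySp U)) c) f)) (fo (Cpt (Mul (LayM R)) c) (Cod (Gpd (prodX Simp (LaySp U) (LaySp U)) c) f))"
      "sha (LayS U) (fa (Cpt (Mul (LayM R)) c) f) = fa (Ten M) (sha (prodS (LayS U) (LayS U)) f)"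
      using lay_ten_arr[OF f(2,3)] U.Lay_arrD(1,2)[OF f(2)] U.Lay_arrD(1,2)[OF f(3)] by (simp_all add: in_hom Lay_simps(3,4))
          }
  fix a assume a: "a \<in> Arr Simp"
  show "Nat (Mul (LayM R)) a \<in> extensional (Obj (Gpd (prodX Simp (LaySp U) (LaySp U)) (Cod Simp a)))" using a by simp
  fix x assume "x \<in> Obj (Gpd (prodX Simp (LaySp U) (LaySp U)) (Cod Simp a))"
  then obtain s t where x: "x = (s, t)" "s \<in> Obj (Lay U (Cod Simp a))" "t \<in> Obj (Lay U (Cod Simp a))" by auto
  then show "Nat (Mul (LayM R)) a x \<in> hom (Gpd (LaySp U) (Dom Simp a)) (fo (Cpt (Mul (LayM R)) (Dom Simp a)) (fo (Act (prodX
      Simp (LaySp U) (LaySp U)) a) x)) (fo (Act (LaySp U) a) (fo (Cpt (Mul (LayM R)) (Cod Simp a)) x))"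
    "Cmp (Base (LayS U)) (Lift (LayS U) a (fo (Cpt (Mul (LayM R)) (Cod Simp a)) x)) (sha (LayS U) (Nat (Mul (LayM R)) a x)) =
        fa (Ten M) (Lift (prodS (LayS U) (LayS U)) a x)"
    using lay_ten_fill[OF a x(2,3)] U.act_lift(6)[OF a x(2)] U.act_lift(6)[OF a x(3)] lay_ten_basic(5)[OF x(2,3)] a
    by (simp_all add: in_hom Lay_simps(3,4))
qed (simp_all add: LayM_simps Simp_simps(1) extensional_UNIV)

lemma lifted_map_Uni: "lifted_map Simp oneX oneS (LaySp U) (LayS U) (constF T (One M)) (Uni (LayM R))"
proof -
  have "is_functor oneC T (constF T (One M))" by (rule functor_constF[OF category_T m_rules(3)])
  moreover have "(lay_one R, Id T (One M), lay_one R) \<in> Arr (Lay U c)" for c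
    using category_rules(3)[OF U.category_Lay lay_one_obj, of c] by (simp add: Lay_simps(5) lay_one_simps)
  ultimately show ?thesis unfolding lifted_map_def
    using lay_one_fill lay_one_obj m_rules(3) category_T
    by (auto simp: LayM_simps U.LaySp_simps Simp_simps(1) extensional_UNIV in_hom Lay_simps(3,4) lay_one_simps)
qed

lemma lifted_monoidal_LayM: "lifted_monoidal Simp (LayM R) (LayS U) M"
proof -
  interpret lifted Simp "Und (LayM R)" "LayS U" using U.lifted_LaySp by (simp add: LayM_simps)
  show ?thesis
  proof
    show "monoidal_category M" by (rule M)
    show "lifted_map Simp (prodX Simp (Und (LayM R)) (Und (LayM R))) (prodS (LayS U) (LayS U)) (Und (LayM R)) (LayS U) (Ten
        M) (Mul (LayM R))"
      using lifted_map_Mul by (simp add: LayM_simps)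
    show "lifted_map Simp oneX oneS (Und (LayM R)) (LayS U) (constF T (One M)) (Uni (LayM R))"
      using lifted_map_Uni by (simp add: LayM_simps(1))
  next
    fix c x y z assume "x \<in> Obj (Gpd (Und (LayM R)) c)" "y \<in> Obj (Gpd (Und (LayM R)) c)" "z \<in> Obj (Gpd (Und (LayM R)) c)"
    then have o: "x \<in> Obj (Lay U c)" "y \<in> Obj (Lay U c)" "z \<in> Obj (Lay U c)" by (simp_all add: LayM_simps U.LaySp_simps)
    show "AscM (LayM R) c ((x, y), z) \<in> hom (Gpd (Und (LayM R)) c) (fo (Cpt (Mul (LayM R)) c) (fo (Cpt (Mul (LayM R)) c) (x,
        y), z)) (fo (Cpt (Mul (LayM R)) c) (x, fo (Cpt (Mul (LayM R)) c) (y, z))) \<and>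
       sha (LayS U) (AscM (LayM R) c ((x, y), z)) = Asc M ((sho (LayS U) x, sho (LayS U) y), sho (LayS U) z)"
      using Asc_arr[OF o] lay_ten_basic(5)[OF o(1,2)] lay_ten_basic(5)[OF o(2,3)] o by (simp add: LayM_simps U.LaySp_simps
          in_hom Lay_simps(3,4))
  next
    fix c x assume "x \<in> Obj (Gpd (Und (LayM R)) c)"
    then have o: "x \<in> Obj (Lay U c)" by (simp add: LayM_simps U.LaySp_simps)
    show "LUnM (LayM R) c x \<in> hom (Gpd (Und (LayM R)) c) (fo (Cpt (Mul (LayM R)) c) (fo (Cpt (Uni (LayM R)) c) (), x)) x \<and>
        sha (LayS U) (LUnM (LayM R) c x) = LUn M (sho (LayS U) x)"
      "RUnM (LayM R) c x \<in> hom (Gpd (Und (LayM R)) c) (fo (Cpt (Mul (LayM R)) c) (x, fo (Cpt (Uni (LayM R)) c) ())) x \<and> sha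
          (LayS U) (RUnM (LayM R) c x) = RUn M (sho (LayS U) x)"
      using Un_arr[OF o] o lay_one_obj by (simp_all add: LayM_simps U.LaySp_simps in_hom Lay_simps(3,4))
  qed (simp_all add: LayM_simps U.LaySp_simps Simp_simps(1) extensional_UNIV)
qed

text \<open>A layering of a disjoint union is the same as a pair of layerings of the summands, both
  before and after a generic map acts. Fillers and lifted objects are therefore found on each
  summand separately, by composing with \<open>lf\<close> and \<open>rg\<close>.\<close>

lemma culf_Mul: "culf (prodX Simp (LaySp U) (LaySp U)) (LaySp U) (Mul (LayM R))"
proof (rule lifted_culf[OF lifted_prodX[OF U.lifted_LaySp U.lifted_LaySp] U.lifted_LaySp lifted_map_Mul])
  note LayM_simps [simp] U.LaySp_simps [simp]
  fix g t assume g: "generic g"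
  { assume "t \<in> Obj (Gpd (prodX Simp (LaySp U) (LaySp U)) (Cod Simp g))"
    then show "Lift (prodS (LayS U) (LayS U)) g t = Id (Base (prodS (LayS U) (LayS U))) (sho (prodS (LayS U) (LayS U)) t)"
      using U.act_lift_generic(1)[OF g] by auto }
  { assume "t \<in> Obj (Gpd (LaySp U) (Cod Simp g))"
    then show "Lift (LayS U) g t = Id (Base (LayS U)) (sho (LayS U) t)" using U.act_lift_generic(1)[OF g] by simp }
next
  note LayM_simps [simp] U.LaySp_simps [simp]
  fix g x y u v assume g: "generic g" and "x \<in> Obj (Gpd (prodX Simp (LaySp U) (LaySp U)) (Cod Simp g))" "y \<in> Obj (Gpd (prodX
      Simp (LaySp U) (LaySp U)) (Cod Simp g))"
    and u: "u \<in> hom (Gpd (prodX Simp (LaySp U) (LaySp U)) (Dom Simp g)) (fo (Act (prodX Simp (LaySp U) (LaySp U)) g) x) (fo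
        (Act (prodX Simp (LaySp U) (LaySp U)) g) y)"
    and v: "v \<in> hom (Gpd (LaySp U) (Cod Simp g)) (fo (Cpt (Mul (LayM R)) (Cod Simp g)) x) (fo (Cpt (Mul (LayM R)) (Cod Simp
        g)) y)"
    and uv: "sha (LayS U) v = fa (Ten M) (sha (prodS (LayS U) (LayS U)) u)"
  then obtain s t s' t' where x: "x = (s, t)" "s \<in> Obj (Lay U (Cod Simp g))" "t \<in> Obj (Lay U (Cod Simp g))"
    and y: "y = (s', t')" "s' \<in> Obj (Lay U (Cod Simp g))" "t' \<in> Obj (Lay U (Cod Simp g))" by auto
  obtain u1 u2 where u0: "u = ((act_lay U g s, u1, act_lay U g s'), (act_lay U g t, u2, act_lay U g t'))"
    using u x y by (cases u) (auto simp: in_hom Lay_simps(3,4))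
  have v0: "v = (lay_ten R (s, t), tar u1 u2, lay_ten R (s', t'))"
    using v uv x y by (cases v) (auto simp: in_hom Lay_simps(3,4) u0)
  have d1: "(act_lay U g s, u1, act_lay U g s') \<in> Arr (Lay U (Dom Simp g))" and d2: "(act_lay U g t, u2, act_lay U g t') \<in>
      Arr (Lay U (Dom Simp g))"
    and dv: "(lay_ten R (s, t), tar u1 u2, lay_ten R (s', t')) \<in> Arr (Lay U (Cod Simp g))"
    using u v by (simp_all add: u0 v0 in_hom)
  note D1 = U.Lay_arrD[OF d1, simplified] and D2 = U.Lay_arrD[OF d2, simplified] and Dv = U.Lay_arrD[OF dv, simplified]
  note gs = U.act_lift_generic[OF g x(2)] U.act_lift_generic[OF g y(2)] and gt = U.act_lift_generic[OF g x(3)]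
      U.act_lift_generic[OF g y(3)]
  note L = lay_ten_basic[OF x(2,3)] and L' = lay_ten_basic[OF y(2,3)]
  have us: "und U (str s) = fst s" "und U (str t) = fst t" "str s \<in> Obj T" "str t \<in> Obj T" using x by (auto simp:
      Lay_simps(1))
  have dd: "Dom T u1 = str s" "Cod T u1 = str s'" "Dom T u2 = str t" "Cod T u2 = str t'" using D1 D2 gs gt by simp_all
  note tl = tar_lf[OF D1(3) D2(3), unfolded dd us]
  \<comment> \<open>That \<open>u1\<close> preserves the layers over the target of \<open>g\<close>
    is read off from \<open>v\<close> on the left summand.\<close>
  have a1: "(s, u1, s') \<in> Arr (Lay U (Cod Simp g))"
  proof (rule U.Lay_arrI[OF x(2) y(2)])
    show "u1 \<in> hom (Tot U) (str s) (str s')" using D1(3) dd by (simp add: in_hom)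
    show "fst s' \<subseteq> pm U u1 ` fst s" using D1(6) gs by simp
    fix z assume z: "z \<in> fst s"
    then have "pm U u1 z \<in> fst s'" using D1(6) gs by auto
    then show "lyr s' (pm U u1 z) = lyr s z"
      using tl(1)[OF z] L(3)[OF z] L'(3)[of "pm U u1 z"] Dv(7)[of "lf (str s) (str t) z"] lf_in[OF us(3,4), of z] us L(1) z
          by simp
  qed
  have a2: "(t, u2, t') \<in> Arr (Lay U (Cod Simp g))"
  proof (rule U.Lay_arrI[OF x(3) y(3)])
    show "u2 \<in> hom (Tot U) (str t) (str t')" using D2(3) dd by (simp add: in_hom)
    show "fst t' \<subseteq> pm U u2 ` fst t" using D2(6) gt by simp
    fix z assume z: "z \<in> fst t"
    then have "pm U u2 z \<in> fst t'" using D2(6) gt by auto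
    then show "lyr t' (pm U u2 z) = lyr t z"
      using tl(2)[OF z] L(4)[OF z] L'(4)[of "pm U u2 z"] Dv(7)[of "rg (str s) (str t) z"] rg_in[OF us(3,4), of z] us L(1) z
          by simp
  qed
  show "\<exists>w\<in>hom (Gpd (prodX Simp (LaySp U) (LaySp U)) (Cod Simp g)) x y. sha (prodS (LayS U) (LayS U)) w = sha (prodS (LayS U)
      (LayS U)) u"
    using a1 a2 by (intro bexI[of _ "((s, u1, s'), (t, u2, t'))"]) (simp_all add: u0 x y in_hom Lay_simps(3,4))
next
  note LayM_simps [simp] U.LaySp_simps [simp]
  fix g a b \<gamma> assume g: "generic g" and "a \<in> Obj (Gpd (prodX Simp (LaySp U) (LaySp U)) (Dom Simp g))" and "b \<in> Obj (Gpd
      (LaySp U) (Cod Simp g))"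
    and \<gamma>: "\<gamma> \<in> hom (Gpd (LaySp U) (Dom Simp g)) (fo (Cpt (Mul (LayM R)) (Dom Simp g)) a) (fo (Act (LaySp U) g) b)"
  then obtain s t where a: "a = (s, t)" "s \<in> Obj (Lay U (Dom Simp g))" "t \<in> Obj (Lay U (Dom Simp g))" and b: "b \<in> Obj (Lay U
      (Cod Simp g))" by auto
  have ga: "g \<in> Arr Simp" by (rule generic_Arr[OF g])
  obtain h where h: "\<gamma> = (lay_ten R (s, t), h, act_lay U g b)" using \<gamma> a b by (cases \<gamma>) (auto simp: in_hom Lay_simps(3,4))
  have dh: "(lay_ten R (s, t), h, act_lay U g b) \<in> Arr (Lay U (Dom Simp g))" using \<gamma> by (simp add: h in_hom)
  note d = U.Lay_arrD[OF dh, simplified] and lb = U.act_lift_generic[OF g b] and L = lay_ten_basic[OF a(2,3)]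
  have us: "und U (str s) = fst s" "und U (str t) = fst t" "str s \<in> Obj T" "str t \<in> Obj T" using a by (auto simp:
      Lay_simps(1))
  \<comment> \<open>The layering of \<open>b\<close>, pulled back along \<open>h\<close> and
    restricted to the two summands.\<close>
  define x where "x = (fst s, \<lambda>z \<in> fst s. lyr b (pm U h (lf (str s) (str t) z)), str s)"
  define y where "y = (fst t, \<lambda>z \<in> fst t. lyr b (pm U h (rg (str s) (str t) z)), str t)"
  have hb: "pm U h z \<in> fst b" if "z \<in> fst (lay_ten R (s, t))" for z using d(6) lb(3) that by auto
  have il: "lf (str s) (str t) z \<in> fst (lay_ten R (s, t))" if "z \<in> fst s" for z using lf_in[OF us(3,4), of z] us L(1) that by
      simp
  have ir: "rg (str s) (str t) z \<in> fst (lay_ten R (s, t))" if "z \<in> fst t" for z using rg_in[OF us(3,4), of z] us L(1) that by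
      simp
  have x: "x \<in> Obj (Lay U (Cod Simp g))" and y: "y \<in> Obj (Lay U (Cod Simp g))"
    using a b hb[OF il] hb[OF ir] by (auto simp: x_def y_def Lay_simps(1) PiE_iff)
  note lx = U.act_lift_generic[OF g x] and ly = U.act_lift_generic[OF g y] and L' = lay_ten_basic[OF x y]
  have ix: "idx g (lyr b (pm U h z)) = lyr (lay_ten R (s, t)) z" if "z \<in> fst (lay_ten R (s, t))" for z
    using d(7)[of z] lb(4)[OF hb[OF that]] that by simp
  have "act_lay U g x = s"
  proof (rule prod_eqI)
    show "fst (act_lay U g x) = fst s" using lx by (simp add: x_def)
    show "snd (act_lay U g x) = snd s"
    proof (rule prod_eqI)
      show "str (act_lay U g x) = str s" using lx by (simp add: x_def)
      have "lyr s \<in> extensional (fst s)" using a by (auto simp: Lay_simps(1) PiE_iff)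
      then show "lyr (act_lay U g x) = lyr s"
        unfolding act_lay_eq(2)[OF ga] part_generic[OF g x] using ix[OF il] L(3) by (auto simp: x_def fun_eq_iff
            extensional_def)
    qed
  qed
  moreover have "act_lay U g y = t"
  proof (rule prod_eqI)
    show "fst (act_lay U g y) = fst t" using ly by (simp add: y_def)
    show "snd (act_lay U g y) = snd t"
    proof (rule prod_eqI)
      show "str (act_lay U g y) = str t" using ly by (simp add: y_def)
      have "lyr t \<in> extensional (fst t)" using a by (auto simp: Lay_simps(1) PiE_iff)
      then show "lyr (act_lay U g y) = lyr t"
        unfolding act_lay_eq(2)[OF ga] part_generic[OF g y] using ix[OF ir] L(4) by (auto simp: y_def fun_eq_iff
            extensional_def)
    qed
  qed
  moreover have st: "str x = str s" "str y = str t" "fst x = fst s" "fst y = fst t" by (simp_all add: x_def y_def)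
  moreover have "(lay_ten R (x, y), h, b) \<in> Arr (Lay U (Cod Simp g))"
  proof (rule U.Lay_arrI[OF L'(5) b])
    have e: "fst (lay_ten R (x, y)) = fst (lay_ten R (s, t))" "str (lay_ten R (x, y)) = str (lay_ten R (s, t))" using L L' st
        by simp_all
    show "h \<in> hom (Tot U) (str (lay_ten R (x, y))) (str b)" using d(3-5) lb(2) e by (simp add: in_hom)
    show "fst b \<subseteq> pm U h ` fst (lay_ten R (x, y))" using d(6) lb(3) e by simp
    fix z assume z: "z \<in> fst (lay_ten R (x, y))"
    from lay_ten_cases[OF x y z] show "lyr b (pm U h z) = lyr (lay_ten R (x, y)) z"
      by cases (use L'(3,4) in \<open>auto simp: st\<close>, simp_all add: x_def y_def)
  qed
  ultimately show "\<exists>x\<in>Obj (Gpd (prodX Simp (LaySp U) (LaySp U)) (Cod Simp g)). fo (Act (prodX Simp (LaySp U) (LaySp U)) g) x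
      = a \<and>
        (\<exists>v\<in>hom (Gpd (LaySp U) (Cod Simp g)) (fo (Cpt (Mul (LayM R)) (Cod Simp g)) x) b. sha (LayS U) v = sha (LayS U) \<gamma>)"
    using x y a by (intro bexI[of _ "(x, y)"] conjI bexI[of _ "(lay_ten R (x, y), h, b)"]) (simp_all add: h in_hom
        Lay_simps(3,4))
qed

lemma monoidal_decomposition_space_LayM: "monoidal_decomposition_space (LayM R)"
  using U.decomposition_space_LaySp lifted_monoidal.monoidal_psh[OF lifted_monoidal_LayM] culf_Mul
  by (simp add: monoidal_decomposition_space_def LayM_simps(1))

end

section \<open>Morphisms of monoidal restriction species\<close>

locale mspecies_map = R: mspecies R + S: mspecies S for R S :: "('a, 'o, 'm) mrspecies" +
  fixes \<Phi> :: "('o, 'm, 'o, 'm) smf"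
  assumes \<Phi>: "mrspecies_morphism R \<Phi> S"
begin

abbreviation "F \<equiv> SF \<Phi>"

sublocale species_map R.U S.U F
  using \<Phi> by unfold_locales (simp add: mrspecies_morphism_def)

lemma strong: "strong_monoidal R.M S.M \<Phi>"
  using \<Phi> by (simp add: mrspecies_morphism_def)

lemmas Fr = F_rules[simplified]
lemmas s_rules = strong_monoidal_rules[OF strong]

text \<open>The coprojections of \<open>S\<close>, followed by the structure map of
  \<open>\<Phi>\<close>, form a natural family on \<open>R\<close> because the projections commute
  strictly; \<open>structure_unique\<close> identifies this family with the coprojections of
  \<open>R\<close>. This is what makes \<open>F2 \<Phi>\<close> compatible with layerings.\<close>

lemma F2_lf:
  assumes o: "X \<in> Obj R.T" "Y \<in> Obj R.T"
  shows "x \<in> und R.U X \<Longrightarrow> pm S.U (F2 \<Phi> (X, Y)) (S.lf (fo F X) (fo F Y) x) = R.lf X Y x"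
    "y \<in> und R.U Y \<Longrightarrow> pm S.U (F2 \<Phi> (X, Y)) (S.rg (fo F X) (fo F Y) y) = R.rg X Y y"
proof -
  let ?l = "\<lambda>X Y x. pm S.U (F2 \<Phi> (X, Y)) (S.lf (fo F X) (fo F Y) x)" and ?r = "\<lambda>X Y y. pm S.U (F2 \<Phi> (X, Y)) (S.rg (fo F X)
      (fo F Y) y)"
  note pin = S.U.pm_in[simplified] and pc = S.U.pm_comp_apply[simplified]
  have ty: "?l X Y x \<in> und R.U (R.ten X Y)" if "X \<in> Obj R.T" "Y \<in> Obj R.T" "x \<in> und R.U X" for X Y x
    using pin[of "F2 \<Phi> (X, Y)" "S.lf (fo F X) (fo F Y) x"] s_rules(2)[OF that(1,2)] S.lf_in[of "fo F X" "fo F Y" x] that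
    by (simp add: Fr R.b_rules(2))
  have ty': "?r X Y y \<in> und R.U (R.ten X Y)" if "X \<in> Obj R.T" "Y \<in> Obj R.T" "y \<in> und R.U Y" for X Y y
    using pin[of "F2 \<Phi> (X, Y)" "S.rg (fo F X) (fo F Y) y"] s_rules(2)[OF that(1,2)] S.rg_in[of "fo F X" "fo F Y" y] that
    by (simp add: Fr R.b_rules(2))
  \<comment> \<open>Naturality of \<open>F2 \<Phi>\<close> on underlying functions, where
    \<open>F\<close> leaves no trace.\<close>
  have nat: "pm R.U (R.tar u v) (pm S.U (F2 \<Phi> (Dom R.T u, Dom R.T v)) w) = pm S.U (F2 \<Phi> (Cod R.T u, Cod R.T v)) (pm S.U
      (S.tar (fa F u) (fa F v)) w)"
    if u: "u \<in> Arr R.T" and v: "v \<in> Arr R.T" and w: "w \<in> und S.U (S.ten (fo F (Dom R.T u)) (fo F (Dom R.T v)))" for u v w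
  proof -
    have d: "Dom R.T u \<in> Obj R.T" "Dom R.T v \<in> Obj R.T" "Cod R.T u \<in> Obj R.T" "Cod R.T v \<in> Obj R.T" using u v R.category_T by
        auto
    note k = s_rules(2)[OF d(1,2)] s_rules(2)[OF d(3,4)]
    have "pm S.U (Cmp S.T (F2 \<Phi> (Cod R.T u, Cod R.T v)) (S.tar (fa F u) (fa F v))) w = pm S.U (Cmp S.T (fa F (R.tar u v)) (F2
        \<Phi> (Dom R.T u, Dom R.T v))) w"
      unfolding s_rules(3)[OF u v] ..
    then show ?thesis
      using pc[of "S.tar (fa F u) (fa F v)" "F2 \<Phi> (Cod R.T u, Cod R.T v)" w] pc[of "F2 \<Phi> (Dom R.T u, Dom R.T v)" "fa F (R.tar
          u v)" w] k u v w
      by (simp add: Fr R.b_rules S.b_rules)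
  qed
  have nl: "pm R.U (R.tar u v) (?l (Dom R.T u) (Dom R.T v) x) = ?l (Cod R.T u) (Cod R.T v) (pm R.U u x)"
    if "u \<in> Arr R.T" "v \<in> Arr R.T" "x \<in> und R.U (Dom R.T u)" for u v x
    using nat[OF that(1,2), of "S.lf (fo F (Dom R.T u)) (fo F (Dom R.T v)) x"] S.lf_in[of "fo F (Dom R.T u)" "fo F (Dom R.T
        v)" x]
      S.tar_lf(1)[of "fa F u" "fa F v" x] that R.category_T by (simp add: Fr)
  have nr: "pm R.U (R.tar u v) (?r (Dom R.T u) (Dom R.T v) y) = ?r (Cod R.T u) (Cod R.T v) (pm R.U v y)"
    if "u \<in> Arr R.T" "v \<in> Arr R.T" "y \<in> und R.U (Dom R.T v)" for u v y
    using nat[OF that(1,2), of "S.rg (fo F (Dom R.T u)) (fo F (Dom R.T v)) y"] S.rg_in[of "fo F (Dom R.T u)" "fo F (Dom R.T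
        v)" y]
      S.tar_lf(2)[of "fa F u" "fa F v" y] that R.category_T by (simp add: Fr)
  show "x \<in> und R.U X \<Longrightarrow> ?l X Y x = R.lf X Y x" "y \<in> und R.U Y \<Longrightarrow> ?r X Y y = R.rg X Y y"
    using R.structure_unique[of ?l ?r, OF ty ty' nl nr o] by auto
qed

lemma F2_arr:
  assumes s: "s \<in> Obj (Lay R.U n)" and t: "t \<in> Obj (Lay R.U n)"
  shows "(lay_ten S (lay_map F s, lay_map F t), F2 \<Phi> (str s, str t), lay_map F (lay_ten R (s, t))) \<in> Arr (Lay S.U n)"
proof -
  note s' = lay_map_obj[OF s] and t' = lay_map_obj[OF t]
  note L = R.lay_ten_basic[OF s t] and L' = S.lay_ten_basic[OF s' t', simplified]
  have o: "str s \<in> Obj R.T" "str t \<in> Obj R.T" "und R.U (str s) = fst s" "und R.U (str t) = fst t" using s t by (auto simp: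
      Lay_simps(1))
  note fl = F2_lf[OF o(1,2), unfolded o(3,4)]
  have il: "S.lf (fo F (str s)) (fo F (str t)) x \<in> fst (lay_ten S (lay_map F s, lay_map F t))" if "x \<in> fst s" for x
    using S.lf_in[of "fo F (str s)" "fo F (str t)" x] L'(1) o that by (simp add: Fr)
  have ir: "S.rg (fo F (str s)) (fo F (str t)) x \<in> fst (lay_ten S (lay_map F s, lay_map F t))" if "x \<in> fst t" for x
    using S.rg_in[of "fo F (str s)" "fo F (str t)" x] L'(1) o that by (simp add: Fr)
  show ?thesis
  proof (rule S.U.Lay_arrI[OF L'(5) lay_map_obj[OF L(5)]])
    show "F2 \<Phi> (str s, str t) \<in> hom (Tot S.U) (str (lay_ten S (lay_map F s, lay_map F t))) (str (lay_map F (lay_ten R (s,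
        t))))"
      using s_rules(2)[OF o(1,2)] L L' by (simp add: in_hom)
    show "fst (lay_map F (lay_ten R (s, t))) \<subseteq> pm S.U (F2 \<Phi> (str s, str t)) ` fst (lay_ten S (lay_map F s, lay_map F t))"
    proof
      fix z assume "z \<in> fst (lay_map F (lay_ten R (s, t)))"
      then have z: "z \<in> fst (lay_ten R (s, t))" by simp
      from R.lay_ten_cases[OF s t z] show "z \<in> pm S.U (F2 \<Phi> (str s, str t)) ` fst (lay_ten S (lay_map F s, lay_map F t))"
      proof cases
        case (1 x) then show ?thesis using fl(1)[of x] il[of x] by (intro image_eqI[of _ _ "S.lf (fo F (str s)) (fo F (str
            t)) x"]) auto
      next
        case (2 x) then show ?thesis using fl(2)[of x] ir[of x] by (intro image_eqI[of _ _ "S.rg (fo F (str s)) (fo F (str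
            t)) x"]) auto
      qed
    qed
    fix z assume z: "z \<in> fst (lay_ten S (lay_map F s, lay_map F t))"
    from S.lay_ten_cases[OF s' t' z] show "lyr (lay_map F (lay_ten R (s, t))) (pm S.U (F2 \<Phi> (str s, str t)) z) = lyr (lay_ten
        S (lay_map F s, lay_map F t)) z"
      by cases (use fl L(3,4) L'(3,4) in auto)
  qed
qed

text \<open>Both underlying sets are empty, so only the endpoints of \<open>F0 \<Phi>\<close>
  matter.\<close>

lemma F0_arr: "(lay_one S, F0 \<Phi>, lay_map F (lay_one R)) \<in> Arr (Lay S.U n)"
  by (rule S.U.Lay_arrI[OF S.lay_one_obj lay_map_obj[OF R.lay_one_obj]])
    (use s_rules(5-7) in \<open>simp_all add: in_hom lay_one_def\<close>)

lemma LayMapM_simps: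
  "MF (LayMapM R \<Phi> S) = LayMap R.U F S.U"
  "M2 (LayMapM R \<Phi> S) n = (\<lambda>(s, t) \<in> Obj (Lay R.U n) \<times> Obj (Lay R.U n).
         (lay_ten S (lay_map F s, lay_map F t), F2 \<Phi> (str s, str t), lay_map F (lay_ten R (s, t))))"
  "M0 (LayMapM R \<Phi> S) n x = (lay_one S, F0 \<Phi>, lay_map F (lay_one R))"
  by (simp_all add: LayMapM_def Let_def prodC_def)

lemma monoidal_pnt_LayMapM: "monoidal_pnt Simp (LayM R) (LayM S) (LayMapM R \<Phi> S)"
proof (rule lifted_monoidal_pnt[OF R.lifted_monoidal_LayM S.lifted_monoidal_LayM])
  note LayMapM_simps [simp] R.LayM_simps [simp] S.LayM_simps [simp] R.U.LaySp_simps [simp] S.U.LaySp_simps [simp]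
      LayMap_simps [simp]
  show "lifted_map Simp (Und (LayM R)) (LayS R.U) (Und (LayM S)) (LayS S.U) F (MF (LayMapM R \<Phi> S))"
    using lifted_map_LayMap by simp
  show "strong_monoidal R.M S.M \<Phi>" by (rule strong)
  show "M2 (LayMapM R \<Phi> S) \<in> extensional (Obj Simp)" "M0 (LayMapM R \<Phi> S) \<in> extensional (Obj Simp)"
    by (simp_all add: Simp_simps(1) extensional_UNIV)
  fix c
  show "M2 (LayMapM R \<Phi> S) c \<in> extensional (Obj (Gpd (Und (LayM R)) c) \<times> Obj (Gpd (Und (LayM R)) c))" by simp
  show "M0 (LayMapM R \<Phi> S) c () \<in> hom (Gpd (Und (LayM S)) c) (fo (Cpt (Uni (LayM S)) c) ()) (fo (Cpt (MF (LayMapM R \<Phi> S)) c)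
      (fo (Cpt (Uni (LayM R)) c) ())) \<and>
     sha (LayS S.U) (M0 (LayMapM R \<Phi> S) c ()) = F0 \<Phi>"
    using F0_arr R.lay_one_obj by (simp add: in_hom Lay_simps(3,4))
  fix s t assume "s \<in> Obj (Gpd (Und (LayM R)) c)" "t \<in> Obj (Gpd (Und (LayM R)) c)"
  then have o: "s \<in> Obj (Lay R.U c)" "t \<in> Obj (Lay R.U c)" by simp_all
  show "M2 (LayMapM R \<Phi> S) c (s, t) \<in> hom (Gpd (Und (LayM S)) c) (fo (Cpt (Mul (LayM S)) c) (fo (Cpt (MF (LayMapM R \<Phi> S)) c)
      s, fo (Cpt (MF (LayMapM R \<Phi> S)) c) t))
         (fo (Cpt (MF (LayMapM R \<Phi> S)) c) (fo (Cpt (Mul (LayM R)) c) (s, t))) \<and> sha (LayS S.U) (M2 (LayMapM R \<Phi> S) c (s, t))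
             = F2 \<Phi> (sho (LayS R.U) s, sho (LayS R.U) t)"
    using F2_arr[OF o] lay_map_obj[OF o(1)] lay_map_obj[OF o(2)] R.lay_ten_basic(5)[OF o] o by (simp add: in_hom
        Lay_simps(3,4))
qed

end

section \<open>Functoriality and compatibility with forgetting the monoidal structures\<close>

lemma MonRSp_simps: "Obj MonRSp = {R. monoidal_restriction_species R}"
  "(R, \<Phi>, S) \<in> Arr MonRSp \<longleftrightarrow> monoidal_restriction_species R \<and> monoidal_restriction_species S \<and> mrspecies_morphism R \<Phi> S"
  "Dom MonRSp (R, \<Phi>, S) = R" "Cod MonRSp (R, \<Phi>, S) = S" "Id MonRSp R = (R, id_smf (MTot R), R)"
  "Cmp MonRSp (S', \<Psi>, Q) (R, \<Phi>, S) = (R, comp_smf (MTot R) (MTot S) (MTot Q) \<Psi> \<Phi>, Q)"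
  by (auto simp: MonRSp_def mk_cat_simps)

lemma MonDcmp_simps: "Obj MonDcmp = {M. monoidal_decomposition_space M}"
  "(M, \<Phi>, N) \<in> Arr MonDcmp \<longleftrightarrow> monoidal_decomposition_space M \<and> monoidal_decomposition_space N \<and> monoidal_pnt Simp M N \<Phi> \<and> culf
      (Und M) (Und N) (MF \<Phi>)"
  "Dom MonDcmp (M, \<Phi>, N) = M" "Cod MonDcmp (M, \<Phi>, N) = N" "Id MonDcmp M = (M, id_monpnt Simp M, M)"
  "Cmp MonDcmp (N', \<Psi>, P) (M, \<Phi>, N) = (M, comp_monpnt Simp M N P \<Psi> \<Phi>, P)"
  by (auto simp: MonDcmp_def mk_cat_simps)

lemma mspecies_map_Arr: "(R, \<Phi>, S) \<in> Arr MonRSp \<Longrightarrow> mspecies_map R S \<Phi>"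
  by (simp add: MonRSp_simps(2) mspecies_map_def mspecies_def mspecies_map_axioms_def)

lemma (in mspecies) LayMapM_id: "LayMapM R (id_smf M) R = id_monpnt Simp (LayM R)"
proof (rule monpnt_eqI[where A = UNIV])
  have "(R, id_smf M, R) \<in> Arr MonRSp"
    using category_rules(3)[OF category_MonRSp, of R] R by (simp add: MonRSp_simps)
  then interpret I: mspecies_map R R "id_smf M" by (rule mspecies_map_Arr)
  show "MF (LayMapM R (id_smf M) R) = MF (id_monpnt Simp (LayM R))"
    using U.LayMap_idF by (simp add: I.LayMapM_simps LayM_simps)
  fix c :: nat
  show "levelF (LayMapM R (id_smf M) R) c = levelF (id_monpnt Simp (LayM R)) c"
  proof (rule smf_eqI[where A = "Obj (Lay U c)" and B = "Obj (Lay U c)"])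
    show "SF (levelF (LayMapM R (id_smf M) R) c) = SF (levelF (id_monpnt Simp (LayM R)) c)"
      using U.LayMap_idF by (simp add: I.LayMapM_simps LayM_simps Simp_simps(1))
    show "F0 (levelF (LayMapM R (id_smf M) R) c) = F0 (levelF (id_monpnt Simp (LayM R)) c)"
      using U.lay_map_idF[OF lay_one_obj] by (simp add: I.LayMapM_simps LayM_simps Simp_simps(1) U.LaySp_simps Lay_simps(5)
          lay_one_simps)
    show "F2 (levelF (LayMapM R (id_smf M) R) c) \<in> extensional (Obj (Lay U c) \<times> Obj (Lay U c))" by (simp add:
        I.LayMapM_simps)
    show "F2 (levelF (id_monpnt Simp (LayM R)) c) \<in> extensional (Obj (Lay U c) \<times> Obj (Lay U c))"
      using id_smf_simps(4)[of "level (LayM R) c"] by (simp add: LayM_simps U.LaySp_simps Simp_simps(1))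
    fix s t assume o: "s \<in> Obj (Lay U c)" "t \<in> Obj (Lay U c)"
    have "str s \<in> Obj T" "str t \<in> Obj T" using o by (auto simp: Lay_simps(1))
    then show "F2 (levelF (LayMapM R (id_smf M) R) c) (s, t) = F2 (levelF (id_monpnt Simp (LayM R)) c) (s, t)"
      using o U.lay_map_idF[OF o(1)] U.lay_map_idF[OF o(2)] U.lay_map_idF[OF lay_ten_basic(5)[OF o]] lay_ten_basic(2)[OF o]
      by (simp add: I.LayMapM_simps LayM_simps U.LaySp_simps Simp_simps(1) Lay_simps(5))
  qed
qed (simp_all add: extensional_UNIV)

text \<open>The underlying transformations compose by \<open>LayMap_compF\<close>. At each level the
  structure maps on both sides are the same composite in the total category between the same layered
  structures.\<close>

lemma LayMapM_comp:
  assumes f: "(R, \<Phi>, S) \<in> Arr MonRSp" and g: "(S, \<Psi>, Q) \<in> Arr MonRSp"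
  shows "LayMapM R (comp_smf (MTot R) (MTot S) (MTot Q) \<Psi> \<Phi>) Q = comp_monpnt Simp (LayM R) (LayM S) (LayM Q) (LayMapM S \<Psi> Q)
      (LayMapM R \<Phi> S)"
proof -
  let ?c = "comp_smf (MTot R) (MTot S) (MTot Q) \<Psi> \<Phi>"
  interpret F: mspecies_map R S \<Phi> by (rule mspecies_map_Arr[OF f])
  interpret G: mspecies_map S Q \<Psi> by (rule mspecies_map_Arr[OF g])
  have "(R, ?c, Q) \<in> Arr MonRSp"
    using category_rules(6)[OF category_MonRSp f g] by (simp add: MonRSp_simps(3-6))
  then interpret H: mspecies_map R Q ?c by (rule mspecies_map_Arr)
  note [simp] = F.LayMapM_simps G.LayMapM_simps H.LayMapM_simps F.R.LayM_simps F.S.LayM_simps G.S.LayM_simps Simp_simps(1)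
    F.R.U.LaySp_simps F.S.U.LaySp_simps G.S.U.LaySp_simps
  have lm: "LayMap F.R.U (compF F.R.T (SF \<Psi>) (SF \<Phi>)) G.S.U = compP Simp (LaySp F.R.U) (LaySp G.S.U) (LayMap F.S.U (SF \<Psi>)
      G.S.U) (LayMap F.R.U (SF \<Phi>) F.S.U)"
    using LayMap_compF[OF F.species_map_axioms G.species_map_axioms] by simp
  have cm: "lay_map (compF F.R.T (SF \<Psi>) (SF \<Phi>)) t = lay_map (SF \<Psi>) (lay_map (SF \<Phi>) t)" if "t \<in> Obj (Lay F.R.U n)" for t n
    using that by (cases t) (simp add: lay_map_def Lay_simps(1))
  show ?thesis
  proof (rule monpnt_eqI[where A = UNIV])
    show "MF (LayMapM R ?c Q) = MF (comp_monpnt Simp (LayM R) (LayM S) (LayM Q) (LayMapM S \<Psi> Q) (LayMapM R \<Phi> S))" using lm by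
        simp
    fix c :: nat
    show "levelF (LayMapM R ?c Q) c = levelF (comp_monpnt Simp (LayM R) (LayM S) (LayM Q) (LayMapM S \<Psi> Q) (LayMapM R \<Phi> S)) c"
    proof (rule smf_eqI[where A = "Obj (Lay F.R.U c)" and B = "Obj (Lay F.R.U c)"])
      show "SF (levelF (LayMapM R ?c Q) c) = SF (levelF (comp_monpnt Simp (LayM R) (LayM S) (LayM Q) (LayMapM S \<Psi> Q) (LayMapM
          R \<Phi> S)) c)"
        using lm by simp
      show "F0 (levelF (LayMapM R ?c Q) c) = F0 (levelF (comp_monpnt Simp (LayM R) (LayM S) (LayM Q) (LayMapM S \<Psi> Q) (LayMapM
          R \<Phi> S)) c)"
        using cm[OF F.R.lay_one_obj] F.F0_arr[of c] by (simp add: LayMap_simps Lay_simps(6))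
      show "F2 (levelF (LayMapM R ?c Q) c) \<in> extensional (Obj (Lay F.R.U c) \<times> Obj (Lay F.R.U c))" by simp
      show "F2 (levelF (comp_monpnt Simp (LayM R) (LayM S) (LayM Q) (LayMapM S \<Psi> Q) (LayMapM R \<Phi> S)) c) \<in> extensional (Obj
          (Lay F.R.U c) \<times> Obj (Lay F.R.U c))"
        using comp_smf_simps(4)[of "level (LayM R) c"] by simp
      fix s t assume o: "s \<in> Obj (Lay F.R.U c)" "t \<in> Obj (Lay F.R.U c)"
      have "str s \<in> Obj F.R.T" "str t \<in> Obj F.R.T" using o by (auto simp: Lay_simps(1))
      then show "F2 (levelF (LayMapM R ?c Q) c) (s, t) = F2 (levelF (comp_monpnt Simp (LayM R) (LayM S) (LayM Q) (LayMapM S \<Psi>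
          Q) (LayMapM R \<Phi> S)) c) (s, t)"
        using o cm[OF o(1)] cm[OF o(2)] cm[OF F.R.lay_ten_basic(5)[OF o]] F.F2_arr[OF o] F.lay_map_obj[OF o(1)]
            F.lay_map_obj[OF o(2)]
        by (simp add: LayMap_simps Lay_simps(6))
    qed
  qed (simp_all add: extensional_UNIV)
qed

lemma LayFM_simps:
  "R \<in> Obj MonRSp \<Longrightarrow> fo LayFM R = LayM R" "(R, \<Phi>, S) \<in> Arr MonRSp \<Longrightarrow> fa LayFM (R, \<Phi>, S) = (LayM R, LayMapM R \<Phi> S, LayM S)"
  by (simp_all add: LayFM_def)

lemma functor_LayFM: "is_functor MonRSp MonDcmp LayFM"
proof (rule functorI[OF category_MonRSp category_MonDcmp])
  fix R :: "('a, 'o, 'm) mrspecies" assume RO: "R \<in> Obj MonRSp"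
  then have "mspecies R" by (simp add: mspecies_def MonRSp_simps(1))
  then interpret mspecies R .
  show "fo LayFM R \<in> Obj MonDcmp" using monoidal_decomposition_space_LayM by (simp add: LayFM_simps(1)[OF RO]
      MonDcmp_simps(1))
  have "Id MonRSp R \<in> Arr MonRSp" by (rule category_rules(3)[OF category_MonRSp RO])
  then show "fa LayFM (Id MonRSp R) = Id MonDcmp (fo LayFM R)" using RO LayMapM_id by (simp add: MonRSp_simps(5) LayFM_simps
      MonDcmp_simps(5))
next
  fix f :: "('a, 'o, 'm) mrspecies_arr" assume f: "f \<in> Arr MonRSp"
  obtain R \<Phi> S where e: "f = (R, \<Phi>, S)" by (cases f)
  interpret mspecies_map R S \<Phi> by (rule mspecies_map_Arr[OF f[unfolded e]])
  show "fa LayFM f \<in> Arr MonDcmp \<and> Dom MonDcmp (fa LayFM f) = fo LayFM (Dom MonRSp f) \<and> Cod MonDcmp (fa LayFM f) = fo LayFM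
      (Cod MonRSp f)"
    using f culf_LayMap R.monoidal_decomposition_space_LayM S.monoidal_decomposition_space_LayM monoidal_pnt_LayMapM R.R S.R
    by (simp add: e LayFM_simps MonDcmp_simps MonRSp_simps(1,3,4) LayMapM_simps R.LayM_simps(1) S.LayM_simps(1))
  fix g :: "('a, 'o, 'm) mrspecies_arr" assume g: "g \<in> Arr MonRSp" and fg: "Cod MonRSp f = Dom MonRSp g"
  obtain \<Psi> Q where e': "g = (S, \<Psi>, Q)" using fg by (cases g) (auto simp: e MonRSp_simps(3,4))
  have "Cmp MonRSp g f \<in> Arr MonRSp" by (rule category_rules(6)[OF category_MonRSp f g fg])
  then show "fa LayFM (Cmp MonRSp g f) = Cmp MonDcmp (fa LayFM g) (fa LayFM f)"
    using f g LayMapM_comp[OF f[unfolded e] g[unfolded e']]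
    by (simp add: e e' MonRSp_simps(6) LayFM_simps MonDcmp_simps(6))
qed (simp_all add: LayFM_def)

text \<open>That one functor extends the other holds as an equality of composites, because
  \<open>LayM\<close> and \<open>LayMapM\<close> contain \<open>LaySp\<close> and
  \<open>LayMap\<close> as components.\<close>

lemma forget_LayFM: "compF MonRSp forget_MonDcmp LayFM = compF MonRSp LayF forget_MonRSp"
proof (rule ftr_eqI[of _ "Obj MonRSp" _ "Arr MonRSp"])
  note r = functor_rules[OF functor_LayFM]
  fix R :: "('a, 'o, 'm) mrspecies" assume RO: "R \<in> Obj MonRSp"
  then have "mspecies R" by (simp add: mspecies_def MonRSp_simps(1))
  then interpret mspecies R .
  have "U \<in> Obj RSp" using U.R by (simp add: RSp_simps(1))
  then show "fo (compF MonRSp forget_MonDcmp LayFM) R = fo (compF MonRSp LayF forget_MonRSp) R"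
    using r(3)[OF RO] RO by (simp add: forget_MonDcmp_def forget_MonRSp_def LayFM_simps LayF_simps LayM_simps(1))
next
  note r = functor_rules[OF functor_LayFM]
  fix f :: "('a, 'o, 'm) mrspecies_arr" assume f: "f \<in> Arr MonRSp"
  obtain R \<Phi> S where e: "f = (R, \<Phi>, S)" by (cases f)
  interpret mspecies_map R S \<Phi> by (rule mspecies_map_Arr[OF f[unfolded e]])
  have "(R.U, SF \<Phi>, S.U) \<in> Arr RSp" using R.U.R S.U.R F by (simp add: RSp_simps(2))
  then show "fa (compF MonRSp forget_MonDcmp LayFM) f = fa (compF MonRSp LayF forget_MonRSp) f"
    using r(4)[OF f] f by (simp add: e forget_MonDcmp_def forget_MonRSp_def LayFM_simps LayF_simps LayMapM_simps(1)
        R.LayM_simps(1) S.LayM_simps(1))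
qed simp_all

theorem proposition5p15:
  shows "is_functor (RSp :: (('a, 'o, 'm) rspecies, ('a, 'o, 'm) rspecies_arr) cat) Dcmp LayF \<and>
    is_functor (MonRSp :: (('a, 'o, 'm) mrspecies, ('a, 'o, 'm) mrspecies_arr) cat) MonDcmp LayFM \<and>
    compF (MonRSp :: (('a, 'o, 'm) mrspecies, ('a, 'o, 'm) mrspecies_arr) cat) forget_MonDcmp LayFM =
      compF MonRSp LayF forget_MonRSp"
  by (intro conjI functor_LayF functor_LayFM forget_LayFM)

end
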